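(* Let $\beta>0$, and let $d=d(n)$ be a sequence of positive integers with $d=o(n^{2/7})$ as $n\to\infty$. For each $n$ let $(e^{ix_j})_{j=1}^n$ be drawn from the $n$-dimensional circular $\beta$-ensemble, and let $$T_d=\left(\sum_{j=1}^n e^{ikx_j}\right)_{k=1}^d,\qquad G_d=\left(\sqrt{\tfrac{2}{\beta}j}\,Z_j\right)_{j=1}^d,$$ where $Z_1,Z_2,\dots$ are i.i.d. standard complex Gaussians. Then $$\mathcal{W}_1^{(d)}(T_d,G_d)=\mathcal{O}\left(d^{7/2}/n\right)\quad\text{as } n\to\infty.$$
   Context: Circular $\beta$-ensemble: for $\beta>0$, let $\Delta_n=\{(x_1,\dots,x_n)\in[0,2\pi]^n: x_1\le x_2\le\dots\le x_n\}$. The $n$-dimensional circular $\beta$-ensemble is the probability measure on $\Delta_n$ given by $$\frac{n!}{Z_{n,\beta}}\prod_{j<k}|e^{ix_j}-e^{ix_k}|^\beta\prod_{j=1}^n\frac{dx_j}{2\pi},\qquad Z_{n,\beta}=\int_{[0,2\pi]^n}\prod_{j<k}|e^{ix_j}-e^{ix_k}|^\beta\prod_{j=1}^n\frac{dx_j}{2\pi}=\frac{\Gamma(1+n\beta/2)}{\Gamma(1+\beta/2)^n}.$$ Wasserstein-1 distance: for $\mathbb{C}^d$-valued random variables $X,Y$ with finite first absolute moment, $\mathcal{W}_1^{(d)}(X,Y)=\inf\mathbb{E}|X-Y|$, where $|\cdot|$ is the Euclidean norm and the infimum is over all couplings of $X$ and $Y$; equivalently, $\mathcal{W}_1^{(d)}(X,Y)$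 is the supremum of $\mathbb{E}f(X)-\mathbb{E}f(Y)$ over all $1$-Lipschitz functions $f:\mathbb{C}^d\to\mathbb{R}$. A standard complex Gaussian has independent centered real Gaussian real and imaginary parts, each of variance $1/2$ (so $\mathbb{E}|Z|^2=1$). The implied constant in $\mathcal{O}$ may depend on $\beta$ and on the sequence $d(n)$, but not on $n$. *)

theory Defs
  imports "HOL-Probability.Probability" "HOL-Library.Landau_Symbols"
begin

text \<open>The measure \<open>uniform_measure lborel {0..2*pi}\<close> is $dx/2\pi$ on $[0,2\pi]$.\<close>

definition torus_measure :: "nat \<Rightarrow> (nat \<Rightarrow> real) measure" where
  "torus_measure n = PiM {1..n} (\<lambda>_. uniform_measure lborel {0..2 * pi})"

definition cbe_weight :: "real \<Rightarrow> nat \<Rightarrow> (nat \<Rightarrow> real) \<Rightarrow> real" where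
  "cbe_weight \<beta> n x = (\<Prod>k\<in>{1..n}. \<Prod>j\<in>{1..<k}. norm (cis (x j) - cis (x k)) powr \<beta>)"

definition cbe_Z :: "real \<Rightarrow> nat \<Rightarrow> real" where
  "cbe_Z \<beta> n = (\<integral>x. cbe_weight \<beta> n x \<partial>torus_measure n)"

definition ordered_angles :: "nat \<Rightarrow> (nat \<Rightarrow> real) set" where
  "ordered_angles n = {x \<in> {1..n} \<rightarrow>\<^sub>E {0..2 * pi}. mono_on {1..n} x}"

definition circular_beta_ensemble :: "real \<Rightarrow> nat \<Rightarrow> (nat \<Rightarrow> real) measure" where
  "circular_beta_ensemble \<beta> n =
     density (torus_measure n)
       (\<lambda>x. ennreal (fact n / cbe_Z \<beta> n * cbe_weight \<beta> n x) * indicator (ordered_angles n) x)"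

text \<open>Vectors in $\mathbb{C}^d$ are functions on \<open>{1..d}\<close>, extended by \<open>undefined\<close>; since the
  index set is finite, the product sigma-algebra below is the Borel sigma-algebra of
  $\mathbb{C}^d$.\<close>

definition cvec_algebra :: "nat \<Rightarrow> (nat \<Rightarrow> complex) measure" where
  "cvec_algebra d = PiM {1..d} (\<lambda>_. borel)"

definition cvec_dist :: "nat \<Rightarrow> (nat \<Rightarrow> complex) \<Rightarrow> (nat \<Rightarrow> complex) \<Rightarrow> real" where
  "cvec_dist d u v = L2_set (\<lambda>k. norm (u k - v k)) {1..d}"

definition couplings :: "'a measure \<Rightarrow> 'b measure \<Rightarrow> ('a \<times> 'b) measure set" where
  "couplings M N =
     {P. sets P = sets (M \<Otimes>\<^sub>M N) \<and> distr P M fst = M \<and> distr P N snd = N}"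

text \<open>The value is taken in \<open>ennreal\<close>, so that no integrability convention is involved: it is
  \<open>\<infinity>\<close> when every coupling has infinite cost.\<close>

definition wasserstein1 ::
    "nat \<Rightarrow> (nat \<Rightarrow> complex) measure \<Rightarrow> (nat \<Rightarrow> complex) measure \<Rightarrow> ennreal" where
  "wasserstein1 d M N = (INF P\<in>couplings M N. \<integral>\<^sup>+ (u, v). ennreal (cvec_dist d u v) \<partial>P)"

text \<open>The second parameter of \<open>normal_density\<close> is the standard deviation.\<close>

definition std_complex_gaussian :: "complex measure" where
  "std_complex_gaussian =
     (let N = density lborel (\<lambda>t. ennreal (normal_density 0 (sqrt (1 / 2)) t))
      in distr (N \<Otimes>\<^sub>M N) borel (\<lambda>(a, b). Complex a b))"

definition power_sums :: "nat \<Rightarrow> nat \<Rightarrow> (nat \<Rightarrow> real) \<Rightarrow> (nat \<Rightarrow> complex)" where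
  "power_sums n d x = (\<lambda>k\<in>{1..d}. \<Sum>j=1..n. exp (\<i> * of_nat k * of_real (x j)))"

definition scaled_gaussians :: "real \<Rightarrow> nat \<Rightarrow> (nat \<Rightarrow> complex) \<Rightarrow> (nat \<Rightarrow> complex)" where
  "scaled_gaussians \<beta> d Z = (\<lambda>j\<in>{1..d}. of_real (sqrt (2 / \<beta> * real j)) * Z j)"

text \<open>The Wasserstein distance depends on the two random vectors only through their laws, so these
  are realised on canonical spaces: \<open>T_law\<close> on the ensemble itself, and \<open>G_law\<close> on the infinite
  product on which the coordinates $Z_1, Z_2, \ldots$ are i.i.d.\ standard complex Gaussians.\<close>

definition T_law :: "real \<Rightarrow> nat \<Rightarrow> nat \<Rightarrow> (nat \<Rightarrow> complex) measure" where
  "T_law \<beta> n d = distr (circular_beta_ensemble \<beta> n) (cvec_algebra d) (power_sums n d)"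

definition G_law :: "real \<Rightarrow> nat \<Rightarrow> (nat \<Rightarrow> complex) measure" where
  "G_law \<beta> d =
     distr (PiM {1..} (\<lambda>_. std_complex_gaussian)) (cvec_algebra d) (scaled_gaussians \<beta> d)"

end

theory Submission
  imports Defs
begin

text \<open>By Kantorovich duality it suffices to compare the expectations of bounded Lipschitz functions
  of $T_d$ and $G_d$. Write $p_k$ for the power sums, $a_k = e^{-\beta k t/2}$ and
  $v_k = \frac{2k}{\beta}(1 - a_k^2)$; the vector with entries $a_k p_k + \sqrt{v_k} Z_k$ interpolates
  between $T_d$ at $t = 0$ and $G_d$ at $t = \infty$. Integration by parts against the ensemble
  (stationarity of circular Dyson Brownian motion, for which $p_k$ is nearly an eigenfunction with
  eigenvalue $-\beta n k/2$) expresses the $t$-derivative of the expectation as $2/n$ times an error term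
  that involves the Gaussian noise and the power sums $p_{k \pm l}$ and $p_l p_{k-l}$ only. The
  noise compensates the missing smoothness of the test function, and the derivative is
  $O(d^{7/2} / (n \sqrt t (1 + t)))$ as soon as $E|p_k|^2 = O(k)$ and $E|p_l p_m|^2 = O(l m)$.

  These moments come from the generator: on products of power sums of total degree $N$ its negative
  is $\beta n N/2$ plus an operator that is symmetric in $L^2$ and of norm at most $(1 + \beta) N^2$,
  hence at least $\beta n N/4$ when $N$ is small compared with $n$.\<close>

text \<open>No explicit formula for joint moments of power sums is used, since \<beta> is arbitrary;
  upper bounds on moments are read off from lower bounds on a Dirichlet form. All differentiation
  falls on the Gaussian density of the interpolating vector given the angles, never on the test
  function, which is only Lipschitz. The power 7/2 is a count. The error is a sum over frequencies
  k, l up to d of products of two normalised residuals. Centering in the first noise coordinate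
  costs sqrt v_k and leaves the factor a_k k. The second residual costs at most (2t)^(-1/2),
  whatever l is, and the power sums of index k + l and k - l have mean modulus O(sqrt d). Summing k
  sqrt d over k and l gives d^(7/2). The products p_l p_(k-l) add up to mean modulus O(k^2), and k^3
  a_k = O(d^(5/2) t^(-1/2)), so the sum over k is again of order d^(7/2). The singularity t^(-1/2)
  is integrable at 0, and the decay of a_k takes care of large t.\<close>

subsection \<open>Kantorovich duality\<close>

text \<open>Hahn-Banach in finitely many dimensions, by adding one point of \<open>A\<close> at a
  time. The direction \<open>g\<close> is kept apart from the functions supported on
  \<open>A\<close> because the functional has to attain \<open>N g\<close> there;
  \<open>r = 0\<close> gives plain domination in the coordinates.\<close>

lemma finite_sublinear_functional_dominates:
  fixes N :: "('a \<Rightarrow> real) \<Rightarrow> real"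
  assumes "finite A"
    and sub: "\<And>u v. N (\<lambda>x. u x + v x) \<le> N u + N v"
    and hom: "\<And>c u. c \<ge> 0 \<Longrightarrow> N (\<lambda>x. c * u x) = c * N u"
  shows "\<exists>\<phi>. \<forall>r h. (\<forall>x. x \<notin> A \<longrightarrow> h x = 0) \<longrightarrow>
           r * N g + (\<Sum>x\<in>A. \<phi> x * h x) \<le> N (\<lambda>x. r * g x + h x)"
  using \<open>finite A\<close>
proof (induction A rule: finite_induct)
  case empty
  have N0: "N (\<lambda>x. 0) = 0"
    using hom[of 0 "\<lambda>x. 0"] by simp
  have "r * N g \<le> N (\<lambda>x. r * g x)" for r
  proof (cases "r \<ge> 0")
    case True
    then show ?thesis using hom[of r g] by simp
  next
    case False
    have "0 \<le> N (\<lambda>x. r * g x) + N (\<lambda>x. (- r) * g x)"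
      using sub[of "\<lambda>x. r * g x" "\<lambda>x. (- r) * g x"] N0 by simp
    then show ?thesis
      using hom[of "- r" g] False by simp
  qed
  then have "r * N g + (\<Sum>x\<in>{}. 0 * h x) \<le> N (\<lambda>x. r * g x + h x)"
    if "\<forall>x. x \<notin> {} \<longrightarrow> h x = 0" for r h
    using that by simp
  then show ?case by (intro exI[of _ "\<lambda>_. 0"] allI impI) blast
next
  case (insert a A)
  then obtain \<phi> where \<phi>: "\<And>r h. (\<forall>x. x \<notin> A \<longrightarrow> h x = 0) \<Longrightarrow>
      r * N g + (\<Sum>x\<in>A. \<phi> x * h x) \<le> N (\<lambda>x. r * g x + h x)"
    by blast
  define e where "e = (\<lambda>x. if x = a then 1 else 0 :: real)"
  define l where "l = (\<lambda>r h. r * N g + (\<Sum>x\<in>A. \<phi> x * h x))"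
  define U where "U = {(r :: real, h). \<forall>x. x \<notin> A \<longrightarrow> h x = (0::real)}" 
  \<comment> \<open>By subadditivity every lower bound for the value at the new unit vector
    \<open>e\<close> lies below every upper bound; any number in between extends the functional, and
    \<alpha> is the least one.\<close>
  have key: "l r h - N (\<lambda>x. r * g x + h x - e x) \<le> N (\<lambda>x. r' * g x + h' x + e x) - l r' h'"
    if "(r, h) \<in> U" "(r', h') \<in> U" for r h r' h'
  proof -
    have "l r h + l r' h' = l (r + r') (\<lambda>x. h x + h' x)"
      by (simp add: l_def algebra_simps sum.distrib)
    also have "\<dots> \<le> N (\<lambda>x. (r + r') * g x + (h x + h' x))"
      unfolding l_def using that by (intro \<phi>) (auto simp: U_def)
    also have "\<dots> = N (\<lambda>x. (r * g x + h x - e x) + (r' * g x + h' x + e x))"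
      by (simp add: algebra_simps)
    also have "\<dots> \<le> N (\<lambda>x. r * g x + h x - e x) + N (\<lambda>x. r' * g x + h' x + e x)"
      by (rule sub)
    finally show ?thesis by simp
  qed
  define L where "L = (\<lambda>(r, h). l r h - N (\<lambda>x. r * g x + h x - e x)) ` U"
  have U0: "(0, \<lambda>_. 0) \<in> U" by (simp add: U_def)
  define \<alpha> where "\<alpha> = Sup L"
  have bdd: "bdd_above L"
    unfolding L_def using key[OF _ U0]
    by (intro bdd_aboveI[of _ "N (\<lambda>x. 0 * g x + 0 + e x) - l 0 (\<lambda>_. 0)"]) auto
  have lo: "l r h - N (\<lambda>x. r * g x + h x - e x) \<le> \<alpha>" if "(r, h) \<in> U" for r h
    unfolding \<alpha>_def by (intro cSup_upper bdd) (use that in \<open>force simp: L_def\<close>)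
  have hi: "\<alpha> \<le> N (\<lambda>x. r * g x + h x + e x) - l r h" if "(r, h) \<in> U" for r h
    unfolding \<alpha>_def by (intro cSup_least) (use U0 key[OF _ that] in \<open>auto simp: L_def\<close>)
  \<comment> \<open>Scaling by the modulus of \<open>s\<close> reduces to the coefficients 1 and -1
    of \<open>e\<close>, which are \<open>hi\<close> and \<open>lo\<close>.\<close>
  have main: "l r h + s * \<alpha> \<le> N (\<lambda>x. r * g x + h x + s * e x)" if "(r, h) \<in> U" for r h s
  proof -
    have sc: "(r / c, \<lambda>x. h x / c) \<in> U" for c using that by (auto simp: U_def)
    have ls: "l (r / c) (\<lambda>x. h x / c) = l r h / c" for c
      by (simp add: l_def sum_divide_distrib add_divide_distrib)
    consider "s = 0" | "s > 0" | "s < 0" by linarith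
    then show ?thesis
    proof cases
      case 1
      then show ?thesis using \<phi>[of h r] that by (simp add: l_def U_def)
    next
      case 2
      have "s * \<alpha> \<le> s * (N (\<lambda>x. r / s * g x + h x / s + e x) - l r h / s)"
        using hi[OF sc[of s]] 2 by (simp add: ls mult_left_mono)
      also have "\<dots> = N (\<lambda>x. s * (r / s * g x + h x / s + e x)) - l r h"
        using 2 by (subst hom) (auto simp: algebra_simps)
      also have "(\<lambda>x. s * (r / s * g x + h x / s + e x)) = (\<lambda>x. r * g x + h x + s * e x)"
        using 2 by (auto simp: algebra_simps)
      finally show ?thesis by simp
    next
      case 3
      define t where "t = - s"
      have t: "t > 0" using 3 by (simp add: t_def)
      have "t * (l r h / t - N (\<lambda>x. r / t * g x + h x / t - e x)) \<le> t * \<alpha>"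
        using lo[OF sc[of t]] t by (simp add: ls mult_left_mono)
      moreover have "t * (l r h / t - N (\<lambda>x. r / t * g x + h x / t - e x))
          = l r h - N (\<lambda>x. t * (r / t * g x + h x / t - e x))"
        using t by (subst hom) (auto simp: algebra_simps)
      moreover have "(\<lambda>x. t * (r / t * g x + h x / t - e x)) = (\<lambda>x. r * g x + h x + s * e x)"
        using t by (auto simp: algebra_simps t_def)
      ultimately show ?thesis by (simp add: t_def)
    qed
  qed
  define \<phi>' where "\<phi>' = \<phi>(a := \<alpha>)"
  have "r * N g + (\<Sum>x\<in>insert a A. \<phi>' x * h x) \<le> N (\<lambda>x. r * g x + h x)"
    if h: "\<forall>x. x \<notin> insert a A \<longrightarrow> h x = 0" for r h
  proof -
    define h' where "h' = h(a := 0)"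
    have "(r, h') \<in> U" using h by (auto simp: U_def h'_def)
    from main[OF this, of "h a"]
    have "l r h' + h a * \<alpha> \<le> N (\<lambda>x. r * g x + h' x + h a * e x)" .
    also have "(\<lambda>x. r * g x + h' x + h a * e x) = (\<lambda>x. r * g x + h x)"
      by (auto simp: h'_def e_def)
    also have "l r h' + h a * \<alpha> = r * N g + (\<Sum>x\<in>insert a A. \<phi>' x * h x)"
    proof -
      have "(\<Sum>x\<in>A. \<phi> x * h' x) = (\<Sum>x\<in>A. \<phi>' x * h x)"
        using insert.hyps by (intro sum.cong) (auto simp: h'_def \<phi>'_def)
      then show ?thesis using insert.hyps by (simp add: l_def \<phi>'_def)
    qed
    finally show ?thesis .
  qed
  then show ?case by blast
qed

text \<open>Missing the marginals is penalised rather than forbidden, so the infimum over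
  \<open>\<pi>\<close> is finite for every \<open>u\<close>, also for signed or unbalanced ones, and
  is a sublinear functional on all functions. \<open>Inl\<close> carries the first marginal and
  \<open>Inr\<close> the second.\<close>

definition transport_penalty ::
  "'a set \<Rightarrow> ('a \<Rightarrow> 'a \<Rightarrow> real) \<Rightarrow> real \<Rightarrow> ('a + 'a \<Rightarrow> real) \<Rightarrow> ('a \<Rightarrow> 'a \<Rightarrow> real) \<Rightarrow> real" where
  "transport_penalty I D M u \<pi> = (\<Sum>i\<in>I. \<Sum>j\<in>I. \<pi> i j * D i j)
     + M * ((\<Sum>i\<in>I. \<bar>u (Inl i) - (\<Sum>j\<in>I. \<pi> i j)\<bar>) + (\<Sum>j\<in>I. \<bar>u (Inr j) - (\<Sum>i\<in>I. \<pi> i j)\<bar>))"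

lemma transport_penalty_nonneg:
  assumes "M \<ge> 0" "\<And>i j. D i j \<ge> 0" "\<And>i j. \<pi> i j \<ge> 0"
  shows "transport_penalty I D M u \<pi> \<ge> 0"
  unfolding transport_penalty_def using assms
  by (intro add_nonneg_nonneg mult_nonneg_nonneg sum_nonneg) auto

lemma transport_penalty_add:
  assumes "M \<ge> 0" 
  shows "transport_penalty I D M (\<lambda>x. u x + v x) (\<lambda>i j. \<pi> i j + \<rho> i j)
     \<le> transport_penalty I D M u \<pi> + transport_penalty I D M v \<rho>"
proof -
  have 1: "(\<Sum>i\<in>I. \<bar>u (Inl i) + v (Inl i) - (\<Sum>j\<in>I. \<pi> i j + \<rho> i j)\<bar>)
     \<le> (\<Sum>i\<in>I. \<bar>u (Inl i) - (\<Sum>j\<in>I. \<pi> i j)\<bar>) + (\<Sum>i\<in>I. \<bar>v (Inl i) - (\<Sum>j\<in>I. \<rho> i j)\<bar>)"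
    unfolding sum.distrib[symmetric] by (intro sum_mono) (simp add: sum.distrib)
  have 2: "(\<Sum>i\<in>I. \<bar>u (Inr i) + v (Inr i) - (\<Sum>j\<in>I. \<pi> j i + \<rho> j i)\<bar>)
     \<le> (\<Sum>i\<in>I. \<bar>u (Inr i) - (\<Sum>j\<in>I. \<pi> j i)\<bar>) + (\<Sum>i\<in>I. \<bar>v (Inr i) - (\<Sum>j\<in>I. \<rho> j i)\<bar>)"
    unfolding sum.distrib[symmetric] by (intro sum_mono) (simp add: sum.distrib)
  have "M * ((\<Sum>i\<in>I. \<bar>u (Inl i) + v (Inl i) - (\<Sum>j\<in>I. \<pi> i j + \<rho> i j)\<bar>)
     + (\<Sum>i\<in>I. \<bar>u (Inr i) + v (Inr i) - (\<Sum>j\<in>I. \<pi> j i + \<rho> j i)\<bar>))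
    \<le> M * (((\<Sum>i\<in>I. \<bar>u (Inl i) - (\<Sum>j\<in>I. \<pi> i j)\<bar>) + (\<Sum>i\<in>I. \<bar>v (Inl i) - (\<Sum>j\<in>I. \<rho> i j)\<bar>))
    + ((\<Sum>i\<in>I. \<bar>u (Inr i) - (\<Sum>j\<in>I. \<pi> j i)\<bar>) + (\<Sum>i\<in>I. \<bar>v (Inr i) - (\<Sum>j\<in>I. \<rho> j i)\<bar>)))"
    using assms 1 2 by (intro mult_left_mono add_mono)
  then show ?thesis
    unfolding transport_penalty_def by (simp add: sum.distrib algebra_simps)
qed

lemma transport_penalty_scale:
  assumes "c \<ge> 0" 
  shows "transport_penalty I D M (\<lambda>x. c * u x) (\<lambda>i j. c * \<pi> i j) = c * transport_penalty I D M u \<pi>"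
proof -
  have *: "\<bar>c * a - c * b\<bar> = c * \<bar>a - b\<bar>" for a b :: real
    using assms by (simp add: abs_mult flip: right_diff_distrib)
  show ?thesis
    unfolding transport_penalty_def
    by (simp add: sum_distrib_left[symmetric] * mult.assoc) (simp add: algebra_simps)
qed

text \<open>Finite Kantorovich duality up to an arbitrarily small penalty for missing the marginals.
  The linear functional dominated by the optimal penalised cost is a pair of potentials
  \<open>f i + g j \<le> D i j\<close>, and the c-transform of \<open>g\<close> replaces it by one 1-Lipschitz function.\<close>

lemma approx_transport_exists:
  fixes D :: "'a \<Rightarrow> 'a \<Rightarrow> real"
  assumes I: "finite I" "I \<noteq> {}" and M: "M \<ge> 0"
    and D0: "\<And>i j. D i j \<ge> 0" and Dr: "\<And>i. D i i = 0" and tri: "\<And>i j k. D i k \<le> D i j + D j k"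
    and p: "\<And>i. p i \<ge> 0" and q: "\<And>i. q i \<ge> 0"
    and B: "\<And>\<phi>. (\<And>i j. i \<in> I \<Longrightarrow> j \<in> I \<Longrightarrow> \<phi> i - \<phi> j \<le> D i j) \<Longrightarrow>
              (\<Sum>i\<in>I. \<phi> i * p i) - (\<Sum>i\<in>I. \<phi> i * q i) \<le> B"
    and e: "e > 0"
  shows "\<exists>\<pi>. (\<forall>i j. \<pi> i j \<ge> 0) \<and> transport_penalty I D M (case_sum p q) \<pi> \<le> B + e"
proof -
  define F where "F = (\<lambda>u. transport_penalty I D M u ` {\<pi>. \<forall>i j. \<pi> i j \<ge> 0})"
  define N where "N = (\<lambda>u. Inf (F u))"
  have ne: "F u \<noteq> {}" for u
    unfolding F_def by (auto intro: exI[of _ "\<lambda>_ _. 0"])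
  have nn: "0 \<le> x" if "x \<in> F u" for x u
    using that M D0 by (auto simp: F_def intro!: transport_penalty_nonneg)
  have bdd: "bdd_below (F u)" for u using nn by (intro bdd_belowI[of _ 0])
  have N_le: "N u \<le> transport_penalty I D M u \<pi>" if "\<And>i j. \<pi> i j \<ge> 0" for u \<pi>
    unfolding N_def by (intro cInf_lower bdd) (use that in \<open>auto simp: F_def\<close>)
  have N_ex: "\<exists>\<pi>. (\<forall>i j. \<pi> i j \<ge> 0) \<and> transport_penalty I D M u \<pi> < N u + e'" if "e' > 0" for u e'
  proof -
    have "\<exists>x\<in>F u. x < N u + e'"
      unfolding N_def using that ne by (intro cInf_lessD) auto
    then show ?thesis by (auto simp: F_def)
  qed
  have N0: "N u \<ge> 0" for u unfolding N_def using ne nn by (intro cInf_greatest) auto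
  have sub: "N (\<lambda>x. u x + v x) \<le> N u + N v" for u v
  proof (rule field_le_epsilon)
    fix e' :: real assume "e' > 0"
    obtain \<pi> where \<pi>: "\<forall>i j. \<pi> i j \<ge> 0" "transport_penalty I D M u \<pi> < N u + e'/2"
      using N_ex[of "e'/2" u] \<open>e' > 0\<close> by auto
    obtain \<rho> where \<rho>: "\<forall>i j. \<rho> i j \<ge> 0" "transport_penalty I D M v \<rho> < N v + e'/2"
      using N_ex[of "e'/2" v] \<open>e' > 0\<close> by auto
    have "N (\<lambda>x. u x + v x) \<le> transport_penalty I D M (\<lambda>x. u x + v x) (\<lambda>i j. \<pi> i j + \<rho> i j)"
      using \<pi> \<rho> by (intro N_le) auto
    also have "\<dots> \<le> transport_penalty I D M u \<pi> + transport_penalty I D M v \<rho>"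
      by (rule transport_penalty_add[OF M])
    finally show "N (\<lambda>x. u x + v x) \<le> N u + N v + e'" using \<pi> \<rho> by linarith
  qed
  have hom_le: "N (\<lambda>x. c * u x) \<le> c * N u" if c: "c > 0" for c u
  proof (rule field_le_epsilon)
    fix e' :: real assume "e' > 0"
    obtain \<pi> where \<pi>: "\<forall>i j. \<pi> i j \<ge> 0" "transport_penalty I D M u \<pi> < N u + e'/c"
      using N_ex[of "e'/c" u] \<open>e' > 0\<close> c by auto
    have "N (\<lambda>x. c * u x) \<le> transport_penalty I D M (\<lambda>x. c * u x) (\<lambda>i j. c * \<pi> i j)"
      using \<pi> c by (intro N_le) auto
    also have "\<dots> = c * transport_penalty I D M u \<pi>" using c by (intro transport_penalty_scale) auto
    also have "\<dots> \<le> c * (N u + e'/c)" using \<pi> c by (intro mult_left_mono) auto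
    finally show "N (\<lambda>x. c * u x) \<le> c * N u + e'" using c by (simp add: algebra_simps)
  qed
  have hom: "N (\<lambda>x. c * u x) = c * N u" if "c \<ge> 0" for c u
  proof (cases "c = 0")
    case True
    have "N (\<lambda>x. 0) \<le> transport_penalty I D M (\<lambda>x. 0) (\<lambda>i j. 0)" by (intro N_le) auto
    then show ?thesis using True N0[of "\<lambda>x. 0"] by (simp add: transport_penalty_def)
  next
    case False
    then have "c > 0" using that by simp
    have "c * N u = c * N (\<lambda>x. (1/c) * (c * u x))" using False by simp
    also have "\<dots> \<le> c * ((1/c) * N (\<lambda>x. c * u x))"
      using \<open>c > 0\<close> by (intro mult_left_mono hom_le) auto
    finally show ?thesis using hom_le[OF \<open>c > 0\<close>, of u] \<open>c > 0\<close> by simp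
  qed
  define A where "A = Inl ` I \<union> (Inr ` I :: ('a + 'a) set)"
  have finA: "finite A" using I by (simp add: A_def)
  \<comment> \<open>Cut off outside \<open>A\<close>, so that \<open>- w\<close> is an admissible
    perturbation; the penalty sees only the values on \<open>A\<close>.\<close>
  define w where "w = (\<lambda>x. if x \<in> A then case_sum p q x else 0)"
  have pen_w: "transport_penalty I D M w \<pi> = transport_penalty I D M (case_sum p q) \<pi>" for \<pi>
    unfolding transport_penalty_def w_def A_def by simp
  obtain \<phi> where \<phi>: "\<And>r h. (\<forall>x. x \<notin> A \<longrightarrow> h x = 0) \<Longrightarrow>
      r * N w + (\<Sum>x\<in>A. \<phi> x * h x) \<le> N (\<lambda>x. r * w x + h x)"
    using finite_sublinear_functional_dominates[where N = N and g = w, OF finA sub hom] by blast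
  have sumA: "(\<Sum>x\<in>A. h x) = (\<Sum>i\<in>I. h (Inl i)) + (\<Sum>i\<in>I. h (Inr i))" for h :: "'a + 'a \<Rightarrow> real"
    unfolding A_def using I by (subst sum.union_disjoint) (auto simp: sum.reindex)
  define f where "f = (\<lambda>i. \<phi> (Inl i))"
  define g where "g = (\<lambda>i. \<phi> (Inr i))"
  have fg: "f i + g j \<le> D i j" if ij: "i \<in> I" "j \<in> I" for i j
  proof -
    \<comment> \<open>Unit mass at \<open>i\<close> on the left and at \<open>j\<close> on the
      right: moving it meets both marginals exactly, so the penalised cost is
      \<open>D i j\<close>.\<close>
    define h where "h = (\<lambda>x. if x = Inl i \<or> x = Inr j then 1 else 0 :: real)"
    have "0 * N w + (\<Sum>x\<in>A. \<phi> x * h x) \<le> N (\<lambda>x. 0 * w x + h x)"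
      using ij by (intro \<phi>) (auto simp: h_def A_def)
    then have "(\<Sum>x\<in>A. \<phi> x * h x) \<le> N h" by simp
    also have "\<dots> \<le> transport_penalty I D M h (\<lambda>i' j'. if i' = i \<and> j' = j then 1 else 0)"
      by (intro N_le) auto
    also have "\<dots> = D i j"
    proof -
      have "(\<Sum>j'\<in>I. if i' = i \<and> j' = j then 1 else 0 :: real) = (if i' = i then 1 else 0)" for i'
        using ij I by (cases "i' = i") auto
      moreover have "(\<Sum>i'\<in>I. if i' = i \<and> j' = j then 1 else 0 :: real) = (if j' = j then 1 else 0)" for j'
        using ij I by (cases "j' = j") auto
      moreover have "(\<Sum>i'\<in>I. \<Sum>j'\<in>I. (if i' = i \<and> j' = j then 1 else 0) * D i' j') = D i j"
      proof -
        have "(\<Sum>j'\<in>I. (if i' = i \<and> j' = j then 1 else 0) * D i' j') = (if i' = i then D i j else 0)" for i'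
        proof -
          have "(\<Sum>j'\<in>I. (if i' = i \<and> j' = j then 1 else 0) * D i' j') = (\<Sum>j'\<in>I. if j' = j then (if i' = i then D i j else 0) else 0)"
            by (intro sum.cong) auto
          then show ?thesis using ij I by simp
        qed
        then show ?thesis using ij I by simp
      qed
      ultimately show ?thesis unfolding transport_penalty_def h_def by simp
    qed
    also have "(\<Sum>x\<in>A. \<phi> x * h x) = f i + g j"
    proof -
      have "(\<Sum>i'\<in>I. \<phi> (Inl i') * h (Inl i')) = (\<Sum>i'\<in>I. if i' = i then f i else 0)"
        by (intro sum.cong) (auto simp: h_def f_def)
      moreover have "(\<Sum>i'\<in>I. \<phi> (Inr i') * h (Inr i')) = (\<Sum>i'\<in>I. if i' = j then g j else 0)"
        by (intro sum.cong) (auto simp: h_def g_def)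
      ultimately show ?thesis unfolding sumA using ij I by simp
    qed
    finally show ?thesis .
  qed
  \<comment> \<open>It dominates \<open>f\<close> because \<open>f i + g j \<le> D i j\<close>, lies
    below \<open>- g\<close> because \<open>D i i = 0\<close>, and inherits the Lipschitz property
    from \<open>D\<close> by the triangle inequality.\<close>
  define \<psi> where "\<psi> = (\<lambda>x. Min ((\<lambda>j. D x j - g j) ` I))"
  have \<psi>_le: "\<psi> x \<le> D x j - g j" if "j \<in> I" for x j
    unfolding \<psi>_def using I that by (intro Min_le) auto
  have \<psi>_ge: "c \<le> \<psi> x" if "\<And>j. j \<in> I \<Longrightarrow> c \<le> D x j - g j" for c x
    unfolding \<psi>_def using I that by (subst Min_ge_iff) auto
  have "(\<Sum>i\<in>I. \<psi> i * p i) - (\<Sum>i\<in>I. \<psi> i * q i) \<le> B"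
  proof (rule B)
    fix i j assume "i \<in> I" "j \<in> I"
    have "\<psi> i - D i j \<le> \<psi> j"
    proof (rule \<psi>_ge)
      fix k assume k: "k \<in> I"
      show "\<psi> i - D i j \<le> D j k - g k" using \<psi>_le[OF k, of i] tri[of i k j] by linarith
    qed
    then show "\<psi> i - \<psi> j \<le> D i j" by linarith
  qed
  moreover have "(\<Sum>i\<in>I. f i * p i) \<le> (\<Sum>i\<in>I. \<psi> i * p i)"
    using p fg by (intro sum_mono mult_right_mono \<psi>_ge) (auto simp: le_diff_eq)
  moreover have "(\<Sum>i\<in>I. \<psi> i * q i) \<le> (\<Sum>i\<in>I. - g i * q i)"
    using q \<psi>_le[of i i for i] Dr by (intro sum_mono mult_right_mono) auto
  moreover have "N w \<le> (\<Sum>i\<in>I. f i * p i) + (\<Sum>i\<in>I. g i * q i)"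
  proof -
    \<comment> \<open>Perturbing \<open>w\<close> by \<open>- w\<close> gives the zero function,
      where \<open>N\<close> vanishes; this bounds \<open>N w\<close> by the value of the coordinate
      functional at \<open>w\<close>.\<close>
    have "1 * N w + (\<Sum>x\<in>A. \<phi> x * (- w x)) \<le> N (\<lambda>x. 1 * w x + (- w x))"
      by (intro \<phi>) (auto simp: w_def)
    also have "\<dots> = 0" using hom[of 0 w] by simp
    finally have "N w \<le> (\<Sum>x\<in>A. \<phi> x * w x)" by (simp add: sum_negf)
    also have "\<dots> = (\<Sum>i\<in>I. f i * p i) + (\<Sum>i\<in>I. g i * q i)"
      unfolding sumA by (intro arg_cong2[where f = plus] sum.cong) (auto simp: f_def g_def w_def A_def)
    finally show ?thesis .
  qed
  ultimately have "N w \<le> B" by (simp add: sum_negf)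
  moreover obtain \<pi> where "\<forall>i j. \<pi> i j \<ge> 0" "transport_penalty I D M w \<pi> < N w + e"
    using N_ex[OF e] by blast
  ultimately show ?thesis unfolding pen_w by (intro exI[of _ \<pi>]) auto
qed

text \<open>A plan of the penalised problem is repaired at small cost. Its rows and columns are
  shrunk until both marginals fall below \<open>p\<close> and \<open>q\<close>; the missing mass is
  the same on both sides and is put back as a product measure. A large penalty weight makes that
  mass, and so the cost of adding it, small.\<close>

lemma finite_kantorovich_duality:
  fixes D :: "'a \<Rightarrow> 'a \<Rightarrow> real"
  assumes I: "finite I"
    and D0: "\<And>i j. D i j \<ge> 0" and Dr: "\<And>i. D i i = 0" and tri: "\<And>i j k. D i k \<le> D i j + D j k"
    and p: "\<And>i. p i \<ge> 0" "(\<Sum>i\<in>I. p i) = 1" and q: "\<And>i. q i \<ge> 0" "(\<Sum>i\<in>I. q i) = 1"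
    and B: "\<And>\<phi>. (\<And>i j. i \<in> I \<Longrightarrow> j \<in> I \<Longrightarrow> \<phi> i - \<phi> j \<le> D i j) \<Longrightarrow>
              (\<Sum>i\<in>I. \<phi> i * p i) - (\<Sum>i\<in>I. \<phi> i * q i) \<le> B"
    and e: "e > 0"
  shows "\<exists>\<pi>. (\<forall>i j. \<pi> i j \<ge> 0) \<and> (\<forall>i\<in>I. (\<Sum>j\<in>I. \<pi> i j) = p i) \<and>
           (\<forall>j\<in>I. (\<Sum>i\<in>I. \<pi> i j) = q j) \<and> (\<Sum>i\<in>I. \<Sum>j\<in>I. \<pi> i j * D i j) \<le> B + e"
proof -
  have ne: "I \<noteq> {}" using p(2) by auto
  have B0: "0 \<le> B" using B[of "\<lambda>_. 0"] D0 by simp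
  define Dm where "Dm = (\<Sum>i\<in>I. \<Sum>j\<in>I. D i j)"
  have Dm: "D i j \<le> Dm" if "i \<in> I" "j \<in> I" for i j
  proof -
    have "D i j \<le> (\<Sum>j\<in>I. D i j)" using that I D0 by (intro member_le_sum) auto
    also have "\<dots> \<le> Dm" unfolding Dm_def using that I D0
      by (intro member_le_sum[of i I "\<lambda>i. \<Sum>j\<in>I. D i j"] sum_nonneg) auto
    finally show ?thesis .
  qed
  have Dm0: "Dm \<ge> 0" unfolding Dm_def using D0 by (intro sum_nonneg) auto
  \<comment> \<open>Chosen so that a penalised value of at most \<open>B + e / 2\<close> forces
    \<open>2 * Dm * \<delta> \<le> e / 2\<close>. The summand 1 keeps \<open>M\<close> positive when
    \<open>Dm = 0\<close>.\<close>
  define M where "M = 4 * Dm * (B + e) / e + 1"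
  have M0: "M > 0" unfolding M_def using Dm0 B0 e by (intro add_nonneg_pos) auto
  obtain \<rho> where \<rho>: "\<And>i j. \<rho> i j \<ge> 0" "transport_penalty I D M (case_sum p q) \<rho> \<le> B + e / 2"
    using approx_transport_exists[where e = "e / 2" and B = B and D = D and p = p and q = q,
        OF I ne less_imp_le[OF M0] D0 Dr tri p(1) q(1) B] e by auto
  define r where "r = (\<lambda>i. \<Sum>j\<in>I. \<rho> i j)"
  define s where "s = (\<lambda>j. \<Sum>i\<in>I. \<rho> i j)"
  define \<delta> where "\<delta> = (\<Sum>i\<in>I. \<bar>p i - r i\<bar>) + (\<Sum>j\<in>I. \<bar>q j - s j\<bar>)"
  define cost where "cost = (\<Sum>i\<in>I. \<Sum>j\<in>I. \<rho> i j * D i j)"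
  have pen: "cost + M * \<delta> \<le> B + e / 2"
    using \<rho>(2) by (simp add: transport_penalty_def cost_def \<delta>_def r_def s_def)
  have \<delta>0: "\<delta> \<ge> 0" unfolding \<delta>_def by (intro add_nonneg_nonneg sum_nonneg) auto
  have cost0: "cost \<ge> 0" unfolding cost_def using \<rho> D0 by (intro sum_nonneg mult_nonneg_nonneg) auto
  have r0: "r i \<ge> 0" for i unfolding r_def using \<rho> by (intro sum_nonneg) auto
  have s0: "s i \<ge> 0" for i unfolding s_def using \<rho> by (intro sum_nonneg) auto
  have cost_le: "cost \<le> B + e / 2"
    using pen mult_nonneg_nonneg[OF less_imp_le[OF M0] \<delta>0] by linarith
  have "4 * Dm * (B + e) / e * \<delta> \<le> B + e / 2"
    using pen cost0 \<delta>0 unfolding M_def by (simp add: algebra_simps)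
  then have "4 * Dm * (B + e) * \<delta> \<le> (B + e / 2) * e"
    using e by (simp add: field_simps)
  also have "\<dots> \<le> (B + e) * e" using e by (intro mult_right_mono) auto
  finally have "(4 * Dm * \<delta>) * (B + e) \<le> e * (B + e)" by (simp add: algebra_simps)
  then have \<delta>_le: "2 * Dm * \<delta> \<le> e / 2" using B0 e by (auto dest!: mult_right_le_imp_le)
  \<comment> \<open>Where a marginal is too large the factor brings it down exactly to the
    prescribed mass, and the loss is at most the deviation of that marginal.\<close>
  define x where "x = (\<lambda>i. if r i \<le> p i then 1 else p i / r i)"
  define y where "y = (\<lambda>i. if s i \<le> q i then 1 else q i / s i)"
  have x: "0 \<le> x i" "x i \<le> 1" "r i * x i \<le> p i" "r i * (1 - x i) \<le> \<bar>p i - r i\<bar>" for i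
    using p(1)[of i] r0[of i] by (auto simp: x_def field_simps)
  have y: "0 \<le> y i" "y i \<le> 1" "s i * y i \<le> q i" "s i * (1 - y i) \<le> \<bar>q i - s i\<bar>" for i
    using q(1)[of i] s0[of i] by (auto simp: y_def field_simps)
  define \<sigma> where "\<sigma> = (\<lambda>i j. \<rho> i j * x i * y j)"
  have \<sigma>0: "\<sigma> i j \<ge> 0" for i j using \<rho> x y by (simp add: \<sigma>_def)
  have \<sigma>_le1: "\<sigma> i j \<le> \<rho> i j * x i" for i j
    unfolding \<sigma>_def using \<rho> x y by (intro mult_left_le) auto
  have \<sigma>_le2: "\<sigma> i j \<le> \<rho> i j * y j" for i j
    using mult_left_le[of "x i" "\<rho> i j * y j"] \<rho> x y by (simp add: \<sigma>_def mult_ac)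
  have \<sigma>_le: "\<sigma> i j \<le> \<rho> i j" for i j
    using \<sigma>_le1[of i j] mult_left_le[of "x i" "\<rho> i j"] \<rho> x by (meson order_trans)
  define \<alpha> where "\<alpha> = (\<lambda>i. p i - (\<Sum>j\<in>I. \<sigma> i j))"
  define \<beta> where "\<beta> = (\<lambda>j. q j - (\<Sum>i\<in>I. \<sigma> i j))"
  have \<alpha>0: "\<alpha> i \<ge> 0" for i
  proof -
    have "(\<Sum>j\<in>I. \<sigma> i j) \<le> (\<Sum>j\<in>I. \<rho> i j * x i)" by (intro sum_mono \<sigma>_le1)
    also have "\<dots> = r i * x i" by (simp add: r_def sum_distrib_right)
    finally show ?thesis using x(3)[of i] by (simp add: \<alpha>_def)
  qed
  have \<beta>0: "\<beta> j \<ge> 0" for j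
  proof -
    have "(\<Sum>i\<in>I. \<sigma> i j) \<le> (\<Sum>i\<in>I. \<rho> i j * y j)" by (intro sum_mono \<sigma>_le2)
    also have "\<dots> = s j * y j" by (simp add: s_def sum_distrib_right)
    finally show ?thesis using y(3)[of j] by (simp add: \<beta>_def)
  qed
  define \<tau> where "\<tau> = (\<Sum>i\<in>I. \<alpha> i)"
  have \<tau>1: "\<tau> = 1 - (\<Sum>i\<in>I. \<Sum>j\<in>I. \<sigma> i j)" by (simp add: \<tau>_def \<alpha>_def sum_subtractf p)
  have \<tau>\<beta>: "\<tau> = (\<Sum>j\<in>I. \<beta> j)"
    unfolding \<tau>1 by (simp add: \<beta>_def sum_subtractf q) (rule sum.swap)
  have \<tau>0: "\<tau> \<ge> 0" unfolding \<tau>_def using \<alpha>0 by (intro sum_nonneg) auto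
  \<comment> \<open>One \<open>\<delta>\<close> bounds the mass lost by shrinking, through
    \<open>1 - x y \<le> (1 - x) + (1 - y)\<close>; the other bounds the deficit in the total mass
    of \<open>\<rho>\<close>.\<close>
  have \<tau>_le: "\<tau> \<le> 2 * \<delta>"
  proof -
    have "\<rho> i j - \<sigma> i j \<le> \<rho> i j * (1 - x i) + \<rho> i j * (1 - y j)" for i j
    proof -
      have "0 \<le> \<rho> i j * ((1 - x i) * (1 - y j))" using \<rho> x y by simp
      then show ?thesis by (simp add: \<sigma>_def algebra_simps)
    qed
    then have "(\<Sum>i\<in>I. \<Sum>j\<in>I. \<rho> i j - \<sigma> i j) \<le> (\<Sum>i\<in>I. \<Sum>j\<in>I. \<rho> i j * (1 - x i) + \<rho> i j * (1 - y j))"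
      by (intro sum_mono)
    also have "\<dots> = (\<Sum>i\<in>I. r i * (1 - x i)) + (\<Sum>j\<in>I. s j * (1 - y j))"
    proof -
      have "(\<Sum>i\<in>I. \<Sum>j\<in>I. \<rho> i j * (1 - y j)) = (\<Sum>j\<in>I. \<Sum>i\<in>I. \<rho> i j * (1 - y j))" by (rule sum.swap)
      then show ?thesis by (simp add: sum.distrib r_def s_def sum_distrib_right)
    qed
    also have "\<dots> \<le> \<delta>" unfolding \<delta>_def using x y by (intro add_mono sum_mono) auto
    finally have "(\<Sum>i\<in>I. r i) - (\<Sum>i\<in>I. \<Sum>j\<in>I. \<sigma> i j) \<le> \<delta>" by (simp add: sum_subtractf r_def)
    moreover have "1 - (\<Sum>i\<in>I. r i) \<le> (\<Sum>i\<in>I. \<bar>p i - r i\<bar>)"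
      unfolding p(2)[symmetric] sum_subtractf[symmetric] by (intro sum_mono) auto
    moreover have "(\<Sum>i\<in>I. \<bar>p i - r i\<bar>) \<le> \<delta>" unfolding \<delta>_def by (simp add: sum_nonneg)
    ultimately show ?thesis unfolding \<tau>1 by linarith
  qed
  \<comment> \<open>If \<open>\<tau> = 0\<close> the quotient is 0 by convention, and then
    \<open>\<alpha>\<close> and \<open>\<beta>\<close> vanish on \<open>I\<close>, so the marginals
    are still right.\<close>
  define \<pi> where "\<pi> = (\<lambda>i j. \<sigma> i j + \<alpha> i * \<beta> j / \<tau>)"
  have z\<alpha>: "\<alpha> i = 0" if "\<tau> = 0" "i \<in> I" for i
    using that \<alpha>0 I unfolding \<tau>_def by (simp add: sum_nonneg_eq_0_iff)
  have z\<beta>: "\<beta> i = 0" if "\<tau> = 0" "i \<in> I" for i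
    using that \<beta>0 I unfolding \<tau>\<beta> by (simp add: sum_nonneg_eq_0_iff)
  have "(\<Sum>j\<in>I. \<pi> i j) = p i" if "i \<in> I" for i
  proof -
    have "(\<Sum>j\<in>I. \<alpha> i * \<beta> j / \<tau>) = \<alpha> i * \<tau> / \<tau>"
      unfolding \<tau>\<beta> by (simp add: sum_distrib_left sum_divide_distrib)
    also have "\<dots> = \<alpha> i" using z\<alpha> that by auto
    finally show ?thesis by (simp add: \<pi>_def sum.distrib \<alpha>_def)
  qed
  moreover have "(\<Sum>i\<in>I. \<pi> i j) = q j" if "j \<in> I" for j
  proof -
    have "(\<Sum>i\<in>I. \<alpha> i * \<beta> j / \<tau>) = \<tau> * \<beta> j / \<tau>"
      unfolding \<tau>_def by (simp add: sum_distrib_right sum_divide_distrib)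
    also have "\<dots> = \<beta> j" using z\<beta> that by auto
    finally show ?thesis by (simp add: \<pi>_def sum.distrib \<beta>_def)
  qed
  moreover have "\<pi> i j \<ge> 0" for i j using \<sigma>0 \<alpha>0 \<beta>0 \<tau>0 by (simp add: \<pi>_def)
  moreover have "(\<Sum>i\<in>I. \<Sum>j\<in>I. \<pi> i j * D i j) \<le> B + e"
  proof -
    have "(\<Sum>i\<in>I. \<Sum>j\<in>I. \<pi> i j * D i j) \<le> (\<Sum>i\<in>I. \<Sum>j\<in>I. \<rho> i j * D i j + \<alpha> i * \<beta> j / \<tau> * Dm)"
      unfolding \<pi>_def distrib_right using \<sigma>_le D0 Dm \<alpha>0 \<beta>0 \<tau>0
      by (intro sum_mono add_mono mult_right_mono mult_left_mono) auto
    also have "\<dots> = cost + (\<Sum>i\<in>I. \<Sum>j\<in>I. \<alpha> i * \<beta> j / \<tau> * Dm)"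
      by (simp add: sum.distrib cost_def)
    also have "(\<Sum>i\<in>I. \<Sum>j\<in>I. \<alpha> i * \<beta> j / \<tau> * Dm) = sum \<alpha> I * sum \<beta> I / \<tau> * Dm"
      by (subst sum_product) (simp add: sum_divide_distrib sum_distrib_right)
    also have "sum \<alpha> I * sum \<beta> I / \<tau> * Dm = \<tau> * \<tau> / \<tau> * Dm"
      by (simp only: \<tau>_def[symmetric] \<tau>\<beta>[symmetric])
    also have "\<tau> * \<tau> / \<tau> * Dm = \<tau> * Dm" by simp
    also have "cost + \<tau> * Dm \<le> (B + e / 2) + (2 * \<delta>) * Dm"
      using cost_le \<tau>_le Dm0 by (intro add_mono mult_right_mono) auto
    also have "\<dots> \<le> B + e" using \<delta>_le by (simp add: algebra_simps)
    finally show ?thesis .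
  qed
  ultimately show ?thesis by blast
qed

section \<open>The Euclidean metric and the passage from finitely supported to general laws\<close>

lemma cvec_dist_nonneg: "cvec_dist d u v \<ge> 0"
  by (simp add: cvec_dist_def L2_set_nonneg)

lemma cvec_dist_self: "cvec_dist d u u = 0"
  by (simp add: cvec_dist_def L2_set_def)

lemma cvec_dist_commute: "cvec_dist d u v = cvec_dist d v u"
  by (simp add: cvec_dist_def norm_minus_commute)

lemma cvec_dist_triangle: "cvec_dist d u w \<le> cvec_dist d u v + cvec_dist d v w"
proof -
  have "cvec_dist d u w \<le> L2_set (\<lambda>k. norm (u k - v k) + norm (v k - w k)) {1..d}"
    unfolding cvec_dist_def by (intro L2_set_mono) (use norm_triangle_ineq[of "u k - v k" "v k - w k" for k] in auto)
  also have "\<dots> \<le> cvec_dist d u v + cvec_dist d v w"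
    unfolding cvec_dist_def by (rule L2_set_triangle_ineq)
  finally show ?thesis .
qed

lemma cvec_dist_le_sum: "cvec_dist d u v \<le> (\<Sum>k\<in>{1..d}. norm (u k - v k))"
  unfolding cvec_dist_def by (rule L2_set_le_sum) auto

lemma measurable_cvec_dist [measurable]:
  assumes "f \<in> measurable M (cvec_algebra d)" "g \<in> measurable M (cvec_algebra d)"
  shows "(\<lambda>x. cvec_dist d (f x) (g x)) \<in> borel_measurable M"
proof -
  have [measurable]: "(\<lambda>x. f x k) \<in> borel_measurable M" "(\<lambda>x. g x k) \<in> borel_measurable M"
    if "k \<in> {1..d}" for k
    using assms that unfolding cvec_algebra_def by (auto intro: measurable_compose[OF _ measurable_component_singleton])
  show ?thesis unfolding cvec_dist_def L2_set_def by measurable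
qed

lemma (in prob_space) nn_integral_finite_range:
  assumes rr: "rr \<in> measurable M (count_space I)" and I: "finite I" and g: "\<And>c. c \<in> I \<Longrightarrow> g c \<ge> 0"
  shows "(\<integral>\<^sup>+ x. ennreal (g (rr x)) \<partial>M) = ennreal (\<Sum>c\<in>I. g c * prob (rr -` {c} \<inter> space M))"
proof -
  have [measurable]: "rr -` {c} \<inter> space M \<in> sets M" if "c \<in> I" for c
    using measurable_sets[OF rr, of "{c}"] that by simp
  have "(\<integral>\<^sup>+ x. ennreal (g (rr x)) \<partial>M) = (\<integral>\<^sup>+ x. (\<Sum>c\<in>I. ennreal (g c) * indicator (rr -` {c} \<inter> space M) x) \<partial>M)"
  proof (intro nn_integral_cong)
    fix x assume x: "x \<in> space M"
    then have "rr x \<in> I" using rr by (auto simp: measurable_def)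
    have "(\<Sum>c\<in>I. ennreal (g c) * indicator (rr -` {c} \<inter> space M) x) = (\<Sum>c\<in>I. if c = rr x then ennreal (g c) else 0)"
      using x by (intro sum.cong) (auto simp: indicator_def)
    then show "ennreal (g (rr x)) = (\<Sum>c\<in>I. ennreal (g c) * indicator (rr -` {c} \<inter> space M) x)"
      using I \<open>rr x \<in> I\<close> by simp
  qed
  also have "\<dots> = (\<Sum>c\<in>I. ennreal (g c) * emeasure M (rr -` {c} \<inter> space M))"
    by (subst nn_integral_sum) (auto simp: nn_integral_cmult_indicator)
  also have "\<dots> = (\<Sum>c\<in>I. ennreal (g c * prob (rr -` {c} \<inter> space M)))"
    using g by (intro sum.cong) (auto simp: emeasure_eq_measure ennreal_mult)
  also have "\<dots> = ennreal (\<Sum>c\<in>I. g c * prob (rr -` {c} \<inter> space M))"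
    using g by (intro sum_ennreal) auto
  finally show ?thesis .
qed

lemma (in prob_space) integral_finite_range:
  fixes g :: "'b \<Rightarrow> real"
  assumes rr: "rr \<in> measurable M (count_space I)" and I: "finite I"
  shows "(\<integral> x. g (rr x) \<partial>M) = (\<Sum>c\<in>I. g c * prob (rr -` {c} \<inter> space M))"
proof -
  have [measurable]: "rr -` {c} \<inter> space M \<in> sets M" if "c \<in> I" for c
    using measurable_sets[OF rr, of "{c}"] that by simp
  have "(\<integral> x. g (rr x) \<partial>M) = (\<integral> x. (\<Sum>c\<in>I. g c * indicator (rr -` {c} \<inter> space M) x) \<partial>M)"
  proof (intro Bochner_Integration.integral_cong refl)
    fix x assume x: "x \<in> space M"
    then have "rr x \<in> I" using rr by (auto simp: measurable_def)
    have "(\<Sum>c\<in>I. g c * indicator (rr -` {c} \<inter> space M) x) = (\<Sum>c\<in>I. if c = rr x then g c else 0)"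
      using x by (intro sum.cong) (auto simp: indicator_def)
    then show "g (rr x) = (\<Sum>c\<in>I. g c * indicator (rr -` {c} \<inter> space M) x)"
      using I \<open>rr x \<in> I\<close> by simp
  qed
  also have "\<dots> = (\<Sum>c\<in>I. g c * prob (rr -` {c} \<inter> space M))"
    by (subst Bochner_Integration.integral_sum)
       (auto intro!: integrable_mult_right sum.cong simp: emeasure_eq_measure)
  finally show ?thesis .
qed

text \<open>A finite transport plan \<open>\<pi>\<close> between the images of \<open>M\<close> and \<open>N\<close> under a map with finitely
  many values lifts to the coupling of \<open>M\<close> and \<open>N\<close> that is a product measure on every cell.\<close>

lemma coupling_of_finite_plan:
  fixes r :: "'x \<Rightarrow> 'a"
  assumes M: "prob_space M" and N: "prob_space N" and I: "finite I"
    and rM: "r \<in> measurable M (count_space I)" and rN: "r \<in> measurable N (count_space I)"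
    and p: "\<And>c. p c = measure M (r -` {c} \<inter> space M)"
    and q: "\<And>c. q c = measure N (r -` {c} \<inter> space N)"
    and \<pi>0: "\<And>a b. \<pi> a b \<ge> 0"
    and rows: "\<And>a. a \<in> I \<Longrightarrow> (\<Sum>b\<in>I. \<pi> a b) = p a"
    and cols: "\<And>b. b \<in> I \<Longrightarrow> (\<Sum>a\<in>I. \<pi> a b) = q b"
  shows "\<exists>P\<in>couplings M N. \<forall>D. (\<forall>a b. D a b \<ge> 0) \<longrightarrow>
     (\<integral>\<^sup>+ z. ennreal (D (r (fst z)) (r (snd z))) \<partial>P) = ennreal (\<Sum>a\<in>I. \<Sum>b\<in>I. \<pi> a b * D a b)"
proof -
  interpret M: prob_space M by fact
  interpret N: prob_space N by fact
  interpret MN: pair_prob_space M N ..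
  \<comment> \<open>Density of the coupling with respect to the product measure, constant on cells.
    On a cell of mass zero the quotient is 0, which is right because the plan puts no mass there
    either.\<close>
  define h where "h = (\<lambda>a b. \<pi> a b / (p a * q b))"
  have p0: "p a \<ge> 0" for a by (simp add: p)
  have q0: "q a \<ge> 0" for a by (simp add: q)
  have h0: "h a b \<ge> 0" for a b using \<pi>0 p0 q0 by (simp add: h_def)
  have zq: "\<pi> a b = 0" if "q b = 0" "a \<in> I" "b \<in> I" for a b
    using cols[of b] that I \<pi>0 by (simp add: sum_nonneg_eq_0_iff)
  have zp: "\<pi> a b = 0" if "p a = 0" "a \<in> I" "b \<in> I" for a b
    using rows[of a] that I \<pi>0 by (simp add: sum_nonneg_eq_0_iff)
  have hq: "h a b * q b = \<pi> a b / p a" if "a \<in> I" "b \<in> I" for a b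
    using zq[of b a] that by (auto simp: h_def)
  have hp: "h a b * p a = \<pi> a b / q b" if "a \<in> I" "b \<in> I" for a b
    using zp[of a b] that by (auto simp: h_def)
  have rI: "r x \<in> I" if "x \<in> space M" for x using rM that by (auto simp: measurable_def)
  have rI': "r x \<in> I" if "x \<in> space N" for x using rN that by (auto simp: measurable_def)
  have mh[measurable]: "(\<lambda>z. g (r (fst z)) (r (snd z))) \<in> borel_measurable (M \<Otimes>\<^sub>M N)" for g :: "'a \<Rightarrow> 'a \<Rightarrow> real"
  proof -
    have "(\<lambda>z. (r (fst z), r (snd z))) \<in> measurable (M \<Otimes>\<^sub>M N) (count_space I \<Otimes>\<^sub>M count_space I)"
      using rM rN by (intro measurable_Pair) (auto intro: measurable_compose[OF measurable_fst] measurable_compose[OF measurable_snd])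
    also have "count_space I \<Otimes>\<^sub>M count_space I = count_space (I \<times> I)"
      using I by (intro pair_measure_count_space)
    finally have "(\<lambda>z. (r (fst z), r (snd z))) \<in> measurable (M \<Otimes>\<^sub>M N) (count_space (I \<times> I))" .
    from measurable_compose[OF this, of "\<lambda>(a, b). g a b" borel] show ?thesis by simp
  qed
  \<comment> \<open>In the marginal computation the row sum is divided by \<open>p (r x)\<close>, so
    cells of mass zero have to be discarded first.\<close>
  have AEp: "AE x in M. p (r x) > 0"
  proof -
    have "AE x in M. r x \<noteq> c" if "c \<in> I" "p c = 0" for c
    proof (rule AE_I')
      show "r -` {c} \<inter> space M \<in> null_sets M"
        using measurable_sets[OF rM, of "{c}"] that by (auto simp: null_sets_def M.emeasure_eq_measure p)
    qed auto
    then have "AE x in M. \<forall>c\<in>{c\<in>I. p c = 0}. r x \<noteq> c"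
      using I by (intro AE_finite_allI) auto
    then show ?thesis
      by (rule AE_mp) (intro AE_I2 impI, use rI p0 in \<open>fastforce simp: order_less_le\<close>)
  qed
  have AEq: "AE x in N. q (r x) > 0"
  proof -
    have "AE x in N. r x \<noteq> c" if "c \<in> I" "q c = 0" for c
    proof (rule AE_I')
      show "r -` {c} \<inter> space N \<in> null_sets N"
        using measurable_sets[OF rN, of "{c}"] that by (auto simp: null_sets_def N.emeasure_eq_measure q)
    qed auto
    then have "AE x in N. \<forall>c\<in>{c\<in>I. q c = 0}. r x \<noteq> c"
      using I by (intro AE_finite_allI) auto
    then show ?thesis
      by (rule AE_mp) (intro AE_I2 impI, use rI' q0 in \<open>fastforce simp: order_less_le\<close>)
  qed
  define P where "P = density (M \<Otimes>\<^sub>M N) (\<lambda>z. ennreal (h (r (fst z)) (r (snd z))))"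
  have sets_P: "sets P = sets (M \<Otimes>\<^sub>M N)" by (simp add: P_def)
  have fst_P: "distr P M fst = M"
  proof (rule measure_eqI)
    fix A assume "A \<in> sets (distr P M fst)"
    then have A[measurable]: "A \<in> sets M" by simp
    have mf: "fst \<in> measurable P M" by (simp add: P_def)
    have "emeasure (distr P M fst) A = (\<integral>\<^sup>+ z. indicator A (fst z) \<partial>P)"
    proof -
      have "emeasure (distr P M fst) A = (\<integral>\<^sup>+ z. indicator A z \<partial>distr P M fst)" by simp
      also have "\<dots> = (\<integral>\<^sup>+ z. indicator A (fst z) \<partial>P)" using mf by (intro nn_integral_distr) auto
      finally show ?thesis .
    qed
    also have "\<dots> = (\<integral>\<^sup>+ z. ennreal (h (r (fst z)) (r (snd z))) * indicator A (fst z) \<partial>(M \<Otimes>\<^sub>M N))"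
      unfolding P_def by (intro nn_integral_density) measurable
    also have "\<dots> = (\<integral>\<^sup>+ x. (\<integral>\<^sup>+ y. ennreal (h (r x) (r y)) * indicator A x \<partial>N) \<partial>M)"
      by (subst N.nn_integral_fst[symmetric]) (auto simp: case_prod_beta)
    also have "\<dots> = (\<integral>\<^sup>+ x. indicator A x \<partial>M)"
    proof (rule nn_integral_cong_AE, rule AE_mp[OF AEp], rule AE_I2, rule impI)
      fix x assume x: "x \<in> space M" "0 < p (r x)"
      have "(\<integral>\<^sup>+ y. ennreal (h (r x) (r y)) * indicator A x \<partial>N) = (\<integral>\<^sup>+ y. ennreal (h (r x) (r y)) \<partial>N) * indicator A x"
        by (simp add: indicator_def)
      also have "(\<integral>\<^sup>+ y. ennreal (h (r x) (r y)) \<partial>N) = ennreal (\<Sum>b\<in>I. h (r x) b * q b)"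
        unfolding q using N.nn_integral_finite_range[OF rN I, of "h (r x)"] h0 by simp
      also have "(\<Sum>b\<in>I. h (r x) b * q b) = (\<Sum>b\<in>I. \<pi> (r x) b) / p (r x)"
        using rI x by (simp add: hq sum_divide_distrib)
      also have "\<dots> = 1" using rI x rows by simp
      finally show "(\<integral>\<^sup>+ y. ennreal (h (r x) (r y)) * indicator A x \<partial>N) = indicator A x" by simp
    qed
    finally show "emeasure (distr P M fst) A = emeasure M A" by simp
  qed simp
  have snd_P: "distr P N snd = N"
  proof (rule measure_eqI)
    fix A assume "A \<in> sets (distr P N snd)"
    then have A[measurable]: "A \<in> sets N" by simp
    have mf: "snd \<in> measurable P N" by (simp add: P_def)
    have "emeasure (distr P N snd) A = (\<integral>\<^sup>+ z. indicator A (snd z) \<partial>P)"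
    proof -
      have "emeasure (distr P N snd) A = (\<integral>\<^sup>+ z. indicator A z \<partial>distr P N snd)" by simp
      also have "\<dots> = (\<integral>\<^sup>+ z. indicator A (snd z) \<partial>P)" using mf by (intro nn_integral_distr) auto
      finally show ?thesis .
    qed
    also have "\<dots> = (\<integral>\<^sup>+ z. ennreal (h (r (fst z)) (r (snd z))) * indicator A (snd z) \<partial>(M \<Otimes>\<^sub>M N))"
      unfolding P_def by (intro nn_integral_density) measurable
    also have "\<dots> = (\<integral>\<^sup>+ y. (\<integral>\<^sup>+ x. ennreal (h (r x) (r y)) * indicator A y \<partial>M) \<partial>N)"
      by (subst MN.nn_integral_snd[symmetric]) (auto simp: case_prod_beta)
    also have "\<dots> = (\<integral>\<^sup>+ y. indicator A y \<partial>N)"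
    proof (rule nn_integral_cong_AE, rule AE_mp[OF AEq], rule AE_I2, rule impI)
      fix y assume y: "y \<in> space N" "0 < q (r y)"
      have "(\<integral>\<^sup>+ x. ennreal (h (r x) (r y)) * indicator A y \<partial>M) = (\<integral>\<^sup>+ x. ennreal (h (r x) (r y)) \<partial>M) * indicator A y"
        by (simp add: indicator_def)
      also have "(\<integral>\<^sup>+ x. ennreal (h (r x) (r y)) \<partial>M) = ennreal (\<Sum>a\<in>I. h a (r y) * p a)"
        unfolding p using M.nn_integral_finite_range[OF rM I, of "\<lambda>a. h a (r y)"] h0 by simp
      also have "(\<Sum>a\<in>I. h a (r y) * p a) = (\<Sum>a\<in>I. \<pi> a (r y)) / q (r y)"
        using rI' y by (simp add: hp sum_divide_distrib)
      also have "\<dots> = 1" using rI' y cols by simp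
      finally show "(\<integral>\<^sup>+ x. ennreal (h (r x) (r y)) * indicator A y \<partial>M) = indicator A y" by simp
    qed
    finally show "emeasure (distr P N snd) A = emeasure N A" by simp
  qed simp
  have "(\<integral>\<^sup>+ z. ennreal (D (r (fst z)) (r (snd z))) \<partial>P) = ennreal (\<Sum>a\<in>I. \<Sum>b\<in>I. \<pi> a b * D a b)"
    if D: "\<And>a b. D a b \<ge> 0" for D
  proof -
    have "(\<integral>\<^sup>+ z. ennreal (D (r (fst z)) (r (snd z))) \<partial>P)
       = (\<integral>\<^sup>+ z. ennreal (h (r (fst z)) (r (snd z))) * ennreal (D (r (fst z)) (r (snd z))) \<partial>(M \<Otimes>\<^sub>M N))"
      unfolding P_def by (intro nn_integral_density) measurable
    also have "\<dots> = (\<integral>\<^sup>+ z. ennreal (h (r (fst z)) (r (snd z)) * D (r (fst z)) (r (snd z))) \<partial>(M \<Otimes>\<^sub>M N))"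
      using h0 D by (simp add: ennreal_mult)
    also have "\<dots> = (\<integral>\<^sup>+ x. (\<integral>\<^sup>+ y. ennreal (h (r x) (r y) * D (r x) (r y)) \<partial>N) \<partial>M)"
      using mh[of "\<lambda>a b. h a b * D a b"] by (subst N.nn_integral_fst[symmetric]) auto
    also have "\<dots> = (\<integral>\<^sup>+ x. ennreal (\<Sum>b\<in>I. h (r x) b * D (r x) b * q b) \<partial>M)"
      unfolding q using h0 D
      by (intro nn_integral_cong N.nn_integral_finite_range[OF rN I, of "\<lambda>b. h a b * D a b" for a]) auto
    also have "\<dots> = ennreal (\<Sum>a\<in>I. (\<Sum>b\<in>I. h a b * D a b * q b) * p a)"
      unfolding p using h0 D q0 by (intro M.nn_integral_finite_range[OF rM I]) (auto intro!: sum_nonneg)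
    also have "(\<Sum>a\<in>I. (\<Sum>b\<in>I. h a b * D a b * q b) * p a) = (\<Sum>a\<in>I. \<Sum>b\<in>I. \<pi> a b * D a b)"
    proof -
      have "h a b * D a b * q b * p a = \<pi> a b * D a b" if "a \<in> I" "b \<in> I" for a b
        using hq[OF that] zp[OF _ that] by (simp add: field_simps)
      then show ?thesis unfolding sum_distrib_right by (intro sum.cong refl) blast
    qed
    finally show ?thesis .
  qed
  moreover have "P \<in> couplings M N" unfolding couplings_def using sets_P fst_P snd_P by simp
  ultimately show ?thesis by blast
qed

text \<open>Both laws are rounded, coordinate by coordinate, to the finite range of a simple
  function, where finite duality applies; the finite plan is then lifted to a coupling. By the first
  moments the rounding moves each law arbitrarily little in mean. The test functions in
  \<open>dual\<close> are bounded, so their integrals exist.\<close>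

lemma wasserstein1_le_of_lipschitz_bound:
  assumes M: "prob_space M" "sets M = sets (cvec_algebra d)"
    and N: "prob_space N" "sets N = sets (cvec_algebra d)"
    and iM: "\<And>k. k \<in> {1..d} \<Longrightarrow> integrable M (\<lambda>x. norm (x k))"
    and iN: "\<And>k. k \<in> {1..d} \<Longrightarrow> integrable N (\<lambda>x. norm (x k))"
    and dual: "\<And>f C. \<lbrakk>f \<in> borel_measurable (cvec_algebra d); \<And>x. \<bar>f x\<bar> \<le> C;
                 \<And>x y. \<bar>f x - f y\<bar> \<le> cvec_dist d x y\<rbrakk> \<Longrightarrow> (\<integral>x. f x \<partial>M) - (\<integral>x. f x \<partial>N) \<le> B"
  shows "wasserstein1 d M N \<le> ennreal B"
proof (rule ennreal_le_epsilon)
  fix e :: real assume "e > 0"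
  interpret M: prob_space M by fact
  interpret N: prob_space N by fact
  have B0: "B \<ge> 0" using dual[of "\<lambda>_. 0" 0] cvec_dist_nonneg by simp
  have [measurable_cong]: "sets M = sets (cvec_algebra d)" "sets N = sets (cvec_algebra d)"
    using M N by auto
  have spM: "space M = ({1..d} \<rightarrow>\<^sub>E UNIV)" using sets_eq_imp_space_eq[OF M(2)] by (simp add: cvec_algebra_def space_PiM)
  have spN: "space N = ({1..d} \<rightarrow>\<^sub>E UNIV)" using sets_eq_imp_space_eq[OF N(2)] by (simp add: cvec_algebra_def space_PiM)
  have spC: "space (cvec_algebra d) = ({1..d} \<rightarrow>\<^sub>E UNIV)" by (simp add: cvec_algebra_def space_PiM)
  \<comment> \<open>The bound \<open>2 * dist z 0\<close> makes the rounding error of a coordinate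
    at most three times its modulus, as dominated convergence requires.\<close>
  obtain s :: "nat \<Rightarrow> complex \<Rightarrow> complex" where s: "\<And>i. simple_function borel (s i)"
      "\<And>z. (\<lambda>i. s i z) \<longlonglongrightarrow> z" "\<And>i z. dist (s i z) 0 \<le> 2 * dist z 0"
    using borel_measurable_implies_sequence_metric[of "\<lambda>z. z" "borel :: complex measure" 0] by auto
  have [measurable]: "s i \<in> borel_measurable borel" for i
    using s(1) by (rule borel_measurable_simple_function)
  define rr where "rr = (\<lambda>i x. \<lambda>k\<in>{1..d}. s i (x k))"
  define Is where "Is = (\<lambda>i. PiE {1..d} (\<lambda>_. range (s i)))"
  have finI: "finite (Is i)" for i
    unfolding Is_def using s(1)[of i] by (intro finite_PiE) (auto simp: simple_function_def)
  have rrI: "rr i x \<in> Is i" for i x by (auto simp: rr_def Is_def)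
  have rr_cvec: "rr i \<in> measurable (cvec_algebra d) (cvec_algebra d)" for i
    unfolding rr_def cvec_algebra_def by measurable
  note [measurable] = rr_cvec
  have sing: "{c} \<in> sets (cvec_algebra d)" if "c \<in> Is i" for c i
  proof -
    have "{c} = PiE {1..d} (\<lambda>k. {c k})" using that by (subst PiE_singleton) (auto simp: Is_def PiE_iff)
    then show ?thesis unfolding cvec_algebra_def by (auto intro!: sets_PiM_I_finite)
  qed
  have rrC: "rr i \<in> measurable (cvec_algebra d) (count_space (Is i))" for i
    using finI rrI measurable_sets[OF rr_cvec sing] by (subst measurable_count_space_eq2) auto
  have rrM: "rr i \<in> measurable M (count_space (Is i))" for i using rrC by simp
  have rrN: "rr i \<in> measurable N (count_space (Is i))" for i using rrC by simp
  define \<rho> where "\<rho> = (\<lambda>i x. cvec_dist d x (rr i x))"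
  have \<rho>0: "\<rho> i x \<ge> 0" for i x by (simp add: \<rho>_def cvec_dist_nonneg)
  have \<rho>m[measurable]: "\<rho> i \<in> borel_measurable (cvec_algebra d)" for i
    unfolding \<rho>_def by measurable
  have \<rho>_le: "\<rho> i x \<le> (\<Sum>k\<in>{1..d}. 3 * norm (x k))" for i x
  proof -
    have "\<rho> i x \<le> (\<Sum>k\<in>{1..d}. norm (x k - rr i x k))" unfolding \<rho>_def by (rule cvec_dist_le_sum)
    also have "\<dots> \<le> (\<Sum>k\<in>{1..d}. 3 * norm (x k))"
    proof (rule sum_mono)
      fix k assume "k \<in> {1..d}"
      then show "norm (x k - rr i x k) \<le> 3 * norm (x k)"
        using norm_triangle_ineq4[of "x k" "s i (x k)"] s(3)[of i "x k"] by (simp add: rr_def)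
    qed
    finally show ?thesis .
  qed
  have \<rho>_lim: "(\<lambda>i. \<rho> i x) \<longlonglongrightarrow> 0" for x
  proof (rule tendsto_sandwich[of "\<lambda>_. 0" _ _ "\<lambda>i. \<Sum>k\<in>{1..d}. norm (x k - s i (x k))"])
    show "(\<lambda>i. \<Sum>k\<in>{1..d}. norm (x k - s i (x k))) \<longlonglongrightarrow> 0"
    proof (rule tendsto_null_sum)
      fix k
      have "(\<lambda>i. norm (x k - s i (x k))) \<longlonglongrightarrow> norm (x k - x k)" by (intro tendsto_intros s(2))
      then show "(\<lambda>i. norm (x k - s i (x k))) \<longlonglongrightarrow> 0" by simp
    qed
    show "\<forall>\<^sub>F i in sequentially. \<rho> i x \<le> (\<Sum>k\<in>{1..d}. norm (x k - s i (x k)))"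
    proof (intro always_eventually allI)
      fix i
      show "\<rho> i x \<le> (\<Sum>k\<in>{1..d}. norm (x k - s i (x k)))"
        unfolding \<rho>_def by (rule order_trans[OF cvec_dist_le_sum]) (simp add: rr_def)
    qed
  qed (use \<rho>0 in auto)
  have lim: "integrable Q (\<rho> i)" "(\<lambda>i. \<integral>x. \<rho> i x \<partial>Q) \<longlonglongrightarrow> 0"
    if Q: "sets Q = sets (cvec_algebra d)" "\<And>k. k \<in> {1..d} \<Longrightarrow> integrable Q (\<lambda>x. norm (x k))"
    for Q :: "(nat \<Rightarrow> complex) measure" and i
  proof -
    have [measurable_cong]: "sets Q = sets (cvec_algebra d)" by fact
    have int: "integrable Q (\<lambda>x. \<Sum>k\<in>{1..d}. 3 * norm (x k))"
      using Q(2) by (intro Bochner_Integration.integrable_sum integrable_mult_right) auto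
    have m: "\<rho> i \<in> borel_measurable Q" for i by measurable
    have bd: "AE x in Q. norm (\<rho> i x) \<le> (\<Sum>k\<in>{1..d}. 3 * norm (x k))" for i
      using \<rho>_le \<rho>0 by (intro AE_I2) auto
    show "integrable Q (\<rho> i)"
      by (rule Bochner_Integration.integrable_bound[OF int m]) (use \<rho>_le \<rho>0 in \<open>auto intro!: AE_I2 intro: order_trans[OF _ abs_ge_self]\<close>)
    have "(\<lambda>i. \<integral>x. \<rho> i x \<partial>Q) \<longlonglongrightarrow> (\<integral>x. 0 \<partial>Q)"
      by (rule integral_dominated_convergence[OF _ m int _ bd]) (use \<rho>_lim in auto)
    then show "(\<lambda>i. \<integral>x. \<rho> i x \<partial>Q) \<longlonglongrightarrow> 0" by simp
  qed
  have "\<forall>\<^sub>F i in sequentially. (\<integral>x. \<rho> i x \<partial>M) < e / 6 \<and> (\<integral>x. \<rho> i x \<partial>N) < e / 6"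
    using order_tendstoD(2)[OF lim(2)[OF M(2) iM], of "e / 6"]
      order_tendstoD(2)[OF lim(2)[OF N(2) iN], of "e / 6"] \<open>e > 0\<close>
    by (intro eventually_conj) auto
  then obtain i where i: "(\<integral>x. \<rho> i x \<partial>M) < e / 6" "(\<integral>x. \<rho> i x \<partial>N) < e / 6"
    by (auto simp: eventually_sequentially)
  define I where "I = Is i"
  define r where "r = rr i"
  define p where "p = (\<lambda>c. measure M (r -` {c} \<inter> space M))"
  define q where "q = (\<lambda>c. measure N (r -` {c} \<inter> space N))"
  have rM: "r \<in> measurable M (count_space I)" and rN: "r \<in> measurable N (count_space I)"
    using rrM rrN by (auto simp: r_def I_def)
  have fI: "finite I" using finI by (simp add: I_def)
  have p1: "(\<Sum>c\<in>I. p c) = 1"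
    using M.integral_finite_range[OF rM fI, of "\<lambda>_. 1"] by (simp add: p_def M.prob_space)
  have q1: "(\<Sum>c\<in>I. q c) = 1"
    using N.integral_finite_range[OF rN fI, of "\<lambda>_. 1"] by (simp add: q_def N.prob_space)
  have Ine: "I \<noteq> {}" using p1 by auto
  have iMM: "integrable M (\<rho> i)" "integrable N (\<rho> i)" using lim(1)[OF M(2) iM] lim(1)[OF N(2) iN] by auto
  \<comment> \<open>A Lipschitz function on the finite range is extended and tested against the
    original laws. The two rounding errors, each below \<open>e / 6\<close>, make up
    \<open>e / 3\<close>.\<close>
  have dualI: "(\<Sum>c\<in>I. \<phi> c * p c) - (\<Sum>c\<in>I. \<phi> c * q c) \<le> B + e / 3"
    if \<phi>: "\<And>a b. a \<in> I \<Longrightarrow> b \<in> I \<Longrightarrow> \<phi> a - \<phi> b \<le> cvec_dist d a b" for \<phi> :: "(nat \<Rightarrow> complex) \<Rightarrow> real"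
  proof -
    define C where "C = (\<Sum>c\<in>I. \<bar>\<phi> c\<bar>)"
    have C: "\<bar>\<phi> c\<bar> \<le> C" if "c \<in> I" for c unfolding C_def using that fI by (intro member_le_sum) auto
    \<comment> \<open>McShane extension: the largest 1-Lipschitz function that agrees with
      \<open>\<phi>\<close> on \<open>I\<close>. Truncation at \<open>C\<close> leaves the values on
      \<open>I\<close> alone and makes it bounded.\<close>
    define g where "g = (\<lambda>x. Min ((\<lambda>c. \<phi> c + cvec_dist d x c) ` I))"
    define f where "f = (\<lambda>x. max (- C) (min C (g x)))"
    have g_le: "g x \<le> \<phi> c + cvec_dist d x c" if "c \<in> I" for x c
      unfolding g_def using fI that by (intro Min_le) auto
    have g_ge: "a \<le> g x" if "\<And>c. c \<in> I \<Longrightarrow> a \<le> \<phi> c + cvec_dist d x c" for x a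
      unfolding g_def using fI Ine that by (subst Min_ge_iff) auto
    have gI: "g c = \<phi> c" if "c \<in> I" for c
    proof (rule antisym)
      show "g c \<le> \<phi> c" using g_le[OF that, of c] by (simp add: cvec_dist_self)
      show "\<phi> c \<le> g c"
      proof (rule g_ge)
        fix b assume "b \<in> I"
        then show "\<phi> c \<le> \<phi> b + cvec_dist d c b" using \<phi>[OF that \<open>b \<in> I\<close>] by linarith
      qed
    qed
    have g_lip: "g x - g y \<le> cvec_dist d x y" for x y
    proof -
      have "g x - cvec_dist d x y \<le> g y"
      proof (rule g_ge)
        fix c assume "c \<in> I"
        then show "g x - cvec_dist d x y \<le> \<phi> c + cvec_dist d y c"
          using g_le[OF \<open>c \<in> I\<close>, of x] cvec_dist_triangle[of d x c y] by linarith
      qed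
      then show ?thesis by linarith
    qed
    have f_lip: "\<bar>f x - f y\<bar> \<le> cvec_dist d x y" for x y
      using g_lip[of x y] g_lip[of y x] cvec_dist_commute[of d x y] by (auto simp: f_def)
    have fI': "f c = \<phi> c" if "c \<in> I" for c using C[OF that] gI[OF that] by (auto simp: f_def)
    have C0: "C \<ge> 0" unfolding C_def by (intro sum_nonneg) auto
    have f_bd: "\<bar>f x\<bar> \<le> C" for x using C0 by (auto simp: f_def)
    have [measurable]: "g \<in> borel_measurable (cvec_algebra d)"
      unfolding g_def
    proof (rule borel_measurable_Min[OF fI])
      fix c assume "c \<in> I"
      then have "c \<in> space (cvec_algebra d)" using spC by (auto simp: I_def Is_def)
      then show "(\<lambda>x. \<phi> c + cvec_dist d x c) \<in> borel_measurable (cvec_algebra d)" by measurable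
    qed
    have fm[measurable]: "f \<in> borel_measurable (cvec_algebra d)" unfolding f_def by measurable
    have if_int: "integrable M f" "integrable N f"
      using f_bd by (auto intro!: M.integrable_const_bound[of _ C] N.integrable_const_bound[of _ C])
    have "(\<Sum>c\<in>I. \<phi> c * p c) = (\<integral>x. \<phi> (r x) \<partial>M)"
      unfolding p_def by (rule M.integral_finite_range[OF rM fI, symmetric])
    also have "\<dots> \<le> (\<integral>x. f x + \<rho> i x \<partial>M)"
    proof (rule integral_mono)
      have "integrable M (\<lambda>x. f (rr i x))"
        using f_bd by (intro M.integrable_const_bound[of _ C]) auto
      then show "integrable M (\<lambda>x. \<phi> (r x))" using fI' rrI by (simp add: r_def I_def)
      show "integrable M (\<lambda>x. f x + \<rho> i x)"
        using if_int iMM by (intro Bochner_Integration.integrable_add) auto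
      show "\<phi> (r x) \<le> f x + \<rho> i x" for x
        using f_lip[of x "rr i x"] fI'[of "rr i x"] rrI[of i x] by (auto simp: r_def I_def \<rho>_def abs_le_iff)
    qed
    also have "\<dots> = (\<integral>x. f x \<partial>M) + (\<integral>x. \<rho> i x \<partial>M)"
      using if_int iMM by (intro Bochner_Integration.integral_add) auto
    finally have 1: "(\<Sum>c\<in>I. \<phi> c * p c) \<le> (\<integral>x. f x \<partial>M) + (\<integral>x. \<rho> i x \<partial>M)" .
    have "(\<integral>x. f x \<partial>N) - (\<integral>x. \<rho> i x \<partial>N) = (\<integral>x. f x - \<rho> i x \<partial>N)"
      using if_int iMM by (intro Bochner_Integration.integral_diff[symmetric]) auto
    also have "\<dots> \<le> (\<integral>x. \<phi> (r x) \<partial>N)"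
    proof (rule integral_mono)
      have "integrable N (\<lambda>x. f (rr i x))"
        using f_bd by (intro N.integrable_const_bound[of _ C]) auto
      then show "integrable N (\<lambda>x. \<phi> (r x))" using fI' rrI by (simp add: r_def I_def)
      show "integrable N (\<lambda>x. f x - \<rho> i x)"
        using if_int iMM by (intro Bochner_Integration.integrable_diff) auto
      show "f x - \<rho> i x \<le> \<phi> (r x)" for x
        using f_lip[of x "rr i x"] fI'[of "rr i x"] rrI[of i x] by (auto simp: r_def I_def \<rho>_def abs_le_iff)
    qed
    also have "\<dots> = (\<Sum>c\<in>I. \<phi> c * q c)"
      unfolding q_def by (rule N.integral_finite_range[OF rN fI])
    finally have 2: "(\<integral>x. f x \<partial>N) - (\<integral>x. \<rho> i x \<partial>N) \<le> (\<Sum>c\<in>I. \<phi> c * q c)" .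
    have "(\<integral>x. f x \<partial>M) - (\<integral>x. f x \<partial>N) \<le> B" by (rule dual[OF fm f_bd f_lip])
    then show ?thesis using 1 2 i by linarith
  qed
  have p0: "p c \<ge> 0" and q0: "q c \<ge> 0" for c by (auto simp: p_def q_def)
  have "0 < e / 6" using \<open>e > 0\<close> by simp
  from finite_kantorovich_duality[where D = "cvec_dist d" and p = p and q = q and B = "B + e / 3",
      OF fI cvec_dist_nonneg cvec_dist_self cvec_dist_triangle p0 p1 q0 q1 dualI this]
  obtain \<pi> where \<pi>: "\<And>a b. \<pi> a b \<ge> 0" "\<And>a. a \<in> I \<Longrightarrow> (\<Sum>b\<in>I. \<pi> a b) = p a"
      "\<And>b. b \<in> I \<Longrightarrow> (\<Sum>a\<in>I. \<pi> a b) = q b"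
      "(\<Sum>a\<in>I. \<Sum>b\<in>I. \<pi> a b * cvec_dist d a b) \<le> (B + e / 3) + e / 6"
    by blast
  obtain P where P: "P \<in> couplings M N" "\<And>D. (\<And>a b. D a b \<ge> 0) \<Longrightarrow>
     (\<integral>\<^sup>+ z. ennreal (D (r (fst z)) (r (snd z))) \<partial>P) = ennreal (\<Sum>a\<in>I. \<Sum>b\<in>I. \<pi> a b * D a b)"
    using coupling_of_finite_plan[OF M(1) N(1) fI rM rN p_def[THEN fun_cong] q_def[THEN fun_cong] \<pi>(1-3)] by blast
  have [measurable_cong]: "sets P = sets (M \<Otimes>\<^sub>M N)" using P(1) by (simp add: couplings_def)
  have fstP: "distr P M fst = M" and sndP: "distr P N snd = N" using P(1) by (auto simp: couplings_def)
  have mr[measurable]: "r \<in> measurable (cvec_algebra d) (cvec_algebra d)" unfolding r_def by measurable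
  \<comment> \<open>Triangle inequality through the two rounded points. The errors add up to five
    sixths of \<open>e\<close>.\<close>
  have "wasserstein1 d M N \<le> (\<integral>\<^sup>+ (u, v). ennreal (cvec_dist d u v) \<partial>P)"
    unfolding wasserstein1_def by (rule INF_lower[OF P(1)])
  also have "\<dots> \<le> (\<integral>\<^sup>+ z. ennreal (\<rho> i (fst z)) + ennreal (cvec_dist d (r (fst z)) (r (snd z))) + ennreal (\<rho> i (snd z)) \<partial>P)"
  proof (rule nn_integral_mono)
    fix z :: "(nat \<Rightarrow> complex) \<times> (nat \<Rightarrow> complex)"
    have "cvec_dist d (fst z) (snd z) \<le> \<rho> i (fst z) + cvec_dist d (r (fst z)) (r (snd z)) + \<rho> i (snd z)"
      unfolding \<rho>_def r_def
      using cvec_dist_triangle[of d "fst z" "snd z" "rr i (fst z)"] cvec_dist_triangle[of d "rr i (fst z)" "snd z" "rr i (snd z)"]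
        cvec_dist_commute[of d "rr i (snd z)" "snd z"] by linarith
    then show "(case z of (u, v) \<Rightarrow> ennreal (cvec_dist d u v))
       \<le> ennreal (\<rho> i (fst z)) + ennreal (cvec_dist d (r (fst z)) (r (snd z))) + ennreal (\<rho> i (snd z))"
      using \<rho>0 cvec_dist_nonneg by (auto simp: case_prod_beta ennreal_plus[symmetric] simp del: ennreal_plus intro!: ennreal_leI)
  qed
  also have "\<dots> = (\<integral>\<^sup>+ z. ennreal (\<rho> i (fst z)) \<partial>P) + (\<integral>\<^sup>+ z. ennreal (cvec_dist d (r (fst z)) (r (snd z))) \<partial>P)
      + (\<integral>\<^sup>+ z. ennreal (\<rho> i (snd z)) \<partial>P)"
    by (simp add: nn_integral_add)
  also have "(\<integral>\<^sup>+ z. ennreal (\<rho> i (fst z)) \<partial>P) = (\<integral>\<^sup>+ x. ennreal (\<rho> i x) \<partial>distr P M fst)"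
    by (intro nn_integral_distr[symmetric]) auto
  also have "\<dots> = ennreal (\<integral>x. \<rho> i x \<partial>M)"
    unfolding fstP using iMM \<rho>0 by (intro nn_integral_eq_integral) auto
  also have "(\<integral>\<^sup>+ z. ennreal (\<rho> i (snd z)) \<partial>P) = (\<integral>\<^sup>+ x. ennreal (\<rho> i x) \<partial>distr P N snd)"
    by (intro nn_integral_distr[symmetric]) auto
  also have "\<dots> = ennreal (\<integral>x. \<rho> i x \<partial>N)"
    unfolding sndP using iMM \<rho>0 by (intro nn_integral_eq_integral) auto
  also have "(\<integral>\<^sup>+ z. ennreal (cvec_dist d (r (fst z)) (r (snd z))) \<partial>P) = ennreal (\<Sum>a\<in>I. \<Sum>b\<in>I. \<pi> a b * cvec_dist d a b)"
    by (rule P(2)) (rule cvec_dist_nonneg)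
  also have "ennreal (\<integral>x. \<rho> i x \<partial>M) + ennreal (\<Sum>a\<in>I. \<Sum>b\<in>I. \<pi> a b * cvec_dist d a b) + ennreal (\<integral>x. \<rho> i x \<partial>N)
     \<le> ennreal (e / 6) + ennreal (B + e / 3 + e / 6) + ennreal (e / 6)"
    using i \<pi>(4) by (intro add_mono ennreal_leI) auto
  also have "\<dots> \<le> ennreal B + ennreal e"
    using B0 \<open>e > 0\<close> by (simp add: ennreal_plus[symmetric] del: ennreal_plus)
  finally show "wasserstein1 d M N \<le> ennreal B + ennreal e" .
qed

subsection \<open>Schwinger--Dyson equations on the torus\<close>

abbreviation angle_measure :: "real measure" where
  "angle_measure \<equiv> uniform_measure lborel {0..2 * pi}"

lemma prob_space_angle_measure: "prob_space angle_measure"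
  by (rule prob_space_uniform_measure) auto

lemma product_prob_space_angle: "product_prob_space (\<lambda>_::nat. angle_measure)"
  using prob_space_angle_measure
  by (auto simp: product_prob_space_def product_prob_space_axioms_def product_sigma_finite_def
      intro: prob_space_imp_sigma_finite)

lemma prob_space_torus_measure: "prob_space (torus_measure n)"
  unfolding torus_measure_def by (intro prob_space_PiM prob_space_angle_measure)

lemma sets_torus_measure [measurable_cong]: "sets (torus_measure n) = sets (PiM {1..n} (\<lambda>_. borel))"
  unfolding torus_measure_def by (intro sets_PiM_cong) auto

lemma integral_angle_measure:
  fixes h :: "real \<Rightarrow> 'a :: {banach, second_countable_topology}"
  assumes [measurable]: "h \<in> borel_measurable borel"
  shows "(\<integral>t. h t \<partial>angle_measure) = (1 / (2 * pi)) *\<^sub>R (LINT t:{0..2 * pi}|lborel. h t)"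
proof -
  have *: "indicator {0..2*pi} t / ennreal (2 * pi) = ennreal (indicator {0..2*pi} t / (2 * pi))" for t :: real
    by (cases "t \<in> {0..2*pi}") (auto simp: divide_ennreal ennreal_1[symmetric] simp del: ennreal_1)
  have "angle_measure = density lborel (\<lambda>t. ennreal (indicator {0..2*pi} t / (2 * pi)))"
    unfolding uniform_measure_def by (simp add: *)
  then have "(\<integral>t. h t \<partial>angle_measure) = (\<integral>t. (indicator {0..2*pi} t / (2 * pi)) *\<^sub>R h t \<partial>lborel)"
    by (simp add: integral_density)
  also have "\<dots> = (\<integral>t. (1 / (2*pi)) *\<^sub>R (indicator {0..2*pi} t *\<^sub>R h t) \<partial>lborel)"
    by simp
  finally show ?thesis unfolding set_lebesgue_integral_def by (simp only: integral_scaleR_right)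
qed

text \<open>With the other coordinates fixed, the exceptional values of \<open>x j\<close> form a
  single point, so Fubini gives measure zero.\<close>

lemma AE_torus_distinct:
  assumes jk: "j \<in> {1..n}" "k \<in> {1..n}" "j \<noteq> k"
  shows "AE x in torus_measure n. x j \<noteq> x k"
proof -
  interpret product_prob_space "\<lambda>_::nat. angle_measure" by (rule product_prob_space_angle)
  define A where "A = {x \<in> space (torus_measure n). x j = x k}"
  have Am: "A \<in> sets (torus_measure n)" 
    unfolding A_def using jk by measurable
  have ins: "{1..n} = insert j ({1..n} - {j})" using jk by auto
  have "emeasure (torus_measure n) A = (\<integral>\<^sup>+ x. indicator A x \<partial>PiM (insert j ({1..n} - {j})) (\<lambda>_. angle_measure))"
    using Am jk by (simp add: torus_measure_def insert_absorb)
  also have "\<dots> = (\<integral>\<^sup>+ x. (\<integral>\<^sup>+ y. indicator A (x(j := y)) \<partial>angle_measure) \<partial>PiM ({1..n} - {j}) (\<lambda>_. angle_measure))"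
    by (rule product_nn_integral_insert) (use Am jk in \<open>auto simp: torus_measure_def insert_absorb\<close>)
  also have "\<dots> = 0"
  proof (rule nn_integral_zero')
    show "AE x in PiM ({1..n} - {j}) (\<lambda>_. angle_measure). (\<integral>\<^sup>+ y. indicator A (x(j := y)) \<partial>angle_measure) = 0"
    proof (rule AE_I2)
      fix x :: "nat \<Rightarrow> real"
      have "(\<integral>\<^sup>+ y. indicator A (x(j := y)) \<partial>angle_measure) \<le> (\<integral>\<^sup>+ y. indicator {x k} y \<partial>angle_measure)"
        using jk by (intro nn_integral_mono) (auto simp: A_def indicator_def)
      also have "\<dots> = emeasure angle_measure {x k}" by simp
      also have "\<dots> = 0" 
        by (subst emeasure_uniform_measure) (auto intro!: emeasure_lborel_countable)
      finally show "(\<integral>\<^sup>+ y. indicator A (x(j := y)) \<partial>angle_measure) = 0" by simp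
    qed
  qed
  finally have "A \<in> null_sets (torus_measure n)" using Am by auto
  then show ?thesis by (rule AE_I') (auto simp: A_def)
qed

lemma AE_torus_inj: "AE x in torus_measure n. inj_on x {1..n}"
proof -
  have "AE x in torus_measure n. \<forall>j\<in>{1..n}. \<forall>k\<in>{1..n}-{j}. x j \<noteq> x k"
    by (intro AE_finite_allI AE_torus_distinct) auto
  then show ?thesis by eventually_elim (auto simp: inj_on_def)
qed

text \<open>All that integration by parts on the torus asks of a function, packed so that it is
  stable under sums, products, conjugation and \<open>exp\<close>: bounds give integrability and
  periodicity removes the boundary terms. \<open>c' j\<close> is the partial derivative along
  \<open>x(j := t)\<close> at every point, not only inside the period cube.\<close>

definition torus_deriv :: "nat \<Rightarrow> ((nat \<Rightarrow> real) \<Rightarrow> complex) \<Rightarrow> (nat \<Rightarrow> (nat \<Rightarrow> real) \<Rightarrow> complex) \<Rightarrow> bool" where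
  "torus_deriv n c c' \<longleftrightarrow> c \<in> borel_measurable (PiM {1..n} (\<lambda>_. borel)) \<and>
     (\<forall>j\<in>{1..n}. c' j \<in> borel_measurable (PiM {1..n} (\<lambda>_. borel))) \<and>
     (\<exists>B. \<forall>x. norm (c x) \<le> B \<and> (\<forall>j\<in>{1..n}. norm (c' j x) \<le> B)) \<and>
     (\<forall>j\<in>{1..n}. \<forall>x. ((\<lambda>t. c (x(j := t))) has_vector_derivative c' j x) (at (x j)) \<and>
        c (x(j := x j + 2 * pi)) = c x)"

lemma torus_derivD:
  assumes "torus_deriv n c c'"
  shows torus_deriv_measurable: "c \<in> borel_measurable (PiM {1..n} (\<lambda>_. borel))"
    and torus_deriv_measurable': "\<And>j. j \<in> {1..n} \<Longrightarrow> c' j \<in> borel_measurable (PiM {1..n} (\<lambda>_. borel))"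
    and torus_deriv_has_derivative: "\<And>j x. j \<in> {1..n} \<Longrightarrow> ((\<lambda>t. c (x(j := t))) has_vector_derivative c' j x) (at (x j))"
    and torus_deriv_periodic: "\<And>j x. j \<in> {1..n} \<Longrightarrow> c (x(j := x j + 2 * pi)) = c x"
  using assms by (auto simp: torus_deriv_def)

lemma torus_deriv_bounded:
  assumes "torus_deriv n c c'"
  obtains B where "B \<ge> 0" "\<And>x. norm (c x) \<le> B" "\<And>x j. j \<in> {1..n} \<Longrightarrow> norm (c' j x) \<le> B"
proof -
  obtain B where B: "\<forall>x. norm (c x) \<le> B \<and> (\<forall>j\<in>{1..n}. norm (c' j x) \<le> B)"
    using assms by (auto simp: torus_deriv_def)
  moreover have "B \<ge> 0" using B norm_ge_zero order_trans by blast
  ultimately show ?thesis using that by auto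
qed

lemma torus_deriv_const: "torus_deriv n (\<lambda>_. a) (\<lambda>_ _. 0)"
  by (auto simp: torus_deriv_def intro!: exI[of _ "norm a"])

lemma torus_deriv_add:
  assumes c: "torus_deriv n c c'" and e: "torus_deriv n e e'"
  shows "torus_deriv n (\<lambda>x. c x + e x) (\<lambda>j x. c' j x + e' j x)"
proof -
  obtain B where B: "\<And>x. norm (c x) \<le> B" "\<And>x j. j \<in> {1..n} \<Longrightarrow> norm (c' j x) \<le> B"
    using torus_deriv_bounded[OF c] by metis
  obtain C where C: "\<And>x. norm (e x) \<le> C" "\<And>x j. j \<in> {1..n} \<Longrightarrow> norm (e' j x) \<le> C"
    using torus_deriv_bounded[OF e] by metis
  have "\<forall>x. norm (c x + e x) \<le> B + C \<and> (\<forall>j\<in>{1..n}. norm (c' j x + e' j x) \<le> B + C)"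
    using B C by (meson add_mono norm_triangle_le)
  then show ?thesis
    unfolding torus_deriv_def using torus_derivD[OF c] torus_derivD[OF e]
    by (auto intro!: has_vector_derivative_add borel_measurable_add exI[of _ "B + C"])
qed

lemma torus_deriv_mult:
  assumes c: "torus_deriv n c c'" and e: "torus_deriv n e e'"
  shows "torus_deriv n (\<lambda>x. c x * e x) (\<lambda>j x. c x * e' j x + c' j x * e x)"
proof -
  obtain B where B: "B \<ge> 0" "\<And>x. norm (c x) \<le> B" "\<And>x j. j \<in> {1..n} \<Longrightarrow> norm (c' j x) \<le> B"
    using torus_deriv_bounded[OF c] by metis
  obtain C where C: "C \<ge> 0" "\<And>x. norm (e x) \<le> C" "\<And>x j. j \<in> {1..n} \<Longrightarrow> norm (e' j x) \<le> C"
    using torus_deriv_bounded[OF e] by metis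
  have 1: "norm (c x * e x) \<le> 2 * B * C" for x
    using mult_mono[OF B(2)[of x] C(2)[of x] B(1)] mult_nonneg_nonneg[OF B(1) C(1)] by (simp add: norm_mult)
  have 2: "norm (c x * e' j x + c' j x * e x) \<le> 2 * B * C" if "j \<in> {1..n}" for x j
  proof -
    have "norm (c x * e' j x) \<le> B * C" "norm (c' j x * e x) \<le> B * C"
      unfolding norm_mult using B C that by (auto intro!: mult_mono)
    then show ?thesis using norm_triangle_ineq[of "c x * e' j x" "c' j x * e x"] by linarith
  qed
  have 3: "((\<lambda>t. c (x(j := t)) * e (x(j := t))) has_vector_derivative c x * e' j x + c' j x * e x) (at (x j))"
    if "j \<in> {1..n}" for x j
    using has_vector_derivative_mult[OF torus_deriv_has_derivative[OF c that, of x] torus_deriv_has_derivative[OF e that, of x]] by simp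
  show ?thesis
    unfolding torus_deriv_def using torus_derivD[OF c] torus_derivD[OF e] 1 2 3
    by (auto intro!: borel_measurable_add borel_measurable_times exI[of _ "2 * B * C"])
qed

lemma torus_deriv_cmult: "torus_deriv n c c' \<Longrightarrow> torus_deriv n (\<lambda>x. a * c x) (\<lambda>j x. a * c' j x)"
  using torus_deriv_mult[OF torus_deriv_const, of n c c' a] by simp

lemma torus_deriv_uminus: "torus_deriv n c c' \<Longrightarrow> torus_deriv n (\<lambda>x. - c x) (\<lambda>j x. - c' j x)"
  using torus_deriv_cmult[of n c c' "-1"] by simp

lemma torus_deriv_diff: "torus_deriv n c c' \<Longrightarrow> torus_deriv n e e' \<Longrightarrow> torus_deriv n (\<lambda>x. c x - e x) (\<lambda>j x. c' j x - e' j x)"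
  using torus_deriv_add[OF _ torus_deriv_uminus] by simp

lemma torus_deriv_sum:
  assumes "\<And>i. i \<in> I \<Longrightarrow> torus_deriv n (c i) (c' i)"
  shows "torus_deriv n (\<lambda>x. \<Sum>i\<in>I. c i x) (\<lambda>j x. \<Sum>i\<in>I. c' i j x)"
  using assms by (induction I rule: infinite_finite_induct) (auto simp: torus_deriv_const intro: torus_deriv_add)

lemma torus_deriv_cnj:
  assumes c: "torus_deriv n c c'"
  shows "torus_deriv n (\<lambda>x. cnj (c x)) (\<lambda>j x. cnj (c' j x))"
proof -
  obtain B where B: "\<And>x. norm (c x) \<le> B" "\<And>x j. j \<in> {1..n} \<Longrightarrow> norm (c' j x) \<le> B"
    using torus_deriv_bounded[OF c] by metis
  have "((\<lambda>t. cnj (c (x(j := t)))) has_vector_derivative cnj (c' j x)) (at (x j))" if "j \<in> {1..n}" for x j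
    using torus_deriv_has_derivative[OF c that, of x] by (rule has_vector_derivative_cnj)
  moreover have "(\<lambda>x. cnj (c x)) \<in> borel_measurable (PiM {1..n} (\<lambda>_. borel))"
    by (rule measurable_compose[OF torus_derivD(1)[OF c] borel_measurable_continuous_onI]) (intro continuous_intros)
  moreover have "(\<lambda>x. cnj (c' j x)) \<in> borel_measurable (PiM {1..n} (\<lambda>_. borel))" if "j \<in> {1..n}" for j
    by (rule measurable_compose[OF torus_derivD(2)[OF c that] borel_measurable_continuous_onI]) (intro continuous_intros)
  ultimately show ?thesis
    unfolding torus_deriv_def using torus_derivD[OF c] B by (auto intro!: exI[of _ B])
qed

lemma torus_deriv_exp:
  assumes c: "torus_deriv n c c'"
  shows "torus_deriv n (\<lambda>x. exp (c x)) (\<lambda>j x. c' j x * exp (c x))"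
proof -
  obtain B where B: "B \<ge> 0" "\<And>x. norm (c x) \<le> B" "\<And>x j. j \<in> {1..n} \<Longrightarrow> norm (c' j x) \<le> B"
    using torus_deriv_bounded[OF c] by metis
  have e: "norm (exp (c x)) \<le> exp B" for x
    using norm_exp[of "c x"] B(2)[of x] by (meson exp_le_cancel_iff order_trans)
  have "norm (c' j x * exp (c x)) \<le> B * exp B" if "j \<in> {1..n}" for j x
    unfolding norm_mult using B e that by (intro mult_mono) auto
  moreover have "B * exp B \<le> max (exp B) (B * exp B)" "exp B \<le> max (exp B) (B * exp B)" by auto
  ultimately have bd: "\<exists>B. \<forall>x. norm (exp (c x)) \<le> B \<and> (\<forall>j\<in>{1..n}. norm (c' j x * exp (c x)) \<le> B)"
    using e by (meson order_trans)
  have "((\<lambda>t. exp (c (x(j := t)))) has_vector_derivative c' j x * exp (c x)) (at (x j))" if "j \<in> {1..n}" for x j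
    using field_vector_diff_chain_at[OF torus_deriv_has_derivative[OF c that, of x], of exp "exp (c x)"]
    by (simp add: o_def DERIV_exp)
  then show ?thesis
    unfolding torus_deriv_def using torus_derivD[OF c] bd
    by (auto intro!: borel_measurable_times measurable_compose[OF _ borel_measurable_continuous_onI[OF continuous_on_exp[OF continuous_on_id]]])
qed

lemma torus_deriv_cis_power:
  assumes "k \<in> {1..n}"
  shows "torus_deriv n (\<lambda>x. cis (x k) ^ m) (\<lambda>j x. if j = k then \<i> * of_nat m * cis (x k) ^ m else 0)"
proof -
  have d: "((\<lambda>t. cis t ^ m) has_vector_derivative \<i> * of_nat m * cis s ^ m) (at s)" for s
  proof -
    have "((\<lambda>t. exp (\<i> * of_nat m * of_real t)) has_vector_derivative (\<i> * of_nat m) * exp (\<i> * of_nat m * of_real s)) (at s)"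
      by (auto intro!: derivative_eq_intros has_vector_derivative_real_field)
    moreover have "exp (\<i> * of_nat m * of_real t) = cis t ^ m" for t
      by (simp add: cis_conv_exp exp_of_nat_mult[symmetric] mult_ac)
    ultimately show ?thesis by simp
  qed
  have "((\<lambda>t. cis ((x(j := t)) k) ^ m) has_vector_derivative (if j = k then \<i> * of_nat m * cis (x k) ^ m else 0)) (at (x j))" for x j
    using d[of "x k"] by auto
  moreover have "cis (t + 2 * pi) = cis t" for t by (simp add: cis_mult[symmetric])
  moreover have "(\<lambda>x. cis (x k) ^ m) \<in> borel_measurable (PiM {1..n} (\<lambda>_. borel))"
    using assms by (auto simp: cis_conv_exp intro!: borel_measurable_power measurable_compose[OF _ borel_measurable_continuous_onI[OF continuous_on_exp[OF continuous_on_id]]])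
  ultimately show ?thesis
    unfolding torus_deriv_def using assms
    by (auto simp: norm_power norm_mult intro!: exI[of _ "real m + 1"])
qed

definition psum :: "nat \<Rightarrow> nat \<Rightarrow> (nat \<Rightarrow> real) \<Rightarrow> complex" where
  "psum n m x = (\<Sum>j\<in>{1..n}. cis (x j) ^ m)"

lemma torus_deriv_psum: "torus_deriv n (psum n m) (\<lambda>j x. if j \<in> {1..n} then \<i> * of_nat m * cis (x j) ^ m else 0)"
proof -
  have "torus_deriv n (\<lambda>x. \<Sum>k\<in>{1..n}. cis (x k) ^ m) (\<lambda>j x. \<Sum>k\<in>{1..n}. if j = k then \<i> * of_nat m * cis (x k) ^ m else 0)"
    by (intro torus_deriv_sum torus_deriv_cis_power)
  then show ?thesis by (simp add: psum_def[abs_def])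
qed

text \<open>Fubini isolates the angle \<open>j\<close>; there the fundamental theorem leaves a
  difference of values one period apart.\<close>

lemma integral_torus_deriv:
  assumes c: "torus_deriv n c c'" and j: "j \<in> {1..n}"
  shows "(\<integral>x. c' j x \<partial>torus_measure n) = 0"
proof -
  interpret product_prob_space "\<lambda>_::nat. angle_measure" by (rule product_prob_space_angle)
  interpret T: prob_space "torus_measure n" by (rule prob_space_torus_measure)
  have ins: "{1..n} = insert j ({1..n} - {j})" using j by auto
  obtain B where B: "B \<ge> 0" "\<And>x. norm (c x) \<le> B" "\<And>x j. j \<in> {1..n} \<Longrightarrow> norm (c' j x) \<le> B"
    using torus_deriv_bounded[OF c] by metis
  have m[measurable]: "c' j \<in> borel_measurable (PiM {1..n} (\<lambda>_. borel))" by (rule torus_deriv_measurable'[OF c j])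
  have int: "integrable (torus_measure n) (c' j)"
    using B(3)[OF j] by (intro T.integrable_const_bound[of _ B]) auto
  have "(\<integral>x. c' j x \<partial>torus_measure n) = (\<integral>x. c' j x \<partial>PiM (insert j ({1..n} - {j})) (\<lambda>_. angle_measure))"
    using j by (simp add: torus_measure_def insert_absorb)
  also have "\<dots> = (\<integral>x. (\<integral>t. c' j (x(j := t)) \<partial>angle_measure) \<partial>PiM ({1..n} - {j}) (\<lambda>_. angle_measure))"
    by (rule product_integral_insert) (use int j in \<open>auto simp: torus_measure_def insert_absorb\<close>)
  also have "\<dots> = (\<integral>x. 0 \<partial>PiM ({1..n} - {j}) (\<lambda>_. angle_measure))"
  proof (rule Bochner_Integration.integral_cong[OF refl])
    fix x assume x: "x \<in> space (PiM ({1..n} - {j}) (\<lambda>_. angle_measure))"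
    have "(\<lambda>t. x(j := t)) \<in> measurable borel (PiM (insert j ({1..n} - {j})) (\<lambda>_. borel))"
      using x by (intro measurable_fun_upd[of _ "{1..n} - {j}"]) (auto simp: space_PiM)
    then have [measurable]: "(\<lambda>t. x(j := t)) \<in> measurable borel (PiM {1..n} (\<lambda>_. borel))"
      using j by (simp add: insert_absorb)
    have mt[measurable]: "(\<lambda>t. c' j (x(j := t))) \<in> borel_measurable borel" by measurable
    have der: "((\<lambda>t. c (x(j := t))) has_vector_derivative c' j (x(j := t))) (at t)" for t
      using torus_deriv_has_derivative[OF c j, of "x(j := t)"] by simp
    have hk: "((\<lambda>t. c' j (x(j := t))) has_integral (c (x(j := 2 * pi)) - c (x(j := 0)))) {0..2*pi}"
      by (rule fundamental_theorem_of_calculus[where f = "\<lambda>t. c (x(j := t))"])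
         (simp, rule has_vector_derivative_at_within[OF der])
    have si: "set_integrable lborel {0..2*pi} (\<lambda>t. c' j (x(j := t)))"
      unfolding set_integrable_def using B(3)[OF j]
      by (intro integrableI_bounded_set_indicator[where B = B]) (auto simp: emeasure_lborel_Icc_eq)
    have "(LINT t:{0..2*pi}|lborel. c' j (x(j := t))) = integral {0..2*pi} (\<lambda>t. c' j (x(j := t)))"
      using si by (rule set_borel_integral_eq_integral)
    also have "\<dots> = c (x(j := 2 * pi)) - c (x(j := 0))" using hk by (rule integral_unique)
    also have "\<dots> = 0" using torus_deriv_periodic[OF c j, of "x(j := 0)"] by simp
    finally show "(\<integral>t. c' j (x(j := t)) \<partial>angle_measure) = 0"
      by (subst integral_angle_measure[OF mt]) simp
  qed
  finally show ?thesis by simp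
qed

section \<open>The pair interaction expressed through power sums\<close>

lemma norm_cis_diff_squared: "norm (cis a - cis b) ^ 2 = 2 - 2 * cos (a - b)"
proof -
  have "norm (cis a - cis b) ^ 2 = (cos a - cos b) ^ 2 + (sin a - sin b) ^ 2"
    by (simp add: cmod_power2)
  also have "\<dots> = ((cos a)\<^sup>2 + (sin a)\<^sup>2) + ((cos b)\<^sup>2 + (sin b)\<^sup>2) - 2 * cos (a - b)"
    by (simp add: power2_eq_square cos_diff algebra_simps)
  finally show ?thesis by simp
qed

text \<open>Follows from \<open>sin^2 = (1 - cos) * (1 + cos)\<close>. It lets the numerator of the
  regularised drift absorb one factor of the distance, uniformly in the regularisation.\<close>

lemma abs_sin_diff_le: "\<bar>sin (a - b)\<bar> \<le> norm (cis a - cis b)"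
proof -
  have "(sin (a - b))\<^sup>2 = (1 - cos (a - b)) * (1 + cos (a - b))"
    by (simp add: sin_squared_eq power2_eq_square algebra_simps)
  also have "\<dots> \<le> (1 - cos (a - b)) * 2"
    using cos_le_one[of "a - b"] by (intro mult_left_mono) auto
  also have "\<dots> = norm (cis a - cis b) ^ 2" by (simp add: norm_cis_diff_squared)
  finally have "\<bar>sin (a - b)\<bar>\<^sup>2 \<le> norm (cis a - cis b) ^ 2" by (simp only: power2_abs)
  then show ?thesis by (rule power2_le_imp_le) (rule norm_ge_zero)
qed

text \<open>For \<open>m \<ge> 1\<close> this is the quotient
  \<open>(z + w) * (z ^ m - w ^ m) / (z - w)\<close> as a polynomial, hence meaningful on the
  diagonal, where it equals \<open>2 * m * z ^ m\<close>.\<close>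

definition geom_mix :: "nat \<Rightarrow> complex \<Rightarrow> complex \<Rightarrow> complex" where
  "geom_mix m z w = z ^ m + w ^ m + 2 * (\<Sum>l\<in>{1..<m}. z ^ l * w ^ (m - l))"

lemma geom_mix_eq:
  assumes "m \<ge> 1"
  shows "(z + w) * (z ^ m - w ^ m) = (z - w) * geom_mix m z w"
proof -
  obtain k where m: "m = Suc k" using assms by (cases m) auto
  have d: "z ^ m - w ^ m = (z - w) * (\<Sum>p<Suc k. z ^ p * w ^ (k - p))"
    unfolding m by (rule diff_power_eq_sum)
  have 1: "z * (\<Sum>p<Suc k. z ^ p * w ^ (k - p)) = z ^ m + (\<Sum>l\<in>{1..<m}. z ^ l * w ^ (m - l))"
  proof -
    have "(\<Sum>p<k. z ^ Suc p * w ^ (k - p)) = (\<Sum>l\<in>{1..<m}. z ^ l * w ^ (m - l))"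
      by (rule sum.reindex_bij_witness[of _ "\<lambda>l. l - 1" Suc]) (auto simp: m)
    then show ?thesis by (simp add: sum_distrib_left m algebra_simps)
  qed
  have 2: "w * (\<Sum>p<Suc k. z ^ p * w ^ (k - p)) = w ^ m + (\<Sum>l\<in>{1..<m}. z ^ l * w ^ (m - l))"
  proof -
    have eqS: "{..<Suc k} = insert 0 {1..<m}" by (auto simp: m)
    have "w * (\<Sum>p<Suc k. z ^ p * w ^ (k - p)) = (\<Sum>p<Suc k. z ^ p * w ^ (Suc k - p))"
      unfolding sum_distrib_left by (intro sum.cong) (auto simp: Suc_diff_le)
    also have "\<dots> = w ^ m + (\<Sum>l\<in>{1..<m}. z ^ l * w ^ (m - l))"
      unfolding eqS by (subst sum.insert) (simp_all add: m del: sum.op_ivl_Suc)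
    finally show ?thesis .
  qed
  have "(z + w) * ((z - w) * S) = (z - w) * (z * S + w * S)" for S
    by (simp add: algebra_simps)
  then show ?thesis unfolding d geom_mix_def
    using 1 2 by (simp only:) (simp only: mult_2 add_ac)
qed

text \<open>The half-angle cotangent is \<open>\<i> (z + w) / (z - w)\<close>, written here without half angles.\<close>

lemma sin_ratio_cis_power_diff:
  assumes "cis a \<noteq> cis b" "m \<ge> 1"
  shows "of_real (sin (a - b) / (2 - 2 * cos (a - b))) * (cis a ^ m - cis b ^ m) = \<i> / 2 * geom_mix m (cis a) (cis b)"
proof -
  define z where "z = cis a"
  define w where "w = cis b"
  have nz: "z \<noteq> w" "z \<noteq> 0" "w \<noteq> 0" using assms by (auto simp: z_def w_def)
  have q: "cis (a - b) = z / w" "cis (b - a) = w / z" by (simp_all add: z_def w_def cis_divide)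
  \<comment> \<open>Sine and cosine of the difference are rational in \<open>z\<close> and
    \<open>w\<close>; numerator and denominator then share the factor
    \<open>(z - w) / (z * w)\<close>.\<close>
  have "2 * \<i> * of_real (sin (a - b)) = z / w - w / z"
    unfolding q[symmetric] by (auto simp: complex_eq_iff sin_diff cos_diff)
  then have s: "of_real (sin (a - b)) = (z / w - w / z) / (2 * \<i>)"
    by (simp add: field_simps)
  have c: "of_real (2 - 2 * cos (a - b)) = 2 - (z / w + w / z)"
    unfolding q[symmetric] by (auto simp: complex_eq_iff sin_diff cos_diff field_simps)
  have c': "2 - (z / w + w / z) = - ((z - w)\<^sup>2 / (z * w))"
    using nz by (simp add: field_simps power2_eq_square)
  have s': "(z / w - w / z) / (2 * \<i>) = - \<i> / 2 * ((z - w) * (z + w) / (z * w))"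
    using nz by (simp add: field_simps power2_eq_square)
  have "of_real (sin (a - b) / (2 - 2 * cos (a - b))) * (z ^ m - w ^ m)
     = (- \<i> / 2 * ((z - w) * (z + w) / (z * w))) / (- ((z - w)\<^sup>2 / (z * w))) * (z ^ m - w ^ m)"
    unfolding of_real_divide s c c' s' ..
  also have "\<dots> = \<i> / 2 * ((z + w) * (z ^ m - w ^ m) / (z - w))"
  proof -
    have "(- \<i> / 2 * (e * u / p)) / (- (e\<^sup>2 / p)) * v = \<i> / 2 * (u * v / e)" if "e \<noteq> 0" "p \<noteq> 0" for e u p v :: complex
      using that by (simp add: field_simps power2_eq_square)
    then show ?thesis using nz by simp
  qed
  also have "\<dots> = \<i> / 2 * geom_mix m z w"
    unfolding geom_mix_eq[OF assms(2)] using nz by simp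
  finally show ?thesis by (simp add: z_def w_def)
qed

definition psum_conv :: "nat \<Rightarrow> nat \<Rightarrow> (nat \<Rightarrow> real) \<Rightarrow> complex" where
  "psum_conv n m x = (\<Sum>l\<in>{1..<m}. psum n l x * psum n (m - l) x)"

lemma sum_pairs_symmetric:
  fixes q :: "nat \<Rightarrow> nat \<Rightarrow> complex"
  assumes "\<And>j k. q j k = q k j"
  shows "2 * (\<Sum>k\<in>{1..n}. \<Sum>j\<in>{1..<k}. q j k) + (\<Sum>k\<in>{1..n}. q k k) = (\<Sum>k\<in>{1..n}. \<Sum>j\<in>{1..n}. q j k)"
proof (induction n)
  case (Suc n)
  have 1: "{1..Suc n} = insert (Suc n) {1..n}" by auto
  have 2: "{Suc 0..<Suc n} = {Suc 0..n}" by auto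
  have "(\<Sum>j\<in>{1..n}. q (Suc n) j) = (\<Sum>j\<in>{1..n}. q j (Suc n))" using assms by simp
  then show ?case using Suc unfolding 1
    by (simp add: 2 sum.distrib algebra_simps del: sum.op_ivl_Suc)
qed simp

text \<open>Over all ordered pairs the sum factorises: the pure powers give \<open>2 * n\<close>
  times the power sum and the mixed terms twice \<open>psum_conv\<close>. Removing the diagonal,
  worth \<open>2 * m\<close> times the power sum, and halving leaves the pairs
  \<open>j < k\<close>.\<close>

lemma sum_pairs_geom_mix:
  "(\<Sum>k\<in>{1..n}. \<Sum>j\<in>{1..<k}. geom_mix m (cis (x j)) (cis (x k)))
     = of_nat n * psum n m x + psum_conv n m x - of_nat m * psum n m x" if "m \<ge> 1"
proof -
  define q where "q = (\<lambda>j k. geom_mix m (cis (x j)) (cis (x k)))"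
  have sym: "q j k = q k j" for j k
  proof -
    have "(\<Sum>l\<in>{1..<m}. z ^ l * w ^ (m - l)) = (\<Sum>l\<in>{1..<m}. w ^ l * z ^ (m - l))" for z w :: complex
      by (rule sum.reindex_bij_witness[of _ "\<lambda>l. m - l" "\<lambda>l. m - l"]) auto
    then show ?thesis by (simp add: q_def geom_mix_def add_ac)
  qed
  have diag: "q k k = 2 * of_nat m * cis (x k) ^ m" for k
    using that by (simp add: q_def geom_mix_def power_add[symmetric] of_nat_diff algebra_simps)
  have all: "(\<Sum>k\<in>{1..n}. \<Sum>j\<in>{1..n}. q j k) = 2 * of_nat n * psum n m x + 2 * psum_conv n m x"
  proof -
    have "(\<Sum>k\<in>{1..n}. \<Sum>j\<in>{1..n}. \<Sum>l\<in>{1..<m}. cis (x j) ^ l * cis (x k) ^ (m - l))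
       = (\<Sum>k\<in>{1..n}. \<Sum>l\<in>{1..<m}. \<Sum>j\<in>{1..n}. cis (x j) ^ l * cis (x k) ^ (m - l))"
      by (rule sum.cong[OF refl sum.swap])
    also have "\<dots> = (\<Sum>l\<in>{1..<m}. \<Sum>k\<in>{1..n}. \<Sum>j\<in>{1..n}. cis (x j) ^ l * cis (x k) ^ (m - l))"
      by (rule sum.swap)
    also have "\<dots> = psum_conv n m x"
    proof -
      have "(\<Sum>k\<in>{1..n}. \<Sum>j\<in>{1..n}. cis (x j) ^ l * cis (x k) ^ (m - l)) = psum n (m - l) x * psum n l x" for l
        unfolding psum_def sum_product by (intro sum.cong refl) (rule mult.commute)
      then show ?thesis unfolding psum_conv_def by (simp only: mult.commute)
    qed
    finally show ?thesis
      unfolding q_def geom_mix_def sum.distrib sum_distrib_left[symmetric] by (simp add: psum_def sum_distrib_left[symmetric])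
  qed
  have "2 * (\<Sum>k\<in>{1..n}. \<Sum>j\<in>{1..<k}. q j k) + 2 * of_nat m * psum n m x
     = 2 * of_nat n * psum n m x + 2 * psum_conv n m x"
    using sum_pairs_symmetric[of q n, OF sym] unfolding all by (simp add: diag psum_def sum_distrib_left)
  then have "2 * (\<Sum>k\<in>{1..n}. \<Sum>j\<in>{1..<k}. q j k) = 2 * (of_nat n * psum n m x + psum_conv n m x - of_nat m * psum n m x)"
    by (simp add: algebra_simps)
  then show ?thesis unfolding q_def by (simp only: mult_cancel_left) simp
qed

text \<open>For \<open>\<beta> \<le> 1\<close> the weight is not differentiable at collisions, so integration by parts is done
  for the weight with \<open>\<epsilon>\<close> added to each squared distance.\<close>

definition reg_potential :: "real \<Rightarrow> nat \<Rightarrow> real \<Rightarrow> (nat \<Rightarrow> real) \<Rightarrow> real" where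
  "reg_potential \<beta> n \<epsilon> x = (\<Sum>k\<in>{1..n}. \<Sum>j\<in>{1..<k}. \<beta> / 2 * ln (2 - 2 * cos (x j - x k) + \<epsilon>))"

text \<open>The regularisation keeps the argument of \<open>ln\<close> above
  \<open>\<epsilon>\<close>, so the logarithm and its derivative are bounded even at
  collisions.\<close>

lemma torus_deriv_log_distance:
  assumes "j \<in> {1..n}" "k \<in> {1..n}" "j \<noteq> k" "\<epsilon> > 0"
  shows "torus_deriv n (\<lambda>x. of_real (ln (2 - 2 * cos (x j - x k) + \<epsilon>)))
     (\<lambda>i x. of_real (2 * sin (x j - x k) / (2 - 2 * cos (x j - x k) + \<epsilon>)) *
            ((if i = j then 1 else 0) - (if i = k then 1 else 0)))"
proof -
  have pos: "2 - 2 * cos t + \<epsilon> > 0" for t using cos_le_one[of t] assms(4) by linarith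
  have [measurable]: "(\<lambda>x. x j) \<in> borel_measurable (PiM {1..n} (\<lambda>_. borel::real measure))" 
    "(\<lambda>x. x k) \<in> borel_measurable (PiM {1..n} (\<lambda>_. borel::real measure))" using assms by auto
  have chain: "((\<lambda>t. ln (2 - 2 * cos (g t) + \<epsilon>)) has_real_derivative 2 * sin (g y) / (2 - 2 * cos (g y) + \<epsilon>) * s) (at y)"
    if "(g has_real_derivative s) (at y)" for g s y
    using that pos[of "g y"] by (auto intro!: derivative_eq_intros)
  define B where "B = max \<bar>ln \<epsilon>\<bar> \<bar>ln (4 + \<epsilon>)\<bar> + 2 / \<epsilon>"
  have 1: "\<bar>ln (2 - 2 * cos t + \<epsilon>)\<bar> \<le> B" for t
  proof -
    have "ln \<epsilon> \<le> ln (2 - 2 * cos t + \<epsilon>)"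
      using cos_le_one[of t] assms(4) by (intro ln_mono) auto
    moreover have "ln (2 - 2 * cos t + \<epsilon>) \<le> ln (4 + \<epsilon>)"
      using cos_ge_minus_one[of t] assms(4) pos[of t] by (intro ln_mono) linarith+
    moreover have "0 \<le> 2 / \<epsilon>" using assms by simp
    ultimately show ?thesis unfolding B_def by linarith
  qed
  have 2: "\<bar>2 * sin t / (2 - 2 * cos t + \<epsilon>)\<bar> \<le> B" for t
  proof -
    have "\<bar>2 * sin t / (2 - 2 * cos t + \<epsilon>)\<bar> = 2 * \<bar>sin t\<bar> / (2 - 2 * cos t + \<epsilon>)"
      using pos[of t] by (simp add: abs_mult)
    also have "\<dots> \<le> 2 / \<epsilon>"
      using abs_sin_le_one[of t] cos_le_one[of t] assms(4) by (intro frac_le) linarith+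
    also have "\<dots> \<le> B" unfolding B_def by simp
    finally show ?thesis .
  qed
  have B0: "B \<ge> 0" using 1[of 0] by linarith
  have 3: "norm (of_real (2 * sin t / (2 - 2 * cos t + \<epsilon>)) * ((if i = j then 1 else 0) - (if i = k then 1 else 0)) :: complex) \<le> B" for t i
    using 2[of t] B0 assms(3) by (auto simp: norm_mult norm_divide simp del: of_real_divide of_real_mult)
  have "((\<lambda>t. of_real (ln (2 - 2 * cos ((x(i := t)) j - (x(i := t)) k) + \<epsilon>)) :: complex) has_vector_derivative
     of_real (2 * sin (x j - x k) / (2 - 2 * cos (x j - x k) + \<epsilon>)) * ((if i = j then 1 else 0) - (if i = k then 1 else 0))) (at (x i))" for x i
  proof -
    define s where "s = (if i = j then 1 else 0) - (if i = k then 1 else 0 :: real)"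
    have "((\<lambda>t. (x(i := t)) j - (x(i := t)) k) has_real_derivative s) (at (x i))"
      unfolding s_def using assms(3) by (auto intro!: derivative_eq_intros)
    then have "((\<lambda>t. ln (2 - 2 * cos ((x(i := t)) j - (x(i := t)) k) + \<epsilon>)) has_real_derivative
        2 * sin (x j - x k) / (2 - 2 * cos (x j - x k) + \<epsilon>) * s) (at (x i))"
      using chain[of "\<lambda>t. (x(i := t)) j - (x(i := t)) k" s "x i"] by simp
    then have "((\<lambda>t. of_real (ln (2 - 2 * cos ((x(i := t)) j - (x(i := t)) k) + \<epsilon>)) :: complex) has_vector_derivative
       of_real (2 * sin (x j - x k) / (2 - 2 * cos (x j - x k) + \<epsilon>) * s)) (at (x i))"
      by (intro has_vector_derivative_of_real) (simp add: has_real_derivative_iff_has_vector_derivative)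
    moreover have "complex_of_real (r * s) = of_real r * ((if i = j then 1 else 0) - (if i = k then 1 else 0))" for r
      by (simp add: s_def)
    ultimately show ?thesis by (simp only:)
  qed
  note der = this
  have per: "cos (a + 2 * pi - b) = cos (a - b)" "cos (a - (b + 2 * pi)) = cos (a - b)" for a b :: real
    using cos_periodic[of "a - b"] cos_periodic[of "a - b - 2 * pi"] by (simp_all add: algebra_simps)
  show ?thesis
    unfolding torus_deriv_def
  proof (intro conjI ballI allI exI[of _ B])
    show "(\<lambda>x. complex_of_real (ln (2 - 2 * cos (x j - x k) + \<epsilon>))) \<in> borel_measurable (PiM {1..n} (\<lambda>_. borel))"
      by measurable
    show "(\<lambda>x. complex_of_real (2 * sin (x j - x k) / (2 - 2 * cos (x j - x k) + \<epsilon>)) *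
        ((if i = j then 1 else 0) - (if i = k then 1 else 0))) \<in> borel_measurable (PiM {1..n} (\<lambda>_. borel))" for i
      by measurable
    show "norm (complex_of_real (ln (2 - 2 * cos (x j - x k) + \<epsilon>))) \<le> B" for x
      using 1[of "x j - x k"] by (simp only: norm_of_real)
    show "norm (complex_of_real (2 * sin (x j - x k) / (2 - 2 * cos (x j - x k) + \<epsilon>)) *
        ((if i = j then 1 else 0) - (if i = k then 1 else 0))) \<le> B" for x i
      by (rule 3)
    show "((\<lambda>t. of_real (ln (2 - 2 * cos ((x(i := t)) j - (x(i := t)) k) + \<epsilon>)) :: complex) has_vector_derivative
     of_real (2 * sin (x j - x k) / (2 - 2 * cos (x j - x k) + \<epsilon>)) * ((if i = j then 1 else 0) - (if i = k then 1 else 0))) (at (x i))" for x i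
      by (rule der)
    show "complex_of_real (ln (2 - 2 * cos ((x(i := x i + 2 * pi)) j - (x(i := x i + 2 * pi)) k) + \<epsilon>))
        = of_real (ln (2 - 2 * cos (x j - x k) + \<epsilon>))" for x i
      using assms(3) per by auto
  qed
qed

lemma torus_deriv_reg_potential:
  assumes "\<epsilon> > 0"
  shows "torus_deriv n (\<lambda>x. of_real (reg_potential \<beta> n \<epsilon> x))
     (\<lambda>i x. \<Sum>k\<in>{1..n}. \<Sum>j\<in>{1..<k}. of_real (\<beta> / 2) * (of_real (2 * sin (x j - x k) / (2 - 2 * cos (x j - x k) + \<epsilon>)) *
            ((if i = j then 1 else 0) - (if i = k then 1 else 0))))"
proof -
  have "torus_deriv n (\<lambda>x. \<Sum>k\<in>{1..n}. \<Sum>j\<in>{1..<k}. of_real (\<beta> / 2) * of_real (ln (2 - 2 * cos (x j - x k) + \<epsilon>)))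
     (\<lambda>i x. \<Sum>k\<in>{1..n}. \<Sum>j\<in>{1..<k}. of_real (\<beta> / 2) * (of_real (2 * sin (x j - x k) / (2 - 2 * cos (x j - x k) + \<epsilon>)) *
            ((if i = j then 1 else 0) - (if i = k then 1 else 0))))"
    using assms by (intro torus_deriv_sum torus_deriv_cmult torus_deriv_log_distance) auto
  then show ?thesis by (simp add: reg_potential_def)
qed

text \<open>At a collision the limiting factor is \<open>0 powr \<beta>\<close>; convergence there
  rests on \<open>\<beta> > 0\<close>.\<close>

lemma tendsto_reg_weight:
  assumes "\<beta> > 0"
  shows "(\<lambda>i. exp (reg_potential \<beta> n (1 / real (Suc i)) x)) \<longlonglongrightarrow> cbe_weight \<beta> n x"
proof -
  have "exp (reg_potential \<beta> n (1 / real (Suc i)) x)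
      = (\<Prod>k\<in>{1..n}. \<Prod>j\<in>{1..<k}. (2 - 2 * cos (x j - x k) + 1 / real (Suc i)) powr (\<beta> / 2))" for i
  proof -
    have "2 - 2 * cos t + 1 / real (Suc i) > 0" for t
      using cos_le_one[of t] by (intro add_nonneg_pos) auto
    then show ?thesis unfolding reg_potential_def
      by (simp add: exp_sum powr_def less_imp_neq[THEN not_sym])
  qed
  moreover have "(\<lambda>i. \<Prod>k\<in>{1..n}. \<Prod>j\<in>{1..<k}. (2 - 2 * cos (x j - x k) + 1 / real (Suc i)) powr (\<beta> / 2))
      \<longlonglongrightarrow> (\<Prod>k\<in>{1..n}. \<Prod>j\<in>{1..<k}. (2 - 2 * cos (x j - x k) + 0) powr (\<beta> / 2))"
  proof (intro tendsto_prod tendsto_powr' tendsto_add tendsto_const)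
    fix k j
    show "(\<lambda>i. 1 / real (Suc i)) \<longlonglongrightarrow> 0" by (rule LIMSEQ_Suc[OF lim_const_over_n[of 1]])
    have "2 - 2 * cos (x j - x k) + 1 / real (Suc i) \<ge> 0" for i
      using cos_le_one[of "x j - x k"] by (intro add_nonneg_nonneg) auto
    then show "2 - 2 * cos (x j - x k) + 0 \<noteq> 0 \<or> 0 < \<beta> / 2 \<and> (\<forall>\<^sub>F i in sequentially. 0 \<le> 2 - 2 * cos (x j - x k) + 1 / real (Suc i))"
      using assms by auto
  qed
  moreover have "(2 - 2 * cos (x j - x k)) powr (\<beta> / 2) = norm (cis (x j) - cis (x k)) powr \<beta>" for j k
  proof -
    have "(2 - 2 * cos (x j - x k)) powr (\<beta> / 2) = (norm (cis (x j) - cis (x k)) powr 2) powr (\<beta> / 2)"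
      by (simp add: norm_cis_diff_squared[symmetric])
    then show ?thesis by (simp only: powr_powr) simp
  qed
  ultimately show ?thesis by (simp add: cbe_weight_def)
qed

lemma reg_weight_le:
  assumes "\<beta> > 0" "0 < \<epsilon>" "\<epsilon> \<le> 1"
  shows "exp (reg_potential \<beta> n \<epsilon> x) \<le> exp (\<Sum>k\<in>{1..n}. \<Sum>j\<in>{1..<k}. \<beta> / 2 * ln 5)"
proof -
  \<comment> \<open>The squared distance is at most 4 and \<open>\<epsilon>\<close> at most
    1.\<close>
  have "ln (2 - 2 * cos t + \<epsilon>) \<le> ln 5" for t
  proof (rule ln_mono)
    show "2 - 2 * cos t + \<epsilon> > 0" using cos_le_one[of t] assms(2) by linarith
    show "2 - 2 * cos t + \<epsilon> \<le> 5" using cos_ge_minus_one[of t] assms(3) by linarith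
  qed
  then show ?thesis
    unfolding reg_potential_def exp_le_cancel_iff using assms by (intro sum_mono mult_left_mono) auto
qed

lemma cbe_weight_nonneg: "cbe_weight \<beta> n x \<ge> 0"
  unfolding cbe_weight_def by (intro prod_nonneg) auto

lemma cbe_weight_bounded: "\<exists>C. \<forall>x. cbe_weight \<beta> n x \<le> C" if "\<beta> > 0"
proof -
  have "norm (cis a - cis b) powr \<beta> \<le> 2 powr \<beta>" for a b
    using norm_triangle_ineq4[of "cis a" "cis b"] that by (intro powr_mono2) auto
  then have "cbe_weight \<beta> n x \<le> (\<Prod>k\<in>{1..n}. \<Prod>j\<in>{1..<k}. 2 powr \<beta>)" for x
    unfolding cbe_weight_def by (intro prod_mono conjI prod_nonneg) auto
  then show ?thesis by blast
qed

lemma cbe_weight_measurable [measurable]: "cbe_weight \<beta> n \<in> borel_measurable (PiM {1..n} (\<lambda>_. borel))"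
proof -
  have [measurable]: "cis \<in> borel_measurable borel"
    by (intro borel_measurable_continuous_onI continuous_on_cis continuous_on_id)
  have cj: "(\<lambda>x. cis (x j)) \<in> borel_measurable (PiM {1..n} (\<lambda>_. borel :: real measure))" if "j \<in> {1..n}" for j
    using that by measurable
  have "(\<lambda>x. norm (cis (x j) - cis (x k)) powr \<beta>) \<in> borel_measurable (PiM {1..n} (\<lambda>_. borel :: real measure))"
    if "k \<in> {1..n}" "j \<in> {1..<k}" for j k
  proof -
    have "j \<in> {1..n}" "k \<in> {1..n}" using that by auto
    from this[THEN cj] show ?thesis by measurable
  qed
  then show ?thesis unfolding cbe_weight_def[abs_def] by (intro borel_measurable_prod)
qed

lemma cbe_weight_pos: "cbe_weight \<beta> n x > 0" if "inj_on (\<lambda>j. cis (x j)) {1..n}"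
  unfolding cbe_weight_def
proof (intro prod_pos ballI)
  fix k j assume "k \<in> {1..n}" "j \<in> {1..<k}"
  then have "j \<in> {1..n}" "j \<noteq> k" by auto
  with \<open>k \<in> {1..n}\<close> have "cis (x j) \<noteq> cis (x k)" using inj_onD[OF that] by blast
  then show "0 < norm (cis (x j) - cis (x k)) powr \<beta>" by simp
qed

lemma AE_torus_range: "AE x in torus_measure n. \<forall>j\<in>{1..n}. x j \<in> {0<..<2*pi}"
proof -
  have "AE t in lborel. t \<noteq> 0 \<and> t \<noteq> 2 * pi"
    using AE_lborel_singleton[of "0::real"] AE_lborel_singleton[of "2 * pi"] by eventually_elim auto
  then have U: "AE t in angle_measure. t \<in> {0<..<2*pi}" by (subst AE_uniform_measure) auto
  have "AE x in torus_measure n. x j \<in> {0<..<2*pi}" if "j \<in> {1..n}" for j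
    unfolding torus_measure_def
    by (rule AE_PiM_component[OF prob_space_angle_measure that U])
  then show ?thesis by (intro AE_finite_allI) auto
qed

text \<open>Equal points on the circle have angles that differ by a multiple of
  \<open>2 * pi\<close>; inside the open interval this multiple is zero, and the endpoints are
  null.\<close>

lemma AE_torus_inj_cis: "AE x in torus_measure n. inj_on (\<lambda>j. cis (x j)) {1..n}"
proof -
  have "AE x in torus_measure n. \<forall>j\<in>{1..n}. x j \<in> {0<..<2*pi}" by (rule AE_torus_range)
  with AE_torus_inj show ?thesis
  proof eventually_elim
    case (elim x)
    show ?case
    proof (rule inj_onI)
      fix j k assume jk: "j \<in> {1..n}" "k \<in> {1..n}" "cis (x j) = cis (x k)"
      then have "cis (x j - x k) = 1" by (simp add: cis_divide[symmetric])
      then have "cos (x j - x k) = 1" by (simp add: complex_eq_iff)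
      then obtain i :: int where i: "x j - x k = of_int i * (2 * pi)"
        by (auto simp: cos_one_2pi_int)
      have b: "0 < x j" "x j < 2 * pi" "0 < x k" "x k < 2 * pi" using elim jk by auto
      have "of_int i * (2 * pi) < 1 * (2 * pi)" "(-1) * (2 * pi) < of_int i * (2 * pi)" using i b by linarith+
      then have "of_int i < (1::real)" "(-1::real) < of_int i"
        using mult_less_cancel_right_pos[of "2 * pi" "of_int i" 1] mult_less_cancel_right_pos[of "2 * pi" "-1" "of_int i"]
        by linarith+
      then have "i = 0" by linarith
      then have "x j = x k" using i by simp
      then show "j = k" using inj_onD[OF elim(1)] jk by blast
    qed
  qed
qed

text \<open>The partial derivatives of \<open>c * cis (x j) ^ m\<close> times the regularised
  weight, summed over \<open>j\<close>, integrate to zero. In the logarithmic derivative of the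
  weight the two contributions of a pair combine to a sine ratio times a difference of
  \<open>m\<close>-th powers. This stays bounded at collisions, so the regularisation is removed by
  dominated convergence.\<close>

theorem schwinger_dyson:
  assumes "\<beta> > 0" "m \<ge> 1" and c: "torus_deriv n c c'"
  shows "(\<integral>x. of_real (cbe_weight \<beta> n x) * ((\<Sum>j\<in>{1..n}. cis (x j) ^ m * c' j x)
     + \<i> * (of_nat m * psum n m x + of_real (\<beta> / 2) *
         (of_nat n * psum n m x + psum_conv n m x - of_nat m * psum n m x)) * c x) \<partial>torus_measure n) = 0"
proof -
  interpret T: prob_space "torus_measure n" by (rule prob_space_torus_measure)
  \<comment> \<open>Coefficient of the pair \<open>j\<close>, \<open>k\<close> in the gradient of
    \<open>reg_potential\<close>; it enters the two coordinates with opposite signs.\<close>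
  define A where "A = (\<lambda>\<epsilon> j k (x :: nat \<Rightarrow> real). \<beta> * (sin (x j - x k) / (2 - 2 * cos (x j - x k) + \<epsilon>)))"
  define S where "S = (\<lambda>x. (\<Sum>j\<in>{1..n}. cis (x j) ^ m * c' j x) + \<i> * of_nat m * psum n m x * c x)"
  define F where "F = (\<lambda>\<epsilon> x. of_real (exp (reg_potential \<beta> n \<epsilon> x)) *
     (S x + (\<Sum>k\<in>{1..n}. \<Sum>j\<in>{1..<k}. of_real (A \<epsilon> j k x) * (cis (x j) ^ m - cis (x k) ^ m)) * c x))"
  obtain B where B: "B \<ge> 0" "\<And>x. norm (c x) \<le> B" "\<And>x j. j \<in> {1..n} \<Longrightarrow> norm (c' j x) \<le> B"
    using torus_deriv_bounded[OF c] by metis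
  have F0: "F \<epsilon> \<in> borel_measurable (torus_measure n) \<and> integral\<^sup>L (torus_measure n) (F \<epsilon>) = 0" if "\<epsilon> > 0" for \<epsilon>
  proof -
    define E where "E = (\<lambda>x. exp (of_real (reg_potential \<beta> n \<epsilon> x)) :: complex)"
    define V' where "V' = (\<lambda>i x. \<Sum>k\<in>{1..n}. \<Sum>j\<in>{1..<k}. of_real (\<beta> / 2) * (of_real (2 * sin (x j - x k) / (2 - 2 * cos (x j - x k) + \<epsilon>)) *
            ((if i = j then 1 else 0) - (if i = k then 1 else 0 :: complex))))"
    define P where "P = (\<lambda>j i x. (c x * cis (x j) ^ m) * (V' i x * E x) +
         (c x * (if i = j then \<i> * of_nat m * cis (x j) ^ m else 0) + c' i x * cis (x j) ^ m) * E x)"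
    have nP: "torus_deriv n (\<lambda>x. (c x * cis (x j) ^ m) * E x) (P j)" if "j \<in> {1..n}" for j
      unfolding P_def E_def V'_def
      by (intro torus_deriv_mult[OF torus_deriv_mult[OF c torus_deriv_cis_power[OF that]] torus_deriv_exp] torus_deriv_reg_potential \<open>\<epsilon> > 0\<close>)
    have intP: "integrable (torus_measure n) (P j j)" if j: "j \<in> {1..n}" for j
    proof -
      obtain B where "\<And>x. norm (P j j x) \<le> B" using torus_deriv_bounded[OF nP[OF j]] j by metis
      moreover have "P j j \<in> borel_measurable (torus_measure n)"
        using torus_deriv_measurable'[OF nP[OF j] j] measurable_cong_sets[OF sets_torus_measure refl] by blast
      ultimately show ?thesis by (intro T.integrable_const_bound[of _ B]) auto
    qed
    have FP: "F \<epsilon> x = (\<Sum>j\<in>{1..n}. P j j x)" for x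
    proof -
      have V: "V' i x = (\<Sum>k\<in>{1..n}. \<Sum>j\<in>{1..<k}. of_real (A \<epsilon> j k x) * ((if i = j then 1 else 0) - (if i = k then 1 else 0)))" for i
        unfolding V'_def A_def by (intro sum.cong refl) (simp add: mult_ac)
      have "(\<Sum>i\<in>{1..n}. cis (x i) ^ m * V' i x) = (\<Sum>k\<in>{1..n}. \<Sum>j\<in>{1..<k}. \<Sum>i\<in>{1..n}.
           cis (x i) ^ m * (of_real (A \<epsilon> j k x) * ((if i = j then 1 else 0) - (if i = k then 1 else 0))))"
        unfolding V sum_distrib_left by (subst sum.swap, intro sum.cong[OF refl], rule sum.swap)
      also have "\<dots> = (\<Sum>k\<in>{1..n}. \<Sum>j\<in>{1..<k}. of_real (A \<epsilon> j k x) * (cis (x j) ^ m - cis (x k) ^ m))"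
      proof (intro sum.cong refl)
        fix k j assume kj: "k \<in> {1..n}" "j \<in> {1..<k}"
        have "(\<Sum>i\<in>{1..n}. cis (x i) ^ m * (of_real (A \<epsilon> j k x) * ((if i = j then 1 else 0) - (if i = k then 1 else 0))))
           = (\<Sum>i\<in>{1..n}. (if i = j then of_real (A \<epsilon> j k x) * cis (x j) ^ m else 0) - (if i = k then of_real (A \<epsilon> j k x) * cis (x k) ^ m else 0))"
          by (intro sum.cong refl) auto
        also have "\<dots> = of_real (A \<epsilon> j k x) * (cis (x j) ^ m - cis (x k) ^ m)"
          using kj unfolding sum_subtractf by (simp add: algebra_simps)
        finally show "(\<Sum>i\<in>{1..n}. cis (x i) ^ m * (of_real (A \<epsilon> j k x) * ((if i = j then 1 else 0) - (if i = k then 1 else 0))))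
           = of_real (A \<epsilon> j k x) * (cis (x j) ^ m - cis (x k) ^ m)" .
      qed
      finally have sV: "(\<Sum>i\<in>{1..n}. cis (x i) ^ m * V' i x) = (\<Sum>k\<in>{1..n}. \<Sum>j\<in>{1..<k}. of_real (A \<epsilon> j k x) * (cis (x j) ^ m - cis (x k) ^ m))" .
      have "(\<Sum>j\<in>{1..n}. P j j x) = (\<Sum>j\<in>{1..n}. E x * (cis (x j) ^ m * c' j x) + E x * c x * \<i> * of_nat m * cis (x j) ^ m + E x * c x * (cis (x j) ^ m * V' j x))"
        unfolding P_def by (intro sum.cong refl) (simp add: algebra_simps)
      also have "\<dots> = E x * (\<Sum>j\<in>{1..n}. cis (x j) ^ m * c' j x) + E x * c x * \<i> * of_nat m * psum n m x + E x * c x * (\<Sum>i\<in>{1..n}. cis (x i) ^ m * V' i x)"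
        unfolding psum_def sum.distrib sum_distrib_left[symmetric] by simp
      also have "\<dots> = F \<epsilon> x"
        unfolding sV F_def S_def E_def exp_of_real by (simp add: algebra_simps)
      finally show ?thesis by simp
    qed
    have "integral\<^sup>L (torus_measure n) (F \<epsilon>) = (\<Sum>j\<in>{1..n}. \<integral>x. P j j x \<partial>torus_measure n)"
      unfolding FP[abs_def] by (rule Bochner_Integration.integral_sum) (rule intP)
    also have "\<dots> = 0"
      using integral_torus_deriv[OF nP] by simp
    finally have i0: "integral\<^sup>L (torus_measure n) (F \<epsilon>) = 0" .
    have "F \<epsilon> \<in> borel_measurable (torus_measure n)"
      unfolding FP[abs_def] using intP by (intro borel_measurable_sum) auto
    with i0 show ?thesis by blast
  qed
  define W0 where "W0 = exp (\<Sum>k\<in>{1..n}. \<Sum>j\<in>{1..<k}. \<beta> / 2 * ln 5)"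
  define C where "C = W0 * ((\<Sum>j\<in>{1..n}. B) + real m * real n * B + (\<Sum>k\<in>{1..n}. \<Sum>j\<in>{1..<k}. \<beta> * real m) * B)"
  have bound: "norm (F \<epsilon> x) \<le> C" if e: "0 < \<epsilon>" "\<epsilon> \<le> 1" for \<epsilon> x
  proof -
    have "norm (\<Sum>j\<in>{1..n}. cis (x j) ^ m * c' j x) \<le> (\<Sum>j\<in>{1..n}. B)"
      by (rule sum_norm_le) (simp add: norm_mult norm_power B)
    moreover have "norm (psum n m x) \<le> real n"
      unfolding psum_def using sum_norm_le[of "{1..n}" "\<lambda>j. cis (x j) ^ m" "\<lambda>_. 1"] by (simp add: norm_power)
    then have "norm (\<i> * of_nat m * psum n m x * c x) \<le> real m * real n * B"
      unfolding norm_mult using B by (auto intro!: mult_mono)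
    moreover have "norm (\<Sum>k\<in>{1..n}. \<Sum>j\<in>{1..<k}. of_real (A \<epsilon> j k x) * (cis (x j) ^ m - cis (x k) ^ m)) \<le> (\<Sum>k\<in>{1..n}. \<Sum>j\<in>{1..<k}. \<beta> * real m)"
    proof (intro sum_norm_le)
      fix k j
      define D where "D = norm (cis (x j) - cis (x k))"
      have D2: "2 - 2 * cos (x j - x k) = D\<^sup>2" by (simp add: D_def norm_cis_diff_squared)
      have D0: "D \<ge> 0" by (simp add: D_def)
      have pos: "D\<^sup>2 + \<epsilon> > 0" using e by (simp add: add_nonneg_pos)
      have "norm (cis (x j) ^ m - cis (x k) ^ m) \<le> real m * D"
        unfolding D_def by (rule norm_power_diff) auto
      then have "norm (of_real (A \<epsilon> j k x) * (cis (x j) ^ m - cis (x k) ^ m)) \<le> \<bar>A \<epsilon> j k x\<bar> * (real m * D)"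
        by (simp add: norm_mult mult_left_mono)
      \<comment> \<open>The singular drift, of size \<open>D / (D^2 + \<epsilon>)\<close>, meets a
        difference of powers of size at most \<open>m * D\<close>. Their product is bounded
        independently of \<open>\<epsilon>\<close>.\<close>
      also have "\<dots> \<le> (\<beta> * (D / (D\<^sup>2 + \<epsilon>))) * (real m * D)"
      proof (intro mult_right_mono)
        have "\<bar>A \<epsilon> j k x\<bar> = \<beta> * (\<bar>sin (x j - x k)\<bar> / (D\<^sup>2 + \<epsilon>))"
          unfolding A_def D2 using assms(1) pos by (simp add: abs_mult)
        then show "\<bar>A \<epsilon> j k x\<bar> \<le> \<beta> * (D / (D\<^sup>2 + \<epsilon>))"
          using abs_sin_diff_le[of "x j" "x k"] assms(1) pos
          by (auto simp: D_def intro!: mult_left_mono divide_right_mono)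
      qed (use D0 in auto)
      also have "\<dots> = \<beta> * real m * (D\<^sup>2 / (D\<^sup>2 + \<epsilon>))" by (simp add: power2_eq_square)
      also have "\<dots> \<le> \<beta> * real m * 1"
        using assms(1) pos e by (intro mult_left_mono) (auto simp: divide_le_eq_1)
      finally show "norm (of_real (A \<epsilon> j k x) * (cis (x j) ^ m - cis (x k) ^ m)) \<le> \<beta> * real m" by simp
    qed
    then have "norm ((\<Sum>k\<in>{1..n}. \<Sum>j\<in>{1..<k}. of_real (A \<epsilon> j k x) * (cis (x j) ^ m - cis (x k) ^ m)) * c x) \<le> (\<Sum>k\<in>{1..n}. \<Sum>j\<in>{1..<k}. \<beta> * real m) * B"
      unfolding norm_mult using B by (intro mult_mono) (auto intro: order_trans[OF norm_ge_zero])
    ultimately have "norm (S x + (\<Sum>k\<in>{1..n}. \<Sum>j\<in>{1..<k}. of_real (A \<epsilon> j k x) * (cis (x j) ^ m - cis (x k) ^ m)) * c x)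
       \<le> (\<Sum>j\<in>{1..n}. B) + real m * real n * B + (\<Sum>k\<in>{1..n}. \<Sum>j\<in>{1..<k}. \<beta> * real m) * B"
      unfolding S_def by (intro norm_triangle_le add_mono) auto
    moreover have "norm (of_real (exp (reg_potential \<beta> n \<epsilon> x)) :: complex) \<le> W0"
      unfolding W0_def using reg_weight_le[OF assms(1) e] by simp
    ultimately show ?thesis
      unfolding F_def C_def norm_mult[of "of_real _"] by (intro mult_mono) (auto simp: W0_def)
  qed
  define G where "G = (\<lambda>x. of_real (cbe_weight \<beta> n x) * (S x + of_real \<beta> * (\<i> / 2) *
         (of_nat n * psum n m x + psum_conv n m x - of_nat m * psum n m x) * c x))"
  \<comment> \<open>Collisions form a null set; away from them the limiting sine ratio has a nonzero
    denominator.\<close>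
  have lim: "(\<lambda>i. F (1 / real (Suc i)) x) \<longlonglongrightarrow> G x" if inj: "inj_on (\<lambda>j. cis (x j)) {1..n}" for x
  proof -
    have "(\<lambda>i. of_real (A (1 / real (Suc i)) j k x) * (cis (x j) ^ m - cis (x k) ^ m)) \<longlonglongrightarrow>
            of_real \<beta> * (\<i> / 2) * geom_mix m (cis (x j)) (cis (x k))" if "k \<in> {1..n}" "j \<in> {1..<k}" for j k
    proof -
      have "j \<in> {1..n}" "j \<noteq> k" using that by auto
      then have ne: "cis (x j) \<noteq> cis (x k)" using inj_onD[OF inj] that by blast
      then have "2 - 2 * cos (x j - x k) \<noteq> 0" by (simp add: norm_cis_diff_squared[symmetric])
      moreover have "(\<lambda>i. 1 / real (Suc i)) \<longlonglongrightarrow> 0" by (rule LIMSEQ_Suc[OF lim_const_over_n[of 1]])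
      ultimately have "(\<lambda>i. A (1 / real (Suc i)) j k x) \<longlonglongrightarrow> \<beta> * (sin (x j - x k) / (2 - 2 * cos (x j - x k) + 0))"
        unfolding A_def by (intro tendsto_intros) auto
      then have "(\<lambda>i. of_real (A (1 / real (Suc i)) j k x) * (cis (x j) ^ m - cis (x k) ^ m)) \<longlonglongrightarrow>
            of_real (\<beta> * (sin (x j - x k) / (2 - 2 * cos (x j - x k) + 0))) * (cis (x j) ^ m - cis (x k) ^ m)"
        by (intro tendsto_intros)
      also have "of_real (\<beta> * (sin (x j - x k) / (2 - 2 * cos (x j - x k) + 0))) * (cis (x j) ^ m - cis (x k) ^ m)
         = of_real \<beta> * (of_real (sin (x j - x k) / (2 - 2 * cos (x j - x k))) * (cis (x j) ^ m - cis (x k) ^ m))"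
        by simp
      also have "\<dots> = of_real \<beta> * (\<i> / 2) * geom_mix m (cis (x j)) (cis (x k))"
        unfolding sin_ratio_cis_power_diff[OF ne assms(2)] by simp
      finally show ?thesis .
    qed
    then have "(\<lambda>i. \<Sum>k\<in>{1..n}. \<Sum>j\<in>{1..<k}. of_real (A (1 / real (Suc i)) j k x) * (cis (x j) ^ m - cis (x k) ^ m)) \<longlonglongrightarrow>
            (\<Sum>k\<in>{1..n}. \<Sum>j\<in>{1..<k}. of_real \<beta> * (\<i> / 2) * geom_mix m (cis (x j)) (cis (x k)))"
      by (intro tendsto_sum)
    also have "(\<Sum>k\<in>{1..n}. \<Sum>j\<in>{1..<k}. of_real \<beta> * (\<i> / 2) * geom_mix m (cis (x j)) (cis (x k)))
       = of_real \<beta> * (\<i> / 2) * (of_nat n * psum n m x + psum_conv n m x - of_nat m * psum n m x)"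
      unfolding sum_distrib_left[symmetric] sum_pairs_geom_mix[OF assms(2)] ..
    finally have 1: "(\<lambda>i. \<Sum>k\<in>{1..n}. \<Sum>j\<in>{1..<k}. of_real (A (1 / real (Suc i)) j k x) * (cis (x j) ^ m - cis (x k) ^ m)) \<longlonglongrightarrow>
            of_real \<beta> * (\<i> / 2) * (of_nat n * psum n m x + psum_conv n m x - of_nat m * psum n m x)" .
    show ?thesis
      unfolding F_def G_def
      by (intro tendsto_mult[OF tendsto_of_real[OF tendsto_reg_weight[OF assms(1)]]] tendsto_add[OF tendsto_const] tendsto_mult[OF 1] tendsto_const)
  qed
  have eps: "0 < 1 / real (Suc i)" "1 / real (Suc i) \<le> 1" for i by auto
  have [measurable]: "c \<in> borel_measurable (torus_measure n)" "j \<in> {1..n} \<Longrightarrow> c' j \<in> borel_measurable (torus_measure n)" for j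
    using torus_derivD[OF c] measurable_cong_sets[OF sets_torus_measure refl] by blast+
  have [measurable]: "j \<in> {1..n} \<Longrightarrow> (\<lambda>x. cis (x j) ^ l) \<in> borel_measurable (torus_measure n)" for j l
    using torus_deriv_measurable[OF torus_deriv_cis_power] measurable_cong_sets[OF sets_torus_measure refl] by blast
  have [measurable]: "psum n l \<in> borel_measurable (torus_measure n)" for l
    using torus_deriv_measurable[OF torus_deriv_psum] measurable_cong_sets[OF sets_torus_measure refl] by blast
  have Gm: "G \<in> borel_measurable (torus_measure n)"
    unfolding G_def S_def psum_conv_def by measurable
  have "(\<lambda>i. integral\<^sup>L (torus_measure n) (F (1 / real (Suc i)))) \<longlonglongrightarrow> integral\<^sup>L (torus_measure n) G"
  proof (rule integral_dominated_convergence[where w = "\<lambda>_. C"])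
    show "AE x in torus_measure n. (\<lambda>i. F (1 / real (Suc i)) x) \<longlonglongrightarrow> G x"
      using AE_torus_inj_cis by eventually_elim (rule lim)
  qed (use F0[OF eps(1)] bound[OF eps] Gm in auto)
  then have "integral\<^sup>L (torus_measure n) G = 0"
    using F0[OF eps(1)] by (simp add: LIMSEQ_const_iff)
  moreover have "G = (\<lambda>x. of_real (cbe_weight \<beta> n x) * ((\<Sum>j\<in>{1..n}. cis (x j) ^ m * c' j x)
     + \<i> * (of_nat m * psum n m x + of_real (\<beta> / 2) *
         (of_nat n * psum n m x + psum_conv n m x - of_nat m * psum n m x)) * c x))"
    unfolding G_def S_def by (simp add: fun_eq_iff algebra_simps)
  ultimately show ?thesis by simp
qed

subsection \<open>Second moments of power sums\<close>

lemma (in prob_space) cauchy_schwarz_bounded: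
  fixes f g :: "'a \<Rightarrow> complex"
  assumes [measurable]: "f \<in> borel_measurable M" "g \<in> borel_measurable M"
    and B: "\<And>x. norm (f x) \<le> B" "\<And>x. norm (g x) \<le> C"
  shows "(norm (\<integral>x. f x * g x \<partial>M))\<^sup>2 \<le> (\<integral>x. (norm (f x))\<^sup>2 \<partial>M) * (\<integral>x. (norm (g x))\<^sup>2 \<partial>M)"
proof -
  have B0: "B \<ge> 0" "C \<ge> 0" using B norm_ge_zero order_trans by blast+
  have i: "integrable M (\<lambda>x. norm (f x) * norm (g x))" "integrable M (\<lambda>x. (norm (f x))\<^sup>2)" "integrable M (\<lambda>x. (norm (g x))\<^sup>2)"
    subgoal using B B0 by (intro integrable_const_bound[of _ "B * C"]) (auto intro!: mult_mono)
    subgoal using B B0 by (intro integrable_const_bound[of _ "B\<^sup>2"]) (auto intro!: power_mono)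
    subgoal using B B0 by (intro integrable_const_bound[of _ "C\<^sup>2"]) (auto intro!: power_mono)
    done
  have "(\<integral>\<^sup>+x. ennreal (norm (f x)) * ennreal (norm (g x)) \<partial>M)\<^sup>2
      \<le> (\<integral>\<^sup>+x. ennreal (norm (f x)) ^ 2 \<partial>M) * (\<integral>\<^sup>+x. ennreal (norm (g x)) ^ 2 \<partial>M)"
    by (rule Cauchy_Schwarz_nn_integral) auto
  also have "(\<integral>\<^sup>+x. ennreal (norm (f x)) * ennreal (norm (g x)) \<partial>M) = ennreal (\<integral>x. norm (f x) * norm (g x) \<partial>M)"
    using i(1) by (subst nn_integral_eq_integral[symmetric]) (auto simp: ennreal_mult)
  also have "(\<integral>\<^sup>+x. ennreal (norm (f x)) ^ 2 \<partial>M) = ennreal (\<integral>x. (norm (f x))\<^sup>2 \<partial>M)"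
    using i(2) by (subst nn_integral_eq_integral[symmetric]) (auto simp: ennreal_power)
  also have "(\<integral>\<^sup>+x. ennreal (norm (g x)) ^ 2 \<partial>M) = ennreal (\<integral>x. (norm (g x))\<^sup>2 \<partial>M)"
    using i(3) by (subst nn_integral_eq_integral[symmetric]) (auto simp: ennreal_power)
  finally have "(\<integral>x. norm (f x) * norm (g x) \<partial>M)\<^sup>2 \<le> (\<integral>x. (norm (f x))\<^sup>2 \<partial>M) * (\<integral>x. (norm (g x))\<^sup>2 \<partial>M)"
    by (simp add: ennreal_power ennreal_mult'[symmetric])
  moreover have "norm (\<integral>x. f x * g x \<partial>M) \<le> (\<integral>x. norm (f x) * norm (g x) \<partial>M)"
    using integral_norm_bound[of M "\<lambda>x. f x * g x"] by (simp add: norm_mult)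
  ultimately show ?thesis by (meson norm_ge_zero order_trans power_mono)
qed

text \<open>Log-convexity means that the ratios of consecutive terms do not decrease, so
  \<open>a m\<close> is at least \<open>a 0\<close> times the \<open>m\<close>-th power of the first
  ratio. Geometric growth at rate \<open>q\<close> then caps that ratio by \<open>q\<close>,
  whatever the constant \<open>K\<close> is.\<close>

lemma log_convex_ratio_bound:
  fixes a :: "nat \<Rightarrow> real"
  assumes a0: "\<And>m. a m \<ge> 0" and lc: "\<And>m. (a (Suc m))\<^sup>2 \<le> a m * a (Suc (Suc m))"
    and gr: "\<And>m. a m \<le> K * q ^ m" and q: "q \<ge> 0"
  shows "a 1 \<le> q * a 0"
proof (cases "a 1 = 0")
  case True
  then show ?thesis using a0 q by simp
next
  case False
  have p1: "a 1 > 0" using False a0[of 1] by simp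
  have p0: "a 0 > 0"
  proof (rule ccontr)
    assume "\<not> a 0 > 0"
    then have "a 0 = 0" using a0[of 0] by simp
    then show False using lc[of 0] p1 by simp
  qed
  define \<rho> where "\<rho> = a 1 / a 0"
  have \<rho>: "\<rho> > 0" using p0 p1 by (simp add: \<rho>_def)
  have step: "a m > 0 \<and> a (Suc m) \<ge> \<rho> * a m" for m
  proof (induction m)
    case 0
    then show ?case using p0 by (simp add: \<rho>_def)
  next
    case (Suc m)
    then have pos: "a m > 0" "a (Suc m) > 0" using \<rho> by (auto intro: less_le_trans[OF mult_pos_pos])
    have "\<rho> * a m * a (Suc m) \<le> (a (Suc m))\<^sup>2"
      using Suc pos by (simp add: power2_eq_square mult_right_mono)
    also have "\<dots> \<le> a m * a (Suc (Suc m))" by (rule lc)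
    finally have "a m * (\<rho> * a (Suc m)) \<le> a m * a (Suc (Suc m))" by (simp add: mult_ac)
    then show ?case using pos by simp
  qed
  have low: "\<rho> ^ m * a 0 \<le> a m" for m
  proof (induction m)
    case (Suc m)
    have "\<rho> ^ Suc m * a 0 \<le> \<rho> * a m" using Suc \<rho> by (simp add: mult.assoc)
    then show ?case using step[of m] by linarith
  qed simp
  have "\<rho> \<le> q"
  proof (rule ccontr)
    assume "\<not> \<rho> \<le> q"
    then have qr: "q < \<rho>" by simp
    have "(q / \<rho>) ^ m \<ge> a 0 / K" if "K > 0" for m
      using low[of m] gr[of m] that \<rho> by (simp add: power_divide field_simps)
    moreover have K: "K > 0" using gr[of 0] p0 by simp
    moreover have "(\<lambda>m. (q / \<rho>) ^ m) \<longlonglongrightarrow> 0"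
      using qr q \<rho> by (intro LIMSEQ_realpow_zero) auto
    then have "eventually (\<lambda>m. (q / \<rho>) ^ m < a 0 / K) sequentially"
      using p0 K by (intro order_tendstoD) auto
    then obtain m where "(q / \<rho>) ^ m < a 0 / K" by (auto simp: eventually_sequentially)
    ultimately show False by (meson not_le)
  qed
  then show ?thesis using p0 by (simp add: \<rho>_def field_simps)
qed

text \<open>The ensemble without the ordering of the angles.\<close>

definition cbe :: "real \<Rightarrow> nat \<Rightarrow> (nat \<Rightarrow> real) measure" where
  "cbe \<beta> n = density (torus_measure n) (\<lambda>x. ennreal (cbe_weight \<beta> n x / cbe_Z \<beta> n))"

lemma cbe_weight_integrable:
  assumes "\<beta> > 0"
  shows "integrable (torus_measure n) (cbe_weight \<beta> n)"
proof -
  interpret T: prob_space "torus_measure n" by (rule prob_space_torus_measure)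
  obtain C where "\<forall>x. cbe_weight \<beta> n x \<le> C" using cbe_weight_bounded[OF assms] by blast
  then show ?thesis using cbe_weight_nonneg by (intro T.integrable_const_bound[of _ C]) auto
qed

lemma cbe_Z_pos: "cbe_Z \<beta> n > 0" if "\<beta> > 0"
proof -
  interpret T: prob_space "torus_measure n" by (rule prob_space_torus_measure)
  have pos: "AE x in torus_measure n. cbe_weight \<beta> n x > 0"
    using AE_torus_inj_cis by eventually_elim (rule cbe_weight_pos)
  have "cbe_Z \<beta> n \<noteq> 0"
  proof
    assume "cbe_Z \<beta> n = 0"
    then have "AE x in torus_measure n. cbe_weight \<beta> n x = 0"
      using integral_nonneg_eq_0_iff_AE[OF cbe_weight_integrable[OF that]] cbe_weight_nonneg
      by (simp add: cbe_Z_def)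
    with pos have "AE x in torus_measure n. False" by eventually_elim simp
    then show False by simp
  qed
  moreover have "cbe_Z \<beta> n \<ge> 0" unfolding cbe_Z_def using cbe_weight_nonneg by (intro integral_nonneg_AE) auto
  ultimately show ?thesis by simp
qed

lemma sets_cbe [measurable_cong]: "sets (cbe \<beta> n) = sets (PiM {1..n} (\<lambda>_. borel))"
  by (simp add: cbe_def sets_torus_measure)

lemma prob_space_cbe: "prob_space (cbe \<beta> n)" if "\<beta> > 0"
proof
  have "emeasure (cbe \<beta> n) (space (cbe \<beta> n)) = (\<integral>\<^sup>+x. ennreal (cbe_weight \<beta> n x / cbe_Z \<beta> n) \<partial>torus_measure n)"
    unfolding cbe_def by (subst emeasure_density) (auto intro!: nn_integral_cong)
  also have "\<dots> = ennreal (\<integral>x. cbe_weight \<beta> n x / cbe_Z \<beta> n \<partial>torus_measure n)"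
    using cbe_weight_integrable[OF that] cbe_weight_nonneg cbe_Z_pos[OF that, of n]
    by (intro nn_integral_eq_integral) (auto intro!: AE_I2 divide_nonneg_nonneg)
  also have "(\<integral>x. cbe_weight \<beta> n x / cbe_Z \<beta> n \<partial>torus_measure n) = 1"
    using cbe_Z_pos[OF that, of n] by (simp add: cbe_Z_def)
  finally show "emeasure (cbe \<beta> n) (space (cbe \<beta> n)) = 1" by simp
qed

lemma integral_cbe:
  fixes f :: "(nat \<Rightarrow> real) \<Rightarrow> complex"
  assumes "\<beta> > 0" and [measurable]: "f \<in> borel_measurable (PiM {1..n} (\<lambda>_. borel))"
  shows "(\<integral>x. f x \<partial>cbe \<beta> n) = (\<integral>x. of_real (cbe_weight \<beta> n x) * f x \<partial>torus_measure n) / of_real (cbe_Z \<beta> n)"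
proof -
  have "(\<integral>x. f x \<partial>cbe \<beta> n) = (\<integral>x. (cbe_weight \<beta> n x / cbe_Z \<beta> n) *\<^sub>R f x \<partial>torus_measure n)"
    unfolding cbe_def using cbe_weight_nonneg cbe_Z_pos[OF assms(1), of n]
    by (intro integral_density) (auto intro!: AE_I2 divide_nonneg_nonneg)
  also have "\<dots> = (\<integral>x. (of_real (cbe_weight \<beta> n x) * f x) / of_real (cbe_Z \<beta> n) \<partial>torus_measure n)"
    by (simp add: scaleR_conv_of_real)
  also have "\<dots> = (\<integral>x. of_real (cbe_weight \<beta> n x) * f x \<partial>torus_measure n) / of_real (cbe_Z \<beta> n)"
    by (rule Bochner_Integration.integral_divide_zero)
  finally show ?thesis .
qed

section \<open>Bounded measurable functions of the angles under the ensemble\<close>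

definition bdd_meas :: "nat \<Rightarrow> ((nat \<Rightarrow> real) \<Rightarrow> complex) \<Rightarrow> bool" where
  "bdd_meas n f \<longleftrightarrow> f \<in> borel_measurable (PiM {1..n} (\<lambda>_. borel)) \<and> (\<exists>B. \<forall>x. norm (f x) \<le> B)"

lemma torus_deriv_imp_bounded: "torus_deriv n c c' \<Longrightarrow> bdd_meas n c"
  using torus_deriv_bounded torus_deriv_measurable unfolding bdd_meas_def by metis

lemma torus_deriv_imp_bounded': "torus_deriv n c c' \<Longrightarrow> j \<in> {1..n} \<Longrightarrow> bdd_meas n (c' j)"
  using torus_deriv_bounded torus_deriv_measurable' unfolding bdd_meas_def by metis

lemma bdd_meas_integrable: "\<beta> > 0 \<Longrightarrow> bdd_meas n f \<Longrightarrow> integrable (cbe \<beta> n) f"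
proof -
  assume "\<beta> > 0" "bdd_meas n f"
  interpret prob_space "cbe \<beta> n" by (rule prob_space_cbe) fact
  obtain B where "\<And>x. norm (f x) \<le> B" and [measurable]: "f \<in> borel_measurable (PiM {1..n} (\<lambda>_. borel))"
    using \<open>bdd_meas n f\<close> by (auto simp: bdd_meas_def)
  then show ?thesis by (intro integrable_const_bound[of _ B]) auto
qed

lemma bdd_meas_measurable: "bdd_meas n f \<Longrightarrow> f \<in> borel_measurable (cbe \<beta> n)"
  unfolding bdd_meas_def using measurable_cong_sets[OF sets_cbe refl] by blast

lemma bdd_meas_cauchy_schwarz:
  assumes "\<beta> > 0" "bdd_meas n f" "bdd_meas n g"
  shows "(norm (\<integral>x. f x * g x \<partial>cbe \<beta> n))\<^sup>2
     \<le> (\<integral>x. (norm (f x))\<^sup>2 \<partial>cbe \<beta> n) * (\<integral>x. (norm (g x))\<^sup>2 \<partial>cbe \<beta> n)"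
proof -
  obtain B C where "\<And>x. norm (f x) \<le> B" "\<And>x. norm (g x) \<le> C"
    using assms(2,3) by (auto simp: bdd_meas_def)
  then show ?thesis
    by (rule prob_space.cauchy_schwarz_bounded[OF prob_space_cbe[OF assms(1)]
          bdd_meas_measurable[OF assms(2)] bdd_meas_measurable[OF assms(3)]])
qed

lemma bdd_meas_const: "bdd_meas n (\<lambda>_. a)" by (auto simp: bdd_meas_def)

lemma bdd_meas_add: "bdd_meas n f \<Longrightarrow> bdd_meas n g \<Longrightarrow> bdd_meas n (\<lambda>x. f x + g x)"
  unfolding bdd_meas_def by (auto, meson add_mono norm_triangle_le)

lemma bdd_meas_mult: "bdd_meas n f \<Longrightarrow> bdd_meas n g \<Longrightarrow> bdd_meas n (\<lambda>x. f x * g x)"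
proof -
  assume f: "bdd_meas n f" and g: "bdd_meas n g"
  obtain B C where B: "\<And>x. norm (f x) \<le> B" "\<And>x. norm (g x) \<le> C" using f g by (auto simp: bdd_meas_def)
  then have "norm (f x * g x) \<le> B * C" for x
    unfolding norm_mult using order_trans[OF norm_ge_zero B(1)] by (intro mult_mono) auto
  then show ?thesis using f g by (auto simp: bdd_meas_def)
qed

lemma bdd_meas_cmult: "bdd_meas n f \<Longrightarrow> bdd_meas n (\<lambda>x. a * f x)" by (rule bdd_meas_mult[OF bdd_meas_const])

lemma bdd_meas_uminus: "bdd_meas n f \<Longrightarrow> bdd_meas n (\<lambda>x. - f x)" using bdd_meas_cmult[of n f "-1"] by simp

lemma bdd_meas_diff: "bdd_meas n f \<Longrightarrow> bdd_meas n g \<Longrightarrow> bdd_meas n (\<lambda>x. f x - g x)"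
  using bdd_meas_add[OF _ bdd_meas_uminus] by simp

lemma bdd_meas_sum: "(\<And>i. i \<in> I \<Longrightarrow> bdd_meas n (f i)) \<Longrightarrow> bdd_meas n (\<lambda>x. \<Sum>i\<in>I. f i x)"
  by (induction I rule: infinite_finite_induct) (auto simp: bdd_meas_const intro: bdd_meas_add)

lemma bdd_meas_sum_list: "(\<And>i. i \<in> set xs \<Longrightarrow> bdd_meas n (f i)) \<Longrightarrow> bdd_meas n (\<lambda>x. \<Sum>i\<leftarrow>xs. f i x)"
  by (induction xs) (auto simp: bdd_meas_const intro: bdd_meas_add)

lemma bdd_meas_cnj: "bdd_meas n f \<Longrightarrow> bdd_meas n (\<lambda>x. cnj (f x))"
proof -
  assume f: "bdd_meas n f"
  have "(\<lambda>x. cnj (f x)) \<in> borel_measurable (PiM {1..n} (\<lambda>_. borel))"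
    by (rule measurable_compose[OF _ borel_measurable_continuous_onI]) (use f in \<open>auto simp: bdd_meas_def intro!: continuous_intros\<close>)
  then show ?thesis using f by (auto simp: bdd_meas_def)
qed

lemma bdd_meas_psum: "bdd_meas n (psum n k)" by (rule torus_deriv_imp_bounded[OF torus_deriv_psum])

lemma bdd_meas_cis_power: "j \<in> {1..n} \<Longrightarrow> bdd_meas n (\<lambda>x. cis (x j) ^ m)"
  by (rule torus_deriv_imp_bounded[OF torus_deriv_cis_power])

lemma bdd_meas_psum_conv: "bdd_meas n (psum_conv n m)"
  unfolding psum_conv_def[abs_def] by (intro bdd_meas_sum bdd_meas_mult bdd_meas_psum)

lemmas bdd_meas_intros = bdd_meas_const bdd_meas_add bdd_meas_mult bdd_meas_diff bdd_meas_uminus bdd_meas_sum bdd_meas_sum_list bdd_meas_cnj bdd_meas_psum bdd_meas_cis_power bdd_meas_psum_conv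

text \<open>\<open>- m * drift \<beta> n m\<close> is the image of the m-th power sum under the generator of circular
  Dyson Brownian motion.\<close>

definition drift :: "real \<Rightarrow> nat \<Rightarrow> nat \<Rightarrow> (nat \<Rightarrow> real) \<Rightarrow> complex" where
  "drift \<beta> n m x = of_real (\<beta> / 2) * of_nat n * psum n m x + of_real (1 - \<beta> / 2) * of_nat m * psum n m x
      + of_real (\<beta> / 2) * psum_conv n m x"

lemma bdd_meas_drift: "bdd_meas n (drift \<beta> n m)"
  unfolding drift_def[abs_def] by (intro bdd_meas_intros)

text \<open>The normalising constant drops out of an identity with right-hand side zero, and the
  terms multiplying \<open>c\<close> are collected into \<open>\<i> * drift\<close>.\<close>

lemma schwinger_dyson_cbe:
  assumes b: "\<beta> > 0" and m: "m \<ge> 1" and c: "torus_deriv n c c'"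
  shows "(\<integral>x. c x * drift \<beta> n m x \<partial>cbe \<beta> n) = \<i> * (\<integral>x. (\<Sum>j\<in>{1..n}. cis (x j) ^ m * c' j x) \<partial>cbe \<beta> n)"
proof -
  have bm1: "bdd_meas n (\<lambda>x. \<Sum>j\<in>{1..n}. cis (x j) ^ m * c' j x)"
    by (intro bdd_meas_intros torus_deriv_imp_bounded'[OF c])
  have bm2: "bdd_meas n (\<lambda>x. \<i> * (c x * drift \<beta> n m x))" by (intro bdd_meas_intros bdd_meas_drift torus_deriv_imp_bounded[OF c])
  have eq: "(\<Sum>j\<in>{1..n}. cis (x j) ^ m * c' j x)
     + \<i> * (of_nat m * psum n m x + of_real (\<beta> / 2) *
         (of_nat n * psum n m x + psum_conv n m x - of_nat m * psum n m x)) * c x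
     = (\<Sum>j\<in>{1..n}. cis (x j) ^ m * c' j x) + \<i> * (c x * drift \<beta> n m x)" for x
    by (simp add: drift_def algebra_simps)
  have "(\<integral>x. (\<Sum>j\<in>{1..n}. cis (x j) ^ m * c' j x) + \<i> * (c x * drift \<beta> n m x) \<partial>cbe \<beta> n) = 0"
    using schwinger_dyson[OF b m c] unfolding eq
    by (subst integral_cbe[OF b]) (use bdd_meas_add[OF bm1 bm2] in \<open>auto simp: bdd_meas_def\<close>)
  then have "(\<integral>x. (\<Sum>j\<in>{1..n}. cis (x j) ^ m * c' j x) \<partial>cbe \<beta> n) + \<i> * (\<integral>x. c x * drift \<beta> n m x \<partial>cbe \<beta> n) = 0"
    by (subst (asm) Bochner_Integration.integral_add[OF bdd_meas_integrable[OF b bm1] bdd_meas_integrable[OF b bm2]]) simp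
  then have "(\<integral>x. (\<Sum>j\<in>{1..n}. cis (x j) ^ m * c' j x) \<partial>cbe \<beta> n) = - \<i> * (\<integral>x. c x * drift \<beta> n m x \<partial>cbe \<beta> n)"
    by (simp add: eq_neg_iff_add_eq_0)
  then show ?thesis by simp
qed

text \<open>The product rule differentiates one factor at a time. Positions are picked rather than
  values, so equal parts count with their multiplicity.\<close>

fun picks :: "'a list \<Rightarrow> ('a \<times> 'a list) list" where
  "picks [] = []"
| "picks (x # xs) = (x, xs) # map (\<lambda>(y, ys). (y, x # ys)) (picks xs)"

lemma picks_sum_list:
  fixes xs :: "nat list"
  shows "(y, ys) \<in> set (picks xs) \<Longrightarrow> y + sum_list ys = sum_list xs"
  by (induction xs arbitrary: y ys) auto

lemma sum_picks_fst: "(\<Sum>(y, ys)\<leftarrow>picks xs. f y) = (\<Sum>y\<leftarrow>xs. f y)" for f :: "'a \<Rightarrow> 'b :: comm_monoid_add"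
  by (induction xs) (auto simp: o_def case_prod_beta)

definition psums :: "nat \<Rightarrow> nat list \<Rightarrow> (nat \<Rightarrow> real) \<Rightarrow> complex" where
  "psums n ps x = (\<Prod>k\<leftarrow>ps. psum n k x)"

lemma psums_Nil [simp]: "psums n [] x = 1" and psums_Cons [simp]: "psums n (k # ps) x = psum n k x * psums n ps x"
  by (simp_all add: psums_def)

lemma picks_psums: "(k, r) \<in> set (picks ps) \<Longrightarrow> psum n k x * psums n r x = psums n ps x"
  by (induction ps arbitrary: k r) (auto simp: mult_ac)

text \<open>The derivative of \<open>psums n ps\<close> in the angle \<open>j\<close>, divided by
  \<open>\<i>\<close>; without that factor a Dirichlet form is a sum of products of one
  \<open>dpsums\<close> with the conjugate of another.\<close>

definition dpsums :: "nat list \<Rightarrow> nat \<Rightarrow> nat \<Rightarrow> (nat \<Rightarrow> real) \<Rightarrow> complex" where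
  "dpsums ps n j x = (\<Sum>(k, r)\<leftarrow>picks ps. of_nat k * cis (x j) ^ k * psums n r x)"

lemma torus_deriv_cong: "torus_deriv n c c' \<Longrightarrow> (\<And>j x. j \<in> {1..n} \<Longrightarrow> c' j x = d j x) \<Longrightarrow> torus_deriv n c d"
proof -
  assume n: "torus_deriv n c c'" and e: "\<And>j x. j \<in> {1..n} \<Longrightarrow> c' j x = d j x"
  have "c' j = d j" if "j \<in> {1..n}" for j using e that by auto
  then show ?thesis using n unfolding torus_deriv_def by auto
qed

lemma dpsums_Cons: "dpsums (k # ps) n j x = of_nat k * cis (x j) ^ k * psums n ps x + psum n k x * dpsums ps n j x"
  by (simp add: dpsums_def o_def case_prod_beta sum_list_const_mult[symmetric] mult_ac)

lemma torus_deriv_psums: "torus_deriv n (psums n ps) (\<lambda>j x. \<i> * dpsums ps n j x)"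
proof (induction ps)
  case Nil
  have "dpsums [] n j x = 0" for j x by (simp add: dpsums_def)
  then show ?case using torus_deriv_const[of n 1] by (simp add: psums_def)
next
  case (Cons k ps)
  have "torus_deriv n (\<lambda>x. psum n k x * psums n ps x) (\<lambda>j x. psum n k x * (\<i> * dpsums ps n j x) +
     (if j \<in> {1..n} then \<i> * of_nat k * cis (x j) ^ k else 0) * psums n ps x)"
    by (rule torus_deriv_mult[OF torus_deriv_psum Cons.IH])
  then have "torus_deriv n (\<lambda>x. psum n k x * psums n ps x) (\<lambda>j x. \<i> * dpsums (k # ps) n j x)"
    by (rule torus_deriv_cong) (simp add: dpsums_Cons algebra_simps)
  then show ?case by (simp add: psums_def)
qed

lemma bdd_meas_psums: "bdd_meas n (psums n ps)" by (rule torus_deriv_imp_bounded[OF torus_deriv_psums])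

lemma bdd_meas_dpsums: "j \<in> {1..n} \<Longrightarrow> bdd_meas n (dpsums ps n j)"
  using bdd_meas_cmult[OF torus_deriv_imp_bounded'[OF torus_deriv_psums], of j n "-\<i>" ps] by simp

text \<open>\<open>eval_comb n (gen_list \<beta> ps)\<close> is the image of \<open>psums n ps\<close> under minus the generator,
  without the leading term \<open>\<beta> / 2 * n * sum_list ps * psums n ps\<close>.\<close>

definition gen_list :: "real \<Rightarrow> nat list \<Rightarrow> (real \<times> nat list) list" where
  "gen_list \<beta> ps = concat (map (\<lambda>(k, r).
     ((1 - \<beta> / 2) * real k ^ 2, k # r)
     # map (\<lambda>l. (\<beta> / 2 * real k, l # (k - l) # r)) [1..<k]
     @ map (\<lambda>(l, s). (real k * real l, (k + l) # s)) (picks r)) (picks ps))"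

text \<open>Combinations are kept as formal lists because \<open>coeff_norm\<close> belongs to the
  expression and not to the function it defines, and because the generator has to be iterated on
  expressions.\<close>

definition eval_comb :: "nat \<Rightarrow> (real \<times> nat list) list \<Rightarrow> (nat \<Rightarrow> real) \<Rightarrow> complex" where
  "eval_comb n xs x = (\<Sum>(c, ps)\<leftarrow>xs. of_real c * psums n ps x)"

definition coeff_norm :: "(real \<times> nat list) list \<Rightarrow> real" where
  "coeff_norm xs = (\<Sum>(c, ps)\<leftarrow>xs. \<bar>c\<bar>)"

definition homog :: "nat \<Rightarrow> (real \<times> nat list) list \<Rightarrow> bool" where
  "homog N xs \<longleftrightarrow> (\<forall>(c, ps)\<in>set xs. sum_list ps = N)"

definition gen_comb :: "real \<Rightarrow> (real \<times> nat list) list \<Rightarrow> (real \<times> nat list) list" where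
  "gen_comb \<beta> xs = concat (map (\<lambda>(c, ps). map (\<lambda>(e, qs). (c * e, qs)) (gen_list \<beta> ps)) xs)"

lemma eval_comb_simps [simp]:
  "eval_comb n [] x = 0" "eval_comb n ((c, ps) # xs) x = of_real c * psums n ps x + eval_comb n xs x"
  "eval_comb n (xs @ ys) x = eval_comb n xs x + eval_comb n ys x"
  by (simp_all add: eval_comb_def)

lemma coeff_norm_simps [simp]:
  "coeff_norm [] = 0" "coeff_norm ((c, ps) # xs) = \<bar>c\<bar> + coeff_norm xs"
  "coeff_norm (xs @ ys) = coeff_norm xs + coeff_norm ys"
  by (simp_all add: coeff_norm_def)

lemma homog_simps [simp]:
  "homog N []" "homog N ((c, ps) # xs) \<longleftrightarrow> sum_list ps = N \<and> homog N xs"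
  "homog N (xs @ ys) \<longleftrightarrow> homog N xs \<and> homog N ys"
  by (auto simp: homog_def)

lemma homog_gen_list: "homog (sum_list ps) (gen_list \<beta> ps)"
  unfolding homog_def gen_list_def by (fastforce dest: picks_sum_list)

lemma gen_comb_Nil [simp]: "gen_comb \<beta> [] = []"
  by (simp add: gen_comb_def)

lemma gen_comb_Cons:
  "gen_comb \<beta> ((c, ps) # xs) = map (\<lambda>(e, qs). (c * e, qs)) (gen_list \<beta> ps) @ gen_comb \<beta> xs"
  by (simp add: gen_comb_def)

lemma eval_comb_scale: "eval_comb n (map (\<lambda>(e, qs). (c * e, qs)) xs) x = of_real c * eval_comb n xs x"
  by (induction xs) (auto simp: algebra_simps)

lemma eval_gen_comb_Cons [simp]:
  "eval_comb n (gen_comb \<beta> ((c, ps) # xs)) x = of_real c * eval_comb n (gen_list \<beta> ps) x + eval_comb n (gen_comb \<beta> xs) x"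
  by (simp add: gen_comb_Cons eval_comb_scale)

lemma coeff_norm_scale: "coeff_norm (map (\<lambda>(e, qs). (c * e, qs)) xs) = \<bar>c\<bar> * coeff_norm xs"
  by (induction xs) (auto simp: algebra_simps abs_mult)

lemma homog_scale: "homog N (map (\<lambda>(e, qs). (c * e, qs)) xs) = homog N xs"
  by (induction xs) auto

lemma homog_gen_comb: "homog N xs \<Longrightarrow> homog N (gen_comb \<beta> xs)"
  by (induction xs) (auto simp: gen_comb_Cons homog_scale homog_gen_list)

lemma coeff_norm_concat: "coeff_norm (concat (map f ys)) = (\<Sum>y\<leftarrow>ys. coeff_norm (f y))"
  by (induction ys) auto

lemma eval_comb_concat: "eval_comb n (concat (map f ys)) x = (\<Sum>y\<leftarrow>ys. eval_comb n (f y) x)"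
  by (induction ys) auto

lemma coeff_norm_map: "coeff_norm (map (\<lambda>y. (a y, b y)) ys) = (\<Sum>y\<leftarrow>ys. \<bar>a y\<bar>)"
  by (induction ys) auto

lemma coeff_norm_map2: "coeff_norm (map (\<lambda>(l, s). (a l s, b l s)) ys) = (\<Sum>(l, s)\<leftarrow>ys. \<bar>a l s\<bar>)"
  by (induction ys) auto

lemma eval_comb_map2: "eval_comb n (map (\<lambda>(l, s). (a l s, b l s)) ys) x = (\<Sum>(l, s)\<leftarrow>ys. of_real (a l s) * psums n (b l s) x)"
  by (induction ys) auto

lemma eval_comb_map: "eval_comb n (map (\<lambda>y. (a y, b y)) ys) x = (\<Sum>y\<leftarrow>ys. of_real (a y) * psums n (b y) x)"
  by (induction ys) auto

lemma sum_list_mono_set: "(\<And>y. y \<in> set ys \<Longrightarrow> f y \<le> g y) \<Longrightarrow> (\<Sum>y\<leftarrow>ys. f y) \<le> (\<Sum>y\<leftarrow>ys. g y)"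
  for f g :: "'a \<Rightarrow> real"
  by (induction ys) (auto intro: add_mono)

text \<open>Picking a part \<open>k\<close> of a list of total degree \<open>N\<close> costs at most
  \<open>(1 + \<beta>) * N * k\<close>: the diagonal term and the splittings together give at most
  \<open>(1 + \<beta>) * k^2\<close>, the mergers with the other parts give
  \<open>k * (N - k)\<close>. Summing over the parts turns \<open>k\<close> into
  \<open>N\<close>.\<close>

lemma coeff_norm_gen_list:
  assumes "\<beta> > 0"
  shows "coeff_norm (gen_list \<beta> ps) \<le> (1 + \<beta>) * real (sum_list ps) ^ 2"
proof -
  define N where "N = sum_list ps"
  have le: "coeff_norm (((1 - \<beta> / 2) * real k ^ 2, k # r)
     # map (\<lambda>l. (\<beta> / 2 * real k, l # (k - l) # r)) [1..<k]
     @ map (\<lambda>(l, s). (real k * real l, (k + l) # s)) (picks r)) \<le> (1 + \<beta>) * real N * real k"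
    if kr: "(k, r) \<in> set (picks ps)" for k r
  proof -
    have N: "k + sum_list r = N" using picks_sum_list[OF kr] by (simp add: N_def)
    have "coeff_norm (map (\<lambda>l. (\<beta> / 2 * real k, l # (k - l) # r)) [1..<k]) = \<beta> / 2 * real k * real (k - 1)"
      using assms by (simp add: coeff_norm_map sum_list_triv)
    also have "\<dots> \<le> \<beta> / 2 * real k * real k" using assms by (intro mult_left_mono) auto
    finally have 1: "coeff_norm (map (\<lambda>l. (\<beta> / 2 * real k, l # (k - l) # r)) [1..<k]) \<le> \<beta> / 2 * real k * real k" .
    have "coeff_norm (map (\<lambda>(l, s). (real k * real l, (k + l) # s)) (picks r)) = (\<Sum>(l, s)\<leftarrow>picks r. real k * real l)"
      by (simp add: coeff_norm_map2)
    also have "\<dots> = real k * real (sum_list r)"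
      unfolding sum_picks_fst by (induction r) (auto simp: algebra_simps)
    finally have 2: "coeff_norm (map (\<lambda>(l, s). (real k * real l, (k + l) # s)) (picks r)) = real k * real (sum_list r)" .
    have "\<bar>1 - \<beta> / 2\<bar> \<le> 1 + \<beta> / 2" using assms by (auto simp: abs_if)
    then have 3: "\<bar>(1 - \<beta> / 2) * real k ^ 2\<bar> \<le> (1 + \<beta> / 2) * real k ^ 2"
      by (simp add: abs_mult mult_right_mono)
    have "\<bar>(1 - \<beta> / 2) * real k ^ 2\<bar> + \<beta> / 2 * real k * real k + real k * real (sum_list r)
        \<le> (1 + \<beta> / 2) * real k ^ 2 + \<beta> / 2 * real k * real k + (1 + \<beta>) * (real k * real (sum_list r))"
      using 3 assms by (intro add_mono) (auto simp: algebra_simps)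
    also have "\<dots> = (1 + \<beta>) * real N * real k"
      unfolding N[symmetric] by (simp add: power2_eq_square algebra_simps)
    finally show ?thesis using 1 2 by simp
  qed
  have "coeff_norm (gen_list \<beta> ps) \<le> (\<Sum>(k, r)\<leftarrow>picks ps. (1 + \<beta>) * real N * real k)"
    unfolding gen_list_def coeff_norm_concat
    by (rule sum_list_mono_set) (use le in \<open>simp add: case_prod_beta split: prod.splits\<close>)
  also have "\<dots> = (1 + \<beta>) * real N * real (sum_list ps)"
    unfolding sum_picks_fst by (induction ps) (auto simp: algebra_simps)
  finally show ?thesis by (simp add: N_def power2_eq_square mult_ac)
qed

lemma coeff_norm_gen_comb:
  assumes "\<beta> > 0" "homog N xs"
  shows "coeff_norm (gen_comb \<beta> xs) \<le> (1 + \<beta>) * real N ^ 2 * coeff_norm xs"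
  using assms(2)
proof (induction xs)
  case (Cons y xs)
  obtain c ps where y: "y = (c, ps)" by force
  have "\<bar>c\<bar> * coeff_norm (gen_list \<beta> ps) \<le> \<bar>c\<bar> * ((1 + \<beta>) * real N ^ 2)"
    using coeff_norm_gen_list[OF assms(1), of ps] Cons.prems y by (intro mult_left_mono) auto
  moreover have "coeff_norm (gen_comb \<beta> (y # xs)) = \<bar>c\<bar> * coeff_norm (gen_list \<beta> ps) + coeff_norm (gen_comb \<beta> xs)"
    by (simp add: y gen_comb_Cons coeff_norm_scale)
  ultimately show ?case using Cons y by (simp add: algebra_simps)
qed simp

lemma norm_psum_le: "norm (psum n k x) \<le> real n"
  unfolding psum_def using sum_norm_le[of "{1..n}" "\<lambda>j. cis (x j) ^ k" "\<lambda>_. 1"] by (simp add: norm_power)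

text \<open>Parts equal to zero would spoil a bound depending only on the sum of the parts.\<close>

lemma norm_psums_le:
  assumes "0 \<notin> set ps" "n \<ge> 1"
  shows "norm (psums n ps x) \<le> real n ^ sum_list ps"
  using assms(1)
proof (induction ps)
  case (Cons k ps)
  have "norm (psum n k x) \<le> real n ^ 1" using norm_psum_le by simp
  also have "\<dots> \<le> real n ^ k" using Cons.prems assms(2) by (intro power_increasing) auto
  finally show ?case using Cons by (auto simp: norm_mult power_add intro!: mult_mono)
qed simp

definition pos_parts :: "(real \<times> nat list) list \<Rightarrow> bool" where
  "pos_parts xs \<longleftrightarrow> (\<forall>(c, ps)\<in>set xs. 0 \<notin> set ps)"

lemma picks_set: "(y, ys) \<in> set (picks xs) \<Longrightarrow> insert y (set ys) = set xs"
  by (induction xs arbitrary: y ys) fastforce+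

lemma pos_parts_gen_list: "0 \<notin> set ps \<Longrightarrow> pos_parts (gen_list \<beta> ps)"
  unfolding pos_parts_def gen_list_def by (fastforce dest!: picks_set)

lemma pos_parts_gen_comb: "pos_parts xs \<Longrightarrow> pos_parts (gen_comb \<beta> xs)"
proof (induction xs)
  case (Cons y xs)
  then show ?case using pos_parts_gen_list[of "snd y" \<beta>]
    by (cases y) (fastforce simp: gen_comb_Cons pos_parts_def)
qed (simp add: pos_parts_def)

lemma norm_eval_comb_le:
  assumes "homog N xs" "pos_parts xs" "n \<ge> 1"
  shows "norm (eval_comb n xs x) \<le> coeff_norm xs * real n ^ N"
  using assms(1,2)
proof (induction xs)
  case (Cons y xs)
  obtain c ps where y: "y = (c, ps)" by force
  have "norm (of_real c * psums n ps x) \<le> \<bar>c\<bar> * real n ^ N"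
    using norm_psums_le[of ps n x] Cons.prems y assms(3) by (auto simp: norm_mult pos_parts_def intro!: mult_left_mono)
  moreover have "norm (eval_comb n xs x) \<le> coeff_norm xs * real n ^ N"
    using Cons y by (auto simp: pos_parts_def)
  ultimately show ?case using norm_triangle_ineq[of "of_real c * psums n ps x" "eval_comb n xs x"]
    by (simp add: y algebra_simps)
qed simp

lemma bdd_meas_eval_comb: "bdd_meas n (eval_comb n xs)"
  by (induction xs) (auto simp: fun_eq_iff eval_comb_def[abs_def] case_prod_beta intro!: bdd_meas_intros bdd_meas_psums)

lemma sum_sum_list_swap: "(\<Sum>j\<in>A. \<Sum>y\<leftarrow>ys. f j y) = (\<Sum>y\<leftarrow>ys. \<Sum>j\<in>A. f j y)"
  for f :: "_ \<Rightarrow> _ \<Rightarrow> 'b :: comm_monoid_add"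
  by (induction ys) (auto simp: sum.distrib)

lemma integral_sum_list:
  fixes f :: "'c \<Rightarrow> 'a \<Rightarrow> complex"
  assumes "\<And>y. y \<in> set ys \<Longrightarrow> integrable M (f y)"
  shows "(\<integral>x. (\<Sum>y\<leftarrow>ys. f y x) \<partial>M) = (\<Sum>y\<leftarrow>ys. \<integral>x. f y x \<partial>M)"
proof -
  have "(\<integral>x. (\<Sum>y\<leftarrow>ys. f y x) \<partial>M) = (\<Sum>y\<leftarrow>ys. \<integral>x. f y x \<partial>M) \<and> integrable M (\<lambda>x. \<Sum>y\<leftarrow>ys. f y x)"
    using assms by (induction ys) auto
  then show ?thesis by simp
qed

text \<open>Multiplying \<open>cis (x j) ^ k\<close> with the power left by the product rule adds
  the indices: two parts merge into one.\<close>

lemma sum_cis_dpsums: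
  "(\<Sum>j\<in>{1..n}. cis (x j) ^ k * dpsums r n j x) = (\<Sum>(l, s)\<leftarrow>picks r. of_nat l * psum n (k + l) x * psums n s x)"
proof -
  have "(\<Sum>j\<in>{1..n}. cis (x j) ^ k * dpsums r n j x)
      = (\<Sum>j\<in>{1..n}. \<Sum>y\<leftarrow>picks r. of_nat (fst y) * cis (x j) ^ (k + fst y) * psums n (snd y) x)"
    unfolding dpsums_def by (simp add: sum_list_const_mult[symmetric] case_prod_beta' power_add mult_ac)
  also have "\<dots> = (\<Sum>y\<leftarrow>picks r. of_nat (fst y) * psum n (k + fst y) x * psums n (snd y) x)"
    unfolding sum_sum_list_swap psum_def by (simp add: sum_distrib_left sum_distrib_right)
  finally show ?thesis by (simp add: case_prod_beta')
qed

text \<open>The left side is minus the generator on a product: each factor contributes its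
  \<open>drift\<close>, each ordered pair of factors a cross term from the second derivatives. The
  part with the explicit factor \<open>n\<close> acts diagonally, with eigenvalue proportional to
  the degree, and is split off.\<close>

lemma eval_gen_list:
  "(\<Sum>(k, r)\<leftarrow>picks ps. of_nat k * (psums n r x * drift \<beta> n k x + (\<Sum>j\<in>{1..n}. cis (x j) ^ k * dpsums r n j x)))
     = of_real (\<beta> / 2 * real n * real (sum_list ps)) * psums n ps x + eval_comb n (gen_list \<beta> ps) x"
proof -
  define T where "T = (\<lambda>(k, r). ((1 - \<beta> / 2) * real k ^ 2, k # r)
     # map (\<lambda>l. (\<beta> / 2 * real k, l # (k - l) # r)) [1..<k]
     @ map (\<lambda>(l, s). (real k * real l, (k + l) # s)) (picks r))"
  have key: "of_nat k * (psums n r x * drift \<beta> n k x + (\<Sum>j\<in>{1..n}. cis (x j) ^ k * dpsums r n j x))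
     = of_real (\<beta> / 2 * real n * real k) * psums n ps x + eval_comb n (T (k, r)) x"
    if kr: "(k, r) \<in> set (picks ps)" for k r
  proof -
    have pp: "psums n ps x = psum n k x * psums n r x" using picks_psums[OF kr] by simp
    have "eval_comb n (map (\<lambda>l. (\<beta> / 2 * real k, l # (k - l) # r)) [1..<k]) x
       = (\<Sum>l\<leftarrow>[1..<k]. of_real (\<beta> / 2 * real k) * psums n r x * (psum n l x * psum n (k - l) x))"
      by (simp add: eval_comb_map mult_ac)
    also have "\<dots> = of_real (\<beta> / 2 * real k) * psums n r x * psum_conv n k x"
      unfolding sum_list_const_mult psum_conv_def by (simp add: interv_sum_list_conv_sum_set_nat)
    finally have 1: "eval_comb n (map (\<lambda>l. (\<beta> / 2 * real k, l # (k - l) # r)) [1..<k]) x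
       = of_real (\<beta> / 2 * real k) * psums n r x * psum_conv n k x" .
    have "eval_comb n (map (\<lambda>(l, s). (real k * real l, (k + l) # s)) (picks r)) x
       = (\<Sum>y\<leftarrow>picks r. of_nat k * (of_nat (fst y) * psum n (k + fst y) x * psums n (snd y) x))"
      unfolding eval_comb_map2 by (simp add: case_prod_beta' mult_ac)
    also have "\<dots> = of_nat k * (\<Sum>j\<in>{1..n}. cis (x j) ^ k * dpsums r n j x)"
      unfolding sum_cis_dpsums sum_list_const_mult by (simp add: case_prod_beta')
    finally have 2: "eval_comb n (map (\<lambda>(l, s). (real k * real l, (k + l) # s)) (picks r)) x
       = of_nat k * (\<Sum>j\<in>{1..n}. cis (x j) ^ k * dpsums r n j x)" .
    show ?thesis
      unfolding T_def case_prod_conv eval_comb_simps 1 2 pp drift_def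
      by (simp add: algebra_simps power2_eq_square)
  qed
  have "(\<Sum>(k, r)\<leftarrow>picks ps. of_nat k * (psums n r x * drift \<beta> n k x + (\<Sum>j\<in>{1..n}. cis (x j) ^ k * dpsums r n j x)))
     = (\<Sum>(k, r)\<leftarrow>picks ps. of_real (\<beta> / 2 * real n * real k) * psums n ps x + eval_comb n (T (k, r)) x)"
    by (rule arg_cong[where f = sum_list], rule map_cong[OF refl]) (use key in auto)
  also have "\<dots> = (\<Sum>(k, r)\<leftarrow>picks ps. of_real (\<beta> / 2 * real n * real k) * psums n ps x) + (\<Sum>y\<leftarrow>picks ps. eval_comb n (T y) x)"
    by (simp add: case_prod_beta' sum_list_addf)
  also have "(\<Sum>(k, r)\<leftarrow>picks ps. of_real (\<beta> / 2 * real n * real k) * psums n ps x)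
     = of_real (\<beta> / 2 * real n * real (sum_list ps)) * psums n ps x"
    unfolding sum_picks_fst sum_list_mult_const by (induction ps) (auto simp: algebra_simps)
  also have "(\<Sum>y\<leftarrow>picks ps. eval_comb n (T y) x) = eval_comb n (gen_list \<beta> ps) x"
    unfolding gen_list_def T_def eval_comb_concat ..
  finally show ?thesis .
qed

text \<open>Polarised Dirichlet form of the ensemble; the factors \<open>\<i>\<close> and
  \<open>cnj \<i>\<close> of the two derivatives cancel.\<close>

definition energy :: "real \<Rightarrow> nat \<Rightarrow> nat list \<Rightarrow> nat list \<Rightarrow> complex" where
  "energy \<beta> n ps qs = (\<integral>x. (\<Sum>j\<in>{1..n}. dpsums ps n j x * cnj (dpsums qs n j x)) \<partial>cbe \<beta> n)"

lemma energy_cnj: "energy \<beta> n qs ps = cnj (energy \<beta> n ps qs)"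
proof -
  have "energy \<beta> n qs ps = (\<integral>x. cnj (\<Sum>j\<in>{1..n}. dpsums ps n j x * cnj (dpsums qs n j x)) \<partial>cbe \<beta> n)"
    unfolding energy_def by (intro Bochner_Integration.integral_cong refl) (simp add: mult.commute)
  also have "\<dots> = cnj (energy \<beta> n ps qs)"
    unfolding energy_def by (rule Bochner_Integration.integral_cnj)
  finally show ?thesis .
qed

text \<open>Integration by parts: minus the generator, paired with a second product, is the
  Dirichlet form. Schwinger-Dyson is applied once for every picked factor \<open>k\<close>;
  positivity of the parts is what its hypothesis \<open>m \<ge> 1\<close> asks for.\<close>

lemma gen_list_energy:
  assumes b: "\<beta> > 0" and ps: "0 \<notin> set ps"
  shows "(\<integral>x. eval_comb n (gen_list \<beta> ps) x * cnj (psums n qs x) \<partial>cbe \<beta> n)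
     = energy \<beta> n ps qs - of_real (\<beta> / 2 * real n * real (sum_list ps)) * (\<integral>x. psums n ps x * cnj (psums n qs x) \<partial>cbe \<beta> n)"
proof -
  note int = bdd_meas_integrable[OF b]
  define c where "c = (\<lambda>x. cnj (psums n qs x))"
  have bc: "bdd_meas n c" unfolding c_def by (intro bdd_meas_intros bdd_meas_psums)
  define G where "G = (\<lambda>(k, r) x. of_nat k * (psums n r x * drift \<beta> n k x + (\<Sum>j\<in>{1..n}. cis (x j) ^ k * dpsums r n j x)) * c x)"
  define H where "H = (\<lambda>(k, r) x. of_nat k * psums n r x * (\<Sum>j\<in>{1..n}. cis (x j) ^ k * cnj (dpsums qs n j x)))"
  have bG: "bdd_meas n (G y)" for y
    unfolding G_def case_prod_beta by (intro bdd_meas_intros bdd_meas_psums bdd_meas_drift bc bdd_meas_dpsums)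
  have bH: "bdd_meas n (H y)" for y
    unfolding H_def case_prod_beta by (intro bdd_meas_intros bdd_meas_psums bdd_meas_dpsums)
  \<comment> \<open>The test function is \<open>psums n r * c\<close>. The derivative falling on
    \<open>psums n r\<close> cancels the merger terms inside \<open>G\<close>, and only the
    derivative of the conjugated product survives.\<close>
  have GH: "(\<integral>x. G y x \<partial>cbe \<beta> n) = (\<integral>x. H y x \<partial>cbe \<beta> n)" if y: "y \<in> set (picks ps)" for y
  proof -
    obtain k r where y': "y = (k, r)" by force
    have "k \<in> set ps" using picks_set[of k r ps] y unfolding y' by blast
    then have "k \<noteq> 0" using ps by metis
    then have k: "k \<ge> 1" by simp
    define u where "u = (\<lambda>x. psums n r x * (\<Sum>j\<in>{1..n}. cis (x j) ^ k * cnj (dpsums qs n j x)))"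
    define v where "v = (\<lambda>x. c x * (\<Sum>j\<in>{1..n}. cis (x j) ^ k * dpsums r n j x))"
    have bu: "bdd_meas n u" and bv: "bdd_meas n v" unfolding u_def v_def by (intro bdd_meas_intros bdd_meas_psums bdd_meas_dpsums bc; assumption?)+
    have "torus_deriv n (\<lambda>x. psums n r x * c x) (\<lambda>j x. psums n r x * cnj (\<i> * dpsums qs n j x) + \<i> * dpsums r n j x * c x)"
      unfolding c_def by (intro torus_deriv_mult torus_deriv_cnj torus_deriv_psums)
    from schwinger_dyson_cbe[OF b k this]
    have "(\<integral>x. psums n r x * c x * drift \<beta> n k x \<partial>cbe \<beta> n)
       = \<i> * (\<integral>x. (\<Sum>j\<in>{1..n}. cis (x j) ^ k * (psums n r x * cnj (\<i> * dpsums qs n j x) + \<i> * dpsums r n j x * c x)) \<partial>cbe \<beta> n)" .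
    also have "\<dots> = (\<integral>x. \<i> * (\<Sum>j\<in>{1..n}. cis (x j) ^ k * (psums n r x * cnj (\<i> * dpsums qs n j x) + \<i> * dpsums r n j x * c x)) \<partial>cbe \<beta> n)"
      by simp
    also have "\<dots> = (\<integral>x. u x - v x \<partial>cbe \<beta> n)"
    proof (intro Bochner_Integration.integral_cong refl)
      fix x
      have "\<i> * (cis (x j) ^ k * (psums n r x * cnj (\<i> * dpsums qs n j x) + \<i> * dpsums r n j x * c x))
          = psums n r x * (cis (x j) ^ k * cnj (dpsums qs n j x)) - c x * (cis (x j) ^ k * dpsums r n j x)" for j
        by (simp add: algebra_simps)
      then show "\<i> * (\<Sum>j\<in>{1..n}. cis (x j) ^ k * (psums n r x * cnj (\<i> * dpsums qs n j x) + \<i> * dpsums r n j x * c x)) = u x - v x"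
        by (simp add: u_def v_def sum_distrib_left sum_subtractf)
    qed
    finally have "(\<integral>x. psums n r x * c x * drift \<beta> n k x \<partial>cbe \<beta> n) + (\<integral>x. v x \<partial>cbe \<beta> n) = (\<integral>x. u x \<partial>cbe \<beta> n)"
      using int[OF bu] int[OF bv] by simp
    then have "of_nat k * (\<integral>x. psums n r x * c x * drift \<beta> n k x + v x \<partial>cbe \<beta> n) = of_nat k * (\<integral>x. u x \<partial>cbe \<beta> n)"
      by (subst Bochner_Integration.integral_add) (intro int bdd_meas_intros bdd_meas_psums bc bdd_meas_drift bv | simp)+
    then have "(\<integral>x. of_nat k * (psums n r x * c x * drift \<beta> n k x + v x) \<partial>cbe \<beta> n) = (\<integral>x. of_nat k * u x \<partial>cbe \<beta> n)"
      by simp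
    then show ?thesis
      by (simp add: y' G_def H_def u_def v_def algebra_simps)
  qed
  have "(\<integral>x. (of_real (\<beta> / 2 * real n * real (sum_list ps)) * psums n ps x + eval_comb n (gen_list \<beta> ps) x) * c x \<partial>cbe \<beta> n)
     = (\<integral>x. (\<Sum>y\<leftarrow>picks ps. G y x) \<partial>cbe \<beta> n)"
    unfolding eval_gen_list[symmetric] by (simp add: sum_list_mult_const[symmetric] G_def case_prod_beta')
  also have "\<dots> = (\<Sum>y\<leftarrow>picks ps. \<integral>x. G y x \<partial>cbe \<beta> n)" by (intro integral_sum_list int bG)
  also have "\<dots> = (\<Sum>y\<leftarrow>picks ps. \<integral>x. H y x \<partial>cbe \<beta> n)"
    by (rule arg_cong[where f = sum_list], rule map_cong[OF refl GH])
  also have "\<dots> = (\<integral>x. (\<Sum>y\<leftarrow>picks ps. H y x) \<partial>cbe \<beta> n)" by (intro integral_sum_list[symmetric] int bH)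
  also have "\<dots> = energy \<beta> n ps qs"
    unfolding energy_def
  proof (intro Bochner_Integration.integral_cong refl)
    fix x
    have "(\<Sum>j\<in>{1..n}. dpsums ps n j x * cnj (dpsums qs n j x))
       = (\<Sum>j\<in>{1..n}. \<Sum>y\<leftarrow>picks ps. of_nat (fst y) * psums n (snd y) x * (cis (x j) ^ fst y * cnj (dpsums qs n j x)))"
      unfolding dpsums_def[of ps] sum_list_mult_const[symmetric] by (simp add: case_prod_beta' mult_ac)
    also have "\<dots> = (\<Sum>y\<leftarrow>picks ps. H y x)"
      unfolding sum_sum_list_swap H_def by (simp add: sum_distrib_left case_prod_beta')
    finally show "(\<Sum>y\<leftarrow>picks ps. H y x) = (\<Sum>j\<in>{1..n}. dpsums ps n j x * cnj (dpsums qs n j x))" by simp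
  qed
  finally have "(\<integral>x. (of_real (\<beta> / 2 * real n * real (sum_list ps)) * psums n ps x + eval_comb n (gen_list \<beta> ps) x) * c x \<partial>cbe \<beta> n) = energy \<beta> n ps qs" .
  moreover have "(\<integral>x. (of_real (\<beta> / 2 * real n * real (sum_list ps)) * psums n ps x + eval_comb n (gen_list \<beta> ps) x) * c x \<partial>cbe \<beta> n)
     = (\<integral>x. of_real (\<beta> / 2 * real n * real (sum_list ps)) * (psums n ps x * c x) + eval_comb n (gen_list \<beta> ps) x * c x \<partial>cbe \<beta> n)"
    by (simp add: algebra_simps)
  moreover have "\<dots> = of_real (\<beta> / 2 * real n * real (sum_list ps)) * (\<integral>x. psums n ps x * c x \<partial>cbe \<beta> n)
      + (\<integral>x. eval_comb n (gen_list \<beta> ps) x * c x \<partial>cbe \<beta> n)"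
    by (subst Bochner_Integration.integral_add) (intro int bdd_meas_intros bdd_meas_psums bc bdd_meas_eval_comb | simp)+
  ultimately show ?thesis unfolding c_def by (simp add: algebra_simps)
qed

text \<open>\<open>energy\<close> is Hermitian, and the subtracted leading terms agree because both
  products have the same degree.\<close>

lemma gen_list_symmetric:
  assumes b: "\<beta> > 0" and "0 \<notin> set ps" "0 \<notin> set qs" "sum_list ps = sum_list qs"
  shows "(\<integral>x. eval_comb n (gen_list \<beta> ps) x * cnj (psums n qs x) \<partial>cbe \<beta> n)
     = (\<integral>x. psums n ps x * cnj (eval_comb n (gen_list \<beta> qs) x) \<partial>cbe \<beta> n)"
proof -
  have flip: "(\<integral>x. f x * cnj (g x) \<partial>cbe \<beta> n) = cnj (\<integral>x. g x * cnj (f x) \<partial>cbe \<beta> n)" for f g :: "(nat \<Rightarrow> real) \<Rightarrow> complex"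
    unfolding Bochner_Integration.integral_cnj[symmetric] by (intro Bochner_Integration.integral_cong refl) (simp add: mult.commute)
  show ?thesis
    unfolding flip[of "psums n ps"] gen_list_energy[OF b assms(2)] gen_list_energy[OF b assms(3)]
    using energy_cnj[of \<beta> n qs ps] flip[of "psums n ps" "psums n qs"] assms(4)
    by simp
qed

text \<open>Sesquilinear extension of \<open>gen_list_symmetric\<close>, in the second argument
  first. One common degree \<open>N\<close> makes every pair of terms satisfy its
  hypothesis.\<close>

lemma gen_comb_symmetric:
  assumes b: "\<beta> > 0" and xs: "homog N xs" "pos_parts xs" and ys: "homog N ys" "pos_parts ys"
  shows "(\<integral>x. eval_comb n (gen_comb \<beta> xs) x * cnj (eval_comb n ys x) \<partial>cbe \<beta> n)
     = (\<integral>x. eval_comb n xs x * cnj (eval_comb n (gen_comb \<beta> ys) x) \<partial>cbe \<beta> n)"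
proof -
  note int = bdd_meas_integrable[OF b]
  have single: "(\<integral>x. eval_comb n (gen_list \<beta> ps) x * cnj (eval_comb n ys x) \<partial>cbe \<beta> n)
     = (\<integral>x. psums n ps x * cnj (eval_comb n (gen_comb \<beta> ys) x) \<partial>cbe \<beta> n)"
    if ps: "0 \<notin> set ps" "sum_list ps = N" for ps
    using ys
  proof (induction ys)
    case (Cons y ys)
    obtain c qs where y: "y = (c, qs)" by force
    have q: "0 \<notin> set qs" "sum_list qs = N" "homog N ys" "pos_parts ys"
      using Cons.prems y by (auto simp: pos_parts_def)
    have "(\<integral>x. eval_comb n (gen_list \<beta> ps) x * cnj (eval_comb n (y # ys) x) \<partial>cbe \<beta> n)
       = (\<integral>x. of_real c * (eval_comb n (gen_list \<beta> ps) x * cnj (psums n qs x)) + eval_comb n (gen_list \<beta> ps) x * cnj (eval_comb n ys x) \<partial>cbe \<beta> n)"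
      by (simp add: y algebra_simps)
    also have "\<dots> = of_real c * (\<integral>x. eval_comb n (gen_list \<beta> ps) x * cnj (psums n qs x) \<partial>cbe \<beta> n)
        + (\<integral>x. eval_comb n (gen_list \<beta> ps) x * cnj (eval_comb n ys x) \<partial>cbe \<beta> n)"
      by (subst Bochner_Integration.integral_add) (intro int bdd_meas_intros bdd_meas_psums bdd_meas_eval_comb | simp)+
    also have "\<dots> = of_real c * (\<integral>x. psums n ps x * cnj (eval_comb n (gen_list \<beta> qs) x) \<partial>cbe \<beta> n)
        + (\<integral>x. psums n ps x * cnj (eval_comb n (gen_comb \<beta> ys) x) \<partial>cbe \<beta> n)"
      using gen_list_symmetric[OF b ps(1) q(1)] ps(2) q Cons.IH by simp
    also have "\<dots> = (\<integral>x. of_real c * (psums n ps x * cnj (eval_comb n (gen_list \<beta> qs) x)) + psums n ps x * cnj (eval_comb n (gen_comb \<beta> ys) x) \<partial>cbe \<beta> n)"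
      by (subst Bochner_Integration.integral_add) (intro int bdd_meas_intros bdd_meas_psums bdd_meas_eval_comb | simp)+
    also have "\<dots> = (\<integral>x. psums n ps x * cnj (eval_comb n (gen_comb \<beta> (y # ys)) x) \<partial>cbe \<beta> n)"
      by (simp add: y algebra_simps)
    finally show ?case .
  qed simp
  show ?thesis using xs
  proof (induction xs)
    case (Cons y xs)
    obtain c ps where y: "y = (c, ps)" by force
    have p: "0 \<notin> set ps" "sum_list ps = N" "homog N xs" "pos_parts xs"
      using Cons.prems y by (auto simp: pos_parts_def)
    have "(\<integral>x. eval_comb n (gen_comb \<beta> (y # xs)) x * cnj (eval_comb n ys x) \<partial>cbe \<beta> n)
       = (\<integral>x. of_real c * (eval_comb n (gen_list \<beta> ps) x * cnj (eval_comb n ys x)) + eval_comb n (gen_comb \<beta> xs) x * cnj (eval_comb n ys x) \<partial>cbe \<beta> n)"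
      by (simp add: y algebra_simps)
    also have "\<dots> = of_real c * (\<integral>x. eval_comb n (gen_list \<beta> ps) x * cnj (eval_comb n ys x) \<partial>cbe \<beta> n)
        + (\<integral>x. eval_comb n (gen_comb \<beta> xs) x * cnj (eval_comb n ys x) \<partial>cbe \<beta> n)"
      by (subst Bochner_Integration.integral_add) (intro int bdd_meas_intros bdd_meas_psums bdd_meas_eval_comb | simp)+
    also have "\<dots> = of_real c * (\<integral>x. psums n ps x * cnj (eval_comb n (gen_comb \<beta> ys) x) \<partial>cbe \<beta> n)
        + (\<integral>x. eval_comb n xs x * cnj (eval_comb n (gen_comb \<beta> ys) x) \<partial>cbe \<beta> n)"
      using single[OF p(1,2)] Cons.IH[OF p(3,4)] by simp
    also have "\<dots> = (\<integral>x. of_real c * (psums n ps x * cnj (eval_comb n (gen_comb \<beta> ys) x)) + eval_comb n xs x * cnj (eval_comb n (gen_comb \<beta> ys) x) \<partial>cbe \<beta> n)"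
      by (subst Bochner_Integration.integral_add) (intro int bdd_meas_intros bdd_meas_psums bdd_meas_eval_comb | simp)+
    also have "\<dots> = (\<integral>x. eval_comb n (y # xs) x * cnj (eval_comb n (gen_comb \<beta> ys) x) \<partial>cbe \<beta> n)"
      by (simp add: y algebra_simps)
    finally show ?case .
  qed simp
qed

text \<open>The part of the generator not proportional to \<open>n\<close> is bounded in the l1 norm of power sum
  coefficients by a constant independent of \<open>n\<close>. Being symmetric in \<open>L^2\<close>, it satisfies
  the same bound there: this is the spectral radius formula.\<close>

lemma gen_comb_L2_bound:
  assumes b: "\<beta> > 0" and n: "n \<ge> 1" and xs: "homog N xs" "pos_parts xs"
  shows "(\<integral>x. (norm (eval_comb n (gen_comb \<beta> xs) x))\<^sup>2 \<partial>cbe \<beta> n)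
     \<le> ((1 + \<beta>) * real N ^ 2)\<^sup>2 * (\<integral>x. (norm (eval_comb n xs x))\<^sup>2 \<partial>cbe \<beta> n)"
proof -
  interpret prob_space "cbe \<beta> n" by (rule prob_space_cbe[OF b])
  define R where "R = (1 + \<beta>) * real N ^ 2"
  have R0: "R \<ge> 0" using b by (simp add: R_def)
  define g where "g = (\<lambda>m. (gen_comb \<beta> ^^ m) xs)"
  have gS: "g (Suc m) = gen_comb \<beta> (g m)" for m by (simp add: g_def)
  have g: "homog N (g m) \<and> pos_parts (g m) \<and> coeff_norm (g m) \<le> R ^ m * coeff_norm xs" for m
  proof (induction m)
    case 0
    then show ?case using xs by (simp add: g_def)
  next
    case (Suc m)
    have "coeff_norm (g (Suc m)) \<le> R * coeff_norm (g m)"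
      unfolding gS R_def using coeff_norm_gen_comb[OF b] Suc by blast
    also have "\<dots> \<le> R * (R ^ m * coeff_norm xs)" using Suc R0 by (intro mult_left_mono) auto
    finally show ?case using Suc unfolding gS by (simp add: homog_gen_comb pos_parts_gen_comb mult_ac)
  qed
  define e where "e = (\<lambda>m. eval_comb n (g m))"
  have em[measurable]: "e m \<in> borel_measurable (PiM {1..n} (\<lambda>_. borel))" for m
    using bdd_meas_eval_comb unfolding e_def bdd_meas_def by blast
  have e_le: "norm (e m x) \<le> R ^ m * (coeff_norm xs * real n ^ N)" for m x
  proof -
    have "norm (e m x) \<le> coeff_norm (g m) * real n ^ N"
      unfolding e_def using g n by (intro norm_eval_comb_le) auto
    also have "\<dots> \<le> (R ^ m * coeff_norm xs) * real n ^ N" using g by (intro mult_right_mono) auto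
    finally show ?thesis by (simp add: mult_ac)
  qed
  \<comment> \<open>By symmetry the squared norm of iterate \<open>m + 1\<close> is an inner product
    of the iterates \<open>m\<close> and \<open>m + 2\<close>; Cauchy-Schwarz then makes
    \<open>a\<close> log-convex.\<close>
  define a where "a = (\<lambda>m. \<integral>x. (norm (e m x))\<^sup>2 \<partial>cbe \<beta> n)"
  have a_sq: "of_real (a m) = (\<integral>x. e m x * cnj (e m x) \<partial>cbe \<beta> n)" for m
    unfolding a_def integral_complex_of_real[symmetric]
    by (intro Bochner_Integration.integral_cong refl) (simp only: of_real_sum complex_norm_square)
  \<comment> \<open>The constant \<open>K\<close> comes from the crude bound \<open>n\<close> on
    every power sum. It depends on \<open>n\<close>, but only the growth rate \<open>R^2\<close>
    survives in the ratio.\<close>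
  have "a 1 \<le> R\<^sup>2 * a 0"
  proof (rule log_convex_ratio_bound[where K = "(coeff_norm xs * real n ^ N)\<^sup>2"])
    show "a m \<ge> 0" for m unfolding a_def by (intro integral_nonneg_AE) auto
    show "(a (Suc m))\<^sup>2 \<le> a m * a (Suc (Suc m))" for m
    proof -
      have "complex_of_real (a (Suc m)) = (\<integral>x. e m x * cnj (e (Suc (Suc m)) x) \<partial>cbe \<beta> n)"
        unfolding a_sq e_def gS using gen_comb_symmetric[OF b, of N "g m" "gen_comb \<beta> (g m)" n] g[of m] g[of "Suc m"]
        by (simp add: gS)
      then have "(norm (complex_of_real (a (Suc m))))\<^sup>2 \<le> a m * (\<integral>x. (norm (cnj (e (Suc (Suc m)) x)))\<^sup>2 \<partial>cbe \<beta> n)"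
        unfolding a_def
        by (simp only:) (rule bdd_meas_cauchy_schwarz[OF b], unfold e_def, intro bdd_meas_cnj bdd_meas_eval_comb, intro bdd_meas_cnj bdd_meas_eval_comb)
      then show ?thesis by (simp add: a_def)
    qed
    show "a m \<le> (coeff_norm xs * real n ^ N)\<^sup>2 * (R\<^sup>2) ^ m" for m
    proof -
      have "a m \<le> (\<integral>x. (R ^ m * (coeff_norm xs * real n ^ N))\<^sup>2 \<partial>cbe \<beta> n)"
        unfolding a_def
      proof (rule integral_mono)
        show "integrable (cbe \<beta> n) (\<lambda>x. (norm (e m x))\<^sup>2)"
          by (rule integrable_const_bound[of _ "(R ^ m * (coeff_norm xs * real n ^ N))\<^sup>2"])
             (use e_le in \<open>auto intro!: power_mono\<close>)
      qed (use e_le in \<open>auto intro!: power_mono\<close>)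
      also have "\<dots> = (coeff_norm xs * real n ^ N)\<^sup>2 * (R\<^sup>2) ^ m"
        by (simp add: prob_space power_mult_distrib mult_ac flip: power_mult)
      finally show ?thesis .
    qed
  qed simp
  then show ?thesis by (simp add: a_def e_def g_def R_def)
qed

text \<open>Let \<open>X\<close> be the quadratic form of the part of the generator that is not
  proportional to \<open>n\<close>. It equals the energy minus
  \<open>\<beta> / 2 * n * N * A\<close>, and Cauchy-Schwarz with \<open>gen_comb_L2_bound\<close>
  gives modulus at most \<open>(1 + \<beta>) * N^2 * A\<close>. Under \<open>small\<close> this uses
  up at most half of the leading term.\<close>

lemma psums_poincare:
  assumes b: "\<beta> > 0" and n: "n \<ge> 1" and ps: "0 \<notin> set ps"
    and small: "(1 + \<beta>) * real (sum_list ps) \<le> \<beta> / 4 * real n"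
  shows "\<beta> / 4 * real n * real (sum_list ps) * (\<integral>x. (norm (psums n ps x))\<^sup>2 \<partial>cbe \<beta> n)
     \<le> (\<integral>x. (\<Sum>j\<in>{1..n}. (norm (dpsums ps n j x))\<^sup>2) \<partial>cbe \<beta> n)"
proof -
  interpret prob_space "cbe \<beta> n" by (rule prob_space_cbe[OF b])
  define N where "N = sum_list ps"
  define A where "A = (\<integral>x. (norm (psums n ps x))\<^sup>2 \<partial>cbe \<beta> n)"
  define En where "En = (\<integral>x. (\<Sum>j\<in>{1..n}. (norm (dpsums ps n j x))\<^sup>2) \<partial>cbe \<beta> n)"
  define X where "X = (\<integral>x. eval_comb n (gen_list \<beta> ps) x * cnj (psums n ps x) \<partial>cbe \<beta> n)"
  have A0: "A \<ge> 0" unfolding A_def by (intro integral_nonneg_AE) auto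
  have "energy \<beta> n ps ps = of_real En"
    unfolding energy_def En_def integral_complex_of_real[symmetric]
    by (intro Bochner_Integration.integral_cong refl) (simp only: of_real_sum complex_norm_square)
  moreover have "(\<integral>x. psums n ps x * cnj (psums n ps x) \<partial>cbe \<beta> n) = of_real A"
    unfolding A_def integral_complex_of_real[symmetric]
    by (intro Bochner_Integration.integral_cong refl) (simp only: of_real_sum complex_norm_square)
  ultimately have X: "X = of_real (En - \<beta> / 2 * real n * real N * A)"
    unfolding X_def gen_list_energy[OF b ps] by (simp add: N_def)
  have ev: "eval_comb n [(1, ps)] = psums n ps" by (simp add: fun_eq_iff)
  have gc: "gen_comb \<beta> [(1, ps)] = gen_list \<beta> ps" by (simp add: gen_comb_Cons)
  have "(norm X)\<^sup>2 \<le> (\<integral>x. (norm (eval_comb n (gen_list \<beta> ps) x))\<^sup>2 \<partial>cbe \<beta> n) * (\<integral>x. (norm (cnj (psums n ps x)))\<^sup>2 \<partial>cbe \<beta> n)"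
    unfolding X_def
    by (intro bdd_meas_cauchy_schwarz[OF b] bdd_meas_cnj bdd_meas_psums bdd_meas_eval_comb)
  also have "\<dots> = (\<integral>x. (norm (eval_comb n (gen_list \<beta> ps) x))\<^sup>2 \<partial>cbe \<beta> n) * A"
    by (simp add: A_def)
  also have "\<dots> \<le> (((1 + \<beta>) * real N ^ 2)\<^sup>2 * A) * A"
    using gen_comb_L2_bound[OF b n, of N "[(1, ps)]"] ps A0
    unfolding ev gc A_def by (intro mult_right_mono) (auto simp: N_def pos_parts_def)
  also have "\<dots> = ((1 + \<beta>) * real N ^ 2 * A)\<^sup>2" by (simp add: power2_eq_square mult_ac)
  finally have "norm X \<le> (1 + \<beta>) * real N ^ 2 * A"
    by (rule power2_le_imp_le) (use b A0 in auto)
  then have "\<beta> / 2 * real n * real N * A - En \<le> (1 + \<beta>) * real N ^ 2 * A"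
    unfolding X norm_of_real by linarith
  moreover have "(1 + \<beta>) * real N ^ 2 * A \<le> \<beta> / 4 * real n * real N * A"
  proof -
    have "(1 + \<beta>) * real N * (real N * A) \<le> \<beta> / 4 * real n * (real N * A)"
      using small A0 by (intro mult_right_mono) (auto simp: N_def)
    then show ?thesis by (simp add: power2_eq_square mult_ac)
  qed
  ultimately show ?thesis unfolding N_def[symmetric] A_def[symmetric] En_def[symmetric] by (simp add: algebra_simps)
qed

text \<open>For a single power sum the energy is the constant \<open>n * k^2\<close>, so the
  Poincare inequality reads as an upper bound on the second moment.\<close>

theorem psum_second_moment:
  assumes b: "\<beta> > 0" and n: "n \<ge> 1" and k: "k \<ge> 1" and small: "(1 + \<beta>) * real k \<le> \<beta> / 4 * real n"
  shows "(\<integral>x. (norm (psum n k x))\<^sup>2 \<partial>cbe \<beta> n) \<le> 4 / \<beta> * real k"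
proof -
  interpret prob_space "cbe \<beta> n" by (rule prob_space_cbe[OF b])
  have "dpsums [k] n j x = of_nat k * cis (x j) ^ k" for j x by (simp add: dpsums_def)
  then have "(\<integral>x. (\<Sum>j\<in>{1..n}. (norm (dpsums [k] n j x))\<^sup>2) \<partial>cbe \<beta> n) = real n * (real k)\<^sup>2"
    by (simp add: norm_mult norm_power prob_space)
  moreover have "psums n [k] x = psum n k x" for x by simp
  ultimately have "\<beta> / 4 * real n * real k * (\<integral>x. (norm (psum n k x))\<^sup>2 \<partial>cbe \<beta> n) \<le> real n * (real k)\<^sup>2"
    using psums_poincare[OF b n, of "[k]"] k small by simp
  then have "(real n * real k) * (\<beta> / 4 * (\<integral>x. (norm (psum n k x))\<^sup>2 \<partial>cbe \<beta> n)) \<le> (real n * real k) * real k"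
    by (simp add: power2_eq_square mult_ac)
  then have "\<beta> / 4 * (\<integral>x. (norm (psum n k x))\<^sup>2 \<partial>cbe \<beta> n) \<le> real k"
    using n k by (subst (asm) mult_le_cancel_left_pos) auto
  then show ?thesis using b by (simp add: field_simps)
qed

text \<open>The product rule controls the energy by the second moments of the two factors. The
  result contains \<open>k^2 * l + l^2 * k = (k + l) * k * l\<close>, and the factor
  \<open>k + l\<close> cancels against the degree in the Poincare inequality.\<close>

theorem psum_product_second_moment:
  assumes b: "\<beta> > 0" and n: "n \<ge> 1" and k: "k \<ge> 1" and l: "l \<ge> 1"
    and small: "(1 + \<beta>) * real (k + l) \<le> \<beta> / 4 * real n"
  shows "(\<integral>x. (norm (psum n k x * psum n l x))\<^sup>2 \<partial>cbe \<beta> n) \<le> 32 / \<beta>\<^sup>2 * real k * real l"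
proof -
  interpret prob_space "cbe \<beta> n" by (rule prob_space_cbe[OF b])
  define K where "K = (\<integral>x. (norm (psum n k x))\<^sup>2 \<partial>cbe \<beta> n)"
  define L where "L = (\<integral>x. (norm (psum n l x))\<^sup>2 \<partial>cbe \<beta> n)"
  have sm: "(1 + \<beta>) * real k \<le> \<beta> / 4 * real n" "(1 + \<beta>) * real l \<le> \<beta> / 4 * real n"
    subgoal using b by (intro order_trans[OF mult_left_mono small]) simp_all
    subgoal using b by (intro order_trans[OF mult_left_mono small]) simp_all
    done
  have KL: "K \<le> 4 / \<beta> * real k" "L \<le> 4 / \<beta> * real l"
    unfolding K_def L_def using psum_second_moment[OF b n] k l sm by auto
  have int: "integrable (cbe \<beta> n) (\<lambda>x. (norm (psum n m x))\<^sup>2)" for m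
  proof -
    have [measurable]: "psum n m \<in> borel_measurable (cbe \<beta> n)" by (rule bdd_meas_measurable[OF bdd_meas_psum])
    show ?thesis using norm_psum_le[of n m]
      by (intro integrable_const_bound[of _ "(real n)\<^sup>2"]) (auto intro!: power_mono)
  qed
  have "(\<integral>x. (\<Sum>j\<in>{1..n}. (norm (dpsums [k, l] n j x))\<^sup>2) \<partial>cbe \<beta> n)
      \<le> (\<integral>x. 2 * real n * ((real k)\<^sup>2 * (norm (psum n l x))\<^sup>2 + (real l)\<^sup>2 * (norm (psum n k x))\<^sup>2) \<partial>cbe \<beta> n)"
  proof (rule integral_mono_AE')
    show "integrable (cbe \<beta> n) (\<lambda>x. 2 * real n * ((real k)\<^sup>2 * (norm (psum n l x))\<^sup>2 + (real l)\<^sup>2 * (norm (psum n k x))\<^sup>2))"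
      using int by (intro integrable_mult_right Bochner_Integration.integrable_add) auto
    show "AE x in cbe \<beta> n. (\<Sum>j\<in>{1..n}. (norm (dpsums [k, l] n j x))\<^sup>2)
        \<le> 2 * real n * ((real k)\<^sup>2 * (norm (psum n l x))\<^sup>2 + (real l)\<^sup>2 * (norm (psum n k x))\<^sup>2)"
    proof (rule AE_I2)
      fix x
      have "(norm (dpsums [k, l] n j x))\<^sup>2 \<le> 2 * ((real k)\<^sup>2 * (norm (psum n l x))\<^sup>2 + (real l)\<^sup>2 * (norm (psum n k x))\<^sup>2)" for j
      proof -
        define u where "u = of_nat k * cis (x j) ^ k * psum n l x"
        define v where "v = of_nat l * cis (x j) ^ l * psum n k x"
        have "dpsums [k, l] n j x = u + v" by (simp add: dpsums_def u_def v_def)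
        then have "(norm (dpsums [k, l] n j x))\<^sup>2 \<le> (norm u + norm v)\<^sup>2"
          by (simp add: norm_triangle_ineq power_mono)
        also have "\<dots> \<le> 2 * ((norm u)\<^sup>2 + (norm v)\<^sup>2)"
          using sum_squares_bound[of "norm u" "norm v"] by (simp add: power2_sum)
        also have "\<dots> = 2 * ((real k)\<^sup>2 * (norm (psum n l x))\<^sup>2 + (real l)\<^sup>2 * (norm (psum n k x))\<^sup>2)"
          by (simp add: u_def v_def norm_mult norm_power power_mult_distrib)
        finally show ?thesis .
      qed
      then have "(\<Sum>j\<in>{1..n}. (norm (dpsums [k, l] n j x))\<^sup>2)
          \<le> (\<Sum>j\<in>{1..n}. 2 * ((real k)\<^sup>2 * (norm (psum n l x))\<^sup>2 + (real l)\<^sup>2 * (norm (psum n k x))\<^sup>2))"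
        by (intro sum_mono)
      then show "(\<Sum>j\<in>{1..n}. (norm (dpsums [k, l] n j x))\<^sup>2)
        \<le> 2 * real n * ((real k)\<^sup>2 * (norm (psum n l x))\<^sup>2 + (real l)\<^sup>2 * (norm (psum n k x))\<^sup>2)" by (simp add: mult_ac)
    qed
  qed (auto intro!: AE_I2 sum_nonneg)
  also have "\<dots> = 2 * real n * ((real k)\<^sup>2 * L + (real l)\<^sup>2 * K)"
    unfolding K_def L_def using int by simp
  also have "\<dots> \<le> 2 * real n * ((real k)\<^sup>2 * (4 / \<beta> * real l) + (real l)\<^sup>2 * (4 / \<beta> * real k))"
    using KL by (intro mult_left_mono add_mono) auto
  also have "\<dots> = (real n * real (k + l)) * (8 / \<beta> * real k * real l)"
    by (simp add: power2_eq_square algebra_simps add_divide_distrib)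
  finally have "\<beta> / 4 * real n * real (k + l) * (\<integral>x. (norm (psum n k x * psum n l x))\<^sup>2 \<partial>cbe \<beta> n)
      \<le> (real n * real (k + l)) * (8 / \<beta> * real k * real l)"
    using psums_poincare[OF b n, of "[k, l]"] k l small by simp
  then have "(real n * real (k + l)) * (\<beta> / 4 * (\<integral>x. (norm (psum n k x * psum n l x))\<^sup>2 \<partial>cbe \<beta> n))
      \<le> (real n * real (k + l)) * (8 / \<beta> * real k * real l)" by (simp add: mult_ac)
  then have "\<beta> / 4 * (\<integral>x. (norm (psum n k x * psum n l x))\<^sup>2 \<partial>cbe \<beta> n) \<le> 8 / \<beta> * real k * real l"
    using n k by (subst (asm) mult_le_cancel_left_pos) auto
  then show ?thesis using b by (simp add: field_simps power2_eq_square)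
qed

subsection \<open>Complex Gaussian vectors\<close>

abbreviation half_normal :: "real measure" where
  "half_normal \<equiv> density lborel (\<lambda>t. ennreal (normal_density 0 (sqrt (1 / 2)) t))"

lemma prob_space_half_normal: "prob_space half_normal"
  by (rule prob_space_normal_density) simp

lemma measurable_Complex: "(\<lambda>(a, b). Complex a b) \<in> measurable (borel \<Otimes>\<^sub>M borel) borel"
proof -
  have "(\<lambda>(a, b). Complex a b) = (\<lambda>p. of_real (fst p) + \<i> * of_real (snd p))"
    by (auto simp: complex_eq_iff)
  then show ?thesis by simp
qed

lemma std_complex_gaussian_eq: "std_complex_gaussian = distr (half_normal \<Otimes>\<^sub>M half_normal) borel (\<lambda>(a, b). Complex a b)"
  by (simp add: std_complex_gaussian_def Let_def)

lemma measurable_Complex_half_normal [measurable]: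
  "(\<lambda>(a, b). Complex a b) \<in> measurable (half_normal \<Otimes>\<^sub>M half_normal) borel"
proof -
  have "sets (half_normal \<Otimes>\<^sub>M half_normal) = sets (borel \<Otimes>\<^sub>M borel)" by (intro sets_pair_measure_cong) auto
  then show ?thesis using measurable_Complex measurable_cong_sets by blast
qed

lemma prob_space_std_complex_gaussian: "prob_space std_complex_gaussian"
proof -
  interpret N: prob_space half_normal by (rule prob_space_half_normal)
  interpret P: pair_prob_space half_normal half_normal ..
  show ?thesis unfolding std_complex_gaussian_eq by (rule P.prob_space_distr) (rule measurable_Complex_half_normal)
qed

lemma sets_std_complex_gaussian [measurable_cong, simp]: "sets std_complex_gaussian = sets borel"
  by (simp add: std_complex_gaussian_eq)

lemma space_std_complex_gaussian [simp]: "space std_complex_gaussian = UNIV"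
  by (simp add: std_complex_gaussian_eq)

lemma integrable_half_normal_power: "integrable half_normal (\<lambda>t. \<bar>t\<bar> ^ k)" "integrable half_normal (\<lambda>t. t ^ k)"
  using integrable_normal_moment_abs[of "sqrt (1 / 2)" 0 k] integrable_normal_moment[of "sqrt (1 / 2)" 0 k]
  by (simp_all add: integrable_real_density)

lemma integral_half_normal_odd: "(\<integral>t. t \<partial>half_normal) = 0"
  using integral_normal_moment_nz_1[of "sqrt (1 / 2)" 0] by (simp add: integral_real_density)

lemma
  fixes f :: "real \<Rightarrow> 'a :: {banach, second_countable_topology}"
  assumes f: "integrable half_normal f"
  shows integrable_half_normal_fst: "integrable (half_normal \<Otimes>\<^sub>M half_normal) (\<lambda>p. f (fst p))"
    and integral_half_normal_fst: "(\<integral>p. f (fst p) \<partial>(half_normal \<Otimes>\<^sub>M half_normal)) = (\<integral>t. f t \<partial>half_normal)"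
    and integrable_half_normal_snd: "integrable (half_normal \<Otimes>\<^sub>M half_normal) (\<lambda>p. f (snd p))"
    and integral_half_normal_snd: "(\<integral>p. f (snd p) \<partial>(half_normal \<Otimes>\<^sub>M half_normal)) = (\<integral>t. f t \<partial>half_normal)"
proof -
  interpret N: prob_space half_normal by (rule prob_space_half_normal)
  interpret P: pair_prob_space half_normal half_normal ..
  have d: "distr (half_normal \<Otimes>\<^sub>M half_normal) half_normal fst = half_normal"
    by (rule N.distr_pair_fst) 
  have "distr (half_normal \<Otimes>\<^sub>M half_normal) half_normal snd
      = distr (distr (half_normal \<Otimes>\<^sub>M half_normal) (half_normal \<Otimes>\<^sub>M half_normal) (\<lambda>(x, y). (y, x))) half_normal snd"
    using P.distr_pair_swap by simp
  also have "\<dots> = distr (half_normal \<Otimes>\<^sub>M half_normal) half_normal fst"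
    by (subst distr_distr) (auto simp: comp_def case_prod_beta')
  finally have d2: "distr (half_normal \<Otimes>\<^sub>M half_normal) half_normal snd = half_normal" using d by simp
  show "integrable (half_normal \<Otimes>\<^sub>M half_normal) (\<lambda>p. f (fst p))"
    by (rule integrable_distr[OF measurable_fst]) (simp only: d f)
  show "integrable (half_normal \<Otimes>\<^sub>M half_normal) (\<lambda>p. f (snd p))"
    by (rule integrable_distr[OF measurable_snd]) (simp only: d2 f)
  show "(\<integral>p. f (fst p) \<partial>(half_normal \<Otimes>\<^sub>M half_normal)) = (\<integral>t. f t \<partial>half_normal)"
    using integral_distr[OF measurable_fst borel_measurable_integrable[OF f], of half_normal] unfolding d by simp
  show "(\<integral>p. f (snd p) \<partial>(half_normal \<Otimes>\<^sub>M half_normal)) = (\<integral>t. f t \<partial>half_normal)"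
    using integral_distr[OF measurable_snd borel_measurable_integrable[OF f], of half_normal] unfolding d2 by simp
qed

lemma integrable_std_complex_gaussian_norm_power: "integrable std_complex_gaussian (\<lambda>z. norm z ^ k)"
proof -
  have i: "integrable (half_normal \<Otimes>\<^sub>M half_normal) (\<lambda>p. 2 ^ k * (\<bar>fst p\<bar> ^ k + \<bar>snd p\<bar> ^ k))"
    by (intro integrable_mult_right Bochner_Integration.integrable_add
        integrable_half_normal_fst[of "\<lambda>t. \<bar>t\<bar> ^ k"] integrable_half_normal_snd[of "\<lambda>t. \<bar>t\<bar> ^ k"] integrable_half_normal_power)
  have le: "norm (Complex a b) ^ k \<le> 2 ^ k * (\<bar>a\<bar> ^ k + \<bar>b\<bar> ^ k)" for a b
  proof -
    have "norm (Complex a b) \<le> \<bar>a\<bar> + \<bar>b\<bar>" using cmod_le[of "Complex a b"] by simp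
    also have "\<dots> \<le> 2 * max \<bar>a\<bar> \<bar>b\<bar>" by simp
    finally have "norm (Complex a b) ^ k \<le> (2 * max \<bar>a\<bar> \<bar>b\<bar>) ^ k" by (intro power_mono) auto
    also have "\<dots> \<le> 2 ^ k * (\<bar>a\<bar> ^ k + \<bar>b\<bar> ^ k)"
      by (simp add: power_mult_distrib max_def)
    finally show ?thesis .
  qed
  have "integrable (half_normal \<Otimes>\<^sub>M half_normal) (\<lambda>p. norm ((\<lambda>(a, b). Complex a b) p) ^ k)"
  proof (rule Bochner_Integration.integrable_bound[OF i])
    show "AE p in half_normal \<Otimes>\<^sub>M half_normal. norm (norm ((\<lambda>(a, b). Complex a b) p) ^ k) \<le> norm (2 ^ k * (\<bar>fst p\<bar> ^ k + \<bar>snd p\<bar> ^ k))"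
      using le by (intro AE_I2) (auto simp: abs_mult intro: order_trans[OF _ abs_ge_self])
  qed measurable
  then show ?thesis unfolding std_complex_gaussian_eq
    by (subst integrable_distr_eq) auto
qed

lemma integrable_std_complex_gaussian:
  fixes f :: "complex \<Rightarrow> 'a :: {banach, second_countable_topology}"
  assumes [measurable]: "f \<in> borel_measurable borel" and le: "\<And>z. norm (f z) \<le> C * norm z ^ k"
  shows "integrable std_complex_gaussian f"
  by (rule Bochner_Integration.integrable_bound[OF integrable_mult_right[OF integrable_std_complex_gaussian_norm_power[of k], of C]])
     (use le in \<open>auto intro!: AE_I2 intro: order_trans[OF _ abs_ge_self]\<close>)

lemma borel_measurable_cnj [measurable]: "cnj \<in> borel_measurable borel"
  by (intro borel_measurable_continuous_onI continuous_intros)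

lemma integral_std_complex_gaussian:
  fixes f :: "complex \<Rightarrow> complex"
  assumes [measurable]: "f \<in> borel_measurable borel"
  shows "(\<integral>z. f z \<partial>std_complex_gaussian) = (\<integral>p. f (Complex (fst p) (snd p)) \<partial>(half_normal \<Otimes>\<^sub>M half_normal))"
  unfolding std_complex_gaussian_eq by (subst integral_distr) (auto simp: case_prod_beta')

lemma std_complex_gaussian_cnj: "(\<integral>z. cnj z \<partial>std_complex_gaussian) = 0"
proof -
  have i: "integrable half_normal (\<lambda>t. complex_of_real t)"
    using integrable_half_normal_power(2)[of 1] by simp
  have z: "(\<integral>t. complex_of_real t \<partial>half_normal) = 0"
    using integral_half_normal_odd by (simp only: integral_complex_of_real) simp
  have "(\<integral>z. cnj z \<partial>std_complex_gaussian)
      = (\<integral>p. complex_of_real (fst p) - \<i> * complex_of_real (snd p) \<partial>(half_normal \<Otimes>\<^sub>M half_normal))"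
    by (rule trans[OF integral_std_complex_gaussian], measurable, rule Bochner_Integration.integral_cong[OF refl])
       (simp add: complex_eq_iff)
  also have "\<dots> = (\<integral>p. complex_of_real (fst p) \<partial>(half_normal \<Otimes>\<^sub>M half_normal))
      - \<i> * (\<integral>p. complex_of_real (snd p) \<partial>(half_normal \<Otimes>\<^sub>M half_normal))"
    using integrable_half_normal_fst[OF i] integrable_half_normal_snd[OF i] by simp
  also have "\<dots> = 0" unfolding integral_half_normal_fst[OF i] integral_half_normal_snd[OF i] z by simp
  finally show ?thesis .
qed

text \<open>Real and imaginary part have the same variance, and their product has mean zero by
  independence.\<close>

lemma std_complex_gaussian_cnj_square: "(\<integral>z. (cnj z)\<^sup>2 \<partial>std_complex_gaussian) = 0"
proof -
  interpret N: prob_space half_normal by (rule prob_space_half_normal)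
  interpret P: pair_prob_space half_normal half_normal ..
  have i: "integrable half_normal (\<lambda>t. complex_of_real (t\<^sup>2))"
    using integrable_half_normal_power(2)[of 2] by (intro integrable_of_real)
  have i1: "integrable half_normal (\<lambda>t. t)"
    using integrable_half_normal_power(2)[of 1] by simp
  have ab: "integrable (half_normal \<Otimes>\<^sub>M half_normal) (\<lambda>p. fst p * snd p)"
    and abz: "(\<integral>p. fst p * snd p \<partial>(half_normal \<Otimes>\<^sub>M half_normal)) = 0"
  proof -
    show 1: "integrable (half_normal \<Otimes>\<^sub>M half_normal) (\<lambda>p. fst p * snd p)"
    proof (rule P.Fubini_integrable)
      show "integrable half_normal (\<lambda>x. \<integral>y. norm (fst (x, y) * snd (x, y)) \<partial>half_normal)"
        using i1 by (simp add: abs_mult)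
      show "AE x in half_normal. integrable half_normal (\<lambda>y. fst (x, y) * snd (x, y))" using i1 by simp
    qed simp
    have "(\<integral>p. fst p * snd p \<partial>(half_normal \<Otimes>\<^sub>M half_normal)) = (\<integral>x. \<integral>y. x * y \<partial>half_normal \<partial>half_normal)"
      using P.integral_fst'[OF 1] by simp
    also have "\<dots> = 0" using integral_half_normal_odd by simp
    finally show "(\<integral>p. fst p * snd p \<partial>(half_normal \<Otimes>\<^sub>M half_normal)) = 0" .
  qed
  have ab': "integrable (half_normal \<Otimes>\<^sub>M half_normal) (\<lambda>p. complex_of_real (fst p * snd p))"
    using ab by (rule integrable_of_real)
  have "(\<integral>z. (cnj z)\<^sup>2 \<partial>std_complex_gaussian)
      = (\<integral>p. complex_of_real ((fst p)\<^sup>2) - complex_of_real ((snd p)\<^sup>2) - 2 * \<i> * complex_of_real (fst p * snd p) \<partial>(half_normal \<Otimes>\<^sub>M half_normal))"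
    by (rule trans[OF integral_std_complex_gaussian], measurable, rule Bochner_Integration.integral_cong[OF refl])
       (simp add: complex_eq_iff power2_eq_square)
  also have "\<dots> = (\<integral>p. complex_of_real ((fst p)\<^sup>2) \<partial>(half_normal \<Otimes>\<^sub>M half_normal)) - (\<integral>p. complex_of_real ((snd p)\<^sup>2) \<partial>(half_normal \<Otimes>\<^sub>M half_normal))
      - 2 * \<i> * (\<integral>p. complex_of_real (fst p * snd p) \<partial>(half_normal \<Otimes>\<^sub>M half_normal))"
    using integrable_half_normal_fst[OF i] integrable_half_normal_snd[OF i] ab'
    by (subst Bochner_Integration.integral_diff, force, force, subst Bochner_Integration.integral_diff) auto
  also have "\<dots> = 0"
    unfolding integral_half_normal_fst[OF i] integral_half_normal_snd[OF i]
    unfolding integral_complex_of_real abz by simp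
  finally show ?thesis .
qed

text \<open>Lebesgue measure of the plane carried over by \<open>Complex\<close>, the same map that
  defines \<open>std_complex_gaussian\<close>, so a product of two real normal densities turns
  directly into a density here.\<close>

definition complex_lebesgue :: "complex measure" where
  "complex_lebesgue = distr (lborel \<Otimes>\<^sub>M lborel) borel (\<lambda>(a, b). Complex a b)"

definition gauss_dens :: "real \<Rightarrow> complex \<Rightarrow> complex \<Rightarrow> real" where
  "gauss_dens v m z = exp (- (norm (z - m))\<^sup>2 / v) / (pi * v)"

lemma sets_complex_lebesgue [measurable_cong, simp]: "sets complex_lebesgue = sets borel"
  by (simp add: complex_lebesgue_def)

lemma space_complex_lebesgue [simp]: "space complex_lebesgue = UNIV"
  by (simp add: complex_lebesgue_def)

lemma gauss_dens_measurable [measurable]: "gauss_dens v m \<in> borel_measurable borel"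
  unfolding gauss_dens_def[abs_def] by measurable

lemma measurable_Complex_lborel: "(\<lambda>(a, b). Complex a b) \<in> measurable (lborel \<Otimes>\<^sub>M lborel) borel"
proof -
  have "sets (lborel \<Otimes>\<^sub>M lborel :: (real \<times> real) measure) = sets (borel \<Otimes>\<^sub>M borel)" by (intro sets_pair_measure_cong) auto
  then show ?thesis using measurable_Complex measurable_cong_sets by blast
qed

text \<open>Taking real and imaginary parts maps the measure back to the planar one, whose
  \<sigma>-finiteness pulls back.\<close>

lemma sigma_finite_complex_lebesgue: "sigma_finite_measure complex_lebesgue"
proof -
  have inv: "(\<lambda>z. (Re z, Im z)) \<in> measurable borel (lborel \<Otimes>\<^sub>M lborel)" by measurable
  have "distr complex_lebesgue (lborel \<Otimes>\<^sub>M lborel) (\<lambda>z. (Re z, Im z)) = distr (lborel \<Otimes>\<^sub>M lborel) (lborel \<Otimes>\<^sub>M lborel) ((\<lambda>z. (Re z, Im z)) \<circ> (\<lambda>(a, b). Complex a b))"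
    unfolding complex_lebesgue_def by (rule distr_distr[OF inv measurable_Complex_lborel])
  also have "(\<lambda>z. (Re z, Im z)) \<circ> (\<lambda>(a, b). Complex a b) = (\<lambda>p. p)" by auto
  finally have d: "distr complex_lebesgue (lborel \<Otimes>\<^sub>M lborel) (\<lambda>z. (Re z, Im z)) = lborel \<Otimes>\<^sub>M lborel" by (simp add: distr_id2)
  show ?thesis
    by (rule sigma_finite_measure_distr[where N = "lborel \<Otimes>\<^sub>M lborel" and f = "\<lambda>z. (Re z, Im z)"])
       (use d lborel_pair.sigma_finite_measure_axioms in auto)
qed

lemma half_normal_affine:
  assumes "v > 0"
  shows "distr half_normal lborel (\<lambda>t. \<mu> + sqrt v * t) = density lborel (\<lambda>t. ennreal (normal_density \<mu> (sqrt (v / 2)) t))"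
proof -
  interpret N: prob_space half_normal by (rule prob_space_half_normal)
  have "distributed half_normal lborel (\<lambda>t. t) (\<lambda>t. ennreal (normal_density 0 (sqrt (1 / 2)) t))"
    unfolding distributed_def by (auto intro!: distr_id2)
  from N.normal_density_affine[OF this, of "sqrt v" \<mu>] assms
  have "distributed half_normal lborel (\<lambda>t. \<mu> + sqrt v * t) (\<lambda>t. ennreal (normal_density \<mu> (sqrt v * sqrt (1 / 2)) t))"
    by simp
  then show ?thesis unfolding distributed_def by (simp add: real_sqrt_mult[symmetric])
qed

lemma normal_density_prod:
  assumes "v > 0"
  shows "normal_density (Re m) (sqrt (v / 2)) a * normal_density (Im m) (sqrt (v / 2)) b = gauss_dens v m (Complex a b)"
proof -
  have n: "(norm (Complex a b - m))\<^sup>2 = (a - Re m)\<^sup>2 + (b - Im m)\<^sup>2" by (simp add: cmod_power2)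
  have s: "sqrt (pi * v) * sqrt (pi * v) = pi * v" using assms by simp
  show ?thesis
    unfolding normal_density_def gauss_dens_def n using assms s
    by (simp add: exp_add[symmetric] add_divide_distrib[symmetric] mult_ac) (simp add: diff_divide_distrib add_divide_distrib)
qed

lemma std_complex_gaussian_affine:
  assumes v: "v > 0"
  shows "distr std_complex_gaussian borel (\<lambda>z. m + of_real (sqrt v) * z) = density complex_lebesgue (\<lambda>z. ennreal (gauss_dens v m z))"
proof -
  let ?N = "\<lambda>\<mu>. density lborel (\<lambda>t. ennreal (normal_density \<mu> (sqrt (v / 2)) t))"
  have sf: "sigma_finite_measure (?N \<mu>)" for \<mu>
    using prob_space_normal_density[of "sqrt (v / 2)" \<mu>] v prob_space_imp_sigma_finite by auto
  have "distr std_complex_gaussian borel (\<lambda>z. m + of_real (sqrt v) * z)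
      = distr (half_normal \<Otimes>\<^sub>M half_normal) borel ((\<lambda>z. m + of_real (sqrt v) * z) \<circ> (\<lambda>(a, b). Complex a b))"
    unfolding std_complex_gaussian_eq by (rule distr_distr) (auto intro: measurable_Complex_half_normal)
  also have "(\<lambda>z. m + of_real (sqrt v) * z) \<circ> (\<lambda>(a, b). Complex a b)
      = (\<lambda>(a, b). Complex a b) \<circ> (\<lambda>(a, b). (Re m + sqrt v * a, Im m + sqrt v * b))"
    by (auto simp: fun_eq_iff complex_eq_iff)
  also have "distr (half_normal \<Otimes>\<^sub>M half_normal) borel \<dots>
      = distr (distr (half_normal \<Otimes>\<^sub>M half_normal) (lborel \<Otimes>\<^sub>M lborel) (\<lambda>(a, b). (Re m + sqrt v * a, Im m + sqrt v * b))) borel (\<lambda>(a, b). Complex a b)"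
    by (rule distr_distr[symmetric, OF measurable_Complex_lborel]) measurable
  also have "distr (half_normal \<Otimes>\<^sub>M half_normal) (lborel \<Otimes>\<^sub>M lborel) (\<lambda>(a, b). (Re m + sqrt v * a, Im m + sqrt v * b))
      = distr half_normal lborel (\<lambda>t. Re m + sqrt v * t) \<Otimes>\<^sub>M distr half_normal lborel (\<lambda>t. Im m + sqrt v * t)"
    by (rule pair_measure_distr[symmetric]) (use half_normal_affine[OF v] sf in auto)
  also have "\<dots> = density (lborel \<Otimes>\<^sub>M lborel) (\<lambda>(a, b). ennreal (normal_density (Re m) (sqrt (v / 2)) a) * ennreal (normal_density (Im m) (sqrt (v / 2)) b))"
    unfolding half_normal_affine[OF v] by (rule pair_measure_density) (use sf lborel.sigma_finite_measure_axioms in auto)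
  also have "(\<lambda>(a, b). ennreal (normal_density (Re m) (sqrt (v / 2)) a) * ennreal (normal_density (Im m) (sqrt (v / 2)) b))
      = (\<lambda>p. ennreal (gauss_dens v m ((\<lambda>(a, b). Complex a b) p)))"
    by (auto simp: fun_eq_iff normal_density_prod[OF v, symmetric] ennreal_mult')
  also have "distr (density (lborel \<Otimes>\<^sub>M lborel) (\<lambda>p. ennreal (gauss_dens v m ((\<lambda>(a, b). Complex a b) p)))) borel (\<lambda>(a, b). Complex a b)
      = density complex_lebesgue (\<lambda>z. ennreal (gauss_dens v m z))"
    unfolding complex_lebesgue_def by (rule density_distr[symmetric]) (auto intro: measurable_Complex_lborel)
  finally show ?thesis .
qed

section \<open>Gaussian vectors, their densities, and test functions integrated against noise
  monomials\<close>

abbreviation gauss_vec :: "nat \<Rightarrow> (nat \<Rightarrow> complex) measure" where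
  "gauss_vec d \<equiv> PiM {1..d} (\<lambda>_. std_complex_gaussian)"

abbreviation vec_lebesgue :: "nat \<Rightarrow> (nat \<Rightarrow> complex) measure" where
  "vec_lebesgue d \<equiv> PiM {1..d} (\<lambda>_. complex_lebesgue)"

lemma product_prob_space_gauss: "product_prob_space (\<lambda>_::nat. std_complex_gaussian)"
  using prob_space_std_complex_gaussian
  by (auto simp: product_prob_space_def product_prob_space_axioms_def product_sigma_finite_def
      intro: prob_space_imp_sigma_finite)

lemma prob_space_gauss_vec: "prob_space (gauss_vec d)"
  by (intro prob_space_PiM prob_space_std_complex_gaussian)

lemma sets_gauss_vec [measurable_cong]: "sets (gauss_vec d) = sets (PiM {1..d} (\<lambda>_. borel))"
  by (intro sets_PiM_cong) auto

lemma sets_vec_lebesgue [measurable_cong]: "sets (vec_lebesgue d) = sets (PiM {1..d} (\<lambda>_. borel))"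
  by (intro sets_PiM_cong) auto

lemma sigma_finite_vec_lebesgue: "sigma_finite_measure (vec_lebesgue d)"
proof -
  interpret product_sigma_finite "\<lambda>_::nat. complex_lebesgue"
    by (rule product_sigma_finite.intro) (rule sigma_finite_complex_lebesgue)
  show ?thesis by (rule sigma_finite) auto
qed

lemma gauss_dens_nonneg: "v > 0 \<Longrightarrow> gauss_dens v m z \<ge> 0"
  by (simp add: gauss_dens_def)

text \<open>Both sides are identified with the product of the one-dimensional laws by evaluating
  them on boxes.\<close>

lemma gauss_vec_affine:
  assumes v: "\<And>k. k \<in> {1..d} \<Longrightarrow> v k > 0"
  shows "distr (gauss_vec d) (PiM {1..d} (\<lambda>_. borel)) (\<lambda>g. \<lambda>k\<in>{1..d}. m k + of_real (sqrt (v k)) * g k)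
     = density (vec_lebesgue d) (\<lambda>y. ennreal (\<Prod>k\<in>{1..d}. gauss_dens (v k) (m k) (y k)))"
proof -
  \<comment> \<open>The default outside \<open>{1..d}\<close> is a probability measure, so that all
    factors are \<sigma>-finite.\<close>
  define Q where "Q = (\<lambda>k. if k \<in> {1..d} then density complex_lebesgue (\<lambda>z. ennreal (gauss_dens (v k) (m k) z)) else std_complex_gaussian)"
  have Q: "Q k = distr std_complex_gaussian borel (\<lambda>z. m k + of_real (sqrt (v k)) * z)" if "k \<in> {1..d}" for k
    using std_complex_gaussian_affine[OF v[OF that]] that by (simp add: Q_def)
  have pQ: "prob_space (Q k)" for k
  proof (cases "k \<in> {1..d}")
    case True
    show ?thesis unfolding Q[OF True]
      by (rule prob_space.prob_space_distr[OF prob_space_std_complex_gaussian]) measurable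
  qed (auto simp: Q_def prob_space_std_complex_gaussian)
  interpret Q: product_sigma_finite Q
    by (rule product_sigma_finite.intro) (rule prob_space_imp_sigma_finite[OF pQ])
  interpret G: product_prob_space "\<lambda>_::nat. std_complex_gaussian" by (rule product_prob_space_gauss)
  interpret L: product_sigma_finite "\<lambda>_::nat. complex_lebesgue"
    by (rule product_sigma_finite.intro) (rule sigma_finite_complex_lebesgue)
  have sQ: "sets (Q k) = sets borel" for k by (simp add: Q_def)
  have sPQ: "sets (PiM {1..d} Q) = sets (PiM {1..d} (\<lambda>_. borel :: complex measure))"
    using sQ by (intro sets_PiM_cong) auto
  let ?F = "\<lambda>g. \<lambda>k\<in>{1..d}. m k + of_real (sqrt (v k)) * g k"
  have mF: "?F \<in> measurable (gauss_vec d) (PiM {1..d} (\<lambda>_. borel))" by measurable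
  have 1: "distr (gauss_vec d) (PiM {1..d} (\<lambda>_. borel)) ?F = PiM {1..d} Q"
  proof (rule Q.PiM_eqI)
    fix A assume A: "\<And>k. k \<in> {1..d} \<Longrightarrow> A k \<in> sets (Q k)"
    then have A': "A k \<in> sets borel" if "k \<in> {1..d}" for k using sQ that by auto
    define A2 where "A2 = (\<lambda>k. (\<lambda>z. m k + of_real (sqrt (v k)) * z) -` A k)"
    have A2: "A2 k \<in> sets borel" if "k \<in> {1..d}" for k
      unfolding A2_def using measurable_sets[of "\<lambda>z. m k + of_real (sqrt (v k)) * z" borel borel "A k"] A'[OF that] by simp
    have "emeasure (distr (gauss_vec d) (PiM {1..d} (\<lambda>_. borel)) ?F) (PiE {1..d} A)
        = emeasure (gauss_vec d) (?F -` PiE {1..d} A \<inter> space (gauss_vec d))"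
      using A' by (intro emeasure_distr mF sets_PiM_I_finite) auto
    also have "?F -` PiE {1..d} A \<inter> space (gauss_vec d) = PiE {1..d} A2"
      by (auto simp: A2_def space_PiM PiE_iff)
    also have "emeasure (gauss_vec d) (PiE {1..d} A2) = (\<Prod>k\<in>{1..d}. emeasure std_complex_gaussian (A2 k))"
      using A2 by (intro G.emeasure_PiM) auto
    also have "\<dots> = (\<Prod>k\<in>{1..d}. emeasure (Q k) (A k))"
    proof (intro prod.cong refl)
      fix k assume k: "k \<in> {1..d}"
      show "emeasure std_complex_gaussian (A2 k) = emeasure (Q k) (A k)"
        unfolding Q[OF k] A2_def using A'[OF k] by (subst emeasure_distr) auto
    qed
    finally show "emeasure (distr (gauss_vec d) (PiM {1..d} (\<lambda>_. borel)) ?F) (PiE {1..d} A) = (\<Prod>k\<in>{1..d}. emeasure (Q k) (A k))" .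
  qed (use sPQ in auto)
  have 2: "density (vec_lebesgue d) (\<lambda>y. ennreal (\<Prod>k\<in>{1..d}. gauss_dens (v k) (m k) (y k))) = PiM {1..d} Q"
  proof (rule Q.PiM_eqI)
    fix A assume A: "\<And>k. k \<in> {1..d} \<Longrightarrow> A k \<in> sets (Q k)"
    then have A': "A k \<in> sets borel" if "k \<in> {1..d}" for k using sQ that by auto
    have AA: "PiE {1..d} A \<in> sets (vec_lebesgue d)" using A' by (intro sets_PiM_I_finite) auto
    have "emeasure (density (vec_lebesgue d) (\<lambda>y. ennreal (\<Prod>k\<in>{1..d}. gauss_dens (v k) (m k) (y k)))) (PiE {1..d} A)
        = (\<integral>\<^sup>+y. ennreal (\<Prod>k\<in>{1..d}. gauss_dens (v k) (m k) (y k)) * indicator (PiE {1..d} A) y \<partial>vec_lebesgue d)"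
      by (rule emeasure_density[OF _ AA]) measurable
    also have "\<dots> = (\<integral>\<^sup>+y. (\<Prod>k\<in>{1..d}. ennreal (gauss_dens (v k) (m k) (y k)) * indicator (A k) (y k)) \<partial>vec_lebesgue d)"
    proof (intro nn_integral_cong)
      fix y assume y: "y \<in> space (vec_lebesgue d)"
      have "indicator (PiE {1..d} A) y = (\<Prod>k\<in>{1..d}. indicator (A k) (y k) :: ennreal)"
      proof (cases "y \<in> PiE {1..d} A")
        case True
        then show ?thesis by (simp add: PiE_iff)
      next
        case False
        then obtain k where "k \<in> {1..d}" "y k \<notin> A k" using y by (auto simp: PiE_iff space_PiM)
        then have "(\<Prod>k\<in>{1..d}. indicator (A k) (y k) :: ennreal) = 0" by (intro prod_zero bexI[of _ k]) auto
        then show ?thesis using False by simp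
      qed
      then show "ennreal (\<Prod>k\<in>{1..d}. gauss_dens (v k) (m k) (y k)) * indicator (PiE {1..d} A) y
          = (\<Prod>k\<in>{1..d}. ennreal (gauss_dens (v k) (m k) (y k)) * indicator (A k) (y k))"
        unfolding prod.distrib
        using prod_ennreal[of "{1..d}" "\<lambda>k. gauss_dens (v k) (m k) (y k)"] gauss_dens_nonneg[OF v] by simp
    qed
    also have "\<dots> = (\<Prod>k\<in>{1..d}. \<integral>\<^sup>+z. ennreal (gauss_dens (v k) (m k) z) * indicator (A k) z \<partial>complex_lebesgue)"
    proof (rule L.product_nn_integral_prod)
      fix k assume "k \<in> {1..d}"
      from A'[OF this] show "(\<lambda>z. ennreal (gauss_dens (v k) (m k) z) * indicator (A k) z) \<in> borel_measurable complex_lebesgue"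
        by measurable
    qed simp
    also have "\<dots> = (\<Prod>k\<in>{1..d}. emeasure (Q k) (A k))"
      by (intro prod.cong refl) (simp add: Q_def emeasure_density A')
    finally show "emeasure (density (vec_lebesgue d) (\<lambda>y. ennreal (\<Prod>k\<in>{1..d}. gauss_dens (v k) (m k) (y k)))) (PiE {1..d} A)
        = (\<Prod>k\<in>{1..d}. emeasure (Q k) (A k))" .
  next
    show "sets (density (vec_lebesgue d) (\<lambda>y. ennreal (\<Prod>k\<in>{1..d}. gauss_dens (v k) (m k) (y k)))) = sets (PiM {1..d} Q)"
      using sPQ sets_vec_lebesgue by simp
  qed auto
  show ?thesis using 1 2 by simp
qed

lemma
  fixes f :: "complex \<Rightarrow> 'a :: {banach, second_countable_topology}"
  assumes "integrable std_complex_gaussian f" "k \<in> {1..d}"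
  shows integrable_gauss_vec_component: "integrable (gauss_vec d) (\<lambda>g. f (g k))"
    and integral_gauss_vec_component: "(\<integral>g. f (g k) \<partial>gauss_vec d) = (\<integral>z. f z \<partial>std_complex_gaussian)"
proof -
  have d: "distr (gauss_vec d) std_complex_gaussian (\<lambda>g. g k) = std_complex_gaussian"
    by (rule distr_PiM_component[OF prob_space_std_complex_gaussian assms(2)])
  have m: "(\<lambda>g. g k) \<in> measurable (gauss_vec d) std_complex_gaussian" using assms(2) by measurable
  show "integrable (gauss_vec d) (\<lambda>g. f (g k))"
    by (rule integrable_distr[OF m]) (simp only: d assms(1))
  show "(\<integral>g. f (g k) \<partial>gauss_vec d) = (\<integral>z. f z \<partial>std_complex_gaussian)"
    using integral_distr[OF m borel_measurable_integrable[OF assms(1)]] unfolding d by simp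
qed

text \<open>Gaussian factors of mean zero in one coordinate allow subtracting the value of \<open>F\<close> with that
  coordinate set to zero; this replaces integration by parts and needs no derivative of \<open>F\<close>.\<close>

lemma centered_coordinate_bound:
  fixes F :: "(nat \<Rightarrow> complex) \<Rightarrow> real" and W :: "(nat \<Rightarrow> complex) \<Rightarrow> complex"
  assumes k: "k \<in> {1..d}"
    and F[measurable]: "F \<in> borel_measurable (PiM {1..d} (\<lambda>_. borel))" and FC: "\<And>g. \<bar>F g\<bar> \<le> C"
    and lip: "\<And>g z. \<bar>F (g(k := z)) - F (g(k := 0))\<bar> \<le> L * norm z" and L: "L \<ge> 0"
    and h[measurable]: "h \<in> borel_measurable borel" and h0: "(\<integral>z. h z \<partial>std_complex_gaussian) = 0"
    and hi: "integrable std_complex_gaussian h" "integrable std_complex_gaussian (\<lambda>z. norm z * norm (h z))"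
    and W[measurable]: "W \<in> borel_measurable (PiM {1..d} (\<lambda>_. borel))"
    and Wk: "\<And>g z. W (g(k := z)) = W g"
    and int: "integrable (gauss_vec d) W" "integrable (gauss_vec d) (\<lambda>g. h (g k) * W g)"
  shows "norm (\<integral>g. of_real (F g) * (h (g k) * W g) \<partial>gauss_vec d)
     \<le> L * (\<integral>z. norm z * norm (h z) \<partial>std_complex_gaussian) * (\<integral>g. norm (W g) \<partial>gauss_vec d)"
proof -
  interpret G: product_prob_space "\<lambda>_::nat. std_complex_gaussian" by (rule product_prob_space_gauss)
  define I where "I = {1..d} - {k}"
  have ins: "{1..d} = insert k I" and kI: "k \<notin> I" "finite I" using k by (auto simp: I_def)
  interpret GI: prob_space "PiM I (\<lambda>_. std_complex_gaussian)" by (intro prob_space_PiM prob_space_std_complex_gaussian)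
  have fold: "(\<integral>g. f g \<partial>gauss_vec d) = (\<integral>g. (\<integral>z. f (g(k := z)) \<partial>std_complex_gaussian) \<partial>PiM I (\<lambda>_. std_complex_gaussian))"
    if "integrable (gauss_vec d) f" for f :: "(nat \<Rightarrow> complex) \<Rightarrow> 'b :: {banach, second_countable_topology}"
    using G.product_integral_insert[OF kI(2,1), of f] that unfolding ins by simp
  have cst: "integrable M (\<lambda>g. of_real (F g) * f g)" if "integrable M f" "F \<in> borel_measurable M" for M and f :: "(nat \<Rightarrow> complex) \<Rightarrow> complex"
  proof (rule Bochner_Integration.integrable_bound[OF integrable_mult_right[OF that(1), of "of_real C"]])
    show "(\<lambda>g. of_real (F g) * f g) \<in> borel_measurable M" using that by measurable
    have "C \<ge> 0" using FC[of undefined] by simp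
    then show "AE g in M. norm (of_real (F g) * f g) \<le> norm (of_real C * f g)"
      using FC by (intro AE_I2) (auto simp: norm_mult intro!: mult_right_mono)
  qed
  have int2: "integrable (gauss_vec d) (\<lambda>g. of_real (F g) * (h (g k) * W g))"
    by (rule cst[OF int(2)]) measurable
  define m where "m = (\<integral>z. norm z * norm (h z) \<partial>std_complex_gaussian)"
  have upd: "(\<lambda>z. g(k := z)) \<in> measurable borel (PiM {1..d} (\<lambda>_. borel))" if "g \<in> space (PiM I (\<lambda>_. std_complex_gaussian))" for g
    unfolding ins using that by (intro measurable_fun_upd[of _ I]) (auto simp: space_PiM)
  have inner: "norm (\<integral>z. of_real (F (g(k := z))) * (h z * W g) \<partial>std_complex_gaussian) \<le> L * m * norm (W g)"
    if g: "g \<in> space (PiM I (\<lambda>_. std_complex_gaussian))" for g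
  proof -
    have Fz[measurable]: "(\<lambda>z. F (g(k := z))) \<in> borel_measurable borel"
      by (rule measurable_compose[OF upd[OF g] F])
    have iF: "integrable std_complex_gaussian (\<lambda>z. of_real (F (g(k := z))) * h z)"
    proof (rule Bochner_Integration.integrable_bound[OF integrable_mult_right[OF hi(1), of "of_real C"]])
      have "C \<ge> 0" using FC[of undefined] by simp
      then show "AE z in std_complex_gaussian. norm (of_real (F (g(k := z))) * h z) \<le> norm (of_real C * h z)"
        using FC by (intro AE_I2) (auto simp: norm_mult intro!: mult_right_mono)
    qed measurable
    have "(\<integral>z. of_real (F (g(k := z))) * (h z * W g) \<partial>std_complex_gaussian)
        = (\<integral>z. of_real (F (g(k := z))) * h z \<partial>std_complex_gaussian) * W g"
      by (simp add: mult.assoc[symmetric])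
    \<comment> \<open>The subtracted term is a constant in \<open>z\<close> times the mean of
      \<open>h\<close>, which is zero.\<close>
    also have "(\<integral>z. of_real (F (g(k := z))) * h z \<partial>std_complex_gaussian)
        = (\<integral>z. of_real (F (g(k := z))) * h z - of_real (F (g(k := 0))) * h z \<partial>std_complex_gaussian)"
      using iF hi(1) h0 by simp
    also have "\<dots> = (\<integral>z. of_real (F (g(k := z)) - F (g(k := 0))) * h z \<partial>std_complex_gaussian)"
      by (simp add: left_diff_distrib)
    also have "norm (\<dots> * W g) \<le> L * m * norm (W g)"
      unfolding norm_mult
    proof (rule mult_right_mono)
      have "norm (\<integral>z. of_real (F (g(k := z)) - F (g(k := 0))) * h z \<partial>std_complex_gaussian)
         \<le> (\<integral>z. norm (of_real (F (g(k := z)) - F (g(k := 0))) * h z) \<partial>std_complex_gaussian)" by (rule integral_norm_bound)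
      also have "\<dots> \<le> (\<integral>z. L * (norm z * norm (h z)) \<partial>std_complex_gaussian)"
      proof (rule integral_mono_AE')
        show "integrable std_complex_gaussian (\<lambda>z. L * (norm z * norm (h z)))" using hi by simp
        show "AE z in std_complex_gaussian. norm (of_real (F (g(k := z)) - F (g(k := 0))) * h z) \<le> L * (norm z * norm (h z))"
          using lip[of g] by (intro AE_I2) (auto simp: norm_mult mult.assoc[symmetric] simp flip: of_real_diff intro!: mult_right_mono)
      qed (use L in \<open>auto intro!: AE_I2\<close>)
      also have "\<dots> = L * m" by (simp add: m_def)
      finally show "norm (\<integral>z. of_real (F (g(k := z)) - F (g(k := 0))) * h z \<partial>std_complex_gaussian) \<le> L * m" .
    qed simp
    finally show ?thesis .
  qed
  have "(\<integral>g. of_real (F g) * (h (g k) * W g) \<partial>gauss_vec d)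
      = (\<integral>g. (\<integral>z. of_real (F (g(k := z))) * (h z * W g) \<partial>std_complex_gaussian) \<partial>PiM I (\<lambda>_. std_complex_gaussian))"
    unfolding fold[OF int2] by (simp add: Wk)
  also have "norm \<dots> \<le> (\<integral>g. norm (\<integral>z. of_real (F (g(k := z))) * (h z * W g) \<partial>std_complex_gaussian) \<partial>PiM I (\<lambda>_. std_complex_gaussian))"
    by (rule integral_norm_bound)
  also have "\<dots> \<le> (\<integral>g. L * m * norm (W g) \<partial>PiM I (\<lambda>_. std_complex_gaussian))"
  proof (rule integral_mono_AE')
    \<comment> \<open>\<open>W\<close> ignores coordinate \<open>k\<close>, and that coordinate
      carries a probability measure, so integrating over the other coordinates alone gives the same
      value.\<close>
    have "integrable (PiM I (\<lambda>_. std_complex_gaussian)) W"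
      unfolding integrable_iff_bounded
    proof
      have "(\<lambda>g. g(k := 0)) \<in> measurable (PiM I (\<lambda>_. std_complex_gaussian)) (PiM {1..d} (\<lambda>_. borel))"
        unfolding ins by (intro measurable_fun_upd[of _ I]) auto
      from measurable_compose[OF this W] show "W \<in> borel_measurable (PiM I (\<lambda>_. std_complex_gaussian))"
        by (simp add: Wk)
      have "(\<integral>\<^sup>+ g. ennreal (norm (W g)) \<partial>PiM I (\<lambda>_. std_complex_gaussian)) = (\<integral>\<^sup>+ g. ennreal (norm (W g)) \<partial>gauss_vec d)"
        unfolding ins by (subst G.product_nn_integral_insert[OF kI(2,1)])
          (use int(1) in \<open>auto simp: Wk prob_space.emeasure_space_1[OF prob_space_std_complex_gaussian, simplified] ins[symmetric]\<close>)
      also have "\<dots> < \<infinity>" using int(1) by (simp add: integrable_iff_bounded)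
      finally show "(\<integral>\<^sup>+ g. ennreal (norm (W g)) \<partial>PiM I (\<lambda>_. std_complex_gaussian)) < \<infinity>" .
    qed
    then show "integrable (PiM I (\<lambda>_. std_complex_gaussian)) (\<lambda>g. L * m * norm (W g))" by auto
    show "AE g in PiM I (\<lambda>_. std_complex_gaussian). norm (\<integral>z. of_real (F (g(k := z))) * (h z * W g) \<partial>std_complex_gaussian) \<le> L * m * norm (W g)"
      using inner by (intro AE_I2)
    have "m \<ge> 0" unfolding m_def by (intro integral_nonneg_AE) auto
    then show "AE g in PiM I (\<lambda>_. std_complex_gaussian). 0 \<le> L * m * norm (W g)" using L by (intro AE_I2) simp
  qed
  also have "\<dots> = L * m * (\<integral>g. norm (W g) \<partial>PiM I (\<lambda>_. std_complex_gaussian))" by simp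
  also have "(\<integral>g. norm (W g) \<partial>PiM I (\<lambda>_. std_complex_gaussian)) = (\<integral>g. norm (W g) \<partial>gauss_vec d)"
    unfolding fold[OF integrable_norm[OF int(1)]] by (simp add: Wk prob_space.prob_space[OF prob_space_std_complex_gaussian, simplified])
  finally show ?thesis by (simp add: m_def)
qed

text \<open>A sum of moments that dominates the constants of all three bounds below: linear, product
  of two coordinates, and square of one coordinate.\<close>

definition gauss_const :: real where
  "gauss_const = (\<integral>z. norm z * norm z \<partial>std_complex_gaussian) * (1 + (\<integral>z. norm z \<partial>std_complex_gaussian))
     + (\<integral>z. norm z * norm (z ^ 2) \<partial>std_complex_gaussian)"

lemma integrable_std_complex_gaussian_moments:
  "integrable std_complex_gaussian (\<lambda>z. norm z)" "integrable std_complex_gaussian (\<lambda>z. norm z * norm z)"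
  "integrable std_complex_gaussian (\<lambda>z. norm z * norm (z ^ 2))" "integrable std_complex_gaussian cnj"
  "integrable std_complex_gaussian (\<lambda>z. (cnj z)\<^sup>2)" "integrable std_complex_gaussian (\<lambda>z. z)"
  subgoal by (rule integrable_std_complex_gaussian[of _ 1 1]) auto
  subgoal by (rule integrable_std_complex_gaussian[of _ 1 2]) (auto simp: power2_eq_square)
  subgoal by (rule integrable_std_complex_gaussian[of _ 1 3]) (auto simp: norm_mult power2_eq_square power3_eq_cube)
  subgoal by (rule integrable_std_complex_gaussian[of _ 1 1]) auto
  subgoal by (rule integrable_std_complex_gaussian[of _ 1 2]) (auto simp: norm_power)
  subgoal by (rule integrable_std_complex_gaussian[of _ 1 1]) auto
  done

lemma integrable_gauss_vec_product:
  fixes a b :: "complex \<Rightarrow> complex"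
  assumes "k \<in> {1..d}" "l \<in> {1..d}" and [measurable]: "a \<in> borel_measurable borel" "b \<in> borel_measurable borel"
    and n: "\<And>z. norm (a z) = norm z" "\<And>z. norm (b z) = norm z"
  shows "integrable (gauss_vec d) (\<lambda>g. a (g k) * b (g l))"
proof (rule Bochner_Integration.integrable_bound)
  show "integrable (gauss_vec d) (\<lambda>g. norm (g k) * norm (g k) + norm (g l) * norm (g l))"
    by (intro Bochner_Integration.integrable_add integrable_gauss_vec_component[of "\<lambda>z. norm z * norm z"]
        integrable_std_complex_gaussian_moments assms)
  show "(\<lambda>g. a (g k) * b (g l)) \<in> borel_measurable (gauss_vec d)" using assms(1,2) by measurable
  show "AE g in gauss_vec d. norm (a (g k) * b (g l)) \<le> norm (norm (g k) * norm (g k) + norm (g l) * norm (g l))"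
  proof (rule AE_I2)
    fix g :: "nat \<Rightarrow> complex"
    have "2 * (norm (g k) * norm (g l)) \<le> norm (g k) * norm (g k) + norm (g l) * norm (g l)"
      using sum_squares_bound[of "norm (g k)" "norm (g l)"] by (simp add: power2_eq_square)
    moreover have "0 \<le> norm (g k) * norm (g l)" by simp
    ultimately show "norm (a (g k) * b (g l)) \<le> norm (norm (g k) * norm (g k) + norm (g l) * norm (g l))"
      unfolding norm_mult n real_norm_def by linarith
  qed
qed

lemma gauss_const_ge:
  "(\<integral>z. norm z * norm z \<partial>std_complex_gaussian) \<le> gauss_const"
  "(\<integral>z. norm z * norm z \<partial>std_complex_gaussian) * (\<integral>z. norm z \<partial>std_complex_gaussian) \<le> gauss_const"
  "(\<integral>z. norm z * norm (z ^ 2) \<partial>std_complex_gaussian) \<le> gauss_const" "gauss_const \<ge> 0"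
proof -
  have "(\<integral>z. norm z * norm z \<partial>std_complex_gaussian) \<ge> 0" "(\<integral>z. norm z \<partial>std_complex_gaussian) \<ge> 0"
    "(\<integral>z. norm z * norm (z ^ 2) \<partial>std_complex_gaussian) \<ge> 0"
    by (auto intro!: integral_nonneg_AE)
  moreover from this have "(\<integral>z. norm z * norm z \<partial>std_complex_gaussian) * (\<integral>z. norm z \<partial>std_complex_gaussian) \<ge> 0"
    by simp
  ultimately show "(\<integral>z. norm z * norm z \<partial>std_complex_gaussian) \<le> gauss_const"
    "(\<integral>z. norm z * norm z \<partial>std_complex_gaussian) * (\<integral>z. norm z \<partial>std_complex_gaussian) \<le> gauss_const"
    "(\<integral>z. norm z * norm (z ^ 2) \<partial>std_complex_gaussian) \<le> gauss_const" "gauss_const \<ge> 0"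
    unfolding gauss_const_def by (simp_all add: algebra_simps)
qed

text \<open>Each noise monomial is a centered function of \<open>g k\<close> times a function of
  another coordinate: \<open>cnj (g k)\<close> if \<open>k \<noteq> l\<close>, and
  \<open>(cnj (g k))^2\<close> in the quadratic case \<open>k = l\<close>. The product
  \<open>cnj (g k) * g k\<close> has positive mean and is not covered, which is why the mixed bound
  asks for \<open>k \<noteq> l\<close>.\<close>

lemma
  fixes F :: "(nat \<Rightarrow> complex) \<Rightarrow> real"
  assumes k: "k \<in> {1..d}" and l: "l \<in> {1..d}"
    and F: "F \<in> borel_measurable (PiM {1..d} (\<lambda>_. borel))" and FC: "\<And>g. \<bar>F g\<bar> \<le> C"
    and lip: "\<And>g z. \<bar>F (g(k := z)) - F (g(k := 0))\<bar> \<le> L * norm z" and L: "L \<ge> 0"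
  shows gauss_linear_bound: "norm (\<integral>g. of_real (F g) * cnj (g k) \<partial>gauss_vec d) \<le> L * gauss_const"
    and gauss_quadratic_bound: "norm (\<integral>g. of_real (F g) * (cnj (g k) * cnj (g l)) \<partial>gauss_vec d) \<le> L * gauss_const"
    and gauss_mixed_bound: "k \<noteq> l \<Longrightarrow> norm (\<integral>g. of_real (F g) * (cnj (g k) * g l) \<partial>gauss_vec d) \<le> L * gauss_const"
proof -
  interpret G: prob_space "gauss_vec d" by (rule prob_space_gauss_vec)
  note mom = integrable_std_complex_gaussian_moments
  have ml[measurable]: "(\<lambda>g. g l) \<in> borel_measurable (PiM {1..d} (\<lambda>_. borel :: complex measure))"
    "(\<lambda>g. g k) \<in> borel_measurable (PiM {1..d} (\<lambda>_. borel :: complex measure))" using k l by measurable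
  have one: "norm (\<integral>g. of_real (F g) * (h (g k) * 1) \<partial>gauss_vec d) \<le> L * (\<integral>z. norm z * norm (h z) \<partial>std_complex_gaussian)"
    if "h \<in> borel_measurable borel" "(\<integral>z. h z \<partial>std_complex_gaussian) = 0" "integrable std_complex_gaussian h"
      "integrable std_complex_gaussian (\<lambda>z. norm z * norm (h z))" for h :: "complex \<Rightarrow> complex"
  proof -
    have "norm (\<integral>g. of_real (F g) * (h (g k) * 1) \<partial>gauss_vec d)
       \<le> L * (\<integral>z. norm z * norm (h z) \<partial>std_complex_gaussian) * (\<integral>g. norm (1 :: complex) \<partial>gauss_vec d)"
      by (rule centered_coordinate_bound[OF k F FC lip L that, where W = "\<lambda>_. 1"])
         (simp_all only: mult_1_right integrable_gauss_vec_component[OF that(3) k] measurable_const space_borel UNIV_I G.integrable_const)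
    also have "(\<integral>g. norm (1 :: complex) \<partial>gauss_vec d) = 1" using G.prob_space by simp
    finally show ?thesis by simp
  qed
  have "norm (\<integral>g. of_real (F g) * (cnj (g k) * 1) \<partial>gauss_vec d) \<le> L * (\<integral>z. norm z * norm (cnj z) \<partial>std_complex_gaussian)"
    using mom(2) by (intro one[OF _ std_complex_gaussian_cnj mom(4)]) simp_all
  also have "\<dots> \<le> L * gauss_const" using gauss_const_ge(1) L by (intro mult_left_mono) auto
  finally show "norm (\<integral>g. of_real (F g) * cnj (g k) \<partial>gauss_vec d) \<le> L * gauss_const" by simp
  have two: "norm (\<integral>g. of_real (F g) * (cnj (g k) * b (g l)) \<partial>gauss_vec d) \<le> L * gauss_const"
    if kl: "k \<noteq> l" and b[measurable]: "b \<in> borel_measurable borel" "\<And>z. norm (b z) = norm z" for b :: "complex \<Rightarrow> complex"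
  proof -
    have ib: "integrable std_complex_gaussian b" using that by (intro integrable_std_complex_gaussian[of _ 1 1]) auto
    have "norm (\<integral>g. of_real (F g) * (cnj (g k) * b (g l)) \<partial>gauss_vec d)
       \<le> L * (\<integral>z. norm z * norm (cnj z) \<partial>std_complex_gaussian) * (\<integral>g. norm (b (g l)) \<partial>gauss_vec d)"
    proof (rule centered_coordinate_bound[OF k F FC lip L _ std_complex_gaussian_cnj mom(4)])
      show "cnj \<in> borel_measurable borel" by measurable
      show "integrable std_complex_gaussian (\<lambda>z. norm z * norm (cnj z))" using mom(2) by simp
      show "(\<lambda>g. b (g l)) \<in> borel_measurable (PiM {1..d} (\<lambda>_. borel))" by measurable
      show "b ((g(k := z)) l) = b (g l)" for g z using kl by simp
      show "integrable (gauss_vec d) (\<lambda>g. b (g l))" by (rule integrable_gauss_vec_component[OF ib l])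
      show "integrable (gauss_vec d) (\<lambda>g. cnj (g k) * b (g l))"
        by (rule integrable_gauss_vec_product[OF k l _ b(1) _ b(2)]) auto
    qed
    also have "(\<integral>g. norm (b (g l)) \<partial>gauss_vec d) = (\<integral>z. norm z \<partial>std_complex_gaussian)"
      using integral_gauss_vec_component[OF mom(1) l] b by simp
    also have "L * (\<integral>z. norm z * norm (cnj z) \<partial>std_complex_gaussian) * (\<integral>z. norm z \<partial>std_complex_gaussian) \<le> L * gauss_const"
      using mult_left_mono[OF gauss_const_ge(2) L] by (simp add: mult.assoc)
    finally show ?thesis .
  qed
  show "norm (\<integral>g. of_real (F g) * (cnj (g k) * cnj (g l)) \<partial>gauss_vec d) \<le> L * gauss_const"
  proof (cases "k = l")
    case True
    have "norm (\<integral>g. of_real (F g) * ((cnj (g k))\<^sup>2 * 1) \<partial>gauss_vec d) \<le> L * (\<integral>z. norm z * norm ((cnj z)\<^sup>2) \<partial>std_complex_gaussian)"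
      using mom(3) by (intro one[OF _ std_complex_gaussian_cnj_square mom(5)]) (simp_all add: norm_power)
    also have "\<dots> \<le> L * gauss_const" using gauss_const_ge(3) L by (intro mult_left_mono) (auto simp: norm_power)
    finally show ?thesis using True by (simp add: power2_eq_square)
  qed (rule two, auto)
  show "k \<noteq> l \<Longrightarrow> norm (\<integral>g. of_real (F g) * (cnj (g k) * g l) \<partial>gauss_vec d) \<le> L * gauss_const"
    using two[of "\<lambda>z. z"] by simp
qed

subsection \<open>Interpolation by a Gaussian kernel\<close>

definition ou_mean :: "real \<Rightarrow> nat \<Rightarrow> real \<Rightarrow> real" where
  "ou_mean \<beta> k t = exp (- (\<beta> * real k * t / 2))"

text \<open>This variance leaves the Gaussian limit invariant:
  \<open>(ou_mean \<beta> k t)^2 * (2 * k / \<beta>)\<close> plus it is again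
  \<open>2 * k / \<beta>\<close>.\<close>

definition ou_var :: "real \<Rightarrow> nat \<Rightarrow> real \<Rightarrow> real" where
  "ou_var \<beta> k t = 2 * real k / \<beta> * (1 - (ou_mean \<beta> k t)\<^sup>2)"

text \<open>For positive times, the conditional density of the interpolating vector given the
  angles, with respect to \<open>vec_lebesgue d\<close>. Time derivatives and integrations by parts
  act on it instead of on the test function.\<close>

definition kernel :: "real \<Rightarrow> nat \<Rightarrow> nat \<Rightarrow> real \<Rightarrow> (nat \<Rightarrow> real) \<Rightarrow> (nat \<Rightarrow> complex) \<Rightarrow> real" where
  "kernel \<beta> n d t x y = (\<Prod>k\<in>{1..d}. gauss_dens (ou_var \<beta> k t) (of_real (ou_mean \<beta> k t) * psum n k x) (y k))"

definition resid :: "real \<Rightarrow> nat \<Rightarrow> nat \<Rightarrow> real \<Rightarrow> (nat \<Rightarrow> real) \<Rightarrow> (nat \<Rightarrow> complex) \<Rightarrow> complex" where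
  "resid \<beta> n k t x y = y k - of_real (ou_mean \<beta> k t) * psum n k x"

text \<open>The coefficient with which residuals enter the derivatives of \<open>ln kernel\<close>
  in the angles.\<close>

definition ou_rate :: "real \<Rightarrow> nat \<Rightarrow> real \<Rightarrow> real" where
  "ou_rate \<beta> k t = ou_mean \<beta> k t * real k / ou_var \<beta> k t"

text \<open>Time derivative of the logarithm of \<open>kernel\<close>.\<close>

definition kernel_dot :: "real \<Rightarrow> nat \<Rightarrow> nat \<Rightarrow> real \<Rightarrow> (nat \<Rightarrow> real) \<Rightarrow> (nat \<Rightarrow> complex) \<Rightarrow> real" where
  "kernel_dot \<beta> n d t x y = (\<Sum>k\<in>{1..d}. - \<beta> * ou_rate \<beta> k t * Re (cnj (resid \<beta> n k t x y) * psum n k x)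
      + 2 * (ou_rate \<beta> k t)\<^sup>2 * (norm (resid \<beta> n k t x y))\<^sup>2 - 2 * ou_rate \<beta> k t * ou_mean \<beta> k t * real k)"

text \<open>The power sum of integer index \<open>k - l\<close>; a negative index means the
  conjugate of the power sum of opposite index.\<close>

definition psum_diff :: "nat \<Rightarrow> nat \<Rightarrow> nat \<Rightarrow> (nat \<Rightarrow> real) \<Rightarrow> complex" where
  "psum_diff n k l x = (\<Sum>j\<in>{1..n}. cis (x j) ^ k * cnj (cis (x j) ^ l))"

definition drift_rest :: "real \<Rightarrow> nat \<Rightarrow> nat \<Rightarrow> (nat \<Rightarrow> real) \<Rightarrow> complex" where
  "drift_rest \<beta> n k x = of_real (1 - \<beta> / 2) * of_nat k * psum n k x + of_real (\<beta> / 2) * psum_conv n k x"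

text \<open>The diagonal \<open>l = k\<close> is left out of the \<open>psum_diff\<close> terms
  because \<open>psum_diff n k k\<close> equals \<open>n\<close>: it is of leading order and
  balances the quadratic term of \<open>kernel_dot\<close>.\<close>

definition stein_err :: "real \<Rightarrow> nat \<Rightarrow> nat \<Rightarrow> real \<Rightarrow> (nat \<Rightarrow> real) \<Rightarrow> (nat \<Rightarrow> complex) \<Rightarrow> complex" where
  "stein_err \<beta> n d t x y = (\<Sum>k\<in>{1..d}. of_real (ou_rate \<beta> k t) * cnj (resid \<beta> n k t x y) *
      ((\<Sum>l\<in>{1..d}. of_real (ou_rate \<beta> l t) * (cnj (resid \<beta> n l t x y) * psum n (k + l) x
          - (if l = k then 0 else resid \<beta> n l t x y * psum_diff n k l x))) + drift_rest \<beta> n k x))"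

lemma ou_mean_pos: "ou_mean \<beta> k t > 0" by (simp add: ou_mean_def)

lemma ou_var_pos:
  assumes "\<beta> > 0" "k \<ge> 1" "t > 0"
  shows "ou_var \<beta> k t > 0"
proof -
  have "ou_mean \<beta> k t < 1" unfolding ou_mean_def using assms by simp
  then have "(ou_mean \<beta> k t)\<^sup>2 < 1" using ou_mean_pos[of \<beta> k t] by (simp add: power_less_one_iff less_imp_le)
  then show ?thesis unfolding ou_var_def using assms by (intro mult_pos_pos) auto
qed

lemma cis_power_cnj: "cis a ^ m * cnj (cis a ^ m) = 1"
  using complex_norm_square[of "cis a ^ m"] by (simp add: norm_power)

lemma psum_diff_eq: "psum_diff n k l x = (if l \<le> k then psum n (k - l) x else cnj (psum n (l - k) x))"
proof -
  note c = cis_power_cnj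
  have "cis a ^ k * cnj (cis a ^ l) = (if l \<le> k then cis a ^ (k - l) else cnj (cis a ^ (l - k)))" for a
  proof (cases "l \<le> k")
    case True
    then have "cis a ^ k = cis a ^ (k - l) * cis a ^ l" by (simp flip: power_add)
    then show ?thesis using True c[of a l] by (simp add: mult.assoc)
  next
    case False
    then have "cis a ^ l = cis a ^ (l - k) * cis a ^ k" by (simp flip: power_add)
    then have "cis a ^ k * cnj (cis a ^ l) = cnj (cis a ^ (l - k)) * (cis a ^ k * cnj (cis a ^ k))" by simp
    then show ?thesis using False c[of a k] by simp
  qed
  then show ?thesis unfolding psum_diff_def psum_def by simp
qed

lemma psum_diff_self: "psum_diff n k k x = of_nat n"
  unfolding psum_diff_eq by (simp add: psum_def)

lemma drift_eq: "drift \<beta> n k x = of_real (\<beta> / 2) * of_nat n * psum n k x + drift_rest \<beta> n k x"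
  by (simp add: drift_def drift_rest_def)

lemma gauss_dens_exp: "v > 0 \<Longrightarrow> gauss_dens v m z = exp (- (norm (z - m))\<^sup>2 / v - ln (pi * v))"
  by (simp add: gauss_dens_def exp_diff)

text \<open>Logarithms turn the product into a sum, and the coefficients obey
  \<open>a' = - \<beta> * k / 2 * a\<close> and \<open>v' = 2 * k^2 * a^2\<close>.\<close>

lemma kernel_has_derivative:
  assumes b: "\<beta> > 0" and t: "t > 0"
  shows "((\<lambda>t. kernel \<beta> n d t x y) has_real_derivative kernel \<beta> n d t x y * kernel_dot \<beta> n d t x y) (at t)"
proof -
  define L where "L = (\<lambda>k t. - (norm (y k - of_real (ou_mean \<beta> k t) * psum n k x))\<^sup>2 / ou_var \<beta> k t - ln (pi * ou_var \<beta> k t))"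
  have K: "kernel \<beta> n d s x y = exp (\<Sum>k\<in>{1..d}. L k s)" if "s > 0" for s
    unfolding kernel_def L_def using ou_var_pos[OF b _ that] by (simp add: exp_sum gauss_dens_exp)
  have dm: "((\<lambda>t. ou_mean \<beta> k t) has_real_derivative - (\<beta> * real k / 2) * ou_mean \<beta> k t) (at t)" for k
    unfolding ou_mean_def by (auto intro!: derivative_eq_intros)
  have dv: "((\<lambda>t. ou_var \<beta> k t) has_real_derivative 2 * (real k)\<^sup>2 * (ou_mean \<beta> k t)\<^sup>2) (at t)" for k
    unfolding ou_var_def using b by (auto intro!: derivative_eq_intros dm simp: power2_eq_square)
  have dL: "(L k has_real_derivative (- \<beta> * ou_rate \<beta> k t * Re (cnj (resid \<beta> n k t x y) * psum n k x)
      + 2 * (ou_rate \<beta> k t)\<^sup>2 * (norm (resid \<beta> n k t x y))\<^sup>2 - 2 * ou_rate \<beta> k t * ou_mean \<beta> k t * real k)) (at t)"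
    if k: "k \<in> {1..d}" for k
  proof -
    define a where "a = ou_mean \<beta> k"
    define v where "v = ou_var \<beta> k"
    define p where "p = psum n k x"
    define z where "z = y k"
    have v: "v t > 0" using ou_var_pos[OF b _ t] k by (simp add: v_def)
    have da: "(a has_real_derivative - (\<beta> * real k / 2) * a t) (at t)" using dm[of k] by (simp add: a_def)
    have dv': "(v has_real_derivative 2 * (real k)\<^sup>2 * (a t)\<^sup>2) (at t)" using dv[of k] by (simp add: a_def v_def)
    have Lk: "L k = (\<lambda>t. - ((Re z - a t * Re p)\<^sup>2 + (Im z - a t * Im p)\<^sup>2) / v t - ln (pi * v t))"
      unfolding L_def a_def v_def p_def z_def by (simp add: cmod_power2)
    have nu: "(norm (z - of_real (a t) * p))\<^sup>2 = (Re z - a t * Re p)\<^sup>2 + (Im z - a t * Im p)\<^sup>2" by (simp add: cmod_power2)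
    have re: "Re (cnj (z - of_real (a t) * p) * p) = (Re z - a t * Re p) * Re p + (Im z - a t * Im p) * Im p"
      by (simp add: algebra_simps)
    define P where "P = (Re z - a t * Re p)\<^sup>2 + (Im z - a t * Im p)\<^sup>2"
    define R where "R = (Re z - a t * Re p) * Re p + (Im z - a t * Im p) * Im p"
    have dP: "((\<lambda>t. (Re z - a t * Re p)\<^sup>2 + (Im z - a t * Im p)\<^sup>2) has_real_derivative \<beta> * real k * a t * R) (at t)"
      by (auto intro!: derivative_eq_intros da simp: R_def field_simps)
    define Pf where "Pf = (\<lambda>t. (Re z - a t * Re p)\<^sup>2 + (Im z - a t * Im p)\<^sup>2)"
    have dPf: "(Pf has_real_derivative \<beta> * real k * a t * R) (at t)" using dP by (simp add: Pf_def)
    have Pt: "Pf t = P" by (simp add: Pf_def P_def)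
    have Lk': "L k = (\<lambda>t. - Pf t / v t - ln (pi * v t))" unfolding Lk Pf_def ..
    have "(L k has_real_derivative - (\<beta> * real k * a t * R * v t - P * (2 * (real k)\<^sup>2 * (a t)\<^sup>2)) / (v t)\<^sup>2 - 2 * (real k)\<^sup>2 * (a t)\<^sup>2 / v t) (at t)"
      unfolding Lk' using v by (auto intro!: derivative_eq_intros dPf dv' simp: Pt power2_eq_square diff_divide_distrib)
    also have "- (\<beta> * real k * a t * R * v t - P * (2 * (real k)\<^sup>2 * (a t)\<^sup>2)) / (v t)\<^sup>2 - 2 * (real k)\<^sup>2 * (a t)\<^sup>2 / v t
        = - \<beta> * (a t * real k / v t) * R + 2 * (a t * real k / v t)\<^sup>2 * P - 2 * (a t * real k / v t) * a t * real k"
      using v by (simp add: field_simps power2_eq_square)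
    finally show ?thesis
      unfolding resid_def ou_rate_def a_def[symmetric] v_def[symmetric] p_def[symmetric] z_def[symmetric] nu re P_def R_def
      by simp
  qed
  have "((\<lambda>s. exp (\<Sum>k\<in>{1..d}. L k s)) has_real_derivative exp (\<Sum>k\<in>{1..d}. L k t) * kernel_dot \<beta> n d t x y) (at t)"
    unfolding kernel_dot_def by (intro DERIV_fun_exp DERIV_sum dL)
  then have "((\<lambda>s. exp (\<Sum>k\<in>{1..d}. L k s)) has_real_derivative kernel \<beta> n d t x y * kernel_dot \<beta> n d t x y) (at t)"
    unfolding K[OF t] .
  \<comment> \<open>The exponential form is available at positive times, where the variances are
    positive; the derivative is transferred on that open half-line.\<close>
  then show ?thesis
    by (rule has_field_derivative_transform_within_open[where S = "{0<..}"]) (use t K in auto)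
qed

lemma torus_deriv_resid: "torus_deriv n (\<lambda>x. resid \<beta> n k t x y) (\<lambda>j x. - (\<i> * of_real (ou_mean \<beta> k t) * of_nat k * cis (x j) ^ k))"
  unfolding resid_def
  by (rule torus_deriv_cong[OF torus_deriv_diff[OF torus_deriv_const torus_deriv_cmult[OF torus_deriv_psum]]]) simp

lemma torus_deriv_kernel:
  assumes b: "\<beta> > 0" and t: "t > 0"
  shows "torus_deriv n (\<lambda>x. of_real (kernel \<beta> n d t x y))
     (\<lambda>j x. of_real (kernel \<beta> n d t x y) * (\<i> * (\<Sum>l\<in>{1..d}. of_real (ou_rate \<beta> l t) *
        (cis (x j) ^ l * cnj (resid \<beta> n l t x y) - cnj (cis (x j) ^ l) * resid \<beta> n l t x y))))"
proof -
  let ?u = "\<lambda>k x. resid \<beta> n k t x y"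
  define A where "A = (\<Prod>k\<in>{1..d}. 1 / (pi * ou_var \<beta> k t))"
  \<comment> \<open>Writing the squared modulus as \<open>resid * cnj resid\<close> puts the
    exponent within reach of the closure rules of \<open>torus_deriv\<close>.\<close>
  have K: "of_real (kernel \<beta> n d t x y) = of_real A * exp (- (\<Sum>k\<in>{1..d}. of_real (1 / ou_var \<beta> k t) * (?u k x * cnj (?u k x))))" for x
  proof -
    have "kernel \<beta> n d t x y = A * exp (\<Sum>k\<in>{1..d}. - (norm (?u k x))\<^sup>2 / ou_var \<beta> k t)"
      unfolding kernel_def A_def gauss_dens_def resid_def by (simp add: exp_sum prod.distrib[symmetric])
    also have "complex_of_real \<dots> = of_real A * exp (\<Sum>k\<in>{1..d}. - (of_real ((norm (?u k x))\<^sup>2) / of_real (ou_var \<beta> k t)))"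
      by (simp add: exp_of_real[symmetric])
    also have "(\<Sum>k\<in>{1..d}. - (complex_of_real ((norm (?u k x))\<^sup>2) / of_real (ou_var \<beta> k t)))
        = - (\<Sum>k\<in>{1..d}. of_real (1 / ou_var \<beta> k t) * (?u k x * cnj (?u k x)))"
      unfolding complex_norm_square sum_negf[symmetric] by (intro sum.cong) auto
    finally show ?thesis .
  qed
  have "torus_deriv n (\<lambda>x. of_real A * exp (- (\<Sum>k\<in>{1..d}. of_real (1 / ou_var \<beta> k t) * (?u k x * cnj (?u k x)))))
     (\<lambda>j x. of_real A * ((- (\<Sum>k\<in>{1..d}. of_real (1 / ou_var \<beta> k t) *
         (?u k x * cnj (- (\<i> * of_real (ou_mean \<beta> k t) * of_nat k * cis (x j) ^ k))
           + (- (\<i> * of_real (ou_mean \<beta> k t) * of_nat k * cis (x j) ^ k)) * cnj (?u k x))))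
       * exp (- (\<Sum>k\<in>{1..d}. of_real (1 / ou_var \<beta> k t) * (?u k x * cnj (?u k x))))))"
    by (intro torus_deriv_cmult torus_deriv_exp torus_deriv_uminus torus_deriv_sum torus_deriv_mult torus_deriv_cnj torus_deriv_resid)
  then have "torus_deriv n (\<lambda>x. of_real (kernel \<beta> n d t x y))
     (\<lambda>j x. of_real A * ((- (\<Sum>k\<in>{1..d}. of_real (1 / ou_var \<beta> k t) *
         (?u k x * cnj (- (\<i> * of_real (ou_mean \<beta> k t) * of_nat k * cis (x j) ^ k))
           + (- (\<i> * of_real (ou_mean \<beta> k t) * of_nat k * cis (x j) ^ k)) * cnj (?u k x))))
       * exp (- (\<Sum>k\<in>{1..d}. of_real (1 / ou_var \<beta> k t) * (?u k x * cnj (?u k x))))))"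
    unfolding K .
  then show ?thesis
  proof (rule torus_deriv_cong)
    fix j x
    have "- (\<Sum>k\<in>{1..d}. of_real (1 / ou_var \<beta> k t) *
         (?u k x * cnj (- (\<i> * of_real (ou_mean \<beta> k t) * of_nat k * cis (x j) ^ k))
           + (- (\<i> * of_real (ou_mean \<beta> k t) * of_nat k * cis (x j) ^ k)) * cnj (?u k x)))
      = \<i> * (\<Sum>l\<in>{1..d}. of_real (ou_rate \<beta> l t) * (cis (x j) ^ l * cnj (?u l x) - cnj (cis (x j) ^ l) * ?u l x))"
      unfolding sum_distrib_left sum_negf[symmetric]
      by (intro sum.cong refl) (simp add: ou_rate_def algebra_simps)
    then show "of_real A * ((- (\<Sum>k\<in>{1..d}. of_real (1 / ou_var \<beta> k t) *
         (?u k x * cnj (- (\<i> * of_real (ou_mean \<beta> k t) * of_nat k * cis (x j) ^ k))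
           + (- (\<i> * of_real (ou_mean \<beta> k t) * of_nat k * cis (x j) ^ k)) * cnj (?u k x))))
       * exp (- (\<Sum>k\<in>{1..d}. of_real (1 / ou_var \<beta> k t) * (?u k x * cnj (?u k x)))))
      = of_real (kernel \<beta> n d t x y) * (\<i> * (\<Sum>l\<in>{1..d}. of_real (ou_rate \<beta> l t) *
        (cis (x j) ^ l * cnj (?u l x) - cnj (cis (x j) ^ l) * ?u l x)))"
      unfolding K by (simp only: mult_ac)
  qed
qed

lemma bdd_meas_resid: "bdd_meas n (\<lambda>x. resid \<beta> n k t x y)" by (rule torus_deriv_imp_bounded[OF torus_deriv_resid])

lemma bdd_meas_kernel: "\<beta> > 0 \<Longrightarrow> t > 0 \<Longrightarrow> bdd_meas n (\<lambda>x. of_real (kernel \<beta> n d t x y))"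
  by (rule torus_deriv_imp_bounded[OF torus_deriv_kernel])

lemma bdd_meas_psum_diff: "bdd_meas n (psum_diff n k l)"
  unfolding psum_diff_def[abs_def] by (intro bdd_meas_intros)

lemma bdd_meas_drift_rest: "bdd_meas n (drift_rest \<beta> n k)"
  unfolding drift_rest_def[abs_def] by (intro bdd_meas_intros)

lemma bdd_meas_stein_err: "bdd_meas n (\<lambda>x. stein_err \<beta> n d t x y)"
proof -
  have "bdd_meas n (\<lambda>x. if l = k then 0 else resid \<beta> n l t x y * psum_diff n k l x)" for k l
    by (cases "l = k") (auto intro!: bdd_meas_mult bdd_meas_const bdd_meas_resid bdd_meas_psum_diff)
  then show ?thesis
    unfolding stein_err_def by (intro bdd_meas_intros bdd_meas_resid bdd_meas_psum_diff bdd_meas_drift_rest)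
qed

text \<open>Schwinger-Dyson for the test function \<open>kernel * cnj (resid k)\<close>. The
  derivative of the residual yields the constant term because \<open>cis (x j) ^ k\<close> has
  modulus one; the derivative of the kernel yields the sum over \<open>l\<close>.\<close>

lemma kernel_schwinger_dyson:
  fixes \<beta> t :: real and n d k :: nat and y :: "nat \<Rightarrow> complex"
  assumes b: "\<beta> > 0" and t: "t > 0" and k: "k \<ge> 1"
  defines "u \<equiv> \<lambda>l x. resid \<beta> n l t x y" and "K \<equiv> \<lambda>x. complex_of_real (kernel \<beta> n d t x y)"
  shows "(\<integral>x. K x * (cnj (u k x) * drift \<beta> n k x + of_real (ou_mean \<beta> k t * real k * real n)
     + cnj (u k x) * (\<Sum>l\<in>{1..d}. of_real (ou_rate \<beta> l t) * (cnj (u l x) * psum n (k + l) x - u l x * psum_diff n k l x))) \<partial>cbe \<beta> n) = 0"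
proof -
  define F where "F = (\<lambda>x. of_real (ou_mean \<beta> k t * real k * real n)
     + cnj (u k x) * (\<Sum>l\<in>{1..d}. of_real (ou_rate \<beta> l t) * (cnj (u l x) * psum n (k + l) x - u l x * psum_diff n k l x)))"
  have bu: "bdd_meas n (u l)" for l unfolding u_def by (rule bdd_meas_resid)
  have bK: "bdd_meas n K" unfolding K_def by (rule bdd_meas_kernel[OF b t])
  have bF: "bdd_meas n F" unfolding F_def by (intro bdd_meas_intros bu bdd_meas_psum_diff)
  have "torus_deriv n (\<lambda>x. K x * cnj (u k x)) (\<lambda>j x. K x * cnj (- (\<i> * of_real (ou_mean \<beta> k t) * of_nat k * cis (x j) ^ k))
     + K x * (\<i> * (\<Sum>l\<in>{1..d}. of_real (ou_rate \<beta> l t) * (cis (x j) ^ l * cnj (u l x) - cnj (cis (x j) ^ l) * u l x))) * cnj (u k x))"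
    unfolding K_def u_def by (intro torus_deriv_mult torus_deriv_cnj torus_deriv_resid torus_deriv_kernel b t)
  from schwinger_dyson_cbe[OF b k this]
  have "(\<integral>x. K x * cnj (u k x) * drift \<beta> n k x \<partial>cbe \<beta> n)
     = \<i> * (\<integral>x. (\<Sum>j\<in>{1..n}. cis (x j) ^ k * (K x * cnj (- (\<i> * of_real (ou_mean \<beta> k t) * of_nat k * cis (x j) ^ k))
     + K x * (\<i> * (\<Sum>l\<in>{1..d}. of_real (ou_rate \<beta> l t) * (cis (x j) ^ l * cnj (u l x) - cnj (cis (x j) ^ l) * u l x))) * cnj (u k x))) \<partial>cbe \<beta> n)" .
  also have "\<dots> = \<i> * (\<integral>x. \<i> * (K x * F x) \<partial>cbe \<beta> n)"
  proof (intro arg_cong2[where f = times] refl Bochner_Integration.integral_cong)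
    fix x
    note c = cis_power_cnj
    have "cis (x j) ^ k * (K x * cnj (- (\<i> * of_real (ou_mean \<beta> k t) * of_nat k * cis (x j) ^ k))
       + K x * (\<i> * (\<Sum>l\<in>{1..d}. of_real (ou_rate \<beta> l t) * (cis (x j) ^ l * cnj (u l x) - cnj (cis (x j) ^ l) * u l x))) * cnj (u k x))
      = \<i> * K x * (of_real (ou_mean \<beta> k t * real k)) * (cis (x j) ^ k * cnj (cis (x j) ^ k))
       + \<i> * K x * cnj (u k x) * (cis (x j) ^ k * (\<Sum>l\<in>{1..d}. of_real (ou_rate \<beta> l t) * (cis (x j) ^ l * cnj (u l x) - cnj (cis (x j) ^ l) * u l x)))" for j
      by (simp add: algebra_simps)
    also have "\<dots> j = \<i> * K x * (of_real (ou_mean \<beta> k t * real k))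
       + \<i> * K x * cnj (u k x) * (\<Sum>l\<in>{1..d}. of_real (ou_rate \<beta> l t) * (cnj (u l x) * cis (x j) ^ (k + l) - u l x * (cis (x j) ^ k * cnj (cis (x j) ^ l))))" for j
      unfolding c sum_distrib_left[of "cis (x j) ^ k"] by (simp add: algebra_simps power_add)
    finally have e: "cis (x j) ^ k * (K x * cnj (- (\<i> * of_real (ou_mean \<beta> k t) * of_nat k * cis (x j) ^ k))
       + K x * (\<i> * (\<Sum>l\<in>{1..d}. of_real (ou_rate \<beta> l t) * (cis (x j) ^ l * cnj (u l x) - cnj (cis (x j) ^ l) * u l x))) * cnj (u k x))
      = \<i> * K x * (of_real (ou_mean \<beta> k t * real k))
       + \<i> * K x * cnj (u k x) * (\<Sum>l\<in>{1..d}. of_real (ou_rate \<beta> l t) * (cnj (u l x) * cis (x j) ^ (k + l) - u l x * (cis (x j) ^ k * cnj (cis (x j) ^ l))))" for j .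
    have "(\<Sum>j\<in>{1..n}. \<Sum>l\<in>{1..d}. of_real (ou_rate \<beta> l t) * (cnj (u l x) * cis (x j) ^ (k + l) - u l x * (cis (x j) ^ k * cnj (cis (x j) ^ l))))
       = (\<Sum>l\<in>{1..d}. of_real (ou_rate \<beta> l t) * (cnj (u l x) * psum n (k + l) x - u l x * psum_diff n k l x))"
      unfolding psum_def psum_diff_def
      by (subst sum.swap) (simp add: sum_distrib_left sum_subtractf right_diff_distrib)
    then show "(\<Sum>j\<in>{1..n}. cis (x j) ^ k * (K x * cnj (- (\<i> * of_real (ou_mean \<beta> k t) * of_nat k * cis (x j) ^ k))
     + K x * (\<i> * (\<Sum>l\<in>{1..d}. of_real (ou_rate \<beta> l t) * (cis (x j) ^ l * cnj (u l x) - cnj (cis (x j) ^ l) * u l x))) * cnj (u k x)))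
      = \<i> * (K x * F x)"
      unfolding e sum.distrib sum_distrib_left[symmetric] F_def by (simp add: algebra_simps)
  qed
  also have "\<dots> = - (\<integral>x. K x * F x \<partial>cbe \<beta> n)"
    by (simp only: integral_mult_right_zero) (simp add: mult.assoc[symmetric])
  finally have "(\<integral>x. K x * cnj (u k x) * drift \<beta> n k x \<partial>cbe \<beta> n) + (\<integral>x. K x * F x \<partial>cbe \<beta> n) = 0" by simp
  then have "(\<integral>x. K x * cnj (u k x) * drift \<beta> n k x + K x * F x \<partial>cbe \<beta> n) = 0"
    by (subst Bochner_Integration.integral_add) (intro bdd_meas_integrable[OF b] bdd_meas_intros bK bF bu bdd_meas_drift | simp)+
  then show ?thesis unfolding F_def by (simp add: algebra_simps)
qed

text \<open>\<open>kernel_schwinger_dyson\<close> is multiplied by \<open>2 * ou_rate / n\<close>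
  and summed over \<open>k\<close>. Its leading drift then matches the first term of
  \<open>kernel_dot\<close>, its diagonal \<open>l = k\<close> the quadratic term, and its constant
  the last term. What remains carries the factor \<open>2 / n\<close> and is
  \<open>stein_err\<close>.\<close>

theorem stein_identity_kernel:
  assumes b: "\<beta> > 0" and t: "t > 0" and n: "n \<ge> 1"
  shows "(\<integral>x. kernel \<beta> n d t x y * kernel_dot \<beta> n d t x y \<partial>cbe \<beta> n)
     = (\<integral>x. kernel \<beta> n d t x y * (2 / real n * Re (stein_err \<beta> n d t x y)) \<partial>cbe \<beta> n)"
    and "integrable (cbe \<beta> n) (\<lambda>x. kernel \<beta> n d t x y * (2 / real n * Re (stein_err \<beta> n d t x y)))"
proof -
  define u where "u = (\<lambda>l x. resid \<beta> n l t x y)"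
  define K where "K = (\<lambda>x. complex_of_real (kernel \<beta> n d t x y))"
  define X where "X = (\<lambda>k x. K x * (cnj (u k x) * drift \<beta> n k x + of_real (ou_mean \<beta> k t * real k * real n)
     + cnj (u k x) * (\<Sum>l\<in>{1..d}. of_real (ou_rate \<beta> l t) * (cnj (u l x) * psum n (k + l) x - u l x * psum_diff n k l x))))"
  have bu: "bdd_meas n (u l)" for l unfolding u_def by (rule bdd_meas_resid)
  have bK: "bdd_meas n K" unfolding K_def by (rule bdd_meas_kernel[OF b t])
  have bX: "bdd_meas n (X k)" for k unfolding X_def by (intro bdd_meas_intros bK bu bdd_meas_drift bdd_meas_psum_diff)
  have X0: "(\<integral>x. X k x \<partial>cbe \<beta> n) = 0" if "k \<in> {1..d}" for k
    unfolding X_def u_def K_def using that by (intro kernel_schwinger_dyson b t) auto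
  have bE: "bdd_meas n (\<lambda>x. K x * stein_err \<beta> n d t x y)" by (intro bdd_meas_mult bK bdd_meas_stein_err)
  have KE: "kernel \<beta> n d t x y * (2 / real n * Re (stein_err \<beta> n d t x y)) = 2 / real n * Re (K x * stein_err \<beta> n d t x y)" for x
    by (simp add: K_def)
  show iE: "integrable (cbe \<beta> n) (\<lambda>x. kernel \<beta> n d t x y * (2 / real n * Re (stein_err \<beta> n d t x y)))"
    unfolding KE using bdd_meas_integrable[OF b bE] by (intro integrable_mult_right integrable_Re)
  have pt: "kernel \<beta> n d t x y * kernel_dot \<beta> n d t x y = kernel \<beta> n d t x y * (2 / real n * Re (stein_err \<beta> n d t x y))
      - (\<Sum>k\<in>{1..d}. 2 * ou_rate \<beta> k t / real n * Re (X k x))" for x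
  proof -
    define \<kappa> where "\<kappa> = kernel \<beta> n d t x y"
    define S where "S = (\<lambda>k. \<Sum>l\<in>{1..d}. of_real (ou_rate \<beta> l t) * (cnj (u l x) * psum n (k + l) x - (if l = k then 0 else u l x * psum_diff n k l x)))"
    \<comment> \<open>The summand \<open>l = k\<close> is split off with
      \<open>psum_diff n k k x = n\<close>.\<close>
    have S: "(\<Sum>l\<in>{1..d}. of_real (ou_rate \<beta> l t) * (cnj (u l x) * psum n (k + l) x - u l x * psum_diff n k l x))
        = S k - of_real (ou_rate \<beta> k t) * u k x * of_nat n" if "k \<in> {1..d}" for k
    proof -
      have "(\<Sum>l\<in>{1..d}. of_real (ou_rate \<beta> l t) * (cnj (u l x) * psum n (k + l) x - u l x * psum_diff n k l x))
         = (\<Sum>l\<in>{1..d}. of_real (ou_rate \<beta> l t) * (cnj (u l x) * psum n (k + l) x - (if l = k then 0 else u l x * psum_diff n k l x))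
             - (if l = k then of_real (ou_rate \<beta> k t) * u k x * of_nat n else 0))"
        by (intro sum.cong refl) (auto simp: psum_diff_self algebra_simps)
      also have "\<dots> = S k - of_real (ou_rate \<beta> k t) * u k x * of_nat n"
        unfolding sum_subtractf S_def using that by simp
      finally show ?thesis .
    qed
    have uu: "cnj (u k x) * u k x = of_real ((norm (u k x))\<^sup>2)" for k
      unfolding complex_norm_square by (simp add: mult.commute)
    have summand: "\<kappa> * (- \<beta> * ou_rate \<beta> k t * Re (cnj (u k x) * psum n k x)
      + 2 * (ou_rate \<beta> k t)\<^sup>2 * (norm (u k x))\<^sup>2 - 2 * ou_rate \<beta> k t * ou_mean \<beta> k t * real k)
      = \<kappa> * (2 / real n * Re (of_real (ou_rate \<beta> k t) * cnj (u k x) * (S k + drift_rest \<beta> n k x)))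
        - 2 * ou_rate \<beta> k t / real n * Re (X k x)" if k: "k \<in> {1..d}" for k
    proof -
      define g where "g = ou_rate \<beta> k t"
      have "Re (X k x) = \<kappa> * (real n * \<beta> / 2 * Re (cnj (u k x) * psum n k x) + Re (cnj (u k x) * drift_rest \<beta> n k x)
         + ou_mean \<beta> k t * real k * real n + Re (cnj (u k x) * S k) - g * (norm (u k x))\<^sup>2 * real n)"
      proof -
        have "X k x = of_real \<kappa> * (of_real (real n * \<beta> / 2) * (cnj (u k x) * psum n k x) + cnj (u k x) * drift_rest \<beta> n k x
           + of_real (ou_mean \<beta> k t * real k * real n) + cnj (u k x) * S k - of_real (g * real n) * (cnj (u k x) * u k x))"
          unfolding X_def S[OF k] drift_eq K_def \<kappa>_def[symmetric] g_def[symmetric] by (simp add: algebra_simps)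
        then show ?thesis unfolding uu by simp
      qed
      moreover have "Re (of_real g * cnj (u k x) * (S k + drift_rest \<beta> n k x)) = g * (Re (cnj (u k x) * S k) + Re (cnj (u k x) * drift_rest \<beta> n k x))"
        by (simp add: algebra_simps)
      ultimately show ?thesis
        unfolding g_def[symmetric] using n by (simp only:) (simp add: field_simps power2_eq_square)
    qed
    have "\<kappa> * kernel_dot \<beta> n d t x y = (\<Sum>k\<in>{1..d}. \<kappa> * (2 / real n * Re (of_real (ou_rate \<beta> k t) * cnj (u k x) * (S k + drift_rest \<beta> n k x)))
        - 2 * ou_rate \<beta> k t / real n * Re (X k x))"
      unfolding kernel_dot_def sum_distrib_left u_def[symmetric] by (intro sum.cong refl) (use summand in \<open>simp add: u_def\<close>)
    also have "\<dots> = \<kappa> * (2 / real n * Re (stein_err \<beta> n d t x y)) - (\<Sum>k\<in>{1..d}. 2 * ou_rate \<beta> k t / real n * Re (X k x))"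
      unfolding stein_err_def sum_subtractf Re_sum sum_distrib_left S_def u_def ..
    finally show ?thesis by (simp add: \<kappa>_def)
  qed
  have "(\<integral>x. (\<Sum>k\<in>{1..d}. 2 * ou_rate \<beta> k t / real n * Re (X k x)) \<partial>cbe \<beta> n)
      = (\<Sum>k\<in>{1..d}. 2 * ou_rate \<beta> k t / real n * Re (\<integral>x. X k x \<partial>cbe \<beta> n))"
    using bdd_meas_integrable[OF b bX] by (subst Bochner_Integration.integral_sum) auto
  also have "\<dots> = 0" using X0 by simp
  finally have z: "(\<integral>x. (\<Sum>k\<in>{1..d}. 2 * ou_rate \<beta> k t / real n * Re (X k x)) \<partial>cbe \<beta> n) = 0" .
  show "(\<integral>x. kernel \<beta> n d t x y * kernel_dot \<beta> n d t x y \<partial>cbe \<beta> n)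
     = (\<integral>x. kernel \<beta> n d t x y * (2 / real n * Re (stein_err \<beta> n d t x y)) \<partial>cbe \<beta> n)"
    unfolding pt
    by (subst Bochner_Integration.integral_diff[OF iE])
       (use z bdd_meas_integrable[OF b bX] in \<open>auto intro!: Bochner_Integration.integrable_sum integrable_mult_right\<close>)
qed

definition ou_vec :: "real \<Rightarrow> nat \<Rightarrow> nat \<Rightarrow> real \<Rightarrow> (nat \<Rightarrow> real) \<Rightarrow> (nat \<Rightarrow> complex) \<Rightarrow> (nat \<Rightarrow> complex)" where
  "ou_vec \<beta> n d t x g = (\<lambda>k\<in>{1..d}. of_real (ou_mean \<beta> k t) * psum n k x + of_real (sqrt (ou_var \<beta> k t)) * g k)"

section \<open>Joint measurability, and passing between the density and the noise\<close>

lemma psum_measurable [measurable]: "psum n k \<in> borel_measurable (PiM {1..n} (\<lambda>_. borel))"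
  using bdd_meas_psum[of n k] by (simp add: bdd_meas_def)

lemma ou_mean_measurable [measurable]: "ou_mean \<beta> k \<in> borel_measurable borel"
  unfolding ou_mean_def[abs_def] by measurable

lemma ou_var_measurable [measurable]: "ou_var \<beta> k \<in> borel_measurable borel"
  unfolding ou_var_def[abs_def] by measurable

lemma ou_rate_measurable [measurable]: "ou_rate \<beta> k \<in> borel_measurable borel"
  unfolding ou_rate_def[abs_def] by measurable

lemma psum_diff_measurable [measurable]: "psum_diff n k l \<in> borel_measurable (PiM {1..n} (\<lambda>_. borel))"
  using bdd_meas_psum_diff[of n k l] by (simp add: bdd_meas_def)

lemma drift_rest_measurable [measurable]: "drift_rest \<beta> n k \<in> borel_measurable (PiM {1..n} (\<lambda>_. borel))"
  using bdd_meas_drift_rest[of n \<beta> k] by (simp add: bdd_meas_def)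

lemma resid_measurable_pair [measurable]:
  assumes [measurable]: "\<sigma> \<in> borel_measurable M" "\<xi> \<in> measurable M (PiM {1..n} (\<lambda>_. borel))" "\<eta> \<in> measurable M (PiM {1..d} (\<lambda>_. borel))"
    and "k \<in> {1..d}"
  shows "(\<lambda>w. resid \<beta> n k (\<sigma> w) (\<xi> w) (\<eta> w)) \<in> borel_measurable M"
proof -
  have [measurable]: "(\<lambda>w. \<eta> w k) \<in> borel_measurable M"
    using measurable_compose[OF assms(3) measurable_component_singleton[OF assms(4)]] .
  show ?thesis unfolding resid_def by measurable
qed

lemma kernel_measurable_pair [measurable]:
  assumes [measurable]: "\<sigma> \<in> borel_measurable M" "\<xi> \<in> measurable M (PiM {1..n} (\<lambda>_. borel))" "\<eta> \<in> measurable M (PiM {1..d} (\<lambda>_. borel))"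
  shows "(\<lambda>w. kernel \<beta> n d (\<sigma> w) (\<xi> w) (\<eta> w)) \<in> borel_measurable M"
proof -
  have "(\<lambda>w. gauss_dens (ou_var \<beta> k (\<sigma> w)) (of_real (ou_mean \<beta> k (\<sigma> w)) * psum n k (\<xi> w)) (\<eta> w k)) \<in> borel_measurable M"
    if "k \<in> {1..d}" for k
  proof -
    have [measurable]: "(\<lambda>w. \<eta> w k) \<in> borel_measurable M"
      using measurable_compose[OF assms(3) measurable_component_singleton[OF that]] .
    show ?thesis unfolding gauss_dens_def by measurable
  qed
  then show ?thesis unfolding kernel_def by (intro borel_measurable_prod)
qed

lemma kernel_dot_measurable_pair [measurable]:
  assumes [measurable]: "\<sigma> \<in> borel_measurable M" "\<xi> \<in> measurable M (PiM {1..n} (\<lambda>_. borel))" "\<eta> \<in> measurable M (PiM {1..d} (\<lambda>_. borel))"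
  shows "(\<lambda>w. kernel_dot \<beta> n d (\<sigma> w) (\<xi> w) (\<eta> w)) \<in> borel_measurable M"
  unfolding kernel_dot_def by measurable

lemma stein_err_measurable_pair [measurable]:
  assumes [measurable]: "\<sigma> \<in> borel_measurable M" "\<xi> \<in> measurable M (PiM {1..n} (\<lambda>_. borel))" "\<eta> \<in> measurable M (PiM {1..d} (\<lambda>_. borel))"
  shows "(\<lambda>w. stein_err \<beta> n d (\<sigma> w) (\<xi> w) (\<eta> w)) \<in> borel_measurable M"
  unfolding stein_err_def by measurable

lemma kernel_nonneg: "\<beta> > 0 \<Longrightarrow> t > 0 \<Longrightarrow> kernel \<beta> n d t x y \<ge> 0"
  unfolding kernel_def by (intro prod_nonneg gauss_dens_nonneg ou_var_pos) auto

lemma ou_vec_measurable: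
  "ou_vec \<beta> n d t x \<in> measurable (gauss_vec d) (PiM {1..d} (\<lambda>_. borel))"
  unfolding ou_vec_def by measurable

lemma ou_vec_distr:
  assumes "\<beta> > 0" "t > 0"
  shows "distr (gauss_vec d) (PiM {1..d} (\<lambda>_. borel)) (ou_vec \<beta> n d t x) = density (vec_lebesgue d) (\<lambda>y. ennreal (kernel \<beta> n d t x y))"
  unfolding ou_vec_def[abs_def] kernel_def using ou_var_pos[OF assms(1) _ assms(2)]
  by (intro gauss_vec_affine) auto

lemma kernel_section_measurable [measurable]: "kernel \<beta> n d t x \<in> borel_measurable (PiM {1..d} (\<lambda>_. borel))"
  unfolding kernel_def[abs_def] gauss_dens_def by measurable

lemma
  fixes h :: "(nat \<Rightarrow> complex) \<Rightarrow> real"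
  assumes b: "\<beta> > 0" and t: "t > 0" and h[measurable]: "h \<in> borel_measurable (PiM {1..d} (\<lambda>_. borel))"
  shows integral_kernel: "(\<integral>y. kernel \<beta> n d t x y * h y \<partial>vec_lebesgue d) = (\<integral>g. h (ou_vec \<beta> n d t x g) \<partial>gauss_vec d)"
    and integrable_kernel: "integrable (vec_lebesgue d) (\<lambda>y. kernel \<beta> n d t x y * h y) \<longleftrightarrow> integrable (gauss_vec d) (\<lambda>g. h (ou_vec \<beta> n d t x g))"
proof -
  have nn: "AE y in vec_lebesgue d. 0 \<le> kernel \<beta> n d t x y" using kernel_nonneg[OF b t] by simp
  have hm: "h \<in> borel_measurable (vec_lebesgue d)" by measurable
  have km: "kernel \<beta> n d t x \<in> borel_measurable (vec_lebesgue d)" by measurable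
  have "(\<integral>y. kernel \<beta> n d t x y * h y \<partial>vec_lebesgue d) = (\<integral>y. h y \<partial>density (vec_lebesgue d) (\<lambda>y. ennreal (kernel \<beta> n d t x y)))"
    using integral_density[OF hm km nn] by simp
  also have "\<dots> = (\<integral>g. h (ou_vec \<beta> n d t x g) \<partial>gauss_vec d)"
    unfolding ou_vec_distr[OF b t, symmetric] by (rule integral_distr[OF ou_vec_measurable h])
  finally show "(\<integral>y. kernel \<beta> n d t x y * h y \<partial>vec_lebesgue d) = (\<integral>g. h (ou_vec \<beta> n d t x g) \<partial>gauss_vec d)" .
  have "integrable (vec_lebesgue d) (\<lambda>y. kernel \<beta> n d t x y * h y) \<longleftrightarrow> integrable (density (vec_lebesgue d) (\<lambda>y. ennreal (kernel \<beta> n d t x y))) h"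
    using integrable_density[OF hm km nn] by simp
  also have "\<dots> \<longleftrightarrow> integrable (gauss_vec d) (\<lambda>g. h (ou_vec \<beta> n d t x g))"
    unfolding ou_vec_distr[OF b t, symmetric] by (rule integrable_distr_eq[OF ou_vec_measurable h])
  finally show "integrable (vec_lebesgue d) (\<lambda>y. kernel \<beta> n d t x y * h y) \<longleftrightarrow> integrable (gauss_vec d) (\<lambda>g. h (ou_vec \<beta> n d t x g))" .
qed

text \<open>By Tonelli it is enough that the Gaussian integrals of \<open>H\<close> are bounded
  uniformly over the parameter \<open>w\<close>. The parameter space is abstract because it is used
  both for the angles alone and for time together with the angles.\<close>

lemma kernel_pair_integrable:
  fixes H :: "'a \<times> (nat \<Rightarrow> complex) \<Rightarrow> real"
  assumes b: "\<beta> > 0" and N: "finite_measure N"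
    and \<sigma>[measurable]: "\<sigma> \<in> borel_measurable N" and \<sigma>0: "\<And>w. \<sigma> w > 0"
    and \<xi>[measurable]: "\<xi> \<in> measurable N (PiM {1..n} (\<lambda>_. borel))"
    and H[measurable]: "H \<in> borel_measurable (N \<Otimes>\<^sub>M vec_lebesgue d)"
    and bd: "\<And>w. w \<in> space N \<Longrightarrow> integrable (gauss_vec d) (\<lambda>g. H (w, ou_vec \<beta> n d (\<sigma> w) (\<xi> w) g))"
      "\<And>w. w \<in> space N \<Longrightarrow> (\<integral>g. \<bar>H (w, ou_vec \<beta> n d (\<sigma> w) (\<xi> w) g)\<bar> \<partial>gauss_vec d) \<le> D"
  shows "integrable (N \<Otimes>\<^sub>M vec_lebesgue d) (\<lambda>(w, y). kernel \<beta> n d (\<sigma> w) (\<xi> w) y * H (w, y))"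
proof -
  interpret N: finite_measure N by fact
  interpret L: sigma_finite_measure "vec_lebesgue d" by (rule sigma_finite_vec_lebesgue)
  interpret P: pair_sigma_finite N "vec_lebesgue d" ..
  have m[measurable]: "(\<lambda>(w, y). kernel \<beta> n d (\<sigma> w) (\<xi> w) y * H (w, y)) \<in> borel_measurable (N \<Otimes>\<^sub>M vec_lebesgue d)"
    unfolding case_prod_beta' by measurable
  have Hs: "(\<lambda>y. H (w, y)) \<in> borel_measurable (PiM {1..d} (\<lambda>_. borel))" if "w \<in> space N" for w
  proof -
    have "(\<lambda>y. H (w, y)) \<in> borel_measurable (vec_lebesgue d)" using that by measurable
    then show ?thesis using measurable_cong_sets[OF sets_vec_lebesgue refl] by blast
  qed
  show ?thesis
  proof (rule P.Fubini_integrable[OF m])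
    have eq: "(\<integral>y. norm (case (w, y) of (w, y) \<Rightarrow> kernel \<beta> n d (\<sigma> w) (\<xi> w) y * H (w, y)) \<partial>vec_lebesgue d)
        = (\<integral>g. \<bar>H (w, ou_vec \<beta> n d (\<sigma> w) (\<xi> w) g)\<bar> \<partial>gauss_vec d)" if "w \<in> space N" for w
    proof -
      have [measurable]: "(\<lambda>y. H (w, y)) \<in> borel_measurable (PiM {1..d} (\<lambda>_. borel))" by (rule Hs[OF that])
      have "(\<lambda>y. \<bar>H (w, y)\<bar>) \<in> borel_measurable (PiM {1..d} (\<lambda>_. borel))" by measurable
      from integral_kernel[OF b \<sigma>0 this, of n w "\<xi> w"] show ?thesis
        using kernel_nonneg[OF b \<sigma>0, of n d] by (simp add: abs_mult)
    qed
    show "integrable N (\<lambda>w. \<integral>y. norm (case (w, y) of (w, y) \<Rightarrow> kernel \<beta> n d (\<sigma> w) (\<xi> w) y * H (w, y)) \<partial>vec_lebesgue d)"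
    proof (rule N.integrable_const_bound[where B = D])
      show "AE w in N. norm (\<integral>y. norm (case (w, y) of (w, y) \<Rightarrow> kernel \<beta> n d (\<sigma> w) (\<xi> w) y * H (w, y)) \<partial>vec_lebesgue d) \<le> D"
      proof (rule AE_I2)
        fix w assume w: "w \<in> space N"
        have "(\<integral>y. norm (case (w, y) of (w, y) \<Rightarrow> kernel \<beta> n d (\<sigma> w) (\<xi> w) y * H (w, y)) \<partial>vec_lebesgue d) \<ge> 0"
          by (intro integral_nonneg_AE) auto
        then show "norm (\<integral>y. norm (case (w, y) of (w, y) \<Rightarrow> kernel \<beta> n d (\<sigma> w) (\<xi> w) y * H (w, y)) \<partial>vec_lebesgue d) \<le> D"
          using bd(2)[OF w] unfolding eq[OF w] by simp
      qed
    qed measurable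
    show "AE w in N. integrable (vec_lebesgue d) (\<lambda>y. case (w, y) of (w, y) \<Rightarrow> kernel \<beta> n d (\<sigma> w) (\<xi> w) y * H (w, y))"
      using integrable_kernel[OF b \<sigma>0 Hs] bd(1) by (intro AE_I2) simp
  qed
qed

text \<open>An integrable majorant for every expression of degree at most two in the noise. It
  serves integrability only, so its growth with \<open>d\<close> is harmless.\<close>

definition gauss_quad :: "nat \<Rightarrow> (nat \<Rightarrow> complex) \<Rightarrow> real" where
  "gauss_quad d g = 1 + (\<Sum>k\<in>{1..d}. norm (g k)) + (\<Sum>k\<in>{1..d}. \<Sum>l\<in>{1..d}. norm (g k) * norm (g l))"

lemma gauss_quad_ge:
  "1 \<le> gauss_quad d g" "k \<in> {1..d} \<Longrightarrow> norm (g k) \<le> gauss_quad d g"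
  "k \<in> {1..d} \<Longrightarrow> l \<in> {1..d} \<Longrightarrow> norm (g k) * norm (g l) \<le> gauss_quad d g"
proof -
  have 0: "0 \<le> (\<Sum>k\<in>{1..d}. norm (g k))" "0 \<le> (\<Sum>k\<in>{1..d}. \<Sum>l\<in>{1..d}. norm (g k) * norm (g l))"
    by (auto intro!: sum_nonneg)
  show "1 \<le> gauss_quad d g" using 0 by (simp add: gauss_quad_def)
  show "norm (g k) \<le> gauss_quad d g" if "k \<in> {1..d}"
  proof -
    have "norm (g k) \<le> (\<Sum>k\<in>{1..d}. norm (g k))" using that by (intro member_le_sum) auto
    then show ?thesis using 0(2) unfolding gauss_quad_def by linarith
  qed
  show "norm (g k) * norm (g l) \<le> gauss_quad d g" if "k \<in> {1..d}" "l \<in> {1..d}"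
  proof -
    have "norm (g k) * norm (g l) \<le> (\<Sum>l\<in>{1..d}. norm (g k) * norm (g l))" using that by (intro member_le_sum) auto
    also have "\<dots> \<le> (\<Sum>k\<in>{1..d}. \<Sum>l\<in>{1..d}. norm (g k) * norm (g l))"
      using that by (intro member_le_sum[of k "{1..d}" "\<lambda>k. \<Sum>l\<in>{1..d}. norm (g k) * norm (g l)"] sum_nonneg) auto
    finally show ?thesis using 0(1) unfolding gauss_quad_def by linarith
  qed
qed

lemma integrable_gauss_quad: "integrable (gauss_vec d) (gauss_quad d)"
proof -
  interpret G: prob_space "gauss_vec d" by (rule prob_space_gauss_vec)
  have "integrable (gauss_vec d) (\<lambda>g. norm (g k) * norm (g l))" if "k \<in> {1..d}" "l \<in> {1..d}" for k l
    using integrable_norm[OF integrable_gauss_vec_product[OF that, of "\<lambda>z. z" "\<lambda>z. z"]] by (simp add: norm_mult)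
  moreover have "integrable (gauss_vec d) (\<lambda>g. norm (g k))" if "k \<in> {1..d}" for k
    by (rule integrable_gauss_vec_component[OF integrable_std_complex_gaussian_moments(1) that])
  ultimately show ?thesis
    unfolding gauss_quad_def[abs_def] by (intro Bochner_Integration.integrable_add Bochner_Integration.integrable_sum G.integrable_const) auto
qed

lemma resid_ou_vec: "k \<in> {1..d} \<Longrightarrow> resid \<beta> n k t x (ou_vec \<beta> n d t x g) = of_real (sqrt (ou_var \<beta> k t)) * g k"
  by (simp add: resid_def ou_vec_def)

lemma ou_mean_le_one: "\<beta> > 0 \<Longrightarrow> t \<ge> 0 \<Longrightarrow> ou_mean \<beta> k t \<le> 1"
  by (simp add: ou_mean_def)

lemma ou_var_le: "\<beta> > 0 \<Longrightarrow> ou_var \<beta> k t \<le> 2 * real k / \<beta>"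
  unfolding ou_var_def by (intro mult_left_le) auto

lemma ou_var_mono:
  assumes "\<beta> > 0" "s \<le> t"
  shows "ou_var \<beta> k s \<le> ou_var \<beta> k t"
proof -
  have "ou_mean \<beta> k t \<le> ou_mean \<beta> k s" unfolding ou_mean_def using assms by (simp add: mult_left_mono)
  then have "(ou_mean \<beta> k t)\<^sup>2 \<le> (ou_mean \<beta> k s)\<^sup>2" using ou_mean_pos[of \<beta> k t] by (intro power_mono) auto
  then show ?thesis unfolding ou_var_def using assms by (intro mult_left_mono) auto
qed

lemma ou_rate_nonneg: "\<beta> > 0 \<Longrightarrow> t > 0 \<Longrightarrow> k \<ge> 1 \<Longrightarrow> ou_rate \<beta> k t \<ge> 0"
  unfolding ou_rate_def using ou_mean_pos[of \<beta> k t] ou_var_pos[of \<beta> k t] by auto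

lemma ou_rate_le:
  assumes "\<beta> > 0" "0 < s" "s \<le> t" "k \<ge> 1"
  shows "ou_rate \<beta> k t \<le> real k / ou_var \<beta> k s"
proof -
  have "ou_mean \<beta> k t * real k \<le> 1 * real k" using ou_mean_le_one[of \<beta> t k] assms by (intro mult_right_mono) auto
  then show ?thesis unfolding ou_rate_def using ou_var_pos[of \<beta> k s] ou_var_mono[of \<beta> s t k] assms
    by (intro frac_le) auto
qed

text \<open>The bound is uniform in all times from \<open>s\<close> on, in the angles and in the
  noise. It justifies Fubini and is not quantitative: \<open>D\<close> depends on \<open>n\<close>,
  \<open>d\<close> and \<open>s\<close>.\<close>

lemma kernel_dot_bound:
  assumes b: "\<beta> > 0" and s: "s > 0"
  obtains D where "D \<ge> 0" "\<And>t x g. s \<le> t \<Longrightarrow> \<bar>kernel_dot \<beta> n d t x (ou_vec \<beta> n d t x g)\<bar> \<le> D * gauss_quad d g"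
proof -
  define R where "R = (\<lambda>k. real k / ou_var \<beta> k s)"
  define V where "V = (\<lambda>k. 2 * real k / \<beta>)"
  define D where "D = (\<Sum>k\<in>{1..d}. \<beta> * R k * sqrt (V k) * real n + 2 * (R k)\<^sup>2 * V k + 2 * R k * real k)"
  have R0: "R k \<ge> 0" if "k \<in> {1..d}" for k using ou_var_pos[OF b _ s, of k] that by (simp add: R_def)
  have V0: "V k \<ge> 0" for k using b by (simp add: V_def)
  have "\<bar>kernel_dot \<beta> n d t x (ou_vec \<beta> n d t x g)\<bar> \<le> D * gauss_quad d g" if st: "s \<le> t" for t x g
  proof -
    have "\<bar>kernel_dot \<beta> n d t x (ou_vec \<beta> n d t x g)\<bar> \<le> (\<Sum>k\<in>{1..d}. (\<beta> * R k * sqrt (V k) * real n + 2 * (R k)\<^sup>2 * V k + 2 * R k * real k) * gauss_quad d g)"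
      unfolding kernel_dot_def
    proof (rule order_trans[OF sum_abs], rule sum_mono)
      fix k assume k: "k \<in> {1..d}"
      have tri: "\<bar>a + b - c\<bar> \<le> a' + b' + c'" if "\<bar>a\<bar> \<le> a'" "\<bar>b\<bar> \<le> b'" "\<bar>c\<bar> \<le> c'" for a b c a' b' c' :: real
        using that by linarith
      define r where "r = ou_rate \<beta> k t"
      define v where "v = ou_var \<beta> k t"
      define q where "q = gauss_quad d g"
      have r: "0 \<le> r" "r \<le> R k" using ou_rate_nonneg[OF b] ou_rate_le[OF b s st] s st k by (auto simp: r_def R_def)
      have v: "0 < v" "v \<le> V k" using ou_var_pos[OF b] ou_var_le[OF b] s st k by (auto simp: v_def V_def)
      have q: "1 \<le> q" "norm (g k) \<le> q" "(norm (g k))\<^sup>2 \<le> q"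
        using gauss_quad_ge(1)[of d g] gauss_quad_ge(2)[OF k, of g] gauss_quad_ge(3)[OF k k, of g] by (auto simp: q_def power2_eq_square)
      have a: "0 \<le> ou_mean \<beta> k t" "ou_mean \<beta> k t \<le> 1" using ou_mean_pos[of \<beta> k t] ou_mean_le_one[OF b, of t k] s st by auto
      let ?u = "resid \<beta> n k t x (ou_vec \<beta> n d t x g)"
      have u: "?u = of_real (sqrt v) * g k" using resid_ou_vec[OF k] by (simp add: v_def)
      have "\<bar>Re (cnj ?u * psum n k x)\<bar> \<le> norm (cnj ?u * psum n k x)" by (rule abs_Re_le_cmod)
      also have "\<dots> = sqrt v * norm (g k) * norm (psum n k x)" unfolding u using v by (simp add: norm_mult)
      also have "\<dots> \<le> sqrt (V k) * q * real n"
        using v q norm_psum_le V0 by (intro mult_mono) auto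
      finally have 1: "\<bar>Re (cnj ?u * psum n k x)\<bar> \<le> sqrt (V k) * q * real n" .
      have "\<bar>- \<beta> * r * Re (cnj ?u * psum n k x)\<bar> = \<beta> * r * \<bar>Re (cnj ?u * psum n k x)\<bar>" using b r by (simp add: abs_mult)
      also have "\<dots> \<le> \<beta> * R k * (sqrt (V k) * q * real n)" using b r 1 R0[OF k] by (intro mult_mono) auto
      finally have A: "\<bar>- \<beta> * r * Re (cnj ?u * psum n k x)\<bar> \<le> \<beta> * R k * sqrt (V k) * real n * q" by (simp add: mult_ac)
      have "(norm ?u)\<^sup>2 = v * (norm (g k))\<^sup>2" unfolding u using v by (simp add: norm_mult power_mult_distrib)
      then have "\<bar>2 * r\<^sup>2 * (norm ?u)\<^sup>2\<bar> = 2 * r\<^sup>2 * (v * (norm (g k))\<^sup>2)" using v by (simp add: abs_mult)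
      also have "\<dots> \<le> 2 * (R k)\<^sup>2 * (V k * q)"
        using r v q V0 R0[OF k] by (intro mult_mono power_mono) auto
      finally have B: "\<bar>2 * r\<^sup>2 * (norm ?u)\<^sup>2\<bar> \<le> 2 * (R k)\<^sup>2 * V k * q" by (simp add: mult_ac)
      have "\<bar>2 * r * ou_mean \<beta> k t * real k\<bar> = 2 * r * ou_mean \<beta> k t * real k" using r a by simp
      also have "\<dots> \<le> 2 * R k * 1 * real k" using r a R0[OF k] by (intro mult_mono) auto
      also have "\<dots> \<le> 2 * R k * real k * q" using mult_left_mono[OF q(1), of "2 * R k * real k"] R0[OF k] by simp
      finally have C: "\<bar>2 * r * ou_mean \<beta> k t * real k\<bar> \<le> 2 * R k * real k * q" .
      show "\<bar>- \<beta> * ou_rate \<beta> k t * Re (cnj ?u * psum n k x) + 2 * (ou_rate \<beta> k t)\<^sup>2 * (norm ?u)\<^sup>2 - 2 * ou_rate \<beta> k t * ou_mean \<beta> k t * real k\<bar>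
         \<le> (\<beta> * R k * sqrt (V k) * real n + 2 * (R k)\<^sup>2 * V k + 2 * R k * real k) * gauss_quad d g"
        unfolding r_def[symmetric] q_def[symmetric] distrib_right by (rule tri[OF A B C])
    qed
    then show ?thesis by (simp add: D_def sum_distrib_right)
  qed
  moreover have "D \<ge> 0" unfolding D_def using R0 V0 b by (intro sum_nonneg add_nonneg_nonneg mult_nonneg_nonneg) auto
  ultimately show ?thesis using that by blast
qed

lemma norm_psum_diff_le: "norm (psum_diff n k l x) \<le> real n"
  unfolding psum_diff_eq using norm_psum_le by auto

text \<open>Again only for integrability, here at one fixed time. The bounds with the right
  dependence on \<open>n\<close> and \<open>d\<close> use the moments of the power sums
  instead.\<close>

lemma stein_err_bound:
  assumes b: "\<beta> > 0" and t: "t > 0"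
  obtains D where "D \<ge> 0" "\<And>x g. norm (stein_err \<beta> n d t x (ou_vec \<beta> n d t x g)) \<le> D * gauss_quad d g"
proof -
  define r where "r = (\<lambda>k. ou_rate \<beta> k t * sqrt (ou_var \<beta> k t))"
  have r0: "r k \<ge> 0" if "k \<in> {1..d}" for k
    using ou_rate_nonneg[OF b t, of k] ou_var_pos[OF b _ t, of k] that by (simp add: r_def)
  have "\<exists>B. \<forall>x. norm (drift_rest \<beta> n k x) \<le> B" for k using bdd_meas_drift_rest[of n \<beta> k] by (auto simp: bdd_meas_def)
  then obtain B where B: "\<And>k x. norm (drift_rest \<beta> n k x) \<le> B k" by metis
  define D where "D = (\<Sum>k\<in>{1..d}. r k * ((\<Sum>l\<in>{1..d}. r l * (2 * real n)) + B k))"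
  have B0: "B k \<ge> 0" for k using B norm_ge_zero order_trans by blast
  have "norm (stein_err \<beta> n d t x (ou_vec \<beta> n d t x g)) \<le> D * gauss_quad d g" for x g
  proof -
    define q where "q = gauss_quad d g"
    let ?u = "\<lambda>k. resid \<beta> n k t x (ou_vec \<beta> n d t x g)"
    have ru: "norm (of_real (ou_rate \<beta> k t) * ?u k) = r k * norm (g k)" if "k \<in> {1..d}" for k
      using resid_ou_vec[OF that, of \<beta> n t x g] ou_rate_nonneg[OF b t, of k] ou_var_pos[OF b _ t, of k] that by (simp add: r_def norm_mult)
    have "norm (stein_err \<beta> n d t x (ou_vec \<beta> n d t x g)) \<le> (\<Sum>k\<in>{1..d}. r k * ((\<Sum>l\<in>{1..d}. r l * (2 * real n)) + B k) * q)"
      unfolding stein_err_def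
    proof (rule sum_norm_le)
      fix k assume k: "k \<in> {1..d}"
      have inner: "norm (of_real (ou_rate \<beta> l t) * (cnj (?u l) * psum n (k + l) x - (if l = k then 0 else ?u l * psum_diff n k l x)))
          \<le> r l * norm (g l) * (2 * real n)" if l: "l \<in> {1..d}" for l
      proof -
        have "norm (cnj (?u l) * psum n (k + l) x - (if l = k then 0 else ?u l * psum_diff n k l x)) \<le> norm (?u l) * real n + norm (?u l) * real n"
          using norm_psum_le[of n "k + l" x] norm_psum_diff_le[of n k l x]
          by (intro order_trans[OF norm_triangle_ineq4] add_mono) (auto simp: norm_mult intro!: mult_left_mono)
        then have "norm (of_real (ou_rate \<beta> l t) :: complex) * norm (cnj (?u l) * psum n (k + l) x - (if l = k then 0 else ?u l * psum_diff n k l x)) \<le> norm (of_real (ou_rate \<beta> l t) :: complex) * (norm (?u l) * real n + norm (?u l) * real n)"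
          by (intro mult_left_mono) auto
        also have "\<dots> = norm (of_real (ou_rate \<beta> l t) * ?u l) * (2 * real n)" by (simp add: norm_mult algebra_simps)
        finally show ?thesis unfolding norm_mult[symmetric] ru[OF l] by (simp add: norm_mult)
      qed
      have "norm ((\<Sum>l\<in>{1..d}. of_real (ou_rate \<beta> l t) * (cnj (?u l) * psum n (k + l) x - (if l = k then 0 else ?u l * psum_diff n k l x))) + drift_rest \<beta> n k x)
          \<le> (\<Sum>l\<in>{1..d}. r l * norm (g l) * (2 * real n)) + B k"
        by (intro order_trans[OF norm_triangle_ineq] add_mono sum_norm_le inner B)
      then have "norm (of_real (ou_rate \<beta> k t) * cnj (?u k) * ((\<Sum>l\<in>{1..d}. of_real (ou_rate \<beta> l t) * (cnj (?u l) * psum n (k + l) x - (if l = k then 0 else ?u l * psum_diff n k l x))) + drift_rest \<beta> n k x))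
          \<le> r k * norm (g k) * ((\<Sum>l\<in>{1..d}. r l * norm (g l) * (2 * real n)) + B k)"
        unfolding norm_mult[of "_ * cnj _"] using ru[OF k] r0[OF k]
        by (intro mult_mono) (auto simp: norm_mult)
      also have "\<dots> = r k * ((\<Sum>l\<in>{1..d}. r l * (2 * real n) * (norm (g k) * norm (g l))) + B k * norm (g k))"
        by (simp add: sum_distrib_left algebra_simps)
      also have "\<dots> \<le> r k * ((\<Sum>l\<in>{1..d}. r l * (2 * real n) * q) + B k * q)"
        unfolding q_def using r0 k gauss_quad_ge B0
        by (intro mult_left_mono add_mono sum_mono) auto
      also have "\<dots> = r k * ((\<Sum>l\<in>{1..d}. r l * (2 * real n)) + B k) * q" by (simp add: sum_distrib_right sum_distrib_left algebra_simps)
      finally show "norm (of_real (ou_rate \<beta> k t) * cnj (?u k) * ((\<Sum>l\<in>{1..d}. of_real (ou_rate \<beta> l t) * (cnj (?u l) * psum n (k + l) x - (if l = k then 0 else ?u l * psum_diff n k l x))) + drift_rest \<beta> n k x))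
          \<le> r k * ((\<Sum>l\<in>{1..d}. r l * (2 * real n)) + B k) * q" .
    qed
    then show ?thesis by (simp add: D_def q_def sum_distrib_right)
  qed
  moreover have "D \<ge> 0" unfolding D_def using r0 B0 by (intro sum_nonneg mult_nonneg_nonneg add_nonneg_nonneg) auto
  ultimately show ?thesis using that by blast
qed

definition smooth_exp :: "real \<Rightarrow> nat \<Rightarrow> nat \<Rightarrow> ((nat \<Rightarrow> complex) \<Rightarrow> real) \<Rightarrow> real \<Rightarrow> real" where
  "smooth_exp \<beta> n d F t = (\<integral>x. (\<integral>g. F (ou_vec \<beta> n d t x g) \<partial>gauss_vec d) \<partial>cbe \<beta> n)"

definition stein_term :: "real \<Rightarrow> nat \<Rightarrow> nat \<Rightarrow> ((nat \<Rightarrow> complex) \<Rightarrow> real) \<Rightarrow> real \<Rightarrow> real" where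
  "stein_term \<beta> n d F t = (\<integral>x. (\<integral>g. F (ou_vec \<beta> n d t x g) *
      (2 / real n * Re (stein_err \<beta> n d t x (ou_vec \<beta> n d t x g))) \<partial>gauss_vec d) \<partial>cbe \<beta> n)"

lemma kernel_increment:
  assumes b: "\<beta> > 0" and t: "0 < t1" "t1 \<le> t2"
  shows "(\<integral>s. kernel \<beta> n d s x y * kernel_dot \<beta> n d s x y * indicator {t1..t2} s \<partial>lborel) = kernel \<beta> n d t2 x y - kernel \<beta> n d t1 x y"
proof (rule integral_FTC_Icc_real[OF t(2)])
  fix s assume s: "t1 \<le> s" "s \<le> t2"
  then have s0: "s > 0" using t by simp
  show "((\<lambda>s. kernel \<beta> n d s x y) has_real_derivative kernel \<beta> n d s x y * kernel_dot \<beta> n d s x y) (at s)"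
    by (rule kernel_has_derivative[OF b s0])
  have 1: "isCont (\<lambda>s. kernel \<beta> n d s x y) s"
    using kernel_has_derivative[OF b s0] by (rule DERIV_isCont)
  have m: "isCont (ou_mean \<beta> k) s" for k unfolding ou_mean_def by (intro continuous_intros) auto
  then have v: "isCont (ou_var \<beta> k) s" for k unfolding ou_var_def by (intro continuous_intros)
  have r: "isCont (ou_rate \<beta> k) s" if "k \<in> {1..d}" for k
    unfolding ou_rate_def using m[of k] v[of k] ou_var_pos[OF b _ s0, of k] that by (intro continuous_intros) auto
  have u: "isCont (\<lambda>s. resid \<beta> n k s x y) s" for k
    unfolding resid_def using m[of k] by (intro continuous_intros)
  have 2: "isCont (\<lambda>s. kernel_dot \<beta> n d s x y) s"
    unfolding kernel_dot_def using m r u by (intro continuous_intros) auto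
  show "isCont (\<lambda>s. kernel \<beta> n d s x y * kernel_dot \<beta> n d s x y) s" using 1 2 by (rule isCont_mult)
qed

text \<open>At fixed angles and \<open>y\<close> the kernel increment is a time integral of
  \<open>kernel * kernel_dot\<close>. Integrating over the angles at fixed \<open>y\<close> replaces
  \<open>kernel_dot\<close> by the Stein error, and Fubini puts the integrals in the required order.
  As the kernel carries the derivative, \<open>F\<close> has to be no more than bounded and
  measurable.\<close>

theorem interpolation:
  assumes b: "\<beta> > 0" and n: "n \<ge> 1" and t: "0 < t1" "t1 \<le> t2"
    and F[measurable]: "F \<in> borel_measurable (PiM {1..d} (\<lambda>_. borel))" and FC: "\<And>y. \<bar>F y\<bar> \<le> C"
  shows "integrable lborel (\<lambda>s. indicator {t1..t2} s * stein_term \<beta> n d F s)"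
    and "smooth_exp \<beta> n d F t2 - smooth_exp \<beta> n d F t1 = (\<integral>s. indicator {t1..t2} s * stein_term \<beta> n d F s \<partial>lborel)"
proof -
  interpret E: prob_space "cbe \<beta> n" by (rule prob_space_cbe[OF b])
  interpret L: sigma_finite_measure "vec_lebesgue d" by (rule sigma_finite_vec_lebesgue)
  interpret G: prob_space "gauss_vec d" by (rule prob_space_gauss_vec)
  interpret EL: pair_sigma_finite "cbe \<beta> n" "vec_lebesgue d" ..
  have C0: "C \<ge> 0" using FC[of undefined] by simp
  have q0: "gauss_quad d g \<ge> 0" for g using gauss_quad_ge(1)[of d g] by linarith
  have xm: "(\<lambda>x. x) \<in> measurable (cbe \<beta> n) (PiM {1..n} (\<lambda>_. borel))" by measurable
  define Q where "Q = (\<integral>g. gauss_quad d g \<partial>gauss_vec d)"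
  have ov[measurable]: "ou_vec \<beta> n d s x \<in> measurable (gauss_vec d) (PiM {1..d} (\<lambda>_. borel))" for s x by (rule ou_vec_measurable)
  have idm: "id \<in> measurable (PiM {1..d} (\<lambda>_. borel)) (PiM {1..d} (\<lambda>_. borel :: complex measure))" by simp
  have kdm[measurable]: "kernel_dot \<beta> n d s x \<in> borel_measurable (PiM {1..d} (\<lambda>_. borel))" if "x \<in> space (PiM {1..n} (\<lambda>_. borel))" for s x
    using kernel_dot_measurable_pair[of "\<lambda>_. s" "PiM {1..d} (\<lambda>_. borel)" "\<lambda>_. x" n "\<lambda>y. y" d \<beta>] that by simp
  have sem[measurable]: "stein_err \<beta> n d s x \<in> borel_measurable (PiM {1..d} (\<lambda>_. borel))" if "x \<in> space (PiM {1..n} (\<lambda>_. borel))" for s x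
    using stein_err_measurable_pair[of "\<lambda>_. s" "PiM {1..d} (\<lambda>_. borel)" "\<lambda>_. x" n "\<lambda>y. y" d \<beta>] that by simp
  have spE: "x \<in> space (PiM {1..n} (\<lambda>_. borel :: real measure))" if "x \<in> space (cbe \<beta> n)" for x
    using that sets_eq_imp_space_eq[OF sets_cbe] by simp
  obtain D where D: "D \<ge> 0" "\<And>t x g. t1 \<le> t \<Longrightarrow> \<bar>kernel_dot \<beta> n d t x (ou_vec \<beta> n d t x g)\<bar> \<le> D * gauss_quad d g"
    using kernel_dot_bound[OF b t(1), of n d] by blast
  have dom: "integrable (gauss_vec d) f \<and> (\<integral>g. \<bar>f g\<bar> \<partial>gauss_vec d) \<le> A * Q"
    if f: "f \<in> borel_measurable (gauss_vec d)" and le: "\<And>g. \<bar>f g\<bar> \<le> A * gauss_quad d g" for f :: "(nat \<Rightarrow> complex) \<Rightarrow> real" and A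
  proof -
    have i: "integrable (gauss_vec d) (\<lambda>g. A * gauss_quad d g)" using integrable_gauss_quad by (rule integrable_mult_right)
    have if': "integrable (gauss_vec d) f"
      by (rule Bochner_Integration.integrable_bound[OF i f]) (use le in \<open>auto intro!: AE_I2 intro: order_trans[OF _ abs_ge_self]\<close>)
    have "(\<integral>g. \<bar>f g\<bar> \<partial>gauss_vec d) \<le> (\<integral>g. A * gauss_quad d g \<partial>gauss_vec d)"
      using if' i le by (intro integral_mono integrable_abs) auto
    then show ?thesis using if' by (simp add: Q_def)
  qed
  have kd_int: "integrable (gauss_vec d) (\<lambda>g. F (ou_vec \<beta> n d s x g) * kernel_dot \<beta> n d s x (ou_vec \<beta> n d s x g))
     \<and> (\<integral>g. \<bar>F (ou_vec \<beta> n d s x g) * kernel_dot \<beta> n d s x (ou_vec \<beta> n d s x g)\<bar> \<partial>gauss_vec d) \<le> C * D * Q"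
    if "t1 \<le> s" "x \<in> space (PiM {1..n} (\<lambda>_. borel))" for s x
  proof (rule dom)
    note [measurable] = kdm[OF that(2)]
    show "(\<lambda>g. F (ou_vec \<beta> n d s x g) * kernel_dot \<beta> n d s x (ou_vec \<beta> n d s x g)) \<in> borel_measurable (gauss_vec d)" by measurable
    show "\<bar>F (ou_vec \<beta> n d s x g) * kernel_dot \<beta> n d s x (ou_vec \<beta> n d s x g)\<bar> \<le> C * D * gauss_quad d g" for g
      using mult_mono[OF FC[of "ou_vec \<beta> n d s x g"] D(2)[OF that(1), of x g] C0 abs_ge_zero] by (simp add: abs_mult mult.assoc)
  qed
  \<comment> \<open>Time becomes a finite measure, so that \<open>kernel_pair_integrable\<close> and
    Fubini treat time, angles and \<open>y\<close> together.\<close>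
  define S where "S = density lborel (\<lambda>s. ennreal (indicator {t1..t2} s))"
  have sS[measurable_cong]: "sets S = sets borel" by (simp add: S_def)
  have fS: "finite_measure S"
  proof
    have "emeasure S (space S) = (\<integral>\<^sup>+s. indicator {t1..t2} s \<partial>lborel)"
      unfolding S_def by (subst emeasure_density) (auto intro!: nn_integral_cong simp: ennreal_indicator)
    also have "\<dots> = ennreal (t2 - t1)" using t by simp
    finally show "emeasure S (space S) \<noteq> \<infinity>" by simp
  qed
  interpret S: finite_measure S by fact
  have intS: "(\<integral>s. f s \<partial>S) = (\<integral>s. indicator {t1..t2} s * f s \<partial>lborel)" if "f \<in> borel_measurable borel" for f :: "real \<Rightarrow> real"
    unfolding S_def using that by (subst integral_density) auto
  have intgS: "integrable S f \<longleftrightarrow> integrable lborel (\<lambda>s. indicator {t1..t2} s * f s)" if "f \<in> borel_measurable borel" for f :: "real \<Rightarrow> real"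
    unfolding S_def using that by (subst integrable_density) auto
  \<comment> \<open>Outside \<open>{t1..t2}\<close>, where \<open>S\<close> has no mass, times are
    clamped into the interval; the variances stay positive and the bounds hold at every
    point.\<close>
  define cl where "cl = (\<lambda>s. max t1 (min t2 s))"
  have cl: "t1 \<le> cl s" "cl s > 0" for s using t by (auto simp: cl_def)
  have cl_id: "cl s = s" if "s \<in> {t1..t2}" for s using that by (auto simp: cl_def)
  have [measurable]: "cl \<in> borel_measurable borel" unfolding cl_def by measurable
  interpret SE: pair_sigma_finite S "cbe \<beta> n" ..
  have fSE: "finite_measure (S \<Otimes>\<^sub>M cbe \<beta> n)"
  proof
    show "emeasure (S \<Otimes>\<^sub>M cbe \<beta> n) (space (S \<Otimes>\<^sub>M cbe \<beta> n)) \<noteq> \<infinity>"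
      unfolding space_pair_measure by (subst E.emeasure_pair_measure_Times) (auto simp: E.emeasure_space_1 ennreal_mult_eq_top_iff)
  qed
  interpret SE': finite_measure "S \<Otimes>\<^sub>M cbe \<beta> n" by (rule fSE)
  interpret SEL: pair_sigma_finite "S \<Otimes>\<^sub>M cbe \<beta> n" "vec_lebesgue d" ..
  define \<Phi> where "\<Phi> = (\<lambda>s x y. kernel \<beta> n d s x y * (F y * kernel_dot \<beta> n d s x y))"
  have \<Phi>int: "integrable ((S \<Otimes>\<^sub>M cbe \<beta> n) \<Otimes>\<^sub>M vec_lebesgue d) (\<lambda>(w, y). \<Phi> (cl (fst w)) (snd w) y)"
  proof -
    have "integrable ((S \<Otimes>\<^sub>M cbe \<beta> n) \<Otimes>\<^sub>M vec_lebesgue d) (\<lambda>(w, y). kernel \<beta> n d (cl (fst w)) (snd w) y *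
       (\<lambda>(w, y). F y * kernel_dot \<beta> n d (cl (fst w)) (snd w) y) (w, y))"
    proof (rule kernel_pair_integrable[OF b fSE, where D = "C * D * Q"])
      show "(\<lambda>(w, y). F y * kernel_dot \<beta> n d (cl (fst w)) (snd w) y) \<in> borel_measurable ((S \<Otimes>\<^sub>M cbe \<beta> n) \<Otimes>\<^sub>M vec_lebesgue d)"
        unfolding case_prod_beta' by measurable
      show "(\<lambda>w. cl (fst w)) \<in> borel_measurable (S \<Otimes>\<^sub>M cbe \<beta> n)" by measurable
      show "snd \<in> measurable (S \<Otimes>\<^sub>M cbe \<beta> n) (PiM {1..n} (\<lambda>_. borel))" by measurable
    next
      fix w assume "w \<in> space (S \<Otimes>\<^sub>M cbe \<beta> n)"
      then have "snd w \<in> space (PiM {1..n} (\<lambda>_. borel :: real measure))" using spE by (auto simp: space_pair_measure)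
      from kd_int[OF cl(1) this, of "fst w"]
      show "integrable (gauss_vec d) (\<lambda>g. (\<lambda>(w, y). F y * kernel_dot \<beta> n d (cl (fst w)) (snd w) y) (w, ou_vec \<beta> n d (cl (fst w)) (snd w) g))"
        "(\<integral>g. \<bar>(\<lambda>(w, y). F y * kernel_dot \<beta> n d (cl (fst w)) (snd w) y) (w, ou_vec \<beta> n d (cl (fst w)) (snd w) g)\<bar> \<partial>gauss_vec d) \<le> C * D * Q"
        by auto
    qed (use cl in auto)
    then show ?thesis by (simp add: \<Phi>_def)
  qed
  have \<Phi>s: "integrable (cbe \<beta> n \<Otimes>\<^sub>M vec_lebesgue d) (\<lambda>(x, y). \<Phi> s x y)" if s: "t1 \<le> s" for s
  proof -
    have s0: "s > 0" using s t by simp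
    have "integrable (cbe \<beta> n \<Otimes>\<^sub>M vec_lebesgue d) (\<lambda>(x, y). kernel \<beta> n d ((\<lambda>_. s) x) ((\<lambda>x. x) x) y *
       (\<lambda>(x, y). F y * kernel_dot \<beta> n d s x y) (x, y))"
    proof (rule kernel_pair_integrable[OF b E.finite_measure_axioms, where D = "C * D * Q"])
      show "(\<lambda>(x, y). F y * kernel_dot \<beta> n d s x y) \<in> borel_measurable (cbe \<beta> n \<Otimes>\<^sub>M vec_lebesgue d)"
        unfolding case_prod_beta' by measurable
    next
      fix x assume "x \<in> space (cbe \<beta> n)"
      from kd_int[OF s spE[OF this]]
      show "integrable (gauss_vec d) (\<lambda>g. (\<lambda>(x, y). F y * kernel_dot \<beta> n d s x y) (x, ou_vec \<beta> n d s x g))"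
        "(\<integral>g. \<bar>(\<lambda>(x, y). F y * kernel_dot \<beta> n d s x y) (x, ou_vec \<beta> n d s x g)\<bar> \<partial>gauss_vec d) \<le> C * D * Q"
        by auto
    qed (use s0 xm in auto)
    then show ?thesis by (simp add: \<Phi>_def)
  qed
  define \<Psi> where "\<Psi> = (\<lambda>s x y. kernel \<beta> n d s x y * (F y * (2 / real n * Re (stein_err \<beta> n d s x y))))"
  have \<Psi>s: "integrable (cbe \<beta> n \<Otimes>\<^sub>M vec_lebesgue d) (\<lambda>(x, y). \<Psi> s x y)" if s: "0 < s" for s
  proof -
    obtain D' where D': "D' \<ge> 0" "\<And>x g. norm (stein_err \<beta> n d s x (ou_vec \<beta> n d s x g)) \<le> D' * gauss_quad d g"
      using stein_err_bound[OF b s, of n d] by blast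
    have se_int: "integrable (gauss_vec d) (\<lambda>g. F (ou_vec \<beta> n d s x g) * (2 / real n * Re (stein_err \<beta> n d s x (ou_vec \<beta> n d s x g))))
     \<and> (\<integral>g. \<bar>F (ou_vec \<beta> n d s x g) * (2 / real n * Re (stein_err \<beta> n d s x (ou_vec \<beta> n d s x g)))\<bar> \<partial>gauss_vec d) \<le> C * (2 / real n * D') * Q"
      if "x \<in> space (PiM {1..n} (\<lambda>_. borel))" for x
    proof (rule dom)
      note [measurable] = sem[OF that]
      show "(\<lambda>g. F (ou_vec \<beta> n d s x g) * (2 / real n * Re (stein_err \<beta> n d s x (ou_vec \<beta> n d s x g)))) \<in> borel_measurable (gauss_vec d)" by measurable
      fix g
      have "\<bar>Re (stein_err \<beta> n d s x (ou_vec \<beta> n d s x g))\<bar> \<le> D' * gauss_quad d g"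
        using abs_Re_le_cmod D'(2) by (rule order_trans)
      then have "\<bar>2 / real n * Re (stein_err \<beta> n d s x (ou_vec \<beta> n d s x g))\<bar> \<le> 2 / real n * (D' * gauss_quad d g)"
        unfolding abs_mult by (intro mult_mono) auto
      then have "\<bar>F (ou_vec \<beta> n d s x g)\<bar> * \<bar>2 / real n * Re (stein_err \<beta> n d s x (ou_vec \<beta> n d s x g))\<bar> \<le> C * (2 / real n * (D' * gauss_quad d g))"
        using FC C0 by (intro mult_mono) auto
      then show "\<bar>F (ou_vec \<beta> n d s x g) * (2 / real n * Re (stein_err \<beta> n d s x (ou_vec \<beta> n d s x g)))\<bar> \<le> C * (2 / real n * D') * gauss_quad d g"
        by (simp only: abs_mult mult.assoc)
    qed
    have "integrable (cbe \<beta> n \<Otimes>\<^sub>M vec_lebesgue d) (\<lambda>(x, y). kernel \<beta> n d ((\<lambda>_. s) x) ((\<lambda>x. x) x) y *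
       (\<lambda>(x, y). F y * (2 / real n * Re (stein_err \<beta> n d s x y))) (x, y))"
    proof (rule kernel_pair_integrable[OF b E.finite_measure_axioms, where D = "C * (2 / real n * D') * Q"])
      show "(\<lambda>(x, y). F y * (2 / real n * Re (stein_err \<beta> n d s x y))) \<in> borel_measurable (cbe \<beta> n \<Otimes>\<^sub>M vec_lebesgue d)"
        unfolding case_prod_beta' by measurable
    next
      fix x assume "x \<in> space (cbe \<beta> n)"
      from se_int[OF spE[OF this]]
      show "integrable (gauss_vec d) (\<lambda>g. (\<lambda>(x, y). F y * (2 / real n * Re (stein_err \<beta> n d s x y))) (x, ou_vec \<beta> n d s x g))"
        "(\<integral>g. \<bar>(\<lambda>(x, y). F y * (2 / real n * Re (stein_err \<beta> n d s x y))) (x, ou_vec \<beta> n d s x g)\<bar> \<partial>gauss_vec d) \<le> C * (2 / real n * D') * Q"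
        by auto
    qed (use s xm in auto)
    then show ?thesis by (simp add: \<Psi>_def)
  qed
  have Ks: "integrable (cbe \<beta> n \<Otimes>\<^sub>M vec_lebesgue d) (\<lambda>(x, y). kernel \<beta> n d s x y * F y)" if s: "0 < s" for s
  proof -
    have f_int: "integrable (gauss_vec d) (\<lambda>g. F (ou_vec \<beta> n d s x g)) \<and> (\<integral>g. \<bar>F (ou_vec \<beta> n d s x g)\<bar> \<partial>gauss_vec d) \<le> C * Q" for x
    proof (rule dom)
      show "(\<lambda>g. F (ou_vec \<beta> n d s x g)) \<in> borel_measurable (gauss_vec d)" by measurable
      show "\<bar>F (ou_vec \<beta> n d s x g)\<bar> \<le> C * gauss_quad d g" for g
        using FC[of "ou_vec \<beta> n d s x g"] mult_left_mono[OF gauss_quad_ge(1)[of d g] C0] by simp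
    qed
    have "integrable (cbe \<beta> n \<Otimes>\<^sub>M vec_lebesgue d) (\<lambda>(x, y). kernel \<beta> n d ((\<lambda>_. s) x) ((\<lambda>x. x) x) y * (\<lambda>(x, y). F y) (x, y))"
    proof (rule kernel_pair_integrable[OF b E.finite_measure_axioms, where D = "C * Q"])
      show "(\<lambda>(x, y). F y) \<in> borel_measurable (cbe \<beta> n \<Otimes>\<^sub>M vec_lebesgue d)"
        unfolding case_prod_beta' by measurable
    qed (use s f_int xm in auto)
    then show ?thesis by simp
  qed
  have to_y: "(\<integral>x. (\<integral>g. h x (ou_vec \<beta> n d s x g) \<partial>gauss_vec d) \<partial>cbe \<beta> n) = (\<integral>x. (\<integral>y. kernel \<beta> n d s x y * h x y \<partial>vec_lebesgue d) \<partial>cbe \<beta> n)"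
    if "0 < s" "\<And>x. x \<in> space (cbe \<beta> n) \<Longrightarrow> h x \<in> borel_measurable (PiM {1..d} (\<lambda>_. borel))" for s and h :: "_ \<Rightarrow> _ \<Rightarrow> real"
    using that by (intro Bochner_Integration.integral_cong refl integral_kernel[symmetric] b) auto
  \<comment> \<open>The Stein identity holds for each fixed \<open>y\<close>. So the integral over
    the angles is moved inside, the integrand is exchanged, and the order is restored.\<close>
  have \<Phi>\<Psi>: "(\<integral>x. (\<integral>y. \<Phi> s x y \<partial>vec_lebesgue d) \<partial>cbe \<beta> n) = stein_term \<beta> n d F s" if s: "t1 \<le> s" for s
  proof -
    have s0: "s > 0" using s t by simp
    have "(\<integral>x. (\<integral>y. \<Phi> s x y \<partial>vec_lebesgue d) \<partial>cbe \<beta> n) = (\<integral>y. (\<integral>x. \<Phi> s x y \<partial>cbe \<beta> n) \<partial>vec_lebesgue d)"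
      by (rule EL.Fubini_integral[OF \<Phi>s[OF s], symmetric])
    also have "\<dots> = (\<integral>y. (\<integral>x. \<Psi> s x y \<partial>cbe \<beta> n) \<partial>vec_lebesgue d)"
    proof (rule Bochner_Integration.integral_cong[OF refl])
      fix y
      have "(\<integral>x. \<Phi> s x y \<partial>cbe \<beta> n) = (\<integral>x. F y * (kernel \<beta> n d s x y * kernel_dot \<beta> n d s x y) \<partial>cbe \<beta> n)"
        by (simp add: \<Phi>_def mult_ac)
      also have "\<dots> = F y * (\<integral>x. kernel \<beta> n d s x y * (2 / real n * Re (stein_err \<beta> n d s x y)) \<partial>cbe \<beta> n)"
        by (simp only: integral_mult_right_zero stein_identity_kernel(1)[OF b s0 n])
      also have "\<dots> = (\<integral>x. F y * (kernel \<beta> n d s x y * (2 / real n * Re (stein_err \<beta> n d s x y))) \<partial>cbe \<beta> n)"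
        by (simp only: integral_mult_right_zero)
      also have "\<dots> = (\<integral>x. \<Psi> s x y \<partial>cbe \<beta> n)" by (simp add: \<Psi>_def mult_ac)
      finally show "(\<integral>x. \<Phi> s x y \<partial>cbe \<beta> n) = (\<integral>x. \<Psi> s x y \<partial>cbe \<beta> n)" .
    qed
    also have "\<dots> = (\<integral>x. (\<integral>y. \<Psi> s x y \<partial>vec_lebesgue d) \<partial>cbe \<beta> n)"
      by (rule EL.Fubini_integral[OF \<Psi>s[OF s0]])
    also have "\<dots> = stein_term \<beta> n d F s"
    proof -
      have "(\<lambda>y. F y * (2 / real n * Re (stein_err \<beta> n d s x y))) \<in> borel_measurable (PiM {1..d} (\<lambda>_. borel))"
        if "x \<in> space (cbe \<beta> n)" for x
      proof -
        note [measurable] = sem[OF spE[OF that]]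
        show ?thesis by measurable
      qed
      from to_y[of s "\<lambda>x y. F y * (2 / real n * Re (stein_err \<beta> n d s x y))", OF s0 this]
      show ?thesis unfolding stein_term_def \<Psi>_def by (rule sym)
    qed
    finally show ?thesis .
  qed
  have smooth: "smooth_exp \<beta> n d F s = (\<integral>x. (\<integral>y. kernel \<beta> n d s x y * F y \<partial>vec_lebesgue d) \<partial>cbe \<beta> n)" if "0 < s" for s
    unfolding smooth_exp_def by (rule to_y[OF that, of "\<lambda>x y. F y"]) measurable
  define h where "h = (\<lambda>s. \<integral>x. (\<integral>y. \<Phi> (cl s) x y \<partial>vec_lebesgue d) \<partial>cbe \<beta> n)"
  have i1: "integrable (S \<Otimes>\<^sub>M cbe \<beta> n) (\<lambda>w. \<integral>y. \<Phi> (cl (fst w)) (snd w) y \<partial>vec_lebesgue d)"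
    using SEL.integrable_fst[OF \<Phi>int] .
  then have i2: "integrable (S \<Otimes>\<^sub>M cbe \<beta> n) (\<lambda>(s, x). \<integral>y. \<Phi> (cl s) x y \<partial>vec_lebesgue d)"
    by (simp add: case_prod_beta')
  have hint: "integrable S h" unfolding h_def by (rule SE.integrable_fst[OF i2])
  have hm: "h \<in> borel_measurable borel" using borel_measurable_integrable[OF hint] measurable_cong_sets[OF sS refl] by blast
  have h_eq: "h s = stein_term \<beta> n d F (cl s)" for s unfolding h_def by (rule \<Phi>\<Psi>[OF cl(1)])
  have ind: "indicator {t1..t2} s * h s = indicator {t1..t2} s * stein_term \<beta> n d F s" for s
    by (cases "s \<in> {t1..t2}") (auto simp: h_eq cl_id)
  show "integrable lborel (\<lambda>s. indicator {t1..t2} s * stein_term \<beta> n d F s)"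
    using hint unfolding intgS[OF hm] ind .
  have "smooth_exp \<beta> n d F t2 - smooth_exp \<beta> n d F t1
      = (\<integral>y. (\<integral>x. kernel \<beta> n d t2 x y * F y \<partial>cbe \<beta> n) \<partial>vec_lebesgue d) - (\<integral>y. (\<integral>x. kernel \<beta> n d t1 x y * F y \<partial>cbe \<beta> n) \<partial>vec_lebesgue d)"
    using EL.Fubini_integral[OF Ks] smooth t by simp
  also have "\<dots> = (\<integral>y. (\<integral>x. kernel \<beta> n d t2 x y * F y \<partial>cbe \<beta> n) - (\<integral>x. kernel \<beta> n d t1 x y * F y \<partial>cbe \<beta> n) \<partial>vec_lebesgue d)"
    using EL.integrable_snd[OF Ks] t by (intro Bochner_Integration.integral_diff[symmetric]) auto
  also have "\<dots> = (\<integral>y. (\<integral>w. \<Phi> (cl (fst w)) (snd w) y \<partial>(S \<Otimes>\<^sub>M cbe \<beta> n)) \<partial>vec_lebesgue d)"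
  proof (rule integral_cong_AE)
    show "(\<lambda>y. (\<integral>x. kernel \<beta> n d t2 x y * F y \<partial>cbe \<beta> n) - (\<integral>x. kernel \<beta> n d t1 x y * F y \<partial>cbe \<beta> n)) \<in> borel_measurable (vec_lebesgue d)"
      using EL.integrable_snd[OF Ks] t by (intro borel_measurable_diff borel_measurable_integrable) auto
    show "(\<lambda>y. \<integral>w. \<Phi> (cl (fst w)) (snd w) y \<partial>(S \<Otimes>\<^sub>M cbe \<beta> n)) \<in> borel_measurable (vec_lebesgue d)"
      using SEL.integrable_snd[OF \<Phi>int] by (rule borel_measurable_integrable)
    have bmK: "integrable (cbe \<beta> n) (\<lambda>x. kernel \<beta> n d s x y)" if "0 < s" for s y
      using bdd_meas_integrable[OF b bdd_meas_kernel[OF b that, of n d y]] by (simp add: complex_of_real_integrable_eq)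
    show "AE y in vec_lebesgue d. (\<integral>x. kernel \<beta> n d t2 x y * F y \<partial>cbe \<beta> n) - (\<integral>x. kernel \<beta> n d t1 x y * F y \<partial>cbe \<beta> n)
        = (\<integral>w. \<Phi> (cl (fst w)) (snd w) y \<partial>(S \<Otimes>\<^sub>M cbe \<beta> n))"
      using SEL.AE_integrable_snd[OF \<Phi>int]
    proof eventually_elim
      case (elim y)
      then have el: "integrable (S \<Otimes>\<^sub>M cbe \<beta> n) (\<lambda>(s, x). \<Phi> (cl s) x y)" by (simp add: case_prod_beta')
      \<comment> \<open>For almost every \<open>y\<close> the section is integrable in time and
        angles; the time integral is then done first, by the fundamental theorem.\<close>
      have "(\<integral>w. \<Phi> (cl (fst w)) (snd w) y \<partial>(S \<Otimes>\<^sub>M cbe \<beta> n)) = (\<integral>x. (\<integral>s. \<Phi> (cl s) x y \<partial>S) \<partial>cbe \<beta> n)"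
        using SE.integral_snd[OF el] by (simp add: case_prod_beta')
      also have "\<dots> = (\<integral>x. F y * (kernel \<beta> n d t2 x y - kernel \<beta> n d t1 x y) \<partial>cbe \<beta> n)"
      proof (intro Bochner_Integration.integral_cong refl)
        fix x assume x: "x \<in> space (cbe \<beta> n)"
        have m: "(\<lambda>s. \<Phi> (cl s) x y) \<in> borel_measurable borel"
        proof -
          have "(\<lambda>s. kernel \<beta> n d (cl s) x y) \<in> borel_measurable borel"
            unfolding kernel_def gauss_dens_def by measurable
          moreover have "(\<lambda>s. kernel_dot \<beta> n d (cl s) x y) \<in> borel_measurable borel"
            unfolding kernel_dot_def resid_def by measurable
          ultimately show ?thesis unfolding \<Phi>_def by measurable
        qed
        have "(\<integral>s. \<Phi> (cl s) x y \<partial>S) = (\<integral>s. F y * (kernel \<beta> n d s x y * kernel_dot \<beta> n d s x y * indicator {t1..t2} s) \<partial>lborel)"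
          unfolding intS[OF m] by (intro Bochner_Integration.integral_cong refl) (auto simp: \<Phi>_def cl_id indicator_def)
        also have "\<dots> = F y * (kernel \<beta> n d t2 x y - kernel \<beta> n d t1 x y)"
          by (simp only: integral_mult_right_zero kernel_increment[OF b t])
        finally show "(\<integral>s. \<Phi> (cl s) x y \<partial>S) = F y * (kernel \<beta> n d t2 x y - kernel \<beta> n d t1 x y)" .
      qed
      also have "\<dots> = (\<integral>x. kernel \<beta> n d t2 x y * F y \<partial>cbe \<beta> n) - (\<integral>x. kernel \<beta> n d t1 x y * F y \<partial>cbe \<beta> n)"
        using bmK[of t1 y] bmK[of t2 y] t by (simp add: algebra_simps)
      finally show ?case by simp
    qed
  qed
  also have "\<dots> = (\<integral>w. (\<integral>y. \<Phi> (cl (fst w)) (snd w) y \<partial>vec_lebesgue d) \<partial>(S \<Otimes>\<^sub>M cbe \<beta> n))"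
    by (rule SEL.Fubini_integral[OF \<Phi>int])
  also have "\<dots> = (\<integral>s. h s \<partial>S)"
    unfolding h_def using SE.integral_fst[OF i2] by (simp add: case_prod_beta')
  also have "\<dots> = (\<integral>s. indicator {t1..t2} s * stein_term \<beta> n d F s \<partial>lborel)"
    unfolding intS[OF hm] ind ..
  finally show "smooth_exp \<beta> n d F t2 - smooth_exp \<beta> n d F t1 = (\<integral>s. indicator {t1..t2} s * stein_term \<beta> n d F s \<partial>lborel)" .
qed

subsection \<open>Lipschitz test functions\<close>

text \<open>Changing one noise coordinate moves one coordinate of the vector. For this the Lipschitz
  condition in the sum of the coordinate norms, weaker than the Euclidean one, gives the same
  constant.\<close>

lemma lipschitz_ou_vec:
  assumes lip: "\<And>y y'. \<bar>F y - F y'\<bar> \<le> (\<Sum>k\<in>{1..d}. norm (y k - y' k))" and k: "k \<in> {1..d}"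
    and v: "ou_var \<beta> k t \<ge> 0"
  shows "\<bar>F (ou_vec \<beta> n d t x (g(k := z))) - F (ou_vec \<beta> n d t x (g(k := 0)))\<bar> \<le> sqrt (ou_var \<beta> k t) * norm z"
proof -
  have "\<bar>F (ou_vec \<beta> n d t x (g(k := z))) - F (ou_vec \<beta> n d t x (g(k := 0)))\<bar>
     \<le> (\<Sum>l\<in>{1..d}. norm (ou_vec \<beta> n d t x (g(k := z)) l - ou_vec \<beta> n d t x (g(k := 0)) l))" by (rule lip)
  also have "\<dots> = (\<Sum>l\<in>{1..d}. if l = k then sqrt (ou_var \<beta> k t) * norm z else 0)"
    using v by (intro sum.cong refl) (auto simp: ou_vec_def norm_mult)
  also have "\<dots> = sqrt (ou_var \<beta> k t) * norm z" using k by simp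
  finally show ?thesis .
qed

text \<open>In terms of the noise, \<open>stein_err\<close> is a combination of
  \<open>cnj (g k) * cnj (g l)\<close>, \<open>cnj (g k) * g l\<close> with
  \<open>l \<noteq> k\<close>, and \<open>cnj (g k)\<close>, with coefficients depending on the
  angles. Centering in \<open>g k\<close> contributes \<open>sqrt (ou_var \<beta> k t)\<close>, the
  Lipschitz constant in that coordinate, which tames the factor \<open>r k\<close>; only
  \<open>r l\<close> stays singular as \<open>t\<close> tends to 0.\<close>

lemma stein_err_gauss_bound:
  fixes F :: "(nat \<Rightarrow> complex) \<Rightarrow> real"
  assumes b: "\<beta> > 0" and t: "t > 0"
    and F: "F \<in> borel_measurable (PiM {1..d} (\<lambda>_. borel))" and FC: "\<And>y. \<bar>F y\<bar> \<le> C"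
    and lip: "\<And>y y'. \<bar>F y - F y'\<bar> \<le> (\<Sum>k\<in>{1..d}. norm (y k - y' k))"
    and x: "x \<in> space (PiM {1..n} (\<lambda>_. borel :: real measure))"
  defines "r \<equiv> \<lambda>k. ou_rate \<beta> k t * sqrt (ou_var \<beta> k t)"
  shows "\<bar>\<integral>g. F (ou_vec \<beta> n d t x g) * (2 / real n * Re (stein_err \<beta> n d t x (ou_vec \<beta> n d t x g))) \<partial>gauss_vec d\<bar>
     \<le> 2 / real n * gauss_const * (\<Sum>k\<in>{1..d}. ou_mean \<beta> k t * real k *
         ((\<Sum>l\<in>{1..d}. r l * (norm (psum n (k + l) x) + (if l = k then 0 else norm (psum_diff n k l x)))) + norm (drift_rest \<beta> n k x)))"
proof -
  define F' where "F' = (\<lambda>g. F (ou_vec \<beta> n d t x g))"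
  have ovm: "ou_vec \<beta> n d t x \<in> measurable (PiM {1..d} (\<lambda>_. borel)) (PiM {1..d} (\<lambda>_. borel))"
    using ou_vec_measurable measurable_cong_sets[OF sets_gauss_vec refl] by blast
  have F'm[measurable]: "F' \<in> borel_measurable (PiM {1..d} (\<lambda>_. borel))" unfolding F'_def by (rule measurable_compose[OF ovm F])
  have F'C: "\<bar>F' g\<bar> \<le> C" for g unfolding F'_def by (rule FC)
  have v0: "ou_var \<beta> k t > 0" if "k \<in> {1..d}" for k using ou_var_pos[OF b _ t, of k] that by simp
  have r0: "r k \<ge> 0" if "k \<in> {1..d}" for k
    using ou_rate_nonneg[OF b t, of k] v0[OF that] that by (simp add: r_def)
  \<comment> \<open>One square root is contained in \<open>r k\<close>, the other is the Lipschitz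
    constant in coordinate \<open>k\<close>; together they cancel the variance in the denominator of
    \<open>ou_rate\<close>.\<close>
  have rv: "r k * sqrt (ou_var \<beta> k t) = ou_mean \<beta> k t * real k" if "k \<in> {1..d}" for k
  proof -
    have "r k * sqrt (ou_var \<beta> k t) = ou_rate \<beta> k t * (sqrt (ou_var \<beta> k t) * sqrt (ou_var \<beta> k t))"
      by (simp only: r_def mult.assoc)
    also have "\<dots> = ou_rate \<beta> k t * ou_var \<beta> k t" using v0[OF that] by simp
    also have "\<dots> = ou_mean \<beta> k t * real k" using v0[OF that] by (simp add: ou_rate_def)
    finally show ?thesis .
  qed
  have F'lip: "\<bar>F' (g(k := z)) - F' (g(k := 0))\<bar> \<le> sqrt (ou_var \<beta> k t) * norm z" if "k \<in> {1..d}" for k g z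
    unfolding F'_def using v0[OF that] by (intro lipschitz_ou_vec[OF lip that]) auto
  have bnd: "integrable (gauss_vec d) (\<lambda>g. of_real (F' g) * f g)" if "integrable (gauss_vec d) f" for f :: "(nat \<Rightarrow> complex) \<Rightarrow> complex"
  proof (rule Bochner_Integration.integrable_bound[OF integrable_mult_right[OF that, of "of_real C"]])
    show "(\<lambda>g. of_real (F' g) * f g) \<in> borel_measurable (gauss_vec d)" using that by measurable
    have "C \<ge> 0" using F'C[of undefined] by simp
    then show "AE g in gauss_vec d. norm (of_real (F' g) * f g) \<le> norm (of_real C * f g)"
      using F'C by (intro AE_I2) (auto simp: norm_mult intro!: mult_right_mono)
  qed
  have i1: "integrable (gauss_vec d) (\<lambda>g. of_real (F' g) * cnj (g k))" if "k \<in> {1..d}" for k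
    by (rule bnd[OF integrable_gauss_vec_component[OF integrable_std_complex_gaussian_moments(4) that]])
  have i2: "integrable (gauss_vec d) (\<lambda>g. of_real (F' g) * (cnj (g k) * cnj (g l)))" if "k \<in> {1..d}" "l \<in> {1..d}" for k l
    by (rule bnd[OF integrable_gauss_vec_product[OF that]]) auto
  have i3: "integrable (gauss_vec d) (\<lambda>g. of_real (F' g) * (cnj (g k) * g l))" if "k \<in> {1..d}" "l \<in> {1..d}" for k l
    by (rule bnd[OF integrable_gauss_vec_product[OF that, of cnj "\<lambda>z. z"]]) auto
  define A where "A = (\<lambda>k l g. of_real (r k * r l) * (psum n (k + l) x * (of_real (F' g) * (cnj (g k) * cnj (g l)))
      - (if l = k then 0 else psum_diff n k l x * (of_real (F' g) * (cnj (g k) * g l)))))"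
  define B where "B = (\<lambda>k g. of_real (r k) * (drift_rest \<beta> n k x * (of_real (F' g) * cnj (g k))))"
  have iA: "integrable (gauss_vec d) (A k l)" if "k \<in> {1..d}" "l \<in> {1..d}" for k l
    unfolding A_def using i2[OF that] i3[OF that]
    by (cases "l = k") (auto intro!: integrable_mult_right Bochner_Integration.integrable_diff)
  have iB: "integrable (gauss_vec d) (B k)" if "k \<in> {1..d}" for k
    unfolding B_def using i1[OF that] by (intro integrable_mult_right)
  have expand: "of_real (F' g) * stein_err \<beta> n d t x (ou_vec \<beta> n d t x g) = (\<Sum>k\<in>{1..d}. (\<Sum>l\<in>{1..d}. A k l g) + B k g)" for g
  proof -
    have res: "of_real (ou_rate \<beta> k t) * cnj (resid \<beta> n k t x (ou_vec \<beta> n d t x g)) = of_real (r k) * cnj (g k)"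
      "of_real (ou_rate \<beta> k t) * resid \<beta> n k t x (ou_vec \<beta> n d t x g) = of_real (r k) * g k" if "k \<in> {1..d}" for k
      unfolding resid_ou_vec[OF that] by (simp_all add: r_def)
    have inner: "of_real (ou_rate \<beta> l t) * (cnj (resid \<beta> n l t x (ou_vec \<beta> n d t x g)) * psum n (k + l) x -
              (if l = k then 0 else resid \<beta> n l t x (ou_vec \<beta> n d t x g) * psum_diff n k l x))
        = of_real (r l) * (cnj (g l) * psum n (k + l) x - (if l = k then 0 else g l * psum_diff n k l x))"
      if l: "l \<in> {1..d}" for k l
    proof -
      have "of_real (ou_rate \<beta> l t) * (cnj (resid \<beta> n l t x (ou_vec \<beta> n d t x g)) * psum n (k + l) x -
              (if l = k then 0 else resid \<beta> n l t x (ou_vec \<beta> n d t x g) * psum_diff n k l x))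
        = (of_real (ou_rate \<beta> l t) * cnj (resid \<beta> n l t x (ou_vec \<beta> n d t x g))) * psum n (k + l) x -
              (if l = k then 0 else (of_real (ou_rate \<beta> l t) * resid \<beta> n l t x (ou_vec \<beta> n d t x g)) * psum_diff n k l x)"
        by (simp add: algebra_simps)
      also have "\<dots> = of_real (r l) * (cnj (g l) * psum n (k + l) x - (if l = k then 0 else g l * psum_diff n k l x))"
        unfolding res[OF l] by (simp add: algebra_simps)
      finally show ?thesis .
    qed
    have "stein_err \<beta> n d t x (ou_vec \<beta> n d t x g) = (\<Sum>k\<in>{1..d}. of_real (r k) * cnj (g k) *
      ((\<Sum>l\<in>{1..d}. of_real (r l) * (cnj (g l) * psum n (k + l) x - (if l = k then 0 else g l * psum_diff n k l x))) + drift_rest \<beta> n k x))"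
      unfolding stein_err_def
    proof (rule sum.cong[OF refl])
      fix k assume k: "k \<in> {1..d}"
      have "(\<Sum>l\<in>{1..d}. of_real (ou_rate \<beta> l t) * (cnj (resid \<beta> n l t x (ou_vec \<beta> n d t x g)) * psum n (k + l) x -
              (if l = k then 0 else resid \<beta> n l t x (ou_vec \<beta> n d t x g) * psum_diff n k l x)))
        = (\<Sum>l\<in>{1..d}. of_real (r l) * (cnj (g l) * psum n (k + l) x - (if l = k then 0 else g l * psum_diff n k l x)))"
        by (rule sum.cong[OF refl inner])
      then show "of_real (ou_rate \<beta> k t) * cnj (resid \<beta> n k t x (ou_vec \<beta> n d t x g)) *
          ((\<Sum>l\<in>{1..d}. of_real (ou_rate \<beta> l t) * (cnj (resid \<beta> n l t x (ou_vec \<beta> n d t x g)) * psum n (k + l) x -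
              (if l = k then 0 else resid \<beta> n l t x (ou_vec \<beta> n d t x g) * psum_diff n k l x))) + drift_rest \<beta> n k x)
        = of_real (r k) * cnj (g k) *
          ((\<Sum>l\<in>{1..d}. of_real (r l) * (cnj (g l) * psum n (k + l) x - (if l = k then 0 else g l * psum_diff n k l x))) + drift_rest \<beta> n k x)"
        unfolding res[OF k] by simp
    qed
    then show ?thesis
      by (simp add: A_def B_def sum_distrib_left algebra_simps sum.distrib[symmetric] if_distrib cong: if_cong)
  qed
  have int: "integrable (gauss_vec d) (\<lambda>g. of_real (F' g) * stein_err \<beta> n d t x (ou_vec \<beta> n d t x g))"
    unfolding expand using iA iB by (intro Bochner_Integration.integrable_sum Bochner_Integration.integrable_add) auto
  have e1: "(\<integral>g. of_real (F' g) * stein_err \<beta> n d t x (ou_vec \<beta> n d t x g) \<partial>gauss_vec d)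
      = (\<Sum>k\<in>{1..d}. (\<Sum>l\<in>{1..d}. \<integral>g. A k l g \<partial>gauss_vec d) + (\<integral>g. B k g \<partial>gauss_vec d))"
  proof -
    have iAs: "integrable (gauss_vec d) (\<lambda>g. \<Sum>l\<in>{1..d}. A k l g)" if "k \<in> {1..d}" for k
      using iA[OF that] by (intro Bochner_Integration.integrable_sum)
    have "(\<integral>g. (\<Sum>l\<in>{1..d}. A k l g) + B k g \<partial>gauss_vec d) = (\<Sum>l\<in>{1..d}. \<integral>g. A k l g \<partial>gauss_vec d) + (\<integral>g. B k g \<partial>gauss_vec d)"
      if k: "k \<in> {1..d}" for k
      unfolding Bochner_Integration.integral_add[OF iAs[OF k] iB[OF k]]
      by (subst Bochner_Integration.integral_sum[OF iA[OF k]]) auto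
    moreover have "(\<integral>g. (\<Sum>k\<in>{1..d}. (\<Sum>l\<in>{1..d}. A k l g) + B k g) \<partial>gauss_vec d)
        = (\<Sum>k\<in>{1..d}. \<integral>g. (\<Sum>l\<in>{1..d}. A k l g) + B k g \<partial>gauss_vec d)"
      using iAs iB by (intro Bochner_Integration.integral_sum Bochner_Integration.integrable_add)
    ultimately show ?thesis unfolding expand by simp
  qed
  have e2: "norm (\<Sum>k\<in>{1..d}. (\<Sum>l\<in>{1..d}. \<integral>g. A k l g \<partial>gauss_vec d) + (\<integral>g. B k g \<partial>gauss_vec d)) \<le> (\<Sum>k\<in>{1..d}. (\<Sum>l\<in>{1..d}. gauss_const * (ou_mean \<beta> k t * real k * (r l * (norm (psum n (k + l) x) + (if l = k then 0 else norm (psum_diff n k l x))))))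
      + gauss_const * (ou_mean \<beta> k t * real k * norm (drift_rest \<beta> n k x)))"
  proof (intro sum_norm_le order_trans[OF norm_triangle_ineq] add_mono)
    fix k l assume kl: "k \<in> {1..d}" "l \<in> {1..d}"
    define q where "q = sqrt (ou_var \<beta> k t) * gauss_const"
    have q: "norm (\<integral>g. of_real (F' g) * (cnj (g k) * cnj (g l)) \<partial>gauss_vec d) \<le> q"
      unfolding q_def using v0[OF kl(1)] by (intro gauss_quadratic_bound[OF kl F'm F'C F'lip[OF kl(1)]]) auto
    have m: "norm (\<integral>g. of_real (F' g) * (cnj (g k) * g l) \<partial>gauss_vec d) \<le> q" if "l \<noteq> k"
      unfolding q_def using v0[OF kl(1)] that by (intro gauss_mixed_bound[OF kl F'm F'C F'lip[OF kl(1)]]) auto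
    have q0: "q \<ge> 0" using q norm_ge_zero order_trans by blast
    have "(\<integral>g. A k l g \<partial>gauss_vec d) = of_real (r k * r l) * (psum n (k + l) x * (\<integral>g. of_real (F' g) * (cnj (g k) * cnj (g l)) \<partial>gauss_vec d)
        - (if l = k then 0 else psum_diff n k l x * (\<integral>g. of_real (F' g) * (cnj (g k) * g l) \<partial>gauss_vec d)))"
      unfolding A_def using i2[OF kl] i3[OF kl] by (cases "l = k") auto
    also have "norm \<dots> \<le> r k * r l * (norm (psum n (k + l) x) * q + (if l = k then 0 else norm (psum_diff n k l x)) * q)"
    proof -
      have "norm (psum n (k + l) x * (\<integral>g. of_real (F' g) * (cnj (g k) * cnj (g l)) \<partial>gauss_vec d)
        - (if l = k then 0 else psum_diff n k l x * (\<integral>g. of_real (F' g) * (cnj (g k) * g l) \<partial>gauss_vec d)))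
        \<le> norm (psum n (k + l) x) * q + (if l = k then 0 else norm (psum_diff n k l x)) * q"
        using q m q0 by (intro order_trans[OF norm_triangle_ineq4] add_mono) (auto simp: norm_mult intro!: mult_left_mono)
      from mult_left_mono[OF this, of "r k * r l"] r0[OF kl(1)] r0[OF kl(2)] show ?thesis
        by (simp only: norm_mult[of "of_real (r k * r l)"] norm_of_real abs_mult abs_of_nonneg mult_nonneg_nonneg)
    qed
    also have "\<dots> = gauss_const * ((r k * sqrt (ou_var \<beta> k t)) * (r l * (norm (psum n (k + l) x) + (if l = k then 0 else norm (psum_diff n k l x)))))"
      by (simp add: q_def algebra_simps)
    finally show "norm (\<integral>g. A k l g \<partial>gauss_vec d) \<le> gauss_const * (ou_mean \<beta> k t * real k * (r l * (norm (psum n (k + l) x) + (if l = k then 0 else norm (psum_diff n k l x)))))"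
      unfolding rv[OF kl(1)] .
  next
    fix k assume k: "k \<in> {1..d}"
    have q: "norm (\<integral>g. of_real (F' g) * cnj (g k) \<partial>gauss_vec d) \<le> sqrt (ou_var \<beta> k t) * gauss_const"
      using v0[OF k] by (intro gauss_linear_bound[OF k k F'm F'C F'lip[OF k]]) auto
    have "norm (\<integral>g. B k g \<partial>gauss_vec d) = r k * (norm (drift_rest \<beta> n k x) * norm (\<integral>g. of_real (F' g) * cnj (g k) \<partial>gauss_vec d))"
      unfolding B_def using r0[OF k] by (simp add: norm_mult)
    also have "\<dots> \<le> r k * (norm (drift_rest \<beta> n k x) * (sqrt (ou_var \<beta> k t) * gauss_const))"
      using q r0[OF k] by (intro mult_left_mono) auto
    also have "\<dots> = gauss_const * ((r k * sqrt (ou_var \<beta> k t)) * norm (drift_rest \<beta> n k x))" by (simp add: mult_ac)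
    finally show "norm (\<integral>g. B k g \<partial>gauss_vec d) \<le> gauss_const * (ou_mean \<beta> k t * real k * norm (drift_rest \<beta> n k x))"
      unfolding rv[OF k] .
  qed
  have e3: "(\<Sum>k\<in>{1..d}. (\<Sum>l\<in>{1..d}. gauss_const * (ou_mean \<beta> k t * real k * (r l * (norm (psum n (k + l) x) + (if l = k then 0 else norm (psum_diff n k l x))))))
      + gauss_const * (ou_mean \<beta> k t * real k * norm (drift_rest \<beta> n k x))) = gauss_const * (\<Sum>k\<in>{1..d}. ou_mean \<beta> k t * real k *
         ((\<Sum>l\<in>{1..d}. r l * (norm (psum n (k + l) x) + (if l = k then 0 else norm (psum_diff n k l x)))) + norm (drift_rest \<beta> n k x)))"
    by (simp only: sum_distrib_left distrib_left)
  have main: "norm (\<integral>g. of_real (F' g) * stein_err \<beta> n d t x (ou_vec \<beta> n d t x g) \<partial>gauss_vec d)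
     \<le> gauss_const * (\<Sum>k\<in>{1..d}. ou_mean \<beta> k t * real k *
         ((\<Sum>l\<in>{1..d}. r l * (norm (psum n (k + l) x) + (if l = k then 0 else norm (psum_diff n k l x)))) + norm (drift_rest \<beta> n k x)))"
    unfolding e1 using e2 unfolding e3 .
  have "(\<integral>g. F (ou_vec \<beta> n d t x g) * (2 / real n * Re (stein_err \<beta> n d t x (ou_vec \<beta> n d t x g))) \<partial>gauss_vec d)
      = (\<integral>g. 2 / real n * Re (of_real (F' g) * stein_err \<beta> n d t x (ou_vec \<beta> n d t x g)) \<partial>gauss_vec d)"
    by (intro Bochner_Integration.integral_cong refl) (simp add: F'_def)
  also have "\<dots> = 2 / real n * Re (\<integral>g. of_real (F' g) * stein_err \<beta> n d t x (ou_vec \<beta> n d t x g) \<partial>gauss_vec d)"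
    by (simp only: integral_mult_right_zero integral_Re[OF int])
  finally have eq: "(\<integral>g. F (ou_vec \<beta> n d t x g) * (2 / real n * Re (stein_err \<beta> n d t x (ou_vec \<beta> n d t x g))) \<partial>gauss_vec d)
      = 2 / real n * Re (\<integral>g. of_real (F' g) * stein_err \<beta> n d t x (ou_vec \<beta> n d t x g) \<partial>gauss_vec d)" .
  have "\<bar>Re (\<integral>g. of_real (F' g) * stein_err \<beta> n d t x (ou_vec \<beta> n d t x g) \<partial>gauss_vec d)\<bar>
     \<le> norm (\<integral>g. of_real (F' g) * stein_err \<beta> n d t x (ou_vec \<beta> n d t x g) \<partial>gauss_vec d)" by (rule abs_Re_le_cmod)
  with main have "\<bar>Re (\<integral>g. of_real (F' g) * stein_err \<beta> n d t x (ou_vec \<beta> n d t x g) \<partial>gauss_vec d)\<bar> \<le> gauss_const * (\<Sum>k\<in>{1..d}. ou_mean \<beta> k t * real k *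
         ((\<Sum>l\<in>{1..d}. r l * (norm (psum n (k + l) x) + (if l = k then 0 else norm (psum_diff n k l x)))) + norm (drift_rest \<beta> n k x)))"
    by linarith
  then have "2 / real n * \<bar>Re (\<integral>g. of_real (F' g) * stein_err \<beta> n d t x (ou_vec \<beta> n d t x g) \<partial>gauss_vec d)\<bar> \<le> 2 / real n * (gauss_const * (\<Sum>k\<in>{1..d}. ou_mean \<beta> k t * real k *
         ((\<Sum>l\<in>{1..d}. r l * (norm (psum n (k + l) x) + (if l = k then 0 else norm (psum_diff n k l x)))) + norm (drift_rest \<beta> n k x))))"
    by (intro mult_left_mono) auto
  then show ?thesis unfolding eq abs_mult by (simp add: mult.assoc)
qed

section \<open>First moments of the power sums that occur in the error\<close>

lemma (in prob_space) expectation_norm_le_sqrt: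
  fixes f :: "'a \<Rightarrow> complex"
  assumes [measurable]: "f \<in> borel_measurable M" and B: "\<And>x. norm (f x) \<le> B"
    and A: "expectation (\<lambda>x. (norm (f x))\<^sup>2) \<le> A"
  shows "expectation (\<lambda>x. norm (f x)) \<le> sqrt A"
proof -
  have "(norm (expectation (\<lambda>x. of_real (norm (f x)) * (1 :: complex))))\<^sup>2
     \<le> expectation (\<lambda>x. (norm (complex_of_real (norm (f x))))\<^sup>2) * expectation (\<lambda>x. (norm (1 :: complex))\<^sup>2)"
    by (rule cauchy_schwarz_bounded[where B = B and C = 1]) (use B in auto)
  also have "expectation (\<lambda>x. (norm (1 :: complex))\<^sup>2) = 1" by (simp add: prob_space)
  finally have "(expectation (\<lambda>x. norm (f x)))\<^sup>2 \<le> A"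
    using A by (simp add: integral_complex_of_real power2_eq_square norm_mult)
  moreover have "expectation (\<lambda>x. norm (f x)) \<ge> 0" by (intro integral_nonneg_AE) auto
  ultimately show ?thesis by (intro real_le_rsqrt)
qed

lemma psum_first_moment:
  assumes b: "\<beta> > 0" and n: "n \<ge> 1" and m: "1 \<le> m" "m \<le> 2 * d" and small: "(1 + \<beta>) * real (2 * d) \<le> \<beta> / 4 * real n"
  shows "(\<integral>x. norm (psum n m x) \<partial>cbe \<beta> n) \<le> sqrt (4 / \<beta> * real m)"
proof -
  interpret E: prob_space "cbe \<beta> n" by (rule prob_space_cbe[OF b])
  have "(1 + \<beta>) * real m \<le> \<beta> / 4 * real n"
    using m b by (intro order_trans[OF mult_left_mono small]) auto
  then show ?thesis using psum_second_moment[OF b n m(1)]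
    by (intro E.expectation_norm_le_sqrt[OF _ norm_psum_le]) measurable
qed

lemma psum_diff_first_moment:
  assumes b: "\<beta> > 0" and n: "n \<ge> 1" and kl: "k \<in> {1..d}" "l \<in> {1..d}" "k \<noteq> l"
    and small: "(1 + \<beta>) * real (2 * d) \<le> \<beta> / 4 * real n"
  shows "(\<integral>x. norm (psum_diff n k l x) \<partial>cbe \<beta> n) \<le> sqrt (8 / \<beta> * real d)"
proof -
  define m where "m = (if l \<le> k then k - l else l - k)"
  have m: "1 \<le> m" "m \<le> 2 * d" using kl by (auto simp: m_def)
  have "norm (psum_diff n k l x) = norm (psum n m x)" for x by (simp add: psum_diff_eq m_def)
  then have "(\<integral>x. norm (psum_diff n k l x) \<partial>cbe \<beta> n) \<le> sqrt (4 / \<beta> * real m)"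
    using psum_first_moment[OF b n m small] by simp
  also have "\<dots> \<le> sqrt (8 / \<beta> * real d)" using b m by (simp add: field_simps)
  finally show ?thesis .
qed

text \<open>Each of the fewer than \<open>k\<close> products in the convolution has second moment at
  most \<open>32 / \<beta>^2 * k^2\<close>, so together they give order \<open>k^2\<close>. The
  linear term has order \<open>k * sqrt k\<close> and is absorbed.\<close>

lemma drift_rest_first_moment:
  assumes b: "\<beta> > 0" and n: "n \<ge> 1" and k: "k \<in> {1..d}"
    and small: "(1 + \<beta>) * real (2 * d) \<le> \<beta> / 4 * real n"
  shows "(\<integral>x. norm (drift_rest \<beta> n k x) \<partial>cbe \<beta> n) \<le> (2 * \<bar>1 - \<beta> / 2\<bar> / sqrt \<beta> + sqrt 32 / 2) * (real k)\<^sup>2"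
proof -
  interpret E: prob_space "cbe \<beta> n" by (rule prob_space_cbe[OF b])
  have int: "integrable (cbe \<beta> n) (\<lambda>x. norm (f x))" if "bdd_meas n f" for f
    using bdd_meas_integrable[OF b that] by (rule integrable_norm)
  have k1: "real k \<ge> 1" using k by simp
  have ksm: "(1 + \<beta>) * real k \<le> \<beta> / 4 * real n"
    using k b by (intro order_trans[OF mult_left_mono small]) auto
  have ll: "(\<integral>x. norm (psum n l x * psum n (k - l) x) \<partial>cbe \<beta> n) \<le> sqrt 32 / \<beta> * real k" if l: "l \<in> {1..<k}" for l
  proof -
    have [measurable]: "(\<lambda>x. psum n l x * psum n (k - l) x) \<in> borel_measurable (cbe \<beta> n)" by measurable
    have kl: "l + (k - l) = k" using l by simp
    have "(\<integral>x. (norm (psum n l x * psum n (k - l) x))\<^sup>2 \<partial>cbe \<beta> n) \<le> 32 / \<beta>\<^sup>2 * real l * real (k - l)"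
      by (rule psum_product_second_moment[OF b n]) (use l ksm kl in auto)
    also have "\<dots> \<le> 32 / \<beta>\<^sup>2 * real k * real k" using l by (intro mult_mono mult_left_mono) auto
    finally have "(\<integral>x. norm (psum n l x * psum n (k - l) x) \<partial>cbe \<beta> n) \<le> sqrt (32 / \<beta>\<^sup>2 * real k * real k)"
    proof (rule E.expectation_norm_le_sqrt[rotated 2])
      show "norm (psum n l x * psum n (k - l) x) \<le> real n * real n" for x
        unfolding norm_mult by (intro mult_mono norm_psum_le) auto
    qed measurable
    also have "\<dots> = sqrt 32 / \<beta> * real k" using b by (simp add: real_sqrt_mult real_sqrt_divide)
    finally show ?thesis .
  qed
  have bprod: "bdd_meas n (\<lambda>x. psum n l x * psum n (k - l) x)" for l by (intro bdd_meas_intros)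
  have "(\<integral>x. norm (psum_conv n k x) \<partial>cbe \<beta> n) \<le> (\<integral>x. (\<Sum>l\<in>{1..<k}. norm (psum n l x * psum n (k - l) x)) \<partial>cbe \<beta> n)"
    unfolding psum_conv_def
    by (intro integral_mono int Bochner_Integration.integrable_sum bprod norm_sum bdd_meas_sum)
  also have "\<dots> = (\<Sum>l\<in>{1..<k}. \<integral>x. norm (psum n l x * psum n (k - l) x) \<partial>cbe \<beta> n)"
    by (intro Bochner_Integration.integral_sum int bprod)
  also have "\<dots> \<le> (\<Sum>l\<in>{1..<k}. sqrt 32 / \<beta> * real k)" by (intro sum_mono ll)
  also have "\<dots> \<le> real k * (sqrt 32 / \<beta> * real k)"
    using b by (subst sum_constant) (intro mult_right_mono, auto)
  finally have conv: "(\<integral>x. norm (psum_conv n k x) \<partial>cbe \<beta> n) \<le> sqrt 32 / \<beta> * (real k)\<^sup>2" by (simp add: power2_eq_square mult_ac)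
  have "(\<integral>x. norm (psum n k x) \<partial>cbe \<beta> n) \<le> sqrt (4 / \<beta> * real k)"
    by (rule psum_first_moment[OF b n _ _ small]) (use k in auto)
  also have "\<dots> = 2 / sqrt \<beta> * sqrt (real k)" using b by (simp add: real_sqrt_mult real_sqrt_divide)
  also have "\<dots> \<le> 2 / sqrt \<beta> * real k"
  proof (intro mult_left_mono)
    have "real k * 1 \<le> real k * real k" using k1 by (intro mult_left_mono) auto
    then show "sqrt (real k) \<le> real k" by (intro real_le_lsqrt) (auto simp: power2_eq_square)
  qed (use b in auto)
  finally have p: "(\<integral>x. norm (psum n k x) \<partial>cbe \<beta> n) \<le> 2 / sqrt \<beta> * real k" .
  have "(\<integral>x. norm (drift_rest \<beta> n k x) \<partial>cbe \<beta> n) \<le> (\<integral>x. \<bar>1 - \<beta> / 2\<bar> * real k * norm (psum n k x) + \<beta> / 2 * norm (psum_conv n k x) \<partial>cbe \<beta> n)"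
  proof (rule integral_mono)
    show "integrable (cbe \<beta> n) (\<lambda>x. norm (drift_rest \<beta> n k x))" by (rule int[OF bdd_meas_drift_rest])
    show "integrable (cbe \<beta> n) (\<lambda>x. \<bar>1 - \<beta> / 2\<bar> * real k * norm (psum n k x) + \<beta> / 2 * norm (psum_conv n k x))"
      by (intro Bochner_Integration.integrable_add integrable_mult_right int bdd_meas_psum bdd_meas_psum_conv)
    fix x
    have "norm (of_real (1 - \<beta> / 2) * of_nat k * psum n k x :: complex) = \<bar>1 - \<beta> / 2\<bar> * real k * norm (psum n k x)"
      unfolding norm_mult norm_of_real norm_of_nat ..
    moreover have "norm (of_real (\<beta> / 2) * psum_conv n k x :: complex) = \<beta> / 2 * norm (psum_conv n k x)"
      unfolding norm_mult norm_of_real using b by simp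
    ultimately show "norm (drift_rest \<beta> n k x) \<le> \<bar>1 - \<beta> / 2\<bar> * real k * norm (psum n k x) + \<beta> / 2 * norm (psum_conv n k x)"
      unfolding drift_rest_def using norm_triangle_ineq by metis
  qed
  also have "\<dots> = \<bar>1 - \<beta> / 2\<bar> * real k * (\<integral>x. norm (psum n k x) \<partial>cbe \<beta> n) + \<beta> / 2 * (\<integral>x. norm (psum_conv n k x) \<partial>cbe \<beta> n)"
    using int[OF bdd_meas_psum] int[OF bdd_meas_psum_conv] by simp
  also have "\<dots> \<le> \<bar>1 - \<beta> / 2\<bar> * real k * (2 / sqrt \<beta> * real k) + \<beta> / 2 * (sqrt 32 / \<beta> * (real k)\<^sup>2)"
    using p conv b by (intro add_mono mult_left_mono) auto
  also have "\<dots> = (2 * \<bar>1 - \<beta> / 2\<bar> / sqrt \<beta> + sqrt 32 / 2) * (real k)\<^sup>2"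
    using b by (simp add: power2_eq_square algebra_simps)
  finally show ?thesis .
qed

section \<open>Decay in time of the interpolation coefficients, uniformly in the frequency\<close>

lemma sqrt_exp_bound: "y \<ge> 0 \<Longrightarrow> 2 * sqrt y * exp (- y) \<le> 1"
proof -
  assume y: "y \<ge> 0"
  have "2 * sqrt y \<le> 1 + y" using arith_geo_mean_sqrt[of 1 y] y by simp
  also have "\<dots> \<le> exp y" by (rule exp_ge_add_one_self)
  finally show ?thesis by (simp add: exp_minus field_simps)
qed

text \<open>The exponential is split into two equal factors: one absorbs \<open>sqrt k\<close> at
  the price of \<open>1 / sqrt (\<beta> * t)\<close>, the other keeps exponential decay, with rate
  bounded below by that of \<open>k = 1\<close>.\<close>

lemma ou_mean_le:
  assumes "\<beta> > 0" "t > 0" "k \<ge> 1"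
  shows "ou_mean \<beta> k t \<le> exp (- (\<beta> * t / 4))"
    and "sqrt (real k) * ou_mean \<beta> k t \<le> exp (- (\<beta> * t / 4)) / sqrt (\<beta> * t)"
proof -
  have k: "\<beta> * t * 1 \<le> \<beta> * t * real k" using assms by (intro mult_left_mono) auto
  have bt: "\<beta> * t > 0" using assms by simp
  show "ou_mean \<beta> k t \<le> exp (- (\<beta> * t / 4))" unfolding ou_mean_def using k bt by (simp add: mult_ac)
  define y where "y = \<beta> * t * real k / 4"
  have y0: "y \<ge> 0" using assms by (simp add: y_def)
  have "ou_mean \<beta> k t = exp (- y) * exp (- y)" unfolding ou_mean_def y_def exp_add[symmetric] by (simp add: field_simps)
  have s: "sqrt (\<beta> * t) * sqrt (real k) = 2 * sqrt y"
    by (simp add: y_def real_sqrt_mult real_sqrt_divide)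
  have "sqrt (\<beta> * t) * (sqrt (real k) * ou_mean \<beta> k t) = (2 * sqrt y * exp (- y)) * exp (- y)"
    unfolding mult.assoc[symmetric] s \<open>ou_mean \<beta> k t = _\<close> by simp
  also have "\<dots> \<le> 1 * exp (- (\<beta> * t / 4))"
  proof (rule mult_mono)
    show "exp (- y) \<le> exp (- (\<beta> * t / 4))" using k by (simp add: y_def)
  qed (use sqrt_exp_bound[OF y0] in auto)
  finally show "sqrt (real k) * ou_mean \<beta> k t \<le> exp (- (\<beta> * t / 4)) / sqrt (\<beta> * t)"
    using bt by (simp add: field_simps)
qed

text \<open>With \<open>s = \<beta> * k * t\<close>, the inequality
  \<open>exp (- s) * (1 + s) \<le> 1\<close> bounds the variance from below by
  \<open>2 * t * (a * k)^2\<close>, and the frequency cancels in the quotient.\<close>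

lemma ou_rate_sqrt_le:
  assumes b: "\<beta> > 0" and t: "t > 0" and k: "k \<ge> 1"
  shows "ou_rate \<beta> k t * sqrt (ou_var \<beta> k t) \<le> 1 / sqrt (2 * t)"
proof -
  define a where "a = ou_mean \<beta> k t"
  define v where "v = ou_var \<beta> k t"
  have v: "v > 0" using ou_var_pos[OF b k t] by (simp add: v_def)
  have a: "a > 0" using ou_mean_pos by (simp add: a_def)
  define s where "s = \<beta> * real k * t"
  have s: "s > 0" using b t k by (simp add: s_def)
  have a2: "a\<^sup>2 = exp (- s)" unfolding a_def ou_mean_def s_def power2_eq_square exp_add[symmetric] by simp
  have e: "exp (- s) * (1 + s) \<le> 1"
    using exp_ge_add_one_self[of s] by (simp add: exp_minus field_simps)
  have "a\<^sup>2 * s \<le> 1 - a\<^sup>2" unfolding a2 using e by (simp add: algebra_simps)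
  then have "a\<^sup>2 * s * (2 * real k / \<beta>) \<le> v"
    unfolding v_def ou_var_def a_def[symmetric] using b by (subst mult.commute) (intro mult_left_mono, auto)
  then have "2 * t * (a * real k)\<^sup>2 \<le> v" using b by (simp add: s_def power2_eq_square mult_ac)
  then have le: "(a * real k)\<^sup>2 / v \<le> 1 / (2 * t)" using v t by (simp add: field_simps)
  have "ou_rate \<beta> k t * sqrt (ou_var \<beta> k t) = a * real k / sqrt v"
    unfolding ou_rate_def a_def[symmetric] v_def[symmetric] using v by (simp add: field_simps)
  also have "\<dots> = sqrt ((a * real k)\<^sup>2 / v)" using a by (simp add: real_sqrt_divide)
  also have "\<dots> \<le> sqrt (1 / (2 * t))" using le by simp
  finally show ?thesis by (simp add: real_sqrt_divide)
qed

text \<open>The 4 collects the power sums of index \<open>k + l\<close> and \<open>k - l\<close>,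
  the bracket after it is the constant of \<open>drift_rest_first_moment\<close>, and the last
  factor is the price of replacing \<open>exp (- (\<beta> * t / 4))\<close> by
  \<open>1 / (1 + t)\<close>.\<close>

definition stein_const :: "real \<Rightarrow> real" where
  "stein_const \<beta> = 2 * gauss_const * ((4 + (2 * \<bar>1 - \<beta> / 2\<bar> / sqrt \<beta> + sqrt 32 / 2)) / sqrt \<beta>) * max 1 (4 / \<beta>)"

text \<open>Bounds that hold uniformly for \<open>k \<le> d\<close> are multiplied by the number
  \<open>d\<close> of frequencies: each \<open>k\<close> contributes
  \<open>d^2 * sqrt d / sqrt t\<close>, from the \<open>d\<close> power sums of mean size
  \<open>sqrt d\<close> weighted by \<open>k\<close>, and from the drift remainder.\<close>

lemma stein_term_bound:
  fixes F :: "(nat \<Rightarrow> complex) \<Rightarrow> real"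
  assumes b: "\<beta> > 0" and n: "n \<ge> 1" and t: "t > 0"
    and F: "F \<in> borel_measurable (PiM {1..d} (\<lambda>_. borel))" and FC: "\<And>y. \<bar>F y\<bar> \<le> C"
    and lip: "\<And>y y'. \<bar>F y - F y'\<bar> \<le> (\<Sum>k\<in>{1..d}. norm (y k - y' k))"
    and small: "(1 + \<beta>) * real (2 * d) \<le> \<beta> / 4 * real n"
  shows "\<bar>stein_term \<beta> n d F t\<bar> \<le> stein_const \<beta> * (real d ^ 3 * sqrt (real d)) / real n * (1 / (sqrt t * (1 + t)))"
proof -
  interpret E: prob_space "cbe \<beta> n" by (rule prob_space_cbe[OF b])
  define r where "r = (\<lambda>k. ou_rate \<beta> k t * sqrt (ou_var \<beta> k t))"
  define U where "U = (\<lambda>k x. (\<Sum>l\<in>{1..d}. r l * (norm (psum n (k + l) x) + (if l = k then 0 else norm (psum_diff n k l x)))) + norm (drift_rest \<beta> n k x))"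
  define Cd where "Cd = 2 * \<bar>1 - \<beta> / 2\<bar> / sqrt \<beta> + sqrt 32 / 2"
  define ee where "ee = exp (- (\<beta> * t / 4))"
  define dd where "dd = real d"
  have Cd0: "Cd \<ge> 0" using b by (simp add: Cd_def)
  have spE: "x \<in> space (PiM {1..n} (\<lambda>_. borel :: real measure))" if "x \<in> space (cbe \<beta> n)" for x
    using that sets_eq_imp_space_eq[OF sets_cbe] by simp
  have int: "integrable (cbe \<beta> n) (\<lambda>x. norm (f x))" if "bdd_meas n f" for f
    using bdd_meas_integrable[OF b that] by (rule integrable_norm)
  have intd: "integrable (cbe \<beta> n) (\<lambda>x. if l = k then 0 else norm (psum_diff n k l x))" for k l
    using int[OF bdd_meas_psum_diff] by (cases "l = k") auto
  have iU: "integrable (cbe \<beta> n) (U k)" for k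
    unfolding U_def by (intro Bochner_Integration.integrable_add Bochner_Integration.integrable_sum integrable_mult_right int intd bdd_meas_psum bdd_meas_drift_rest)
  have r0: "r k \<ge> 0" if "k \<in> {1..d}" for k
    using ou_rate_nonneg[OF b t, of k] ou_var_pos[OF b _ t, of k] that by (simp add: r_def)
  have r_le: "r k \<le> 1 / sqrt (2 * t)" if "k \<in> {1..d}" for k
    unfolding r_def using that by (intro ou_rate_sqrt_le b t) auto
  have U_le: "(\<integral>x. U k x \<partial>cbe \<beta> n) \<le> dd * (1 / sqrt (2 * t) * (2 * sqrt (8 / \<beta> * dd))) + Cd * (real k)\<^sup>2" if k: "k \<in> {1..d}" for k
  proof -
    have "(\<integral>x. U k x \<partial>cbe \<beta> n) = (\<Sum>l\<in>{1..d}. r l * ((\<integral>x. norm (psum n (k + l) x) \<partial>cbe \<beta> n) + (\<integral>x. (if l = k then 0 else norm (psum_diff n k l x)) \<partial>cbe \<beta> n)))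
        + (\<integral>x. norm (drift_rest \<beta> n k x) \<partial>cbe \<beta> n)"
      unfolding U_def
      by (subst Bochner_Integration.integral_add Bochner_Integration.integral_sum |
          intro Bochner_Integration.integrable_add Bochner_Integration.integrable_sum integrable_mult_right int intd bdd_meas_psum bdd_meas_drift_rest |
          simp only: integral_mult_right_zero)+
    also have "\<dots> \<le> (\<Sum>l\<in>{1..d}. 1 / sqrt (2 * t) * (sqrt (8 / \<beta> * dd) + sqrt (8 / \<beta> * dd))) + Cd * (real k)\<^sup>2"
    proof (intro add_mono sum_mono mult_mono)
      fix l assume l: "l \<in> {1..d}"
      show "r l \<le> 1 / sqrt (2 * t)" by (rule r_le[OF l])
      have "(\<integral>x. norm (psum n (k + l) x) \<partial>cbe \<beta> n) \<le> sqrt (4 / \<beta> * real (k + l))"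
        by (rule psum_first_moment[OF b n _ _ small]) (use k l in auto)
      also have "\<dots> \<le> sqrt (4 / \<beta> * (2 * dd))"
        using b k l by (intro real_sqrt_le_mono mult_left_mono) (auto simp: dd_def)
      also have "\<dots> = sqrt (8 / \<beta> * dd)" by simp
      finally show "(\<integral>x. norm (psum n (k + l) x) \<partial>cbe \<beta> n) \<le> sqrt (8 / \<beta> * dd)" .
      show "(\<integral>x. (if l = k then 0 else norm (psum_diff n k l x)) \<partial>cbe \<beta> n) \<le> sqrt (8 / \<beta> * dd)"
        using psum_diff_first_moment[OF b n k l _ small] b by (cases "l = k") (auto simp: dd_def)
      show "0 \<le> (\<integral>x. norm (psum n (k + l) x) \<partial>cbe \<beta> n) + (\<integral>x. (if l = k then 0 else norm (psum_diff n k l x)) \<partial>cbe \<beta> n)"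
        by (intro add_nonneg_nonneg integral_nonneg_AE) auto
    next
      show "(\<integral>x. norm (drift_rest \<beta> n k x) \<partial>cbe \<beta> n) \<le> Cd * (real k)\<^sup>2"
        unfolding Cd_def by (rule drift_rest_first_moment[OF b n k small])
    qed (use t in auto)
    finally show ?thesis by (simp add: dd_def)
  qed
  have "\<bar>stein_term \<beta> n d F t\<bar> \<le> (\<integral>x. \<bar>\<integral>g. F (ou_vec \<beta> n d t x g) *
      (2 / real n * Re (stein_err \<beta> n d t x (ou_vec \<beta> n d t x g))) \<partial>gauss_vec d\<bar> \<partial>cbe \<beta> n)"
    unfolding stein_term_def by (rule integral_abs_bound)
  also have "\<dots> \<le> (\<integral>x. 2 / real n * gauss_const * (\<Sum>k\<in>{1..d}. ou_mean \<beta> k t * real k * U k x) \<partial>cbe \<beta> n)"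
  proof (rule integral_mono_AE')
    show "integrable (cbe \<beta> n) (\<lambda>x. 2 / real n * gauss_const * (\<Sum>k\<in>{1..d}. ou_mean \<beta> k t * real k * U k x))"
      by (intro integrable_mult_right Bochner_Integration.integrable_sum iU)
    show le: "AE x in cbe \<beta> n. \<bar>\<integral>g. F (ou_vec \<beta> n d t x g) *
      (2 / real n * Re (stein_err \<beta> n d t x (ou_vec \<beta> n d t x g))) \<partial>gauss_vec d\<bar> \<le> 2 / real n * gauss_const * (\<Sum>k\<in>{1..d}. ou_mean \<beta> k t * real k * U k x)"
      using stein_err_gauss_bound[OF b t F FC lip spE] unfolding U_def r_def by (intro AE_I2)
    show "AE x in cbe \<beta> n. 0 \<le> 2 / real n * gauss_const * (\<Sum>k\<in>{1..d}. ou_mean \<beta> k t * real k * U k x)"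
      using le by eventually_elim (rule order_trans[OF abs_ge_zero])
  qed
  also have "\<dots> = 2 / real n * gauss_const * (\<Sum>k\<in>{1..d}. ou_mean \<beta> k t * real k * (\<integral>x. U k x \<partial>cbe \<beta> n))"
    by (subst integral_mult_right_zero, subst Bochner_Integration.integral_sum) (auto intro!: integrable_mult_right iU)
  also have "\<dots> \<le> 2 / real n * gauss_const * (\<Sum>k\<in>{1..d}. dd\<^sup>2 * sqrt dd * ((4 + Cd) / sqrt \<beta> * (ee / sqrt t)))"
  proof (intro mult_left_mono sum_mono)
    fix k assume k: "k \<in> {1..d}"
    have k1: "k \<ge> 1" and kd: "real k \<le> dd" and d1: "dd \<ge> 1" using k by (auto simp: dd_def)
    have a0: "ou_mean \<beta> k t > 0" by (rule ou_mean_pos)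
    have "ou_mean \<beta> k t * real k * (\<integral>x. U k x \<partial>cbe \<beta> n)
       \<le> ou_mean \<beta> k t * real k * (dd * (1 / sqrt (2 * t) * (2 * sqrt (8 / \<beta> * dd))) + Cd * (real k)\<^sup>2)"
      using U_le[OF k] a0 by (intro mult_left_mono) auto
    \<comment> \<open>In \<open>k^3 * ou_mean\<close> one factor \<open>sqrt k\<close> is paired
      with \<open>ou_mean\<close> to produce \<open>1 / sqrt t\<close>; the remaining
      \<open>k^2 * sqrt k\<close> is bounded through \<open>k \<le> d\<close>.\<close>
    also have "\<dots> = ou_mean \<beta> k t * real k * (dd * (1 / sqrt (2 * t) * (2 * sqrt (8 / \<beta> * dd)))) + Cd * ((real k)\<^sup>2 * (sqrt (real k) * (sqrt (real k) * ou_mean \<beta> k t)))"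
      by (simp add: algebra_simps power2_eq_square)
    also have "\<dots> \<le> ee * dd * (dd * (1 / sqrt (2 * t) * (2 * sqrt (8 / \<beta> * dd)))) + Cd * (dd\<^sup>2 * (sqrt dd * (ee / sqrt (\<beta> * t))))"
      using ou_mean_le[OF b t k1] a0 kd d1 Cd0 b t unfolding ee_def
      by (intro add_mono mult_mono mult_left_mono) auto
    also have "1 / sqrt (2 * t) * (2 * sqrt (8 / \<beta> * dd)) = 4 / sqrt \<beta> * (sqrt dd / sqrt t)"
    proof -
      have "sqrt 8 = 2 * sqrt 2" using real_sqrt_mult[of 4 2] by simp
      then show ?thesis by (simp add: real_sqrt_mult real_sqrt_divide)
    qed
    also have "ee * dd * (dd * (4 / sqrt \<beta> * (sqrt dd / sqrt t))) + Cd * (dd\<^sup>2 * (sqrt dd * (ee / sqrt (\<beta> * t))))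
        = dd\<^sup>2 * sqrt dd * ((4 + Cd) / sqrt \<beta> * (ee / sqrt t))"
      using b t by (simp add: real_sqrt_mult power2_eq_square field_simps)
    finally show "ou_mean \<beta> k t * real k * (\<integral>x. U k x \<partial>cbe \<beta> n) \<le> dd\<^sup>2 * sqrt dd * ((4 + Cd) / sqrt \<beta> * (ee / sqrt t))" .
  qed (use gauss_const_ge(4) in auto)
  also have "\<dots> = (2 / real n * gauss_const * (dd ^ 3 * sqrt dd) * ((4 + Cd) / sqrt \<beta>)) * (ee / sqrt t)"
    by (simp add: dd_def power2_eq_square power3_eq_cube)
  also have "\<dots> \<le> (2 / real n * gauss_const * (dd ^ 3 * sqrt dd) * ((4 + Cd) / sqrt \<beta>)) * (max 1 (4 / \<beta>) * (1 / (sqrt t * (1 + t))))"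
  proof (rule mult_left_mono)
    \<comment> \<open>Exponential decay is weakened to \<open>1 / (1 + t)\<close> so that the time
      integral has an elementary primitive.\<close>
    have "1 + t \<le> max 1 (4 / \<beta>) * (1 + \<beta> * t / 4)"
    proof -
      have "max 1 (4 / \<beta>) * (1 + \<beta> * t / 4) = max 1 (4 / \<beta>) + max 1 (4 / \<beta>) * (\<beta> * t / 4)" by (simp add: algebra_simps)
      moreover have "(4 / \<beta>) * (\<beta> * t / 4) \<le> max 1 (4 / \<beta>) * (\<beta> * t / 4)" using b t by (intro mult_right_mono) auto
      moreover have "(4 / \<beta>) * (\<beta> * t / 4) = t" "max 1 (4 / \<beta>) \<ge> 1" using b by auto
      ultimately show ?thesis by linarith
    qed
    also have "\<dots> \<le> max 1 (4 / \<beta>) * exp (\<beta> * t / 4)" by (intro mult_left_mono exp_ge_add_one_self) auto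
    finally have "ee * (1 + t) \<le> max 1 (4 / \<beta>)" unfolding ee_def by (simp add: exp_minus field_simps)
    then have "ee \<le> max 1 (4 / \<beta>) / (1 + t)" using t by (simp add: field_simps)
    then have "ee / sqrt t \<le> max 1 (4 / \<beta>) / (1 + t) / sqrt t" using t by (intro divide_right_mono) auto
    then show "ee / sqrt t \<le> max 1 (4 / \<beta>) * (1 / (sqrt t * (1 + t)))" by (simp add: mult.commute)
  qed (use gauss_const_ge(4) Cd0 b in \<open>auto simp: dd_def intro!: mult_nonneg_nonneg divide_nonneg_nonneg\<close>)
  also have "\<dots> = stein_const \<beta> * (real d ^ 3 * sqrt (real d)) / real n * (1 / (sqrt t * (1 + t)))"
    unfolding stein_const_def Cd_def[symmetric] dd_def[symmetric] by (simp add: mult_ac)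
  finally show ?thesis .
qed

section \<open>The endpoints of the interpolation\<close>

lemma power_sums_eq: "power_sums n d x = (\<lambda>k\<in>{1..d}. psum n k x)"
proof -
  have "exp (\<i> * of_nat k * of_real a) = cis a ^ k" for k a
    by (simp add: cis_conv_exp exp_of_nat_mult[symmetric] mult_ac)
  then show ?thesis by (simp add: power_sums_def psum_def)
qed

lemma power_sums_measurable:
  "power_sums n d \<in> measurable (PiM {1..n} (\<lambda>_. borel)) (PiM {1..d} (\<lambda>_. borel))"
  unfolding power_sums_eq[abs_def] by measurable

lemma scaled_gaussians_measurable:
  "scaled_gaussians \<beta> d \<in> measurable (PiM {1..d} (\<lambda>_. borel)) (PiM {1..d} (\<lambda>_. borel))"
  unfolding scaled_gaussians_def[abs_def] by measurable

abbreviation gauss_abs :: real where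
  "gauss_abs \<equiv> (\<integral>z. norm z \<partial>std_complex_gaussian)"

text \<open>The interpolating vector is compared with either endpoint by using the same angles and
  the same noise. The crude bound \<open>n\<close> on the power sums is enough, since at fixed
  \<open>n\<close> and \<open>d\<close> only limits in \<open>t\<close> are taken.\<close>

lemma
  fixes F :: "(nat \<Rightarrow> complex) \<Rightarrow> real"
  assumes b: "\<beta> > 0" and t: "t > 0"
    and F: "F \<in> borel_measurable (PiM {1..d} (\<lambda>_. borel))" and FC: "\<And>y. \<bar>F y\<bar> \<le> C"
    and lip: "\<And>y y'. \<bar>F y - F y'\<bar> \<le> (\<Sum>k\<in>{1..d}. norm (y k - y' k))"
  shows smooth_exp_small_time: "\<bar>smooth_exp \<beta> n d F t - (\<integral>x. F (power_sums n d x) \<partial>cbe \<beta> n)\<bar>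
      \<le> (\<Sum>k\<in>{1..d}. (1 - ou_mean \<beta> k t) * real n + sqrt (ou_var \<beta> k t) * gauss_abs)" (is ?small)
    and smooth_exp_large_time: "\<bar>smooth_exp \<beta> n d F t - (\<integral>g. F (scaled_gaussians \<beta> d g) \<partial>gauss_vec d)\<bar>
      \<le> (\<Sum>k\<in>{1..d}. ou_mean \<beta> k t * real n + (sqrt (2 / \<beta> * real k) - sqrt (ou_var \<beta> k t)) * gauss_abs)" (is ?large)
proof -
  interpret E: prob_space "cbe \<beta> n" by (rule prob_space_cbe[OF b])
  interpret G: prob_space "gauss_vec d" by (rule prob_space_gauss_vec)
  note [measurable] = F
  have ovj: "(\<lambda>w. ou_vec \<beta> n d t (fst w) (snd w)) \<in> measurable (cbe \<beta> n \<Otimes>\<^sub>M gauss_vec d) (PiM {1..d} (\<lambda>_. borel))"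
    unfolding ou_vec_def by measurable
  have inner_m[measurable]: "(\<lambda>x. \<integral>g. F (ou_vec \<beta> n d t x g) \<partial>gauss_vec d) \<in> borel_measurable (cbe \<beta> n)"
    using measurable_compose[OF ovj F] by (intro G.borel_measurable_lebesgue_integral) (simp add: case_prod_beta')
  have gF: "integrable (gauss_vec d) (\<lambda>g. F (ou_vec \<beta> n d t x g))" for x
    using FC measurable_compose[OF ou_vec_measurable F] by (intro G.integrable_const_bound[of _ C]) auto
  have inner_C: "\<bar>\<integral>g. F (ou_vec \<beta> n d t x g) \<partial>gauss_vec d\<bar> \<le> C" for x
  proof -
    have "\<bar>\<integral>g. F (ou_vec \<beta> n d t x g) \<partial>gauss_vec d\<bar> \<le> (\<integral>g. \<bar>F (ou_vec \<beta> n d t x g)\<bar> \<partial>gauss_vec d)" by (rule integral_abs_bound)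
    also have "\<dots> \<le> (\<integral>g. C \<partial>gauss_vec d)" by (intro integral_mono integrable_abs gF G.integrable_const) (use FC in auto)
    also have "\<dots> = C" using G.prob_space by simp
    finally show ?thesis .
  qed
  have innerI: "integrable (cbe \<beta> n) (\<lambda>x. \<integral>g. F (ou_vec \<beta> n d t x g) \<partial>gauss_vec d)"
    by (rule E.integrable_const_bound[OF _ inner_m, of C]) (use inner_C in \<open>simp add: always_eventually\<close>)
  have comp: "integrable (gauss_vec d) (\<lambda>g. norm (g k))" "(\<integral>g. norm (g k) \<partial>gauss_vec d) = gauss_abs" if "k \<in> {1..d}" for k
    using integrable_gauss_vec_component[OF integrable_std_complex_gaussian_moments(1) that]
      integral_gauss_vec_component[OF integrable_std_complex_gaussian_moments(1) that] by auto
  have est: "\<bar>(\<integral>g. F (ou_vec \<beta> n d t x g) \<partial>gauss_vec d) - (\<integral>g. F (h g) \<partial>gauss_vec d)\<bar> \<le> (\<Sum>k\<in>{1..d}. p k + q k * gauss_abs)"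
    if hi: "integrable (gauss_vec d) (\<lambda>g. F (h g))"
      and le: "\<And>k g. k \<in> {1..d} \<Longrightarrow> norm (ou_vec \<beta> n d t x g k - h g k) \<le> p k + q k * norm (g k)"
    for x h and p q :: "nat \<Rightarrow> real"
  proof -
    have "(\<integral>g. F (ou_vec \<beta> n d t x g) \<partial>gauss_vec d) - (\<integral>g. F (h g) \<partial>gauss_vec d) = (\<integral>g. F (ou_vec \<beta> n d t x g) - F (h g) \<partial>gauss_vec d)"
      using gF hi by simp
    also have "\<bar>\<dots>\<bar> \<le> (\<integral>g. \<bar>F (ou_vec \<beta> n d t x g) - F (h g)\<bar> \<partial>gauss_vec d)" by (rule integral_abs_bound)
    also have "\<dots> \<le> (\<integral>g. (\<Sum>k\<in>{1..d}. p k + q k * norm (g k)) \<partial>gauss_vec d)"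
    proof (rule integral_mono)
      show "integrable (gauss_vec d) (\<lambda>g. \<bar>F (ou_vec \<beta> n d t x g) - F (h g)\<bar>)" using gF hi by auto
      show "integrable (gauss_vec d) (\<lambda>g. \<Sum>k\<in>{1..d}. p k + q k * norm (g k))"
        using comp(1) by (intro Bochner_Integration.integrable_sum Bochner_Integration.integrable_add G.integrable_const integrable_mult_right)
      fix g
      show "\<bar>F (ou_vec \<beta> n d t x g) - F (h g)\<bar> \<le> (\<Sum>k\<in>{1..d}. p k + q k * norm (g k))"
        by (rule order_trans[OF lip]) (intro sum_mono le)
    qed
    also have "\<dots> = (\<Sum>k\<in>{1..d}. \<integral>g. p k + q k * norm (g k) \<partial>gauss_vec d)"
      using comp(1) by (intro Bochner_Integration.integral_sum Bochner_Integration.integrable_add G.integrable_const integrable_mult_right)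
    also have "\<dots> = (\<Sum>k\<in>{1..d}. p k + q k * gauss_abs)"
    proof (rule sum.cong[OF refl])
      fix k assume k: "k \<in> {1..d}"
      have "(\<integral>g. p k + q k * norm (g k) \<partial>gauss_vec d) = (\<integral>g. p k \<partial>gauss_vec d) + q k * (\<integral>g. norm (g k) \<partial>gauss_vec d)"
        using Bochner_Integration.integral_add[OF G.integrable_const[of "p k"] integrable_mult_right[OF comp(1)[OF k], of "q k"]] by simp
      also have "(\<integral>g. p k \<partial>gauss_vec d) = p k" using G.prob_space by simp
      finally show "(\<integral>g. p k + q k * norm (g k) \<partial>gauss_vec d) = p k + q k * gauss_abs" using comp(2)[OF k] by simp
    qed
    finally show ?thesis .
  qed
  have avg: "\<bar>smooth_exp \<beta> n d F t - (\<integral>x. h x \<partial>cbe \<beta> n)\<bar> \<le> K"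
    if hi: "integrable (cbe \<beta> n) h" and le: "\<And>x. \<bar>(\<integral>g. F (ou_vec \<beta> n d t x g) \<partial>gauss_vec d) - h x\<bar> \<le> K" for h K
  proof -
    have "smooth_exp \<beta> n d F t - (\<integral>x. h x \<partial>cbe \<beta> n) = (\<integral>x. (\<integral>g. F (ou_vec \<beta> n d t x g) \<partial>gauss_vec d) - h x \<partial>cbe \<beta> n)"
      unfolding smooth_exp_def using innerI hi by simp
    also have "\<bar>\<dots>\<bar> \<le> (\<integral>x. \<bar>(\<integral>g. F (ou_vec \<beta> n d t x g) \<partial>gauss_vec d) - h x\<bar> \<partial>cbe \<beta> n)" by (rule integral_abs_bound)
    also have "\<dots> \<le> (\<integral>x. K \<partial>cbe \<beta> n)" using innerI hi le by (intro integral_mono) auto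
    also have "\<dots> = K" using E.prob_space by simp
    finally show ?thesis .
  qed
  have a: "0 \<le> ou_mean \<beta> k t" "ou_mean \<beta> k t \<le> 1" for k using ou_mean_pos[of \<beta> k t] ou_mean_le_one[OF b, of t k] t by auto
  have v: "0 \<le> ou_var \<beta> k t" if "k \<in> {1..d}" for k using ou_var_pos[OF b _ t, of k] that by simp
  show ?small
  proof (rule avg)
    have "(\<lambda>x. F (power_sums n d x)) \<in> borel_measurable (cbe \<beta> n)"
      using measurable_compose[OF power_sums_measurable F] measurable_cong_sets[OF sets_cbe refl] by blast
    then show "integrable (cbe \<beta> n) (\<lambda>x. F (power_sums n d x))"
      using FC by (intro E.integrable_const_bound[of _ C]) auto
    fix x
    have c: "(\<integral>g. F (power_sums n d x) \<partial>gauss_vec d) = F (power_sums n d x)" using G.prob_space by simp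
    have "\<bar>(\<integral>g. F (ou_vec \<beta> n d t x g) \<partial>gauss_vec d) - (\<integral>g. F (power_sums n d x) \<partial>gauss_vec d)\<bar>
       \<le> (\<Sum>k\<in>{1..d}. (1 - ou_mean \<beta> k t) * real n + sqrt (ou_var \<beta> k t) * gauss_abs)"
    proof (rule est)
      fix k g assume k: "k \<in> {1..d}"
      have "ou_vec \<beta> n d t x g k - power_sums n d x k = of_real (- (1 - ou_mean \<beta> k t)) * psum n k x + of_real (sqrt (ou_var \<beta> k t)) * g k"
        using k by (simp add: ou_vec_def power_sums_eq algebra_simps)
      also have "norm \<dots> \<le> (1 - ou_mean \<beta> k t) * norm (psum n k x) + sqrt (ou_var \<beta> k t) * norm (g k)"
        using a[of k] v[OF k] by (intro order_trans[OF norm_triangle_ineq]) (simp add: norm_mult del: of_real_minus of_real_diff)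
      also have "\<dots> \<le> (1 - ou_mean \<beta> k t) * real n + sqrt (ou_var \<beta> k t) * norm (g k)"
        using a[of k] norm_psum_le by (intro add_right_mono mult_left_mono) auto
      finally show "norm (ou_vec \<beta> n d t x g k - power_sums n d x k) \<le> (1 - ou_mean \<beta> k t) * real n + sqrt (ou_var \<beta> k t) * norm (g k)" .
    qed (rule G.integrable_const)
    then show "\<bar>(\<integral>g. F (ou_vec \<beta> n d t x g) \<partial>gauss_vec d) - F (power_sums n d x)\<bar>
       \<le> (\<Sum>k\<in>{1..d}. (1 - ou_mean \<beta> k t) * real n + sqrt (ou_var \<beta> k t) * gauss_abs)" unfolding c .
  qed
  have c: "(\<integral>x. (\<integral>g. F (scaled_gaussians \<beta> d g) \<partial>gauss_vec d) \<partial>cbe \<beta> n) = (\<integral>g. F (scaled_gaussians \<beta> d g) \<partial>gauss_vec d)"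
    using E.prob_space by simp
  have "\<bar>smooth_exp \<beta> n d F t - (\<integral>x. (\<integral>g. F (scaled_gaussians \<beta> d g) \<partial>gauss_vec d) \<partial>cbe \<beta> n)\<bar>
      \<le> (\<Sum>k\<in>{1..d}. ou_mean \<beta> k t * real n + (sqrt (2 / \<beta> * real k) - sqrt (ou_var \<beta> k t)) * gauss_abs)"
  proof (rule avg)
    fix x
    show "\<bar>(\<integral>g. F (ou_vec \<beta> n d t x g) \<partial>gauss_vec d) - (\<integral>g. F (scaled_gaussians \<beta> d g) \<partial>gauss_vec d)\<bar>
       \<le> (\<Sum>k\<in>{1..d}. ou_mean \<beta> k t * real n + (sqrt (2 / \<beta> * real k) - sqrt (ou_var \<beta> k t)) * gauss_abs)"
    proof (rule est)
      have "(\<lambda>g. F (scaled_gaussians \<beta> d g)) \<in> borel_measurable (gauss_vec d)"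
        using measurable_compose[OF scaled_gaussians_measurable F] measurable_cong_sets[OF sets_gauss_vec refl] by blast
      then show "integrable (gauss_vec d) (\<lambda>g. F (scaled_gaussians \<beta> d g))"
        using FC by (intro G.integrable_const_bound[of _ C]) auto
      fix k g assume k: "k \<in> {1..d}"
      have vv: "sqrt (ou_var \<beta> k t) \<le> sqrt (2 / \<beta> * real k)" using ou_var_le[OF b, of k t] by simp
      have "ou_vec \<beta> n d t x g k - scaled_gaussians \<beta> d g k = of_real (ou_mean \<beta> k t) * psum n k x + of_real (- (sqrt (2 / \<beta> * real k) - sqrt (ou_var \<beta> k t))) * g k"
        using k by (simp add: ou_vec_def scaled_gaussians_def algebra_simps)
      also have "norm \<dots> \<le> ou_mean \<beta> k t * norm (psum n k x) + (sqrt (2 / \<beta> * real k) - sqrt (ou_var \<beta> k t)) * norm (g k)"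
        using a[of k] vv by (intro order_trans[OF norm_triangle_ineq]) (simp add: norm_mult del: of_real_minus of_real_diff)
      also have "\<dots> \<le> ou_mean \<beta> k t * real n + (sqrt (2 / \<beta> * real k) - sqrt (ou_var \<beta> k t)) * norm (g k)"
        using a[of k] norm_psum_le by (intro add_right_mono mult_left_mono) auto
      finally show "norm (ou_vec \<beta> n d t x g k - scaled_gaussians \<beta> d g k) \<le> ou_mean \<beta> k t * real n + (sqrt (2 / \<beta> * real k) - sqrt (ou_var \<beta> k t)) * norm (g k)" .
    qed
  qed simp
  then show ?large unfolding c .
qed

text \<open>The bound on the time derivative is integrated from \<open>t1\<close> to
  \<open>t2\<close>, uniformly in both, and then \<open>t1\<close> tends to 0 and \<open>t2\<close>
  to infinity along \<open>1 / (i + 1)\<close> and \<open>i + 1\<close>.\<close>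

theorem lipschitz_gap:
  fixes F :: "(nat \<Rightarrow> complex) \<Rightarrow> real"
  assumes b: "\<beta> > 0" and n: "n \<ge> 1"
    and F: "F \<in> borel_measurable (PiM {1..d} (\<lambda>_. borel))" and FC: "\<And>y. \<bar>F y\<bar> \<le> C"
    and lip: "\<And>y y'. \<bar>F y - F y'\<bar> \<le> (\<Sum>k\<in>{1..d}. norm (y k - y' k))"
    and small: "(1 + \<beta>) * real (2 * d) \<le> \<beta> / 4 * real n"
  shows "\<bar>(\<integral>x. F (power_sums n d x) \<partial>cbe \<beta> n) - (\<integral>g. F (scaled_gaussians \<beta> d g) \<partial>gauss_vec d)\<bar>
     \<le> stein_const \<beta> * pi * (real d ^ 3 * sqrt (real d)) / real n"
proof -
  define K where "K = stein_const \<beta> * (real d ^ 3 * sqrt (real d)) / real n"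
  have K0: "K \<ge> 0" unfolding K_def stein_const_def using gauss_const_ge(4) b
    by (intro divide_nonneg_nonneg mult_nonneg_nonneg add_nonneg_nonneg) auto
  have incr: "\<bar>smooth_exp \<beta> n d F t2 - smooth_exp \<beta> n d F t1\<bar> \<le> K * pi" if t: "0 < t1" "t1 \<le> t2" for t1 t2
  proof -
    \<comment> \<open>The function \<open>1 / (sqrt s * (1 + s))\<close> has the primitive
      \<open>2 * arctan (sqrt s)\<close>, whose total increase over the positive half-line is
      \<open>pi\<close>.\<close>
    have ftc: "has_bochner_integral lborel (\<lambda>s. K * (1 / (sqrt s * (1 + s))) * indicator {t1..t2} s) (2 * K * arctan (sqrt t2) - 2 * K * arctan (sqrt t1))"
    proof (rule has_bochner_integral_FTC_Icc_real[OF t(2)])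
      fix s assume "t1 \<le> s" "s \<le> t2"
      then have s: "s > 0" using t by simp
      show "((\<lambda>s. 2 * K * arctan (sqrt s)) has_real_derivative K * (1 / (sqrt s * (1 + s)))) (at s)"
      proof (rule DERIV_cong)
        show "((\<lambda>s. 2 * K * arctan (sqrt s)) has_real_derivative 2 * K * (inverse (1 + (sqrt s)\<^sup>2) * (inverse (sqrt s) / 2))) (at s)"
          using s by (intro DERIV_cmult DERIV_chain2[OF DERIV_arctan] DERIV_real_sqrt)
        have "(sqrt s)\<^sup>2 = s" using s by simp
        then have "2 * K * (inverse (1 + (sqrt s)\<^sup>2) * (inverse (sqrt s) / 2)) = K * (inverse (sqrt s) * inverse (1 + s))"
          by (simp only: mult.assoc) simp
        also have "\<dots> = K * (1 / (sqrt s * (1 + s)))" by (simp only: divide_inverse inverse_mult_distrib mult_1)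
        finally show "2 * K * (inverse (1 + (sqrt s)\<^sup>2) * (inverse (sqrt s) / 2)) = K * (1 / (sqrt s * (1 + s)))" .
      qed
      show "isCont (\<lambda>s. K * (1 / (sqrt s * (1 + s)))) s"
        using s by (intro continuous_intros) auto
    qed
    have "\<bar>smooth_exp \<beta> n d F t2 - smooth_exp \<beta> n d F t1\<bar> \<le> (\<integral>s. \<bar>indicator {t1..t2} s * stein_term \<beta> n d F s\<bar> \<partial>lborel)"
      unfolding interpolation(2)[OF b n t F FC] by (rule integral_abs_bound)
    also have "\<dots> \<le> (\<integral>s. K * (1 / (sqrt s * (1 + s))) * indicator {t1..t2} s \<partial>lborel)"
    proof (rule integral_mono)
      show "integrable lborel (\<lambda>s. \<bar>indicator {t1..t2} s * stein_term \<beta> n d F s\<bar>)"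
        using interpolation(1)[OF b n t F FC] by (rule integrable_abs)
      show "integrable lborel (\<lambda>s. K * (1 / (sqrt s * (1 + s))) * indicator {t1..t2} s)"
        using ftc by (rule integrable.intros)
      fix s :: real
      show "\<bar>indicator {t1..t2} s * stein_term \<beta> n d F s\<bar> \<le> K * (1 / (sqrt s * (1 + s))) * indicator {t1..t2} s"
      proof (cases "s \<in> {t1..t2}")
        case True
        then have "s > 0" using t by simp
        from stein_term_bound[OF b n this F FC lip small] show ?thesis using True by (simp add: K_def)
      qed simp
    qed
    also have "\<dots> = 2 * K * arctan (sqrt t2) - 2 * K * arctan (sqrt t1)"
      using ftc by (rule has_bochner_integral_integral_eq)
    also have "\<dots> \<le> K * pi"
    proof -
      have "arctan (sqrt t2) \<le> pi / 2" "0 \<le> arctan (sqrt t1)" using arctan_ubound[of "sqrt t2"] t by (auto intro: less_imp_le)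
      then have "2 * K * arctan (sqrt t2) \<le> 2 * K * (pi / 2)" "0 \<le> 2 * K * arctan (sqrt t1)"
        using K0 by (intro mult_left_mono mult_nonneg_nonneg; simp)+
      then show ?thesis by simp
    qed
    finally show ?thesis .
  qed
  define A where "A = (\<integral>x. F (power_sums n d x) \<partial>cbe \<beta> n)"
  define B where "B = (\<integral>g. F (scaled_gaussians \<beta> d g) \<partial>gauss_vec d)"
  have l0: "(\<lambda>i. 1 / real (Suc i)) \<longlonglongrightarrow> 0" by (rule LIMSEQ_Suc[OF lim_const_over_n[of 1]])
  have m0: "(\<lambda>i. ou_mean \<beta> k (1 / real (Suc i))) \<longlonglongrightarrow> 1" for k
  proof -
    have "(\<lambda>i. exp (- (\<beta> * real k * (1 / real (Suc i)) / 2))) \<longlonglongrightarrow> exp (- (\<beta> * real k * 0 / 2))"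
      by (intro tendsto_intros l0) auto
    then show ?thesis by (simp add: ou_mean_def)
  qed
  have mi: "(\<lambda>i. ou_mean \<beta> k (real (Suc i))) \<longlonglongrightarrow> 0" if "k \<in> {1..d}" for k
  proof -
    have "ou_mean \<beta> k (real (Suc i)) = exp (- (\<beta> * real k / 2)) ^ Suc i" for i
      unfolding exp_of_nat_mult[symmetric] ou_mean_def by (simp add: field_simps)
    moreover have "(\<lambda>i. exp (- (\<beta> * real k / 2)) ^ Suc i) \<longlonglongrightarrow> 0"
      using b that by (intro LIMSEQ_Suc LIMSEQ_realpow_zero) auto
    ultimately show ?thesis by simp
  qed
  have v0: "(\<lambda>i. ou_var \<beta> k (1 / real (Suc i))) \<longlonglongrightarrow> 2 * real k / \<beta> * (1 - 1\<^sup>2)" for k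
    unfolding ou_var_def by (intro tendsto_intros m0)
  have vi: "(\<lambda>i. ou_var \<beta> k (real (Suc i))) \<longlonglongrightarrow> 2 * real k / \<beta> * (1 - 0\<^sup>2)" if "k \<in> {1..d}" for k
    unfolding ou_var_def by (intro tendsto_intros mi that)
  have S0: "(\<lambda>i. smooth_exp \<beta> n d F (1 / real (Suc i)) - A) \<longlonglongrightarrow> 0"
  proof (rule Lim_null_comparison)
    show "\<forall>\<^sub>F i in sequentially. norm (smooth_exp \<beta> n d F (1 / real (Suc i)) - A)
        \<le> (\<Sum>k\<in>{1..d}. (1 - ou_mean \<beta> k (1 / real (Suc i))) * real n + sqrt (ou_var \<beta> k (1 / real (Suc i))) * gauss_abs)"
      unfolding real_norm_def A_def using smooth_exp_small_time[OF b _ F FC lip, of _ n] by (intro always_eventually) auto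
    have "(\<lambda>i. \<Sum>k\<in>{1..d}. (1 - ou_mean \<beta> k (1 / real (Suc i))) * real n + sqrt (ou_var \<beta> k (1 / real (Suc i))) * gauss_abs)
       \<longlonglongrightarrow> (\<Sum>k\<in>{1..d}. (1 - 1) * real n + sqrt (2 * real k / \<beta> * (1 - 1\<^sup>2)) * gauss_abs)"
      by (intro tendsto_intros m0 v0)
    then show "(\<lambda>i. \<Sum>k\<in>{1..d}. (1 - ou_mean \<beta> k (1 / real (Suc i))) * real n + sqrt (ou_var \<beta> k (1 / real (Suc i))) * gauss_abs) \<longlonglongrightarrow> 0"
      by simp
  qed
  have Si: "(\<lambda>i. smooth_exp \<beta> n d F (real (Suc i)) - B) \<longlonglongrightarrow> 0"
  proof (rule Lim_null_comparison)
    show "\<forall>\<^sub>F i in sequentially. norm (smooth_exp \<beta> n d F (real (Suc i)) - B)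
        \<le> (\<Sum>k\<in>{1..d}. ou_mean \<beta> k (real (Suc i)) * real n + (sqrt (2 / \<beta> * real k) - sqrt (ou_var \<beta> k (real (Suc i)))) * gauss_abs)"
      unfolding real_norm_def B_def using smooth_exp_large_time[OF b _ F FC lip, of _ n] by (intro always_eventually) auto
    have "(\<lambda>i. \<Sum>k\<in>{1..d}. ou_mean \<beta> k (real (Suc i)) * real n + (sqrt (2 / \<beta> * real k) - sqrt (ou_var \<beta> k (real (Suc i)))) * gauss_abs)
       \<longlonglongrightarrow> (\<Sum>k\<in>{1..d}. 0 * real n + (sqrt (2 / \<beta> * real k) - sqrt (2 * real k / \<beta> * (1 - 0\<^sup>2))) * gauss_abs)"
      by (intro tendsto_intros mi vi)
    then show "(\<lambda>i. \<Sum>k\<in>{1..d}. ou_mean \<beta> k (real (Suc i)) * real n + (sqrt (2 / \<beta> * real k) - sqrt (ou_var \<beta> k (real (Suc i)))) * gauss_abs) \<longlonglongrightarrow> 0"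
      by simp
  qed
  have "(\<lambda>i. K * pi + \<bar>smooth_exp \<beta> n d F (real (Suc i)) - B\<bar> + \<bar>smooth_exp \<beta> n d F (1 / real (Suc i)) - A\<bar>) \<longlonglongrightarrow> K * pi + \<bar>0\<bar> + \<bar>0\<bar>"
    by (intro tendsto_intros S0 Si)
  moreover have "\<bar>A - B\<bar> \<le> K * pi + \<bar>smooth_exp \<beta> n d F (real (Suc i)) - B\<bar> + \<bar>smooth_exp \<beta> n d F (1 / real (Suc i)) - A\<bar>" for i
  proof -
    have "\<bar>smooth_exp \<beta> n d F (real (Suc i)) - smooth_exp \<beta> n d F (1 / real (Suc i))\<bar> \<le> K * pi"
    proof (rule incr)
      have "1 / real (Suc i) \<le> 1" by simp
      also have "1 \<le> real (Suc i)" by simp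
      finally show "1 / real (Suc i) \<le> real (Suc i)" .
    qed simp
    then show ?thesis by linarith
  qed
  ultimately have "\<bar>A - B\<bar> \<le> K * pi + \<bar>0\<bar> + \<bar>0\<bar>"
    by (intro LIMSEQ_le_const) auto
  then show ?thesis by (simp add: A_def B_def K_def mult_ac)
qed

subsection \<open>The ordered ensemble and the two laws\<close>

text \<open>The rank of an angle among all angles is a bijection of \<open>{1..n}\<close> when the
  angles are distinct, and a permutation sorts exactly if it inverts the rank.\<close>

lemma sorting_permutation_unique:
  fixes x :: "nat \<Rightarrow> real"
  assumes inj: "inj_on x {1..n}"
  shows "\<exists>!\<sigma>. \<sigma> permutes {1..n} \<and> mono_on {1..n} (\<lambda>k. x (\<sigma> k))"
proof -
  define \<rho> where "\<rho> j = card {i\<in>{1..n}. x i \<le> x j}" for j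
  have \<rho>_mono: "\<rho> i < \<rho> j" if "i \<in> {1..n}" "j \<in> {1..n}" "x i < x j" for i j
  proof -
    have "j \<in> {i\<in>{1..n}. x i \<le> x j}" "j \<notin> {i'\<in>{1..n}. x i' \<le> x i}" using that by auto
    moreover have "{i'\<in>{1..n}. x i' \<le> x i} \<subseteq> {i\<in>{1..n}. x i \<le> x j}" using that by auto
    ultimately show ?thesis unfolding \<rho>_def by (intro psubset_card_mono) auto
  qed
  have \<rho>_inj: "inj_on \<rho> {1..n}"
  proof (rule inj_onI, rule ccontr)
    fix i j assume ij: "i \<in> {1..n}" "j \<in> {1..n}" "\<rho> i = \<rho> j" "i \<noteq> j"
    then have "x i \<noteq> x j" using inj by (auto dest: inj_onD)
    then show False using \<rho>_mono[of i j] \<rho>_mono[of j i] ij by linarith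
  qed
  have "\<rho> j \<in> {1..n}" if "j \<in> {1..n}" for j
  proof -
    have "{i\<in>{1..n}. x i \<le> x j} \<noteq> {}" using that by auto
    then have "\<rho> j \<noteq> 0" unfolding \<rho>_def by (subst card_0_eq) auto
    moreover have "\<rho> j \<le> card {1..n}" unfolding \<rho>_def by (intro card_mono) auto
    ultimately show ?thesis by simp
  qed
  then have \<rho>_bij: "bij_betw \<rho> {1..n} {1..n}"
    using \<rho>_inj by (intro bij_betw_imageI endo_inj_surj) auto
  \<comment> \<open>\<open>permutes\<close> demands the identity outside
    \<open>{1..n}\<close>.\<close>
  define \<tau> where "\<tau> k = (if k \<in> {1..n} then inv_into {1..n} \<rho> k else k)" for k
  have "bij_betw \<tau> {1..n} {1..n}"
    using bij_betw_inv_into[OF \<rho>_bij] by (rule bij_betw_cong[THEN iffD1, rotated]) (simp add: \<tau>_def)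
  then have \<tau>_perm: "\<tau> permutes {1..n}" by (rule bij_imp_permutes) (simp only: \<tau>_def if_False simp_thms)
  have \<rho>_\<tau>: "\<rho> (\<tau> k) = k" if "k \<in> {1..n}" for k
    using that bij_betw_inv_into_right[OF \<rho>_bij that] by (simp add: \<tau>_def)
  have \<tau>_mono: "mono_on {1..n} (\<lambda>k. x (\<tau> k))"
  proof (rule mono_onI, rule ccontr)
    fix k l assume kl: "k \<in> {1..n}" "l \<in> {1..n}" "k \<le> l" "\<not> x (\<tau> k) \<le> x (\<tau> l)"
    then have "\<rho> (\<tau> l) < \<rho> (\<tau> k)" using permutes_in_image[OF \<tau>_perm] by (intro \<rho>_mono) auto
    then show False using kl \<rho>_\<tau> by simp
  qed
  show ?thesis
  proof (rule ex1I[of _ \<tau>], intro conjI \<tau>_perm \<tau>_mono)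
    fix \<sigma> assume \<sigma>: "\<sigma> permutes {1..n} \<and> mono_on {1..n} (\<lambda>k. x (\<sigma> k))"
    have in\<sigma>: "\<sigma> k \<in> {1..n} \<longleftrightarrow> k \<in> {1..n}" for k using permutes_in_image \<sigma> by metis
    \<comment> \<open>In a sorted arrangement the angles not exceeding the one at position
      \<open>k\<close> are those at the positions \<open>1..k\<close>, so the rank there is
      \<open>k\<close>.\<close>
    have "\<rho> (\<sigma> k) = k" if k: "k \<in> {1..n}" for k
    proof -
      have iff: "x (\<sigma> l) \<le> x (\<sigma> k) \<longleftrightarrow> l \<le> k" if l: "l \<in> {1..n}" for l
      proof
        assume le: "x (\<sigma> l) \<le> x (\<sigma> k)"
        show "l \<le> k"
        proof (rule ccontr)
          assume "\<not> l \<le> k"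
          then have "x (\<sigma> k) \<le> x (\<sigma> l)" using mono_onD[OF conjunct2[OF \<sigma>] k l] by simp
          with le have "\<sigma> k = \<sigma> l" using inj in\<sigma> k l by (auto dest: inj_onD)
          then have "k = l" using permutes_inj \<sigma> by (metis injD)
          with \<open>\<not> l \<le> k\<close> show False by simp
        qed
      next
        assume "l \<le> k"
        then show "x (\<sigma> l) \<le> x (\<sigma> k)" using mono_onD[OF conjunct2[OF \<sigma>] l k] by simp
      qed
      have "{i\<in>{1..n}. x i \<le> x (\<sigma> k)} = \<sigma> ` {1..k}"
      proof (intro equalityI subsetI)
        fix i assume i: "i \<in> {i\<in>{1..n}. x i \<le> x (\<sigma> k)}"
        then obtain l where "i = \<sigma> l" using \<sigma> permutes_surj by (metis surjD)
        with i show "i \<in> \<sigma> ` {1..k}" using in\<sigma>[of l] iff[of l] by auto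
      next
        fix i assume "i \<in> \<sigma> ` {1..k}"
        then obtain l where "i = \<sigma> l" "l \<in> {1..k}" by auto
        then show "i \<in> {i\<in>{1..n}. x i \<le> x (\<sigma> k)}" using in\<sigma>[of l] iff[of l] k by auto
      qed
      then have "\<rho> (\<sigma> k) = card (\<sigma> ` {1..k})" by (simp add: \<rho>_def)
      also have "\<dots> = k" using \<sigma> permutes_inj_on by (subst card_image) auto
      finally show ?thesis .
    qed
    then have "\<sigma> k = \<tau> k" if "k \<in> {1..n}" for k
      using inj_onD[OF \<rho>_inj, of "\<sigma> k" "\<tau> k"] \<rho>_\<tau> that in\<sigma> permutes_in_image[OF \<tau>_perm] by metis
    moreover have "\<sigma> k = \<tau> k" if "k \<notin> {1..n}" for k
      using that \<sigma> \<tau>_perm permutes_not_in by metis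
    ultimately show "\<sigma> = \<tau>" by blast
  qed
qed

text \<open>A product over pairs \<open>j < k\<close> is awkward to permute. Its square runs over
  all ordered pairs of distinct indices, an index set that permutations preserve.\<close>

lemma prod_pairs_squared:
  fixes g :: "nat \<Rightarrow> nat \<Rightarrow> real"
  assumes sym: "\<And>j k. g j k = g k j"
  shows "(\<Prod>k\<in>{1..n}. \<Prod>j\<in>{1..<k}. g j k)\<^sup>2 = (\<Prod>k\<in>{1..n}. \<Prod>j\<in>{1..n}-{k}. g j k)"
proof (induction n)
  case (Suc n)
  have "(\<Prod>k\<in>{1..Suc n}. \<Prod>j\<in>{1..Suc n}-{k}. g j k)
      = (\<Prod>k\<in>{1..n}. \<Prod>j\<in>{1..Suc n}-{k}. g j k) * (\<Prod>j\<in>{1..n}. g j (Suc n))"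
  proof -
    have "{1..Suc n} - {Suc n} = {1..n}" by auto
    then show ?thesis by simp
  qed
  also have "(\<Prod>k\<in>{1..n}. \<Prod>j\<in>{1..Suc n}-{k}. g j k) = (\<Prod>k\<in>{1..n}. g (Suc n) k * (\<Prod>j\<in>{1..n}-{k}. g j k))"
  proof (rule prod.cong[OF refl])
    fix k assume "k \<in> {1..n}"
    then have "{1..Suc n} - {k} = insert (Suc n) ({1..n} - {k})" by auto
    then show "(\<Prod>j\<in>{1..Suc n}-{k}. g j k) = g (Suc n) k * (\<Prod>j\<in>{1..n}-{k}. g j k)" by simp
  qed
  also have "\<dots> = (\<Prod>k\<in>{1..n}. g k (Suc n)) * (\<Prod>k\<in>{1..n}. \<Prod>j\<in>{1..n}-{k}. g j k)"
    unfolding sym[of "Suc n"] by (rule prod.distrib)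
  also have "(\<Prod>k\<in>{1..n}. \<Prod>j\<in>{1..n}-{k}. g j k) = (\<Prod>k\<in>{1..n}. \<Prod>j\<in>{1..<k}. g j k)\<^sup>2" using Suc.IH by simp
  also have "(\<Prod>k\<in>{1..n}. g k (Suc n)) * (\<Prod>k\<in>{1..n}. \<Prod>j\<in>{1..<k}. g j k)\<^sup>2 * (\<Prod>j\<in>{1..n}. g j (Suc n))
      = (\<Prod>k\<in>{1..Suc n}. \<Prod>j\<in>{1..<k}. g j k)\<^sup>2"
    by (simp add: power2_eq_square atLeastLessThanSuc_atLeastAtMost)
  finally show ?case by simp
qed simp

text \<open>The squares agree by reindexing over ordered pairs, and both weights are
  nonnegative.\<close>

lemma cbe_weight_permute:
  assumes \<sigma>: "\<sigma> permutes {1..n}"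
  shows "cbe_weight \<beta> n (\<lambda>i\<in>{1..n}. x (\<sigma> i)) = cbe_weight \<beta> n x"
proof -
  define g where "g j k = norm (cis (x j) - cis (x k)) powr \<beta>" for j k
  have sym: "g j k = g k j" for j k by (simp add: g_def norm_minus_commute)
  have sq: "(cbe_weight \<beta> n x)\<^sup>2 = (\<Prod>k\<in>{1..n}. \<Prod>j\<in>{1..n}-{k}. g j k)"
    unfolding cbe_weight_def g_def[symmetric] by (rule prod_pairs_squared[OF sym])
  have "cbe_weight \<beta> n (\<lambda>i\<in>{1..n}. x (\<sigma> i)) = (\<Prod>k\<in>{1..n}. \<Prod>j\<in>{1..<k}. g (\<sigma> j) (\<sigma> k))"
    unfolding cbe_weight_def g_def by (intro prod.cong refl) auto
  then have "(cbe_weight \<beta> n (\<lambda>i\<in>{1..n}. x (\<sigma> i)))\<^sup>2 = (\<Prod>k\<in>{1..n}. \<Prod>j\<in>{1..n}-{k}. g (\<sigma> j) (\<sigma> k))"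
    by (simp only: prod_pairs_squared[of "\<lambda>j k. g (\<sigma> j) (\<sigma> k)", OF sym])
  also have "\<dots> = (\<Prod>k\<in>{1..n}. \<Prod>j\<in>{1..n}-{\<sigma> k}. g j (\<sigma> k))"
  proof (rule prod.cong[OF refl])
    fix k assume "k \<in> {1..n}"
    have "\<sigma> ` ({1..n} - {k}) = {1..n} - {\<sigma> k}"
      using permutes_image[OF \<sigma>] permutes_inj[OF \<sigma>] by (simp add: image_set_diff)
    then show "(\<Prod>j\<in>{1..n}-{k}. g (\<sigma> j) (\<sigma> k)) = (\<Prod>j\<in>{1..n}-{\<sigma> k}. g j (\<sigma> k))"
      using permutes_inj_on[OF \<sigma>] by (intro prod.reindex_cong[symmetric, of \<sigma>]) auto
  qed
  also have "\<dots> = (\<Prod>k\<in>{1..n}. \<Prod>j\<in>{1..n}-{k}. g j k)"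
    using prod.permute[OF \<sigma>, of "\<lambda>k. \<Prod>j\<in>{1..n}-{k}. g j k"] by (simp add: o_def)
  finally have "(cbe_weight \<beta> n (\<lambda>i\<in>{1..n}. x (\<sigma> i)))\<^sup>2 = (cbe_weight \<beta> n x)\<^sup>2" using sq by simp
  then show ?thesis using cbe_weight_nonneg by (metis power2_eq_imp_eq)
qed

lemma power_sums_permute:
  assumes \<sigma>: "\<sigma> permutes {1..n}"
  shows "power_sums n d (\<lambda>i\<in>{1..n}. x (\<sigma> i)) = power_sums n d x"
proof -
  have "psum n k (\<lambda>i\<in>{1..n}. x (\<sigma> i)) = psum n k x" for k
    unfolding psum_def using sum.permute[OF \<sigma>, of "\<lambda>i. cis (x i) ^ k"] by (simp add: o_def)
  then show ?thesis by (simp add: power_sums_eq)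
qed

lemma nn_integral_torus_permute:
  assumes \<sigma>: "\<sigma> permutes {1..n}" and h: "h \<in> borel_measurable (PiM {1..n} (\<lambda>_. borel))"
  shows "(\<integral>\<^sup>+x. h (\<lambda>i\<in>{1..n}. x (\<sigma> i)) \<partial>torus_measure n) = (\<integral>\<^sup>+x. h x \<partial>torus_measure n)"
proof -
  have d: "distr (torus_measure n) (torus_measure n) (\<lambda>x. \<lambda>i\<in>{1..n}. x (\<sigma> i)) = torus_measure n"
    unfolding torus_measure_def using permutes_inj_on[OF \<sigma>] permutes_in_image[OF \<sigma>] prob_space_angle_measure
    by (intro distr_PiM_reindex) auto
  have m: "(\<lambda>x. \<lambda>i\<in>{1..n}. x (\<sigma> i)) \<in> measurable (torus_measure n) (torus_measure n)"
    unfolding torus_measure_def using permutes_in_image[OF \<sigma>]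
    by (intro measurable_restrict measurable_component_singleton) auto
  have h': "h \<in> borel_measurable (distr (torus_measure n) (torus_measure n) (\<lambda>x. \<lambda>i\<in>{1..n}. x (\<sigma> i)))"
    using h by (simp add: measurable_cong_sets[OF sets_torus_measure refl])
  show ?thesis using nn_integral_distr[OF m h'] by (simp only: d)
qed

lemma sets_ordered_angles: "ordered_angles n \<in> sets (PiM {1..n} (\<lambda>_. borel))"
proof -
  have "{x \<in> space (PiM {1..n} (\<lambda>_. borel :: real measure)). (\<forall>i\<in>{1..n}. 0 \<le> x i \<and> x i \<le> 2 * pi)
      \<and> (\<forall>i\<in>{1..n}. \<forall>j\<in>{1..n}. i \<le> j \<longrightarrow> x i \<le> x j)} \<in> sets (PiM {1..n} (\<lambda>_. borel))"
    by (intro sets.sets_Collect_conj sets.sets_Collect_finite_All sets.sets_Collect_imp sets.sets_Collect_const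
        borel_measurable_le borel_measurable_const measurable_component_singleton) auto
  also have "{x \<in> space (PiM {1..n} (\<lambda>_. borel :: real measure)). (\<forall>i\<in>{1..n}. 0 \<le> x i \<and> x i \<le> 2 * pi)
      \<and> (\<forall>i\<in>{1..n}. \<forall>j\<in>{1..n}. i \<le> j \<longrightarrow> x i \<le> x j)} = ordered_angles n"
    unfolding ordered_angles_def by (auto simp: space_PiM PiE_iff extensional_def monotone_on_def)
  finally show ?thesis .
qed

text \<open>For almost every \<open>x\<close> exactly one of the \<open>fact n\<close> permutations
  moves it into the ordered chamber. Inserting this partition of unity and using the symmetry of
  \<open>h\<close> and of the torus measure gives \<open>fact n\<close> equal summands.\<close>

lemma nn_integral_ordered_angles:
  assumes h [measurable]: "h \<in> borel_measurable (PiM {1..n} (\<lambda>_. borel))"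
    and sym: "\<And>\<sigma> x. \<sigma> permutes {1..n} \<Longrightarrow> h (\<lambda>i\<in>{1..n}. x (\<sigma> i)) = h x"
  shows "(\<integral>\<^sup>+x. h x \<partial>torus_measure n) = fact n * (\<integral>\<^sup>+x. h x * indicator (ordered_angles n) x \<partial>torus_measure n)"
proof -
  let ?S = "{\<sigma>. \<sigma> permutes {1..n}}"
  note [measurable] = sets_ordered_angles
  have fin: "finite ?S" by (intro finite_permutations) simp
  have hO: "(\<lambda>x. h x * indicator (ordered_angles n) x) \<in> borel_measurable (PiM {1..n} (\<lambda>_. borel))" by measurable
  have hOp: "(\<lambda>x. h (\<lambda>i\<in>{1..n}. x (\<sigma> i)) * indicator (ordered_angles n) (\<lambda>i\<in>{1..n}. x (\<sigma> i))) \<in> borel_measurable (torus_measure n)"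
    if "\<sigma> \<in> ?S" for \<sigma>
  proof -
    have "(\<lambda>x. \<lambda>i\<in>{1..n}. x (\<sigma> i)) \<in> measurable (torus_measure n) (PiM {1..n} (\<lambda>_. borel))"
      using that permutes_in_image[of \<sigma> "{1..n}"]
      by (subst measurable_cong_sets[OF sets_torus_measure refl]) (intro measurable_restrict measurable_component_singleton, auto)
    from measurable_compose[OF this hO] show ?thesis .
  qed
  have ind: "AE x in torus_measure n. (\<Sum>\<sigma>\<in>?S. indicator (ordered_angles n) (\<lambda>i\<in>{1..n}. x (\<sigma> i))) = (1 :: ennreal)"
    using AE_torus_inj AE_torus_range
  proof eventually_elim
    case (elim x)
    obtain \<tau> where \<tau>: "\<tau> permutes {1..n}" "mono_on {1..n} (\<lambda>k. x (\<tau> k))"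
      and uniq: "\<And>\<sigma>. \<sigma> permutes {1..n} \<Longrightarrow> mono_on {1..n} (\<lambda>k. x (\<sigma> k)) \<Longrightarrow> \<sigma> = \<tau>"
      using sorting_permutation_unique[OF elim(1)] by blast
    have "(\<lambda>i\<in>{1..n}. x (\<sigma> i)) \<in> ordered_angles n \<longleftrightarrow> \<sigma> = \<tau>" if \<sigma>: "\<sigma> \<in> ?S" for \<sigma>
    proof -
      have "x (\<sigma> i) \<in> {0..2 * pi}" if "i \<in> {1..n}" for i
      proof -
        have "\<sigma> i \<in> {1..n}" using \<sigma> that permutes_in_image[of \<sigma> "{1..n}" i] by simp
        with elim(2) have "x (\<sigma> i) \<in> {0<..<2 * pi}" by blast
        then show ?thesis by auto
      qed
      then have "(\<lambda>i\<in>{1..n}. x (\<sigma> i)) \<in> {1..n} \<rightarrow>\<^sub>E {0..2 * pi}" by (intro restrict_PiE_iff[THEN iffD2]) blast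
      moreover have "mono_on {1..n} (\<lambda>i\<in>{1..n}. x (\<sigma> i)) \<longleftrightarrow> mono_on {1..n} (\<lambda>i. x (\<sigma> i))"
        by (auto simp: monotone_on_def)
      ultimately have "(\<lambda>i\<in>{1..n}. x (\<sigma> i)) \<in> ordered_angles n \<longleftrightarrow> mono_on {1..n} (\<lambda>i. x (\<sigma> i))"
        unfolding ordered_angles_def by (simp only: mem_Collect_eq simp_thms)
      also have "\<dots> \<longleftrightarrow> \<sigma> = \<tau>" using \<tau>(2) uniq[of \<sigma>] \<sigma> by blast
      finally show ?thesis .
    qed
    then have "(\<Sum>\<sigma>\<in>?S. indicator (ordered_angles n) (\<lambda>i\<in>{1..n}. x (\<sigma> i))) = (\<Sum>\<sigma>\<in>?S. if \<sigma> = \<tau> then 1 else 0 :: ennreal)"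
      by (intro sum.cong refl) (simp add: indicator_def)
    also have "\<dots> = 1" using fin \<tau> by simp
    finally show ?case .
  qed
  have "(\<integral>\<^sup>+x. h x \<partial>torus_measure n)
      = (\<integral>\<^sup>+x. (\<Sum>\<sigma>\<in>?S. h (\<lambda>i\<in>{1..n}. x (\<sigma> i)) * indicator (ordered_angles n) (\<lambda>i\<in>{1..n}. x (\<sigma> i))) \<partial>torus_measure n)"
  proof (rule nn_integral_cong_AE, use ind in eventually_elim)
    case (elim x)
    have "(\<Sum>\<sigma>\<in>?S. h (\<lambda>i\<in>{1..n}. x (\<sigma> i)) * indicator (ordered_angles n) (\<lambda>i\<in>{1..n}. x (\<sigma> i)))
        = (\<Sum>\<sigma>\<in>?S. h x * indicator (ordered_angles n) (\<lambda>i\<in>{1..n}. x (\<sigma> i)))"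
      using sym by (intro sum.cong refl) simp
    also have "\<dots> = h x" by (simp only: sum_distrib_left[symmetric] elim mult_1_right)
    finally show ?case by simp
  qed
  also have "\<dots> = (\<Sum>\<sigma>\<in>?S. \<integral>\<^sup>+x. h (\<lambda>i\<in>{1..n}. x (\<sigma> i)) * indicator (ordered_angles n) (\<lambda>i\<in>{1..n}. x (\<sigma> i)) \<partial>torus_measure n)"
    by (rule nn_integral_sum) (rule hOp)
  also have "\<dots> = (\<Sum>\<sigma>\<in>?S. \<integral>\<^sup>+x. h x * indicator (ordered_angles n) x \<partial>torus_measure n)"
    by (intro sum.cong refl nn_integral_torus_permute[where h = "\<lambda>x. h x * indicator (ordered_angles n) x"] hO) auto
  also have "\<dots> = fact n * (\<integral>\<^sup>+x. h x * indicator (ordered_angles n) x \<partial>torus_measure n)"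
    using card_permutations[of "{1..n}" n] by simp
  finally show ?thesis .
qed

text \<open>Weight and power sums do not change under permutations, so the mass of the ordered
  chamber may be spread over the whole torus; the factor \<open>fact n\<close> in the density
  compensates for the smaller domain.\<close>

lemma T_law_eq:
  assumes "\<beta> > 0"
  shows "T_law \<beta> n d = distr (cbe \<beta> n) (cvec_algebra d) (power_sums n d)"
proof (rule measure_eqI)
  show "sets (T_law \<beta> n d) = sets (distr (cbe \<beta> n) (cvec_algebra d) (power_sums n d))" by (simp add: T_law_def)
  fix A assume "A \<in> sets (T_law \<beta> n d)"
  then have A: "A \<in> sets (PiM {1..d} (\<lambda>_. borel))" by (simp add: T_law_def cvec_algebra_def)
  note [measurable] = sets_ordered_angles
  define S where "S = power_sums n d -` A \<inter> space (PiM {1..n} (\<lambda>_. borel))"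
  have S [measurable]: "S \<in> sets (PiM {1..n} (\<lambda>_. borel))" unfolding S_def using power_sums_measurable A by (rule measurable_sets)
  have Z: "cbe_Z \<beta> n > 0" by (rule cbe_Z_pos[OF assms])
  define q where "q x = ennreal (cbe_weight \<beta> n x / cbe_Z \<beta> n)" for x
  define h where "h x = q x * indicator A (power_sums n d x)" for x
  have iA [measurable]: "(\<lambda>x. indicator A (power_sums n d x) :: ennreal) \<in> borel_measurable (PiM {1..n} (\<lambda>_. borel))"
    using measurable_compose[OF power_sums_measurable borel_measurable_indicator[OF A]] .
  have q [measurable]: "q \<in> borel_measurable (PiM {1..n} (\<lambda>_. borel))" unfolding q_def by measurable
  have h [measurable]: "h \<in> borel_measurable (PiM {1..n} (\<lambda>_. borel))" unfolding h_def by measurable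
  have dens: "ennreal (fact n / cbe_Z \<beta> n * cbe_weight \<beta> n x) * indicator (ordered_angles n) x = fact n * (q x * indicator (ordered_angles n) x)" for x
  proof -
    have "ennreal (fact n / cbe_Z \<beta> n * cbe_weight \<beta> n x) = ennreal (fact n) * q x"
      unfolding q_def using Z cbe_weight_nonneg[of \<beta> n x] by (subst ennreal_mult[symmetric]) auto
    also have "ennreal (fact n) = fact n" by (metis ennreal_of_nat_eq_real_of_nat of_nat_fact)
    finally show ?thesis by (simp add: mult.assoc)
  qed
  have sp: "space (torus_measure n) = space (PiM {1..n} (\<lambda>_. borel))" by (rule sets_eq_imp_space_eq[OF sets_torus_measure])
  have "emeasure (T_law \<beta> n d) A = emeasure (circular_beta_ensemble \<beta> n) S"
    unfolding T_law_def using A power_sums_measurable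
    by (subst emeasure_distr) (auto simp: circular_beta_ensemble_def cvec_algebra_def sp S_def measurable_cong_sets[OF sets_torus_measure refl])
  also have "\<dots> = (\<integral>\<^sup>+x. fact n * (q x * indicator (ordered_angles n) x) * indicator S x \<partial>torus_measure n)"
    unfolding circular_beta_ensemble_def dens by (subst emeasure_density) measurable
  also have "\<dots> = (\<integral>\<^sup>+x. fact n * (h x * indicator (ordered_angles n) x) \<partial>torus_measure n)"
    by (intro nn_integral_cong) (auto simp: h_def S_def sp indicator_def)
  also have "\<dots> = fact n * (\<integral>\<^sup>+x. h x * indicator (ordered_angles n) x \<partial>torus_measure n)"
    by (rule nn_integral_cmult) measurable
  also have "\<dots> = (\<integral>\<^sup>+x. h x \<partial>torus_measure n)"
    by (rule nn_integral_ordered_angles[symmetric, OF h]) (simp only: h_def q_def cbe_weight_permute power_sums_permute)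
  also have "\<dots> = (\<integral>\<^sup>+x. q x * indicator S x \<partial>torus_measure n)"
    by (intro nn_integral_cong) (auto simp: h_def S_def sp indicator_def)
  also have "\<dots> = emeasure (cbe \<beta> n) S"
    unfolding cbe_def q_def[symmetric] by (subst emeasure_density) measurable
  also have "\<dots> = emeasure (distr (cbe \<beta> n) (cvec_algebra d) (power_sums n d)) A"
    using A power_sums_measurable
    by (subst emeasure_distr) (auto simp: cbe_def cvec_algebra_def sp S_def measurable_cong_sets[OF sets_torus_measure refl])
  finally show "emeasure (T_law \<beta> n d) A = emeasure (distr (cbe \<beta> n) (cvec_algebra d) (power_sums n d)) A" .
qed

text \<open>\<open>scaled_gaussians\<close> reads the coordinates \<open>1..d\<close> only, and
  restricting the infinite product to them gives the finite one.\<close>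

lemma G_law_eq: "G_law \<beta> d = distr (gauss_vec d) (cvec_algebra d) (scaled_gaussians \<beta> d)"
proof -
  let ?G = "PiM {1::nat..} (\<lambda>_. std_complex_gaussian)"
  let ?r = "\<lambda>w. \<lambda>k\<in>{1..d}. w k"
  have r: "distr ?G (gauss_vec d) ?r = gauss_vec d"
    using prob_space_std_complex_gaussian by (intro distr_PiM_reindex[where f = id, simplified id_apply]) auto
  have m: "?r \<in> measurable ?G (gauss_vec d)"
    by (intro measurable_restrict measurable_component_singleton) auto
  have s: "scaled_gaussians \<beta> d \<in> measurable (gauss_vec d) (cvec_algebra d)"
    unfolding cvec_algebra_def using scaled_gaussians_measurable measurable_cong_sets[OF sets_gauss_vec refl] by blast
  have "G_law \<beta> d = distr ?G (cvec_algebra d) (scaled_gaussians \<beta> d \<circ> ?r)"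
    unfolding G_law_def by (intro distr_cong refl) (auto simp: scaled_gaussians_def)
  also have "\<dots> = distr (distr ?G (gauss_vec d) ?r) (cvec_algebra d) (scaled_gaussians \<beta> d)"
    by (rule distr_distr[OF s m, symmetric])
  finally show ?thesis by (simp only: r)
qed

section \<open>Integrals against the two laws and finiteness of their distance\<close>

lemma
  assumes b: "\<beta> > 0"
  shows prob_space_T_law: "prob_space (T_law \<beta> n d)"
    and sets_T_law: "sets (T_law \<beta> n d) = sets (cvec_algebra d)"
    and integrable_T_law: "\<And>k. k \<in> {1..d} \<Longrightarrow> integrable (T_law \<beta> n d) (\<lambda>x. norm (x k))"
    and integral_T_law: "\<And>f. f \<in> borel_measurable (cvec_algebra d) \<Longrightarrow>
      (\<integral>x. f x \<partial>T_law \<beta> n d) = (\<integral>x. f (power_sums n d x) \<partial>cbe \<beta> n :: real)"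
proof -
  interpret E: prob_space "cbe \<beta> n" by (rule prob_space_cbe[OF b])
  have m: "power_sums n d \<in> measurable (cbe \<beta> n) (cvec_algebra d)"
    unfolding cvec_algebra_def using power_sums_measurable measurable_cong_sets[OF sets_cbe refl] by blast
  show "prob_space (T_law \<beta> n d)" unfolding T_law_eq[OF b] by (rule E.prob_space_distr[OF m])
  show "sets (T_law \<beta> n d) = sets (cvec_algebra d)" by (simp add: T_law_def)
  fix f :: "(nat \<Rightarrow> complex) \<Rightarrow> real" assume "f \<in> borel_measurable (cvec_algebra d)"
  then show "(\<integral>x. f x \<partial>T_law \<beta> n d) = (\<integral>x. f (power_sums n d x) \<partial>cbe \<beta> n)"
    unfolding T_law_eq[OF b] by (rule integral_distr[OF m])
next
  fix k assume k: "k \<in> {1..d}"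
  interpret E: prob_space "cbe \<beta> n" by (rule prob_space_cbe[OF b])
  have m: "power_sums n d \<in> measurable (cbe \<beta> n) (cvec_algebra d)"
    unfolding cvec_algebra_def using power_sums_measurable measurable_cong_sets[OF sets_cbe refl] by blast
  have c: "(\<lambda>x. norm (x k)) \<in> borel_measurable (cvec_algebra d)"
    unfolding cvec_algebra_def using k by measurable
  have "norm (power_sums n d x k) \<le> real n" for x
    using k norm_psum_le by (simp add: power_sums_eq)
  then have "integrable (cbe \<beta> n) (\<lambda>x. norm (power_sums n d x k))"
    using measurable_compose[OF m c] by (intro E.integrable_const_bound[of _ "real n"]) (auto intro!: always_eventually)
  then show "integrable (T_law \<beta> n d) (\<lambda>x. norm (x k))"
    unfolding T_law_eq[OF b] by (simp add: integrable_distr_eq[OF m c])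
qed

lemma
  assumes b: "\<beta> > 0"
  shows prob_space_G_law: "prob_space (G_law \<beta> d)"
    and sets_G_law: "sets (G_law \<beta> d) = sets (cvec_algebra d)"
    and integrable_G_law: "\<And>k. k \<in> {1..d} \<Longrightarrow> integrable (G_law \<beta> d) (\<lambda>x. norm (x k))"
    and integral_G_law: "\<And>f. f \<in> borel_measurable (cvec_algebra d) \<Longrightarrow>
      (\<integral>x. f x \<partial>G_law \<beta> d) = (\<integral>g. f (scaled_gaussians \<beta> d g) \<partial>gauss_vec d :: real)"
proof -
  interpret G: prob_space "gauss_vec d" by (rule prob_space_gauss_vec)
  have m: "scaled_gaussians \<beta> d \<in> measurable (gauss_vec d) (cvec_algebra d)"
    unfolding cvec_algebra_def using scaled_gaussians_measurable measurable_cong_sets[OF sets_gauss_vec refl] by blast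
  show "prob_space (G_law \<beta> d)" unfolding G_law_eq by (rule G.prob_space_distr[OF m])
  show "sets (G_law \<beta> d) = sets (cvec_algebra d)" by (simp add: G_law_def)
  show "(\<integral>x. f x \<partial>G_law \<beta> d) = (\<integral>g. f (scaled_gaussians \<beta> d g) \<partial>gauss_vec d)"
    if "f \<in> borel_measurable (cvec_algebra d)" for f :: "(nat \<Rightarrow> complex) \<Rightarrow> real"
    using that unfolding G_law_eq by (rule integral_distr[OF m])
  show "integrable (G_law \<beta> d) (\<lambda>x. norm (x k))" if k: "k \<in> {1..d}" for k
  proof -
    have c: "(\<lambda>x. norm (x k)) \<in> borel_measurable (cvec_algebra d)"
      unfolding cvec_algebra_def using k by measurable
    have eq: "norm (scaled_gaussians \<beta> d g k) = sqrt (2 / \<beta> * real k) * norm (g k)" for g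
      unfolding scaled_gaussians_def using k b by (simp only: restrict_apply if_True norm_mult norm_of_real) simp
    have "integrable (gauss_vec d) (\<lambda>g. norm (scaled_gaussians \<beta> d g k))"
      unfolding eq by (intro integrable_mult_right integrable_gauss_vec_component integrable_std_complex_gaussian_moments(1) k)
    then show ?thesis unfolding G_law_eq integrable_distr_eq[OF m c] .
  qed
qed

lemma wasserstein1_finite:
  assumes M: "prob_space M" "sets M = sets (cvec_algebra d)"
    and N: "prob_space N" "sets N = sets (cvec_algebra d)"
    and iM: "\<And>k. k \<in> {1..d} \<Longrightarrow> integrable M (\<lambda>x. norm (x k))"
    and iN: "\<And>k. k \<in> {1..d} \<Longrightarrow> integrable N (\<lambda>x. norm (x k))"
  shows "wasserstein1 d M N < \<infinity>"
proof -
  define E where "E L = (\<integral>x. (\<Sum>k\<in>{1..d}. norm (x k)) \<partial>L)" for L :: "(nat \<Rightarrow> complex) measure"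
  have one: "\<bar>(\<integral>x. f x \<partial>L) - f (\<lambda>_. 0)\<bar> \<le> E L"
    if L: "prob_space L" "sets L = sets (cvec_algebra d)" "\<And>k. k \<in> {1..d} \<Longrightarrow> integrable L (\<lambda>x. norm (x k))"
      and f: "f \<in> borel_measurable (cvec_algebra d)" "\<And>x. \<bar>f x\<bar> \<le> C" "\<And>x y. \<bar>f x - f y\<bar> \<le> cvec_dist d x y"
    for L f C
  proof -
    interpret L: prob_space L by fact
    have i: "integrable L f"
      using f(1,2) measurable_cong_sets[OF L(2) refl] by (intro L.integrable_const_bound[of _ C]) auto
    have "(\<integral>x. f x \<partial>L) - f (\<lambda>_. 0) = (\<integral>x. f x - f (\<lambda>_. 0) \<partial>L)"
      using i L.prob_space by simp
    also have "\<bar>\<dots>\<bar> \<le> (\<integral>x. \<bar>f x - f (\<lambda>_. 0)\<bar> \<partial>L)" by (rule integral_abs_bound)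
    also have "\<dots> \<le> E L" unfolding E_def
    proof (rule integral_mono)
      show "integrable L (\<lambda>x. \<bar>f x - f (\<lambda>_. 0)\<bar>)" using i by (intro integrable_abs Bochner_Integration.integrable_diff L.integrable_const)
      show "integrable L (\<lambda>x. \<Sum>k\<in>{1..d}. norm (x k))" using L(3) by (intro Bochner_Integration.integrable_sum)
      show "\<bar>f x - f (\<lambda>_. 0)\<bar> \<le> (\<Sum>k\<in>{1..d}. norm (x k))" for x
        using order_trans[OF f(3) cvec_dist_le_sum, of x "\<lambda>_. 0"] by simp
    qed
    finally show ?thesis .
  qed
  have "wasserstein1 d M N \<le> ennreal (E M + E N)"
  proof (rule wasserstein1_le_of_lipschitz_bound[OF M N iM iN])
    fix f C assume f: "f \<in> borel_measurable (cvec_algebra d)" "\<And>x. \<bar>f x\<bar> \<le> C" "\<And>x y. \<bar>f x - f y\<bar> \<le> cvec_dist d x y"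
    show "(\<integral>x. f x \<partial>M) - (\<integral>x. f x \<partial>N) \<le> E M + E N"
      using one[OF M iM f] one[OF N iN f] by linarith
  qed
  then show ?thesis by (auto intro: order_le_less_trans)
qed

lemma wasserstein1_T_law_G_law_le:
  assumes b: "\<beta> > 0" and n: "n \<ge> 1" and small: "(1 + \<beta>) * real (2 * d) \<le> \<beta> / 4 * real n"
  shows "wasserstein1 d (T_law \<beta> n d) (G_law \<beta> d) \<le> ennreal (stein_const \<beta> * pi * (real d ^ 3 * sqrt (real d)) / real n)"
proof (rule wasserstein1_le_of_lipschitz_bound[OF prob_space_T_law[OF b] sets_T_law[OF b] prob_space_G_law[OF b] sets_G_law[OF b]
      integrable_T_law[OF b] integrable_G_law[OF b]])
  fix f :: "(nat \<Rightarrow> complex) \<Rightarrow> real" and C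
  assume f: "f \<in> borel_measurable (cvec_algebra d)" "\<And>x. \<bar>f x\<bar> \<le> C" "\<And>x y. \<bar>f x - f y\<bar> \<le> cvec_dist d x y"
  have "\<bar>(\<integral>x. f (power_sums n d x) \<partial>cbe \<beta> n) - (\<integral>g. f (scaled_gaussians \<beta> d g) \<partial>gauss_vec d)\<bar>
     \<le> stein_const \<beta> * pi * (real d ^ 3 * sqrt (real d)) / real n"
    using f(1) unfolding cvec_algebra_def
    by (intro lipschitz_gap[OF b n _ f(2) order_trans[OF f(3) cvec_dist_le_sum] small])
  then show "(\<integral>x. f x \<partial>T_law \<beta> n d) - (\<integral>x. f x \<partial>G_law \<beta> d) \<le> stein_const \<beta> * pi * (real d ^ 3 * sqrt (real d)) / real n"
    by (simp add: integral_T_law[OF b f(1)] integral_G_law[OF b f(1)])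
qed

text \<open>The finiteness conjunct gives the second one its meaning: \<open>enn2real\<close> sends
  \<infinity> to 0 and would otherwise hide an infinite distance.\<close>

theorem theorem4:
  fixes \<beta> :: real and d :: "nat \<Rightarrow> nat"
  assumes "\<beta> > 0"
    and "\<And>n. d n > 0"
    and "(\<lambda>n. real (d n)) \<in> o(\<lambda>n. real n powr (2 / 7))"
  shows "(\<forall>n. wasserstein1 (d n) (T_law \<beta> n (d n)) (G_law \<beta> (d n)) < \<infinity>) \<and>
    (\<lambda>n. enn2real (wasserstein1 (d n) (T_law \<beta> n (d n)) (G_law \<beta> (d n))))
      \<in> O(\<lambda>n. real (d n) powr (7 / 2) / real n)"
proof (intro conjI allI)
  note b = assms(1)
  show "wasserstein1 (d n) (T_law \<beta> n (d n)) (G_law \<beta> (d n)) < \<infinity>" for n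
    by (rule wasserstein1_finite[OF prob_space_T_law[OF b] sets_T_law[OF b] prob_space_G_law[OF b] sets_G_law[OF b]
      integrable_T_law[OF b] integrable_G_law[OF b]])
  \<comment> \<open>With this constant in the growth hypothesis, and since
    \<open>n powr (2 / 7) \<le> n\<close> for \<open>n \<ge> 1\<close>, eventually
    \<open>2 * (1 + \<beta>) * d n \<le> \<beta> / 4 * n\<close>. This is the smallness condition of
    the moment bounds at the largest index \<open>2 * d n\<close>.\<close>
  have "\<beta> / (8 * (1 + \<beta>)) > 0" using b by simp
  from landau_o.smallD[OF assms(3) this]
  have ev: "eventually (\<lambda>n. real (d n) \<le> \<beta> / (8 * (1 + \<beta>)) * real n powr (2 / 7)) sequentially" by simp
  show "(\<lambda>n. enn2real (wasserstein1 (d n) (T_law \<beta> n (d n)) (G_law \<beta> (d n)))) \<in> O(\<lambda>n. real (d n) powr (7 / 2) / real n)"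
  proof (rule bigoI[of _ "stein_const \<beta> * pi"], use ev eventually_ge_at_top[of 1] in eventually_elim)
    case (elim n)
    let ?W = "wasserstein1 (d n) (T_law \<beta> n (d n)) (G_law \<beta> (d n))"
    have "real n powr (2 / 7) \<le> real n powr 1" using elim(2) by (intro powr_mono) auto
    then have "real (d n) \<le> \<beta> / (8 * (1 + \<beta>)) * real n"
      using elim b by (intro order_trans[OF elim(1)] mult_left_mono) auto
    then have "(2 * (1 + \<beta>)) * real (d n) \<le> (2 * (1 + \<beta>)) * (\<beta> / (8 * (1 + \<beta>)) * real n)"
      using b by (intro mult_left_mono) auto
    also have "\<dots> = \<beta> / 4 * real n"
    proof -
      have "(2 * q) * (\<beta> / (8 * q) * real n) = \<beta> / 4 * real n" if "q \<noteq> 0" for q using that by simp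
      from this[of "1 + \<beta>"] b show ?thesis by linarith
    qed
    finally have small: "(1 + \<beta>) * real (2 * d n) \<le> \<beta> / 4 * real n" by (simp add: algebra_simps)
    have p: "real (d n) ^ 3 * sqrt (real (d n)) = real (d n) powr (7 / 2)"
    proof -
      have "real (d n) ^ 3 = real (d n) powr 3" using assms(2)[of n] powr_realpow[of "real (d n)" 3] by simp
      then have "real (d n) ^ 3 * sqrt (real (d n)) = real (d n) powr (3 + 1 / 2)"
        unfolding powr_add by (simp only: powr_half_sqrt[OF of_nat_0_le_iff])
      then show ?thesis by simp
    qed
    have c: "stein_const \<beta> \<ge> 0" unfolding stein_const_def using gauss_const_ge(4) b
      by (intro divide_nonneg_nonneg mult_nonneg_nonneg add_nonneg_nonneg) auto
    from wasserstein1_T_law_G_law_le[OF b elim(2) small]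
    have "enn2real ?W \<le> stein_const \<beta> * pi * real (d n) powr (7 / 2) / real n"
      using c unfolding p by (intro enn2real_leI) auto
    then show "norm (enn2real ?W) \<le> stein_const \<beta> * pi * norm (real (d n) powr (7 / 2) / real n)"
      by (simp only: real_norm_def abs_of_nonneg[OF enn2real_nonneg] abs_divide abs_of_nonneg[OF powr_ge_zero] abs_of_nat times_divide_eq_right)
  qed
qed

end
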